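(* Let $(X,W)$ be a bivariate zero-mean Gaussian random field on $\mathbb R$ with a valid bivariate matrix covariance function $(K^{NS}_{k\ell})$, where each $K^{NS}_{k\ell}$ has the form $$K^{NS}_{k\ell}(s,s')=\frac{\sigma_k(s)\sigma_\ell(s')\big(|\Phi_{k\ell}(s)|\,|\Phi_{\ell k}(s')|\big)^{1/4}}{\left|\frac{\Phi_{k\ell}(s)+\Phi_{\ell k}(s')}{2}\right|^{1/2}}\,K_{k\ell}\big(\sqrt{Q_{k\ell}(s,s')}\big),\quad Q_{k\ell}(s,s')=(s-s')^2\left(\frac{\Phi_{k\ell}(s)+\Phi_{\ell k}(s')}{2}\right)^{-1},$$ and each $K_{k\ell}$ is a stationary covariance satisfying condition $\mathrm A(L,c_{k\ell},\alpha_{k\ell})$ (defined in the context) for some $L>0$. Let $Y=X\beta+W$. (a) Consistency: If $\alpha_{11}<\min\{\alpha_{12},\alpha_{22}+1,2\}$ and all $\sigma_k(s)$ and $\Phi_{k\ell}(s)$ functions are positive, continuous, and piecewise analytic in $[0,L]$, then the OLS estimator based on first differences of $X$ and $Y$ on the regular grid $jh$, $j=0,\dots,n$, $h=L/n$, in $[0,L]$ is consistent for $\beta$. (b) Equivalence: If $\alpha_{11}>\alpha_{22}+1$, the class of functions for $\Phi_{k\ell}$ and $\sigma_k$ includes the constant functions, and the spectral densities corresponding to $K_{11}$ and $K_{22}$ satisfy the regularity conditions of the context with high frequency decay $\asymp|\omega|^{-(\alpha_{11}+1)}$ and $\asymp|\omega|^{-(\alpha_{22}+1)}$ respectively, then $\beta$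 is not estimable on the paths of $(X,Y)$.
   Context: Condition $\mathrm A(L,c,\alpha)$: $K(t)=A(t)+B(t)$, where $A$ is even and analytic and $B$ is even and continuous on $[-L,L]$; the $k$-th derivative $B^{(k)}$ on $(0,L]$ ($k\ge0$, $B^{(0)}=B$) satisfies, as $t\downarrow0$, $B^{(k)}(t)=(\alpha)_k\,c\,t^{\alpha-k}+o(t^{\alpha-k})$, where $c$ is a constant (non-zero for covariance functions, possibly zero for cross-covariances), $\alpha>0$ is not an even integer, $(\alpha)_k=\Gamma(\alpha+1)/\Gamma(\alpha+1-k)$. Index $1$ refers to $X$, $2$ to $W$. The functions $\sigma_k$ (local standard deviation) and $\Phi_{k\ell}$ (local range) are positive. Piecewise analytic on $[0,L]$: there exist $0=\tau_0<\dots<\tau_m=L$ such that each restriction to $[\tau_{r-1},\tau_r]$ extends to an analytic function on an open neighborhood of $[\tau_{r-1},\tau_r]$. First-difference OLS estimator: $\sum_{j=1}^n\{X(jh)-X((j-1)h)\}\{Y(jh)-Y((j-1)h)\}\big/\sum_{j=1}^n\{X(jh)-X((j-1)h)\}^2$; consistent means convergence to $\beta$ in probability as $n\to\infty$. Regularity conditions on spectral densities $f_1,f_2$ of $K_{11},K_{22}$: each is positive, continuous, bounded away from $0$ and $\infty$ as $\omega\to0$, and there are constants $c_1,c_2>0$ and positive real functions $\phi_1,\phi_2$, each the Fourier transform of a square-integrable function vanishing outside some bounded set containing $[0,L]$, with $c_1\phi_i^2\le f_i\le c_2\phi_i^2$ on $\mathbb R$. In (b), the model consists of all $\beta\in\mathbb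 R$ and all covariances of the stated form with the functions $\sigma_k,\Phi_{k\ell}$ in the given class (the case of $X$ and $W$ independent included). "Not estimable" means there is no sequence of measurable functions of $\{(X(s),Y(s)):s\in[0,L]\}$ converging in probability to $\beta$ under every member of the model. *)

theory Defs
  imports "HOL-Probability.Probability" "HOL-Library.Landau_Symbols"
begin

subsection \<open>Real analyticity\<close>

definition real_analytic_on :: "(real \<Rightarrow> real) \<Rightarrow> real set \<Rightarrow> bool" where
  "real_analytic_on f S \<longleftrightarrow>
     (\<forall>x\<in>S. \<exists>r>0. \<exists>a. \<forall>y. \<bar>y - x\<bar> < r \<longrightarrow> (\<lambda>n. a n * (y - x) ^ n) sums f y)"

definition piecewise_analytic :: "real \<Rightarrow> (real \<Rightarrow> real) \<Rightarrow> bool" where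
  "piecewise_analytic L f \<longleftrightarrow>
     (\<exists>(m::nat) \<tau>. \<tau> 0 = 0 \<and> \<tau> m = L \<and> (\<forall>r<m. \<tau> r < \<tau> (Suc r)) \<and>
        (\<forall>r<m. \<exists>U g. open U \<and> {\<tau> r..\<tau> (Suc r)} \<subseteq> U \<and> real_analytic_on g U \<and>
                     (\<forall>t\<in>{\<tau> r..\<tau> (Suc r)}. g t = f t)))"

subsection \<open>Condition A\<close>

text \<open>
  If \<open>\<alpha>\<close> is an integer, the denominator has a pole for \<open>k > \<alpha>\<close>. \<^const>\<open>Gamma\<close> is \<open>0\<close> there and
  division by \<open>0\<close> gives \<open>0\<close>, which is the correct value of the falling factorial.
\<close>

definition falling :: "real \<Rightarrow> nat \<Rightarrow> real" where
  "falling \<alpha> k = Gamma (\<alpha> + 1) / Gamma (\<alpha> + 1 - real k)"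

text \<open>
  \<open>D k\<close> is the \<open>k\<close>-th derivative of \<open>B\<close> on \<open>(0, L]\<close>, one-sided at \<open>L\<close>. Analyticity of \<open>A\<close> at the
  points of \<open>[-L, L]\<close> means analyticity in a neighbourhood of that interval.
\<close>

definition cond_A :: "real \<Rightarrow> real \<Rightarrow> real \<Rightarrow> (real \<Rightarrow> real) \<Rightarrow> bool" where
  "cond_A L c \<alpha> K \<longleftrightarrow>
     0 < \<alpha> \<and> \<not> (\<exists>m::nat. \<alpha> = 2 * real m) \<and>
     (\<exists>A B D.
        (\<forall>t\<in>{-L..L}. K t = A t + B t) \<and>
        (\<forall>t\<in>{-L..L}. A (- t) = A t) \<and> real_analytic_on A {-L..L} \<and>
        (\<forall>t\<in>{-L..L}. B (- t) = B t) \<and> continuous_on {-L..L} B \<and>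
        (\<forall>t\<in>{0<..L}. D 0 t = B t) \<and>
        (\<forall>k. \<forall>t\<in>{0<..L}. (D k has_real_derivative D (Suc k) t) (at t within {0<..L})) \<and>
        (\<forall>k. (\<lambda>t. D k t - falling \<alpha> k * c * t powr (\<alpha> - real k))
                \<in> o[at_right 0](\<lambda>t. t powr (\<alpha> - real k))))"

subsection \<open>Covariances\<close>

text \<open>The components of bivariate objects are indexed by \<open>1\<close> and \<open>2\<close>; other indices are ignored.\<close>

definition valid_matrix_covariance :: "(nat \<Rightarrow> nat \<Rightarrow> real \<Rightarrow> real \<Rightarrow> real) \<Rightarrow> bool" where
  "valid_matrix_covariance C \<longleftrightarrow>
     (\<forall>k\<in>{1,2}. \<forall>l\<in>{1,2}. \<forall>s s'. C k l s s' = C l k s' s) \<and>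
     (\<forall>S a. finite S \<longrightarrow>
        0 \<le> (\<Sum>k\<in>{1,2}. \<Sum>l\<in>{1,2}. \<Sum>s\<in>S. \<Sum>s'\<in>S. a k s * a l s' * C k l s s'))"

definition stationary_covariance :: "(real \<Rightarrow> real) \<Rightarrow> bool" where
  "stationary_covariance K \<longleftrightarrow>
     (\<forall>t. K (- t) = K t) \<and>
     (\<forall>S a. finite S \<longrightarrow> 0 \<le> (\<Sum>s\<in>S. \<Sum>s'\<in>S. a s * a s' * K (s - s')))"

definition stationary_cross_covariance :: "(real \<Rightarrow> real) \<Rightarrow> bool" where
  "stationary_cross_covariance K \<longleftrightarrow>
     (\<exists>C. C 1 2 = K \<and> valid_matrix_covariance (\<lambda>k l s s'. C k l (s - s')))"

definition Q_NS :: "(nat \<Rightarrow> nat \<Rightarrow> real \<Rightarrow> real) \<Rightarrow> nat \<Rightarrow> nat \<Rightarrow> real \<Rightarrow> real \<Rightarrow> real" where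
  "Q_NS \<Phi> k l s s' = (s - s')\<^sup>2 * inverse ((\<Phi> k l s + \<Phi> l k s') / 2)"

definition K_NS ::
  "(nat \<Rightarrow> real \<Rightarrow> real) \<Rightarrow> (nat \<Rightarrow> nat \<Rightarrow> real \<Rightarrow> real) \<Rightarrow> (nat \<Rightarrow> nat \<Rightarrow> real \<Rightarrow> real) \<Rightarrow>
   nat \<Rightarrow> nat \<Rightarrow> real \<Rightarrow> real \<Rightarrow> real" where
  "K_NS \<sigma> \<Phi> K k l s s' =
     \<sigma> k s * \<sigma> l s' * (\<bar>\<Phi> k l s\<bar> * \<bar>\<Phi> l k s'\<bar>) powr (1/4)
       / \<bar>(\<Phi> k l s + \<Phi> l k s') / 2\<bar> powr (1/2)
       * K k l (sqrt (Q_NS \<Phi> k l s s'))"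

subsection \<open>Gaussian fields\<close>

definition gaussian_rv :: "'a measure \<Rightarrow> ('a \<Rightarrow> real) \<Rightarrow> bool" where
  "gaussian_rv M V \<longleftrightarrow> V \<in> borel_measurable M \<and>
     ((\<exists>\<mu>. AE x in M. V x = \<mu>) \<or>
      (\<exists>\<mu> \<sigma>. 0 < \<sigma> \<and> distributed M lborel V (\<lambda>x. ennreal (normal_density \<mu> \<sigma> x))))"

definition bivariate_gaussian_field ::
  "'a measure \<Rightarrow> (nat \<Rightarrow> real \<Rightarrow> 'a \<Rightarrow> real) \<Rightarrow> (nat \<Rightarrow> nat \<Rightarrow> real \<Rightarrow> real \<Rightarrow> real) \<Rightarrow> bool" where
  "bivariate_gaussian_field M Z C \<longleftrightarrow>
     prob_space M \<and>
     (\<forall>k\<in>{1,2}. \<forall>s. Z k s \<in> borel_measurable M) \<and>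
     (\<forall>S a. finite S \<longrightarrow> gaussian_rv M (\<lambda>x. \<Sum>k\<in>{1,2}. \<Sum>s\<in>S. a k s * Z k s x)) \<and>
     (\<forall>k\<in>{1,2}. \<forall>s. (LINT x|M. Z k s x) = 0) \<and>
     (\<forall>k\<in>{1,2}. \<forall>l\<in>{1,2}. \<forall>s s'. (LINT x|M. Z k s x * Z l s' x) = C k l s s')"

text \<open>For \<open>Z = (X, W)\<close> this is \<open>Y = X \<beta> + W\<close>.\<close>

definition response :: "real \<Rightarrow> (nat \<Rightarrow> real \<Rightarrow> 'a \<Rightarrow> real) \<Rightarrow> real \<Rightarrow> 'a \<Rightarrow> real" where
  "response \<beta> Z s x = Z 1 s x * \<beta> + Z 2 s x"

subsection \<open>Estimation\<close>

definition converges_in_probability ::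
  "'a measure \<Rightarrow> (nat \<Rightarrow> 'a \<Rightarrow> real) \<Rightarrow> real \<Rightarrow> bool" where
  "converges_in_probability M V b \<longleftrightarrow>
     (\<forall>\<epsilon>>0. (\<lambda>n. measure M {x \<in> space M. \<epsilon> < \<bar>V n x - b\<bar>}) \<longlonglongrightarrow> 0)"

definition ols_diff ::
  "real \<Rightarrow> (real \<Rightarrow> 'a \<Rightarrow> real) \<Rightarrow> (real \<Rightarrow> 'a \<Rightarrow> real) \<Rightarrow> nat \<Rightarrow> 'a \<Rightarrow> real" where
  "ols_diff L X Y n x =
     (let h = L / real n in
       (\<Sum>j=1..n. (X (real j * h) x - X ((real j - 1) * h) x)
                  * (Y (real j * h) x - Y ((real j - 1) * h) x))
       / (\<Sum>j=1..n. (X (real j * h) x - X ((real j - 1) * h) x)\<^sup>2))"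

text \<open>
  Fields whose covariance has the nonstationary form built from the given marginal functions
  \<open>K 1 1\<close>, \<open>K 2 2\<close> and a cross-covariance from \<open>CC\<close>, with local standard deviations from \<open>CS\<close> and
  local ranges from \<open>CP\<close>. Independence of \<open>X\<close> and \<open>W\<close> is the cross-covariance \<open>0\<close>.
\<close>

definition in_model ::
  "real \<Rightarrow> (nat \<Rightarrow> nat \<Rightarrow> real \<Rightarrow> real) \<Rightarrow> (real \<Rightarrow> real) set \<Rightarrow> (real \<Rightarrow> real) set \<Rightarrow>
   (real \<Rightarrow> real) set \<Rightarrow> 'a measure \<Rightarrow> (nat \<Rightarrow> real \<Rightarrow> 'a \<Rightarrow> real) \<Rightarrow> bool" where
  "in_model L K CS CP CC M Z \<longleftrightarrow>
     (\<exists>\<sigma> \<Phi> \<kappa>.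
        (\<forall>k\<in>{1,2}. \<sigma> k \<in> CS \<and> (\<forall>s. 0 < \<sigma> k s)) \<and>
        (\<forall>k\<in>{1,2}. \<forall>l\<in>{1,2}. \<Phi> k l \<in> CP \<and> (\<forall>s. 0 < \<Phi> k l s)) \<and>
        \<kappa> \<in> CC \<and> stationary_cross_covariance \<kappa> \<and> (\<exists>c \<alpha>. cond_A L c \<alpha> \<kappa>) \<and>
        valid_matrix_covariance (K_NS \<sigma> \<Phi> (\<lambda>k l. if k = l then K k l else \<kappa>)) \<and>
        bivariate_gaussian_field M Z (K_NS \<sigma> \<Phi> (\<lambda>k l. if k = l then K k l else \<kappa>)))"

text \<open>
  Measurable functions of the paths \<open>(X, Y)\<close> on \<open>[0, L]\<close> are measurable functions on the product
  space over \<open>[0, L]\<close>. Whether an estimator converges depends only on the law of \<open>(X, W)\<close>, and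
  every such law lives on the path space \<open>real \<Rightarrow> real \<times> real\<close>, so it suffices to let the underlying
  probability spaces range over measures on that type.
\<close>

definition estimable ::
  "real \<Rightarrow> (nat \<Rightarrow> nat \<Rightarrow> real \<Rightarrow> real) \<Rightarrow> (real \<Rightarrow> real) set \<Rightarrow> (real \<Rightarrow> real) set \<Rightarrow>
   (real \<Rightarrow> real) set \<Rightarrow> bool" where
  "estimable L K CS CP CC \<longleftrightarrow>
     (\<exists>T :: nat \<Rightarrow> (real \<Rightarrow> real \<times> real) \<Rightarrow> real.
        (\<forall>n. T n \<in> borel_measurable (PiM {0..L} (\<lambda>_. borel))) \<and>
        (\<forall>\<beta> (M :: (real \<Rightarrow> real \<times> real) measure) Z.
           in_model L K CS CP CC M Z \<longrightarrow>
           converges_in_probability M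
             (\<lambda>n x. T n (\<lambda>s\<in>{0..L}. (Z 1 s x, response \<beta> Z s x))) \<beta>))"

subsection \<open>Spectral densities\<close>

definition spectral_density :: "(real \<Rightarrow> real) \<Rightarrow> (real \<Rightarrow> real) \<Rightarrow> bool" where
  "spectral_density f K \<longleftrightarrow>
     integrable lborel f \<and> (\<forall>\<omega>. 0 \<le> f \<omega>) \<and>
     (\<forall>t. complex_of_real (K t) = (LINT \<omega>|lborel. iexp (\<omega> * t) * complex_of_real (f \<omega>)))"

definition fourier_of_bounded_support :: "real \<Rightarrow> (real \<Rightarrow> real) \<Rightarrow> bool" where
  "fourier_of_bounded_support L \<phi> \<longleftrightarrow>
     (\<exists>(g :: real \<Rightarrow> complex) S.
        g \<in> borel_measurable lborel \<and> integrable lborel (\<lambda>t. (norm (g t))\<^sup>2) \<and>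
        bounded S \<and> {0..L} \<subseteq> S \<and> (\<forall>t. t \<notin> S \<longrightarrow> g t = 0) \<and>
        (\<forall>\<omega>. complex_of_real (\<phi> \<omega>) = (LINT t|lborel. iexp (- (\<omega> * t)) * g t)))"

definition regular_densities :: "real \<Rightarrow> (real \<Rightarrow> real) \<Rightarrow> (real \<Rightarrow> real) \<Rightarrow> bool" where
  "regular_densities L f1 f2 \<longleftrightarrow>
     (\<forall>f\<in>{f1, f2}. (\<forall>\<omega>. 0 < f \<omega>) \<and> continuous_on UNIV f \<and>
        (\<exists>a>0. \<exists>b. \<forall>\<^sub>F \<omega> in at 0. a \<le> f \<omega> \<and> f \<omega> \<le> b)) \<and>
     (\<exists>c1>0. \<exists>c2>0. \<forall>f\<in>{f1, f2}. \<exists>\<phi>.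
        (\<forall>\<omega>. 0 < \<phi> \<omega>) \<and> fourier_of_bounded_support L \<phi> \<and>
        (\<forall>\<omega>. c1 * (\<phi> \<omega>)\<^sup>2 \<le> f \<omega> \<and> f \<omega> \<le> c2 * (\<phi> \<omega>)\<^sup>2))"

end

theory Submission
  imports Defs
begin

text \<open>
  (a) The error of the estimator is the ratio of \<open>\<Sum>\<Delta>X\<Delta>W\<close> and \<open>\<Sum>(\<Delta>X)\<^sup>2\<close>. The mean of the
  denominator is at least of order \<open>n h powr \<alpha>\<^sub>1\<^sub>1\<close>, the mean of the numerator is of smaller order
  because \<open>\<alpha>\<^sub>1\<^sub>2 > \<alpha>\<^sub>1\<^sub>1\<close>. By Wick's formula both variances are controlled by the operator norm of
  the Gram matrix of the increments, which a Schur test bounds by \<open>C h powr p\<close> for some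
  \<open>p > \<alpha>\<^sub>1\<^sub>1 - 1\<close>. For this it suffices to interpolate the local ranges linearly in each cell, so only
  their Lipschitz continuity on the pieces is used.

  (b) It suffices to confuse \<open>\<beta> = 0\<close> with \<open>\<beta> = 1\<close> for constant \<open>\<sigma>\<close> and \<open>\<Phi>\<close> and independent \<open>X\<close>
  and \<open>W\<close>. Estimators depend on countably many points \<open>t\<^sub>i\<close> of \<open>[0, L]\<close>. Orthogonalising \<open>W\<close> along
  them gives \<open>W(t\<^sub>i) = \<Sum>b\<^sub>n(t\<^sub>i) v\<^sub>n\<close> with independent standard normal \<open>v\<^sub>n\<close>, and the coordinates of
  the exponential of frequency \<open>\<omega>\<close> along the \<open>b\<^sub>n\<close> have square sum at most
  \<open>C (1 + \<bar>\<omega>\<bar>) powr (\<alpha>\<^sub>2\<^sub>2 + 1)\<close>. This weight is integrable against \<open>f\<^sub>1\<close>, so \<open>X(t\<^sub>i) = \<Sum>b\<^sub>n(t\<^sub>i) h\<^sub>n\<close>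
  with \<open>h\<close> almost surely square summable and independent of \<open>v\<close>. Hence \<open>X + W\<close> arises from \<open>W\<close>
  by the square summable shift \<open>v \<mapsto> v + h\<close>, and the Cameron-Martin density keeps the two laws
  of \<open>(X, Y)\<close> from being mutually singular.
\<close>

section \<open>Moments of Gaussian families\<close>

text \<open>In (a) Wick's formula bounds both variances by \<open>2 * \<rho> * S\<close>, with S the
  mean of the denominator, so Chebyshev leaves \<rho> / S. As S is at least of order
  \<open>h powr (\<alpha> 1 1 - 1)\<close>, this is \<open>h powr (p + 1 - \<alpha> 1 1)\<close> up
  to a constant. The Schur test wants p between 0 and 1 and below both marginal exponents; together
  with p > \<open>\<alpha> 1 1 - 1\<close> this is possible exactly because
  \<open>\<alpha> 1 1 < 2\<close> and \<open>\<alpha> 1 1 < \<alpha> 2 2 + 1\<close>. In (b) weight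
  times f1 decays like |\<omega>| to the power \<open>\<alpha> 2 2 - \<alpha> 1 1\<close>,
  integrable at infinity exactly when \<open>\<alpha> 1 1 > \<alpha> 2 2 + 1\<close>. The obstacle
  is the shift of infinitely many coordinates. Only finitely many are ever shifted, and the outcome
  is a one-sided bound P1(B) \<le> 1/2 + D * P0(B) with D independent of their number; a consistent
  estimator would turn it into 1 \<le> 1/2. For this the orthogonalisation must be triangular: each
  W(t_i) is then a finite sum, and the first N path values involve the first N coordinates
  only.\<close>

lemma centered_gaussian_moments:
  assumes "prob_space M" and "gaussian_rv M V" and mean: "(LINT x|M. V x) = 0"
  shows "integrable M (\<lambda>x. V x ^ k)"
    and "(LINT x|M. V x ^ 4) = 3 * (LINT x|M. V x ^ 2)\<^sup>2"
proof -
  interpret prob_space M by fact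
  have [measurable]: "V \<in> borel_measurable M" using assms(2) by (simp add: gaussian_rv_def)
  consider (const) \<mu> where "AE x in M. V x = \<mu>"
    | (normal) \<mu> \<sigma> where "0 < \<sigma>" "distributed M lborel V (\<lambda>x. ennreal (normal_density \<mu> \<sigma> x))"
    using assms(2) by (auto simp: gaussian_rv_def)
  then have "integrable M (\<lambda>x. V x ^ k) \<and> (LINT x|M. V x ^ 4) = 3 * (LINT x|M. V x ^ 2)\<^sup>2"
  proof cases
    case const
    have "(LINT x|M. V x) = (LINT x|M. \<mu>)" using const by (intro integral_cong_AE) auto
    then have "\<mu> = 0" using mean by (simp add: prob_space)
    then have V0: "AE x in M. V x = 0" using const by simp
    have "integrable M (\<lambda>x. V x ^ k)"
      by (rule integrable_cong_AE_imp[of _ "\<lambda>x. 0 ^ k"]) (use V0 in auto)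
    moreover have "(LINT x|M. V x ^ m) = 0" if "m > 0" for m
    proof -
      have "(LINT x|M. V x ^ m) = (LINT x|M. 0)" by (rule integral_cong_AE) (use V0 that in auto)
      then show ?thesis by simp
    qed
    ultimately show ?thesis by simp
  next
    case normal
    have "\<mu> = 0" using normal_distributed_expectation[OF normal] mean by simp
    note D = normal(2)[unfolded this]
    have "integrable lborel (\<lambda>x. normal_density 0 \<sigma> x * x ^ k)"
      using integrable_normal_moment[OF normal(1), of 0 k] by simp
    then have "integrable M (\<lambda>x. V x ^ k)"
      by (subst distributed_integrable[OF D, of "\<lambda>x. x^k", symmetric]) auto
    moreover have "(LINT x|M. V x ^ (2 * m)) = fact (2 * m) / ((2 / \<sigma>\<^sup>2)^m * fact m)" for m
      using integral_normal_moment_even[OF normal(1), of 0 m]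
        distributed_integral[OF D, of "\<lambda>x. x^(2*m)"] by auto
    \<comment> \<open>For m = 1 and m = 2 the formula gives \<sigma>^2 and 3 \<sigma>^4.\<close>
    from this[of 1] this[of 2] have "(LINT x|M. V x ^ 4) = 3 * (LINT x|M. V x ^ 2)\<^sup>2"
      using normal(1) by (simp add: fact_numeral field_simps power2_eq_square)
    ultimately show ?thesis by simp
  qed
  then show "integrable M (\<lambda>x. V x ^ k)" "(LINT x|M. V x ^ 4) = 3 * (LINT x|M. V x ^ 2)\<^sup>2" by auto
qed

text \<open>Joint Gaussianity is encoded as closure under linear combinations. That suffices for all
  mixed moments, since polarization reduces them to moments of single members of H.\<close>

definition gaussian_space :: "'a measure \<Rightarrow> ('a \<Rightarrow> real) set \<Rightarrow> bool" where
  "gaussian_space M H \<longleftrightarrow> prob_space M \<and> (\<lambda>x. 0) \<in> H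
     \<and> (\<forall>V\<in>H. gaussian_rv M V \<and> (LINT x|M. V x) = 0)
     \<and> (\<forall>U\<in>H. \<forall>V\<in>H. (\<lambda>x. U x + V x) \<in> H) \<and> (\<forall>c. \<forall>V\<in>H. (\<lambda>x. c * V x) \<in> H)"

lemma gaussian_spaceD:
  assumes "gaussian_space M H"
  shows "prob_space M" "V \<in> H \<Longrightarrow> V \<in> borel_measurable M" "U \<in> H \<Longrightarrow> V \<in> H \<Longrightarrow> (\<lambda>x. U x + V x) \<in> H"
    "V \<in> H \<Longrightarrow> (\<lambda>x. c * V x) \<in> H"
    "V \<in> H \<Longrightarrow> integrable M (\<lambda>x. V x ^ k)"
    "V \<in> H \<Longrightarrow> (LINT x|M. V x ^ 4) = 3 * (LINT x|M. V x ^ 2)\<^sup>2"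
  using assms centered_gaussian_moments[of M V] unfolding gaussian_space_def gaussian_rv_def by blast+

lemma gaussian_space_sum:
  assumes "gaussian_space M H" and "\<And>i. i \<in> I \<Longrightarrow> V i \<in> H"
  shows "(\<lambda>x. \<Sum>i\<in>I. c i * V i x) \<in> H"
  using assms(2)
proof (induction I rule: infinite_finite_induct)
  case (insert i I)
  then have "(\<lambda>x. c i * V i x + (\<Sum>i\<in>I. c i * V i x)) \<in> H"
    by (intro gaussian_spaceD(3)[OF assms(1)] gaussian_spaceD(4)[OF assms(1)]) auto
  then show ?case using insert by simp
qed (use assms(1) in \<open>auto simp: gaussian_space_def\<close>)

lemma gaussian_space_integrable_mult:
  assumes H: "gaussian_space M H" and "U \<in> H" "V \<in> H"
  shows "integrable M (\<lambda>x. U x * V x)"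
proof -
  have "(\<lambda>x. U x + V x) \<in> H" using H assms(2,3) by (rule gaussian_spaceD(3))
  then have "integrable M (\<lambda>x. ((U x + V x)^2 - U x^2 - V x^2) / 2)"
    using gaussian_spaceD(5)[OF H] assms by (intro integrable_divide integrable_diff) auto
  then show ?thesis by (simp add: power2_eq_square algebra_simps)
qed

text \<open>Polarization of the fourth power: the sign of u stays fixed, the other three signs vary,
  each term carries their product, and 192 = 8 * 4!.\<close>

lemma product_polarization:
  fixes u v w z :: real
  shows "192 * (u * v * w * z) =
    (u + v + w + z)^4 - (u - v + w + z)^4 - (u + v - w + z)^4 - (u + v + w - z)^4
    + (u - v - w + z)^4 + (u - v + w - z)^4 + (u + v - w - z)^4 - (u - v - w - z)^4"
  by (simp add: power4_eq_xxxx algebra_simps)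

text \<open>Each fourth power in the polarization identity belongs to a centred Gaussian, so its
  mean is three times its squared variance. The variances are quadratic in the covariances, and
  after expansion only the three pairings survive.\<close>

lemma gaussian_space_wick:
  assumes H: "gaussian_space M H" and UV: "U \<in> H" "V \<in> H" "X \<in> H" "Y \<in> H"
  shows "integrable M (\<lambda>x. U x * V x * X x * Y x)"
    and "(LINT x|M. U x * V x * X x * Y x) =
      (LINT x|M. U x * V x) * (LINT x|M. X x * Y x)
      + (LINT x|M. U x * X x) * (LINT x|M. V x * Y x)
      + (LINT x|M. U x * Y x) * (LINT x|M. V x * X x)"
proof -
  define S where "S p q r x = U x + p * V x + q * X x + r * Y x" for p q r x
  have SH: "S p q r \<in> H" for p q r
  proof -
    have "(\<lambda>x. U x + p * V x + q * X x + r * Y x) \<in> H"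
      using UV by (intro gaussian_spaceD(3)[OF H] gaussian_spaceD(4)[OF H])
    then show ?thesis by (simp add: S_def[abs_def])
  qed
  note I = gaussian_space_integrable_mult[OF H]
  define E where "E A B = (LINT x|M. A x * B x)" for A B :: "'a \<Rightarrow> real"
  have E2: "(LINT x|M. S p q r x ^ 2) = E U U + p^2 * E V V + q^2 * E X X + r^2 * E Y Y
     + 2 * p * E U V + 2 * q * E U X + 2 * r * E U Y + 2 * p * q * E V X + 2 * p * r * E V Y
     + 2 * q * r * E X Y" for p q r
  proof -
    have "(LINT x|M. S p q r x ^ 2) = (LINT x|M. U x * U x + p^2 * (V x * V x) + q^2 * (X x * X x)
     + r^2 * (Y x * Y x)  + 2 * p * (U x * V x) + 2 * q * (U x * X x) + 2 * r * (U x * Y x)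
     + 2 * p * q * (V x * X x) + 2 * p * r * (V x * Y x) + 2 * q * r * (X x * Y x))"
      by (rule Bochner_Integration.integral_cong) (auto simp: S_def power2_eq_square algebra_simps)
    then show ?thesis using UV by (simp add: I E_def)
  qed
  have pol: "U x * V x * X x * Y x = (S 1 1 1 x ^ 4 - S (-1) 1 1 x ^ 4 - S 1 (-1) 1 x ^ 4 - S 1 1 (-1) x ^ 4
    + S (-1) (-1) 1 x ^ 4 + S (-1) 1 (-1) x ^ 4 + S 1 (-1) (-1) x ^ 4 - S (-1) (-1) (-1) x ^ 4) / 192" for x
    using product_polarization[of "U x" "V x" "X x" "Y x"] by (simp add: S_def)
  note I4 = gaussian_spaceD(5)[OF H SH]
  show "integrable M (\<lambda>x. U x * V x * X x * Y x)"
    unfolding pol by (intro integrable_divide Bochner_Integration.integrable_diff Bochner_Integration.integrable_add I4)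
  have "(LINT x|M. U x * V x * X x * Y x) = E U V * E X Y + E U X * E V Y + E U Y * E V X"
    unfolding pol by (simp add: I4 gaussian_spaceD(6)[OF H SH] E2) (simp add: power2_eq_square algebra_simps)
  then show "(LINT x|M. U x * V x * X x * Y x) =
      (LINT x|M. U x * V x) * (LINT x|M. X x * Y x)
      + (LINT x|M. U x * X x) * (LINT x|M. V x * Y x)
      + (LINT x|M. U x * Y x) * (LINT x|M. V x * X x)" by (simp add: E_def)
qed

lemma gaussian_space_quadratic_form:
  fixes V :: "'i \<Rightarrow> 'a \<Rightarrow> real"
  assumes H: "gaussian_space M H" and VH: "\<And>i. i \<in> I \<Longrightarrow> V i \<in> H"
  shows "(LINT x|M. (\<Sum>i\<in>I. v i * V i x)\<^sup>2) = (\<Sum>i\<in>I. \<Sum>j\<in>I. v i * v j * (LINT x|M. V i x * V j x))"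
proof -
  note I2 = gaussian_space_integrable_mult[OF H]
    have "(LINT x|M. (\<Sum>i\<in>I. v i * V i x)\<^sup>2) = (LINT x|M. (\<Sum>i\<in>I. \<Sum>j\<in>I. v i * v j * (V i x * V j x)))"
      by (rule Bochner_Integration.integral_cong) (auto simp: power2_eq_square sum_product algebra_simps)
    also have "\<dots> = (\<Sum>i\<in>I. LINT x|M. (\<Sum>j\<in>I. v i * v j * (V i x * V j x)))"
      using VH by (intro Bochner_Integration.integral_sum Bochner_Integration.integrable_sum integrable_mult_right I2) auto
    also have "\<dots> = (\<Sum>i\<in>I. \<Sum>j\<in>I. v i * v j * (LINT x|M. V i x * V j x))"
    proof (rule sum.cong[OF refl])
      fix i assume "i \<in> I"
      then have "(LINT x|M. (\<Sum>j\<in>I. v i * v j * (V i x * V j x))) = (\<Sum>j\<in>I. LINT x|M. v i * v j * (V i x * V j x))"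
        using VH by (intro Bochner_Integration.integral_sum integrable_mult_right I2) auto
      then show "(LINT x|M. (\<Sum>j\<in>I. v i * v j * (V i x * V j x))) = (\<Sum>j\<in>I. v i * v j * (LINT x|M. V i x * V j x))"
        by simp
    qed
    finally show ?thesis .
qed

lemma Cauchy_Schwarz_integral:
  fixes U V :: "'a \<Rightarrow> real"
  assumes "integrable M (\<lambda>x. U x * V x)" "integrable M (\<lambda>x. U x ^ 2)" "integrable M (\<lambda>x. V x ^ 2)"
  shows "(LINT x|M. U x * V x)\<^sup>2 \<le> (LINT x|M. U x ^ 2) * (LINT x|M. V x ^ 2)"
proof -
  define a b c where "a = (LINT x|M. U x ^ 2)" "b = (LINT x|M. U x * V x)" "c = (LINT x|M. V x ^ 2)"
  have nn: "0 \<le> s^2 * a + 2 * s * t * b + t^2 * c" for s t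
  proof -
    have "0 \<le> (LINT x|M. (s * U x + t * V x)^2)" by simp
    also have "\<dots> = (LINT x|M. s^2 * U x ^ 2 + 2 * s * t * (U x * V x) + t^2 * V x ^ 2)"
      by (rule Bochner_Integration.integral_cong) (auto simp: power2_eq_square algebra_simps)
    finally show ?thesis using assms by (simp add: a_b_c_def)
  qed
  have "a \<ge> 0" "c \<ge> 0" by (simp_all add: a_b_c_def)
  show ?thesis
  proof (cases "a = 0")
    case True
    have "b = 0"
    proof (rule ccontr)
      assume "b \<noteq> 0"
      \<comment> \<open>With a = 0 the form is linear in s, and this choice of s gives it the value
        -1.\<close>
      then show False using nn[of "- (c + 1) / (2 * b)" 1] True by (simp add: field_simps)
    qed
    then show ?thesis using True by (simp flip: a_b_c_def)
  next
    case False
    then have "a > 0" using \<open>a \<ge> 0\<close> by simp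
    have "0 \<le> a * (a * c - b\<^sup>2)" using nn[of "-b" a] by (simp add: power2_eq_square algebra_simps)
    then show ?thesis using \<open>a > 0\<close> by (simp flip: a_b_c_def add: zero_le_mult_iff)
  qed
qed

text \<open>By Wick's formula the left-hand side is
  \<open>\<Sum>\<^sub>i \<Sum>\<^sub>j (E[U\<^sub>iU\<^sub>j] E[V\<^sub>iV\<^sub>j] + E[U\<^sub>iV\<^sub>j] E[V\<^sub>iU\<^sub>j])\<close>; both parts are bounded through the operator norm
  \<open>\<rho>\<close> of the Gram matrix of \<open>V\<close>.\<close>

lemma gaussian_product_sum_variance:
  fixes U V :: "'i \<Rightarrow> 'a \<Rightarrow> real"
  assumes H: "gaussian_space M H" and fin: "finite I"
    and UH: "\<And>i. i \<in> I \<Longrightarrow> U i \<in> H" and VH: "\<And>i. i \<in> I \<Longrightarrow> V i \<in> H"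
    and op: "\<And>v. (LINT x|M. (\<Sum>i\<in>I. v i * V i x)\<^sup>2) \<le> \<rho> * (\<Sum>i\<in>I. (v i)\<^sup>2)"
  shows "integrable M (\<lambda>x. ((\<Sum>i\<in>I. U i x * V i x) - (\<Sum>i\<in>I. LINT x|M. U i x * V i x))\<^sup>2)"
    and "(LINT x|M. ((\<Sum>i\<in>I. U i x * V i x) - (\<Sum>i\<in>I. LINT x|M. U i x * V i x))\<^sup>2)
      \<le> 2 * \<rho> * (\<Sum>i\<in>I. LINT x|M. (U i x)\<^sup>2)"
proof -
  interpret prob_space M using H by (rule gaussian_spaceD)
  note I2 = gaussian_space_integrable_mult[OF H]
  note I4 = gaussian_space_wick(1)[OF H]
  define E where "E A B = (LINT x|M. A x * B x)" for A B :: "'a \<Rightarrow> real"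
  define t where "t = (\<Sum>i\<in>I. E (U i) (V i))"
  have expand: "((\<Sum>i\<in>I. U i x * V i x) - t)\<^sup>2
      = (\<Sum>i\<in>I. \<Sum>j\<in>I. U i x * V i x * U j x * V j x) - 2 * t * (\<Sum>i\<in>I. U i x * V i x) + t\<^sup>2" for x
  proof -
    have "(\<Sum>i\<in>I. U i x * V i x)\<^sup>2 = (\<Sum>i\<in>I. \<Sum>j\<in>I. U i x * V i x * U j x * V j x)"
      by (simp add: sum_product power2_eq_square mult.assoc)
    then show ?thesis by (simp add: power2_diff)
  qed
  have int: "integrable M (\<lambda>x. ((\<Sum>i\<in>I. U i x * V i x) - t)\<^sup>2)"
    unfolding expand using UH VH
    by (intro Bochner_Integration.integrable_add Bochner_Integration.integrable_diff
        Bochner_Integration.integrable_sum integrable_mult_right I2 I4 integrable_const) auto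
  have c1: "integrable M (\<lambda>x. \<Sum>i\<in>I. \<Sum>j\<in>I. U i x * V i x * U j x * V j x)"
    using UH VH by (intro Bochner_Integration.integrable_sum I4) auto
  have c2: "integrable M (\<lambda>x. \<Sum>i\<in>I. U i x * V i x)"
    using UH VH by (intro Bochner_Integration.integrable_sum I2) auto
  have "(LINT x|M. ((\<Sum>i\<in>I. U i x * V i x) - t)\<^sup>2)
     = (LINT x|M. (\<Sum>i\<in>I. \<Sum>j\<in>I. U i x * V i x * U j x * V j x)) - 2 * t * (LINT x|M. (\<Sum>i\<in>I. U i x * V i x)) + t\<^sup>2"
    unfolding expand using c1 c2 by (simp add: prob_space)
  also have "(LINT x|M. (\<Sum>i\<in>I. U i x * V i x)) = t"
    unfolding t_def E_def using UH VH by (intro Bochner_Integration.integral_sum I2) auto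
  also have "(LINT x|M. (\<Sum>i\<in>I. \<Sum>j\<in>I. U i x * V i x * U j x * V j x))
      = (\<Sum>i\<in>I. \<Sum>j\<in>I. LINT x|M. U i x * V i x * U j x * V j x)"
    using UH VH by (subst Bochner_Integration.integral_sum)
      (auto intro!: Bochner_Integration.integrable_sum I4 sum.cong Bochner_Integration.integral_sum)
  also have "\<dots> = (\<Sum>i\<in>I. \<Sum>j\<in>I. E (U i) (V i) * E (U j) (V j)
        + E (U i) (U j) * E (V i) (V j) + E (U i) (V j) * E (V i) (U j))"
    unfolding E_def using UH VH by (intro sum.cong refl gaussian_space_wick(2)[OF H]) auto
  also have "\<dots> = t\<^sup>2 + (\<Sum>i\<in>I. \<Sum>j\<in>I. E (U i) (U j) * E (V i) (V j))
      + (\<Sum>i\<in>I. \<Sum>j\<in>I. E (U i) (V j) * E (V i) (U j))"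
    by (simp add: sum.distrib t_def power2_eq_square sum_product)
  finally have var: "(LINT x|M. ((\<Sum>i\<in>I. U i x * V i x) - t)\<^sup>2)
     = (\<Sum>i\<in>I. \<Sum>j\<in>I. E (U i) (U j) * E (V i) (V j)) + (\<Sum>i\<in>I. \<Sum>j\<in>I. E (U i) (V j) * E (V i) (U j))"
    by (simp add: power2_eq_square)
  have quad: "(LINT x|M. (\<Sum>i\<in>I. v i * V i x)\<^sup>2) = (\<Sum>i\<in>I. \<Sum>j\<in>I. v i * v j * E (V i) (V j))" for v
    unfolding E_def using VH by (rule gaussian_space_quadratic_form[OF H])
  have "(\<Sum>i\<in>I. \<Sum>j\<in>I. E (U i) (U j) * E (V i) (V j))
      = (\<Sum>i\<in>I. \<Sum>j\<in>I. LINT y|M. U i y * U j y * E (V i) (V j))"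
    by (simp add: E_def)
  also have "\<dots> = (LINT y|M. (\<Sum>i\<in>I. \<Sum>j\<in>I. U i y * U j y * E (V i) (V j)))"
  proof -
    have int: "integrable M (\<lambda>y. U i y * U j y * E (V i) (V j))" if "i \<in> I" "j \<in> I" for i j
      using UH that by (intro integrable_mult_left I2) auto
    show ?thesis
      using int by (simp add: Bochner_Integration.integral_sum Bochner_Integration.integrable_sum
        del: integral_mult_left_zero)
  qed
  \<comment> \<open>For each fixed y the integrand is the quadratic form of the Gram matrix of V at
    the vector with entries U i y, so \<open>op\<close> applies pointwise.\<close>
  also have "\<dots> \<le> (LINT y|M. \<rho> * (\<Sum>i\<in>I. (U i y)\<^sup>2))"
  proof (rule integral_mono)
    show "integrable M (\<lambda>y. \<Sum>i\<in>I. \<Sum>j\<in>I. U i y * U j y * E (V i) (V j))"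
      using UH by (intro Bochner_Integration.integrable_sum integrable_mult_left I2) auto
    show "integrable M (\<lambda>y. \<rho> * (\<Sum>i\<in>I. (U i y)\<^sup>2))"
      using UH by (intro Bochner_Integration.integrable_sum integrable_mult_right gaussian_spaceD(5)[OF H]) auto
  qed (use quad op in \<open>simp add: mult.commute\<close>)
  also have "\<dots> = \<rho> * (\<Sum>i\<in>I. LINT x|M. (U i x)\<^sup>2)"
    using UH by (simp add: gaussian_spaceD(5)[OF H])
  finally have first: "(\<Sum>i\<in>I. \<Sum>j\<in>I. E (U i) (U j) * E (V i) (V j)) \<le> \<rho> * (\<Sum>i\<in>I. LINT x|M. (U i x)\<^sup>2)" .
  \<comment> \<open>Bessel-type bound: the sum q of squares is the covariance of U i with T, the
    combination of the V j having those covariances as coefficients. Cauchy-Schwarz and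
    \<open>op\<close> give q^2 \<le> \<rho> E[(U i)^2] q, and one q cancels.\<close>
  have row: "(\<Sum>j\<in>I. (E (U i) (V j))\<^sup>2) \<le> \<rho> * (LINT x|M. (U i x)\<^sup>2)" if i: "i \<in> I" for i
  proof -
    define v where "v j = E (U i) (V j)" for j
    define T where "T x = (\<Sum>j\<in>I. v j * V j x)" for x
    have T: "T \<in> H" unfolding T_def[abs_def] using VH by (intro gaussian_space_sum[OF H])
    define q where "q = (\<Sum>j\<in>I. (v j)\<^sup>2)"
    have "q = (LINT x|M. (\<Sum>j\<in>I. v j * (U i x * V j x)))"
      using UH VH i by (simp add: q_def Bochner_Integration.integral_sum I2 v_def E_def power2_eq_square)
    also have "\<dots> = (LINT x|M. U i x * T x)"
      by (simp add: T_def sum_distrib_left algebra_simps)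
    finally have "q\<^sup>2 \<le> (LINT x|M. (U i x)\<^sup>2) * (LINT x|M. (T x)\<^sup>2)"
      using Cauchy_Schwarz_integral[of M "U i" T] UH[OF i] T I2[of "U i" T] gaussian_spaceD(5)[OF H] by simp
    also have "\<dots> \<le> (LINT x|M. (U i x)\<^sup>2) * (\<rho> * q)"
      unfolding T_def q_def by (intro mult_left_mono op) auto
    finally have *: "q * q \<le> (\<rho> * (LINT x|M. (U i x)\<^sup>2)) * q" by (simp add: power2_eq_square algebra_simps)
    have q0: "0 \<le> q" unfolding q_def by (intro sum_nonneg) auto
    have "q \<le> \<rho> * (LINT x|M. (U i x)\<^sup>2)"
    proof (cases "q = 0")
      case True
      \<comment> \<open>For q = 0 only \<rho> \<ge> 0 has to be seen; \<open>op\<close> at a unit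
        vector shows it.\<close>
      have "0 \<le> (LINT x|M. (\<Sum>k\<in>I. (if k = i then 1 else 0) * V k x)\<^sup>2)" by simp
      also have "\<dots> \<le> \<rho>" using op[of "\<lambda>k. if k = i then 1 else 0"] i fin by (simp add: if_distrib[of power2] cong: if_cong)
      finally show ?thesis using True by simp
    next
      case False
      with q0 have "0 < q" by simp
      with * show ?thesis by simp
    qed
    then show ?thesis by (simp add: q_def v_def)
  qed
  have "(\<Sum>i\<in>I. \<Sum>j\<in>I. E (U i) (V j) * E (V i) (U j))
     \<le> (\<Sum>i\<in>I. \<Sum>j\<in>I. ((E (U i) (V j))\<^sup>2 + (E (V i) (U j))\<^sup>2) / 2)"
  proof (intro sum_mono)
    fix i j
    show "E (U i) (V j) * E (V i) (U j) \<le> ((E (U i) (V j))\<^sup>2 + (E (V i) (U j))\<^sup>2) / 2"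
      using sum_squares_bound[of "E (U i) (V j)" "E (V i) (U j)"] by simp
  qed
  also have "\<dots> = ((\<Sum>i\<in>I. \<Sum>j\<in>I. (E (U i) (V j))\<^sup>2) + (\<Sum>i\<in>I. \<Sum>j\<in>I. (E (V i) (U j))\<^sup>2)) / 2"
    by (simp add: sum_divide_distrib sum.distrib add_divide_distrib)
  also have "(\<Sum>i\<in>I. \<Sum>j\<in>I. (E (V i) (U j))\<^sup>2) = (\<Sum>i\<in>I. \<Sum>j\<in>I. (E (U i) (V j))\<^sup>2)"
    by (subst sum.swap) (simp add: E_def mult.commute)
  also have "((\<Sum>i\<in>I. \<Sum>j\<in>I. (E (U i) (V j))\<^sup>2) + (\<Sum>i\<in>I. \<Sum>j\<in>I. (E (U i) (V j))\<^sup>2)) / 2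
      = (\<Sum>i\<in>I. \<Sum>j\<in>I. (E (U i) (V j))\<^sup>2)" by simp
  also have "\<dots> \<le> (\<Sum>i\<in>I. \<rho> * (LINT x|M. (U i x)\<^sup>2))" by (intro sum_mono row)
  finally have second: "(\<Sum>i\<in>I. \<Sum>j\<in>I. E (U i) (V j) * E (V i) (U j)) \<le> \<rho> * (\<Sum>i\<in>I. LINT x|M. (U i x)\<^sup>2)"
    by (simp add: sum_distrib_left)
  show "integrable M (\<lambda>x. ((\<Sum>i\<in>I. U i x * V i x) - (\<Sum>i\<in>I. LINT x|M. U i x * V i x))\<^sup>2)"
    using int by (simp add: t_def E_def)
  show "(LINT x|M. ((\<Sum>i\<in>I. U i x * V i x) - (\<Sum>i\<in>I. LINT x|M. U i x * V i x))\<^sup>2)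
      \<le> 2 * \<rho> * (\<Sum>i\<in>I. LINT x|M. (U i x)\<^sup>2)"
    using var first second by (simp add: t_def E_def)
qed

text \<open>Two combinations over finite sets S and T are both rewritten over their union with zero
  coefficients outside; this gives closure under addition.\<close>

lemma bivariate_gaussian_field_space:
  assumes "bivariate_gaussian_field M Z C"
  shows "gaussian_space M {\<lambda>x. \<Sum>k\<in>{1,2::nat}. \<Sum>s\<in>S. a k s * Z k s x | S a. finite S}"
    (is "gaussian_space M ?H")
proof -
  interpret prob_space M using assms by (simp add: bivariate_gaussian_field_def)
  have Zm: "\<And>k s. k \<in> {1,2} \<Longrightarrow> Z k s \<in> borel_measurable M"
    and gauss: "\<And>S a. finite S \<Longrightarrow> gaussian_rv M (\<lambda>x. \<Sum>k\<in>{1,2}. \<Sum>s\<in>S. a k s * Z k s x)"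
    and Z0: "\<And>k s. k \<in> {1,2} \<Longrightarrow> (LINT x|M. Z k s x) = 0"
    using assms unfolding bivariate_gaussian_field_def by blast+
  have single: "gaussian_rv M (Z k s)" if "k \<in> {1,2}" for k s
    using gauss[of "{s}" "\<lambda>k' _. if k' = k then 1 else 0"] that by auto
  have Zi: "integrable M (Z k s)" if "k \<in> {1,2}" for k s
    using centered_gaussian_moments(1)[OF prob_space_axioms single[OF that] Z0[OF that], of s 1] that by simp
  have mean: "(LINT x|M. (\<Sum>k\<in>{1,2::nat}. \<Sum>s\<in>S. a k s * Z k s x)) = 0" for S a
    using Zi Z0 by (simp add: Bochner_Integration.integral_sum)
  have union: "(\<Sum>k\<in>{1,2::nat}. \<Sum>s\<in>S. a k s * Z k s x) = (\<Sum>k\<in>{1,2}. \<Sum>s\<in>S \<union> T. (if s \<in> S then a k s else 0) * Z k s x)"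
    if "finite S" "finite T" for S T a x
    using that by (intro sum.cong refl sum.mono_neutral_cong_left) auto
  show ?thesis unfolding gaussian_space_def
  proof (intro conjI ballI allI)
    show "(\<lambda>x. 0) \<in> ?H" by (auto intro!: exI[of _ "{}"])
  next
    fix V assume "V \<in> ?H"
    then show "gaussian_rv M V" "(LINT x|M. V x) = 0" using gauss mean by auto
  next
    fix U V assume "U \<in> ?H" "V \<in> ?H"
    then obtain S a T b where fin: "finite S" "finite T"
      and U: "U = (\<lambda>x. \<Sum>k\<in>{1,2::nat}. \<Sum>s\<in>S. a k s * Z k s x)"
      and V: "V = (\<lambda>x. \<Sum>k\<in>{1,2::nat}. \<Sum>s\<in>T. b k s * Z k s x)" by blast
    have "(\<lambda>x. U x + V x) = (\<lambda>x. \<Sum>k\<in>{1,2::nat}. \<Sum>s\<in>S \<union> T.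
        ((if s \<in> S then a k s else 0) + (if s \<in> T then b k s else 0)) * Z k s x)"
      unfolding U V union[OF fin] union[OF fin(2,1)]
      by (simp add: sum.distrib distrib_right Un_commute[of T S] del: Un_iff)
    then show "(\<lambda>x. U x + V x) \<in> ?H"
      using fin by (intro CollectI exI[of _ "S \<union> T"] exI conjI) auto
  next
    fix c :: real and V assume "V \<in> ?H"
    then obtain T b where fin: "finite T"
      and V: "V = (\<lambda>x. \<Sum>k\<in>{1,2::nat}. \<Sum>s\<in>T. b k s * Z k s x)" by blast
    have "(\<lambda>x. c * V x) = (\<lambda>x. \<Sum>k\<in>{1,2::nat}. \<Sum>s\<in>T. (c * b k s) * Z k s x)"
      unfolding V by (simp add: sum_distrib_left distrib_left mult.assoc)
    then show "(\<lambda>x. c * V x) \<in> ?H"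
      using fin by (intro CollectI exI[of _ T] exI conjI) auto
  qed (rule prob_space_axioms)
qed

section \<open>Covariance kernels near the diagonal\<close>

text \<open>Power series are differentiated termwise inside their disc, \<open>diffs\<close> being
  the coefficient sequence of the derivative. Later arguments use analyticity only through this
  local C^2 property.\<close>

lemma real_analytic_on_derivatives:
  assumes "real_analytic_on f S" and "x \<in> S"
  shows "\<exists>r>0. \<exists>f1 f2. \<forall>y. \<bar>y - x\<bar> < r \<longrightarrow>
    (f has_real_derivative f1 y) (at y) \<and> (f1 has_real_derivative f2 y) (at y) \<and> isCont f2 y"
proof -
  obtain r a where r: "r > 0" and sums: "\<And>y. \<bar>y - x\<bar> < r \<Longrightarrow> (\<lambda>n. a n * (y - x) ^ n) sums f y"
    using assms unfolding real_analytic_on_def by blast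
  define F where "F c z = (\<Sum>n. c n * z ^ n)" for c :: "nat \<Rightarrow> real" and z :: real
  have s0: "summable (\<lambda>n. a n * z ^ n)" if "norm z < r" for z
    using sums[of "x + z"] that by (auto simp: sums_iff)
  have s1: "summable (\<lambda>n. diffs a n * z ^ n)" if "norm z < r" for z
    using termdiff_converges[OF that s0] .
  have s2: "summable (\<lambda>n. diffs (diffs a) n * z ^ n)" if "norm z < r" for z
    using termdiff_converges[OF that s1] .
  have D: "((\<lambda>y. F c (y - x)) has_real_derivative F (diffs c) (y - x)) (at y)"
    if "\<And>z. norm z < r \<Longrightarrow> summable (\<lambda>n. c n * z ^ n)" "\<bar>y - x\<bar> < r" for c y
  proof -
    have "(F c has_real_derivative F (diffs c) (y - x)) (at (y - x))"
      unfolding F_def[abs_def] using that by (intro termdiffs_strong') auto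
    moreover have "((\<lambda>y. y - x) has_real_derivative 1) (at y)"
      by (auto intro!: derivative_eq_intros)
    ultimately have "((\<lambda>y. F c (y - x)) has_real_derivative F (diffs c) (y - x) * 1) (at y)"
      by (rule DERIV_chain2)
    then show ?thesis by simp
  qed
  have fF: "F a (y - x) = f y" if "\<bar>y - x\<bar> < r" for y
    using sums[OF that] by (simp add: F_def sums_iff)
  have "(f has_real_derivative F (diffs a) (y - x)) (at y)" if "\<bar>y - x\<bar> < r" for y
  proof (rule has_field_derivative_transform_within_open[OF D[OF s0 that]])
    show "open (ball x r)" by simp
  qed (use that fF in \<open>auto simp: dist_real_def abs_minus_commute\<close>)
  moreover have "isCont (\<lambda>y. F (diffs (diffs a)) (y - x)) y" if "\<bar>y - x\<bar> < r" for y
    using D[OF s2 that] by (rule DERIV_isCont)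
  ultimately show ?thesis using r D[OF s1]
    by (intro exI[of _ r] conjI exI[of _ "\<lambda>y. F (diffs a) (y - x)"] exI[of _ "\<lambda>y. F (diffs (diffs a)) (y - x)"]) auto
qed

text \<open>The derivatives given near each point are merged into the single function
  \<open>deriv g\<close>, which is continuous on a compact interval and hence bounded there.\<close>

lemma real_analytic_on_lipschitz:
  assumes an: "real_analytic_on g U" and sub: "{a..b} \<subseteq> U"
  shows "\<exists>C\<ge>0. \<forall>s\<in>{a..b}. \<forall>t\<in>{a..b}. \<bar>g s - g t\<bar> \<le> C * \<bar>s - t\<bar>"
proof -
  have D: "(g has_real_derivative deriv g x) (at x) \<and> isCont (deriv g) x" if x: "x \<in> {a..b}" for x
  proof -
    from real_analytic_on_derivatives[OF an, of x] x sub
    obtain r f1 f2 where r: "r > 0"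
      and d: "\<And>y. \<bar>y - x\<bar> < r \<Longrightarrow> (g has_real_derivative f1 y) (at y) \<and> (f1 has_real_derivative f2 y) (at y)"
      by (meson subsetD)
    have "(deriv g has_real_derivative f2 x) (at x)"
    proof (rule has_field_derivative_transform_within_open[of f1 _ x "ball x r"])
      show "(f1 has_real_derivative f2 x) (at x)" using d[of x] r by simp
    qed (use r d in \<open>auto simp: dist_real_def abs_minus_commute intro!: DERIV_imp_deriv[symmetric]\<close>)
    then show ?thesis using d[of x] r DERIV_isCont DERIV_imp_deriv by fastforce
  qed
  then have "continuous_on {a..b} (deriv g)"
    by (simp add: continuous_at_imp_continuous_on)
  then have "bounded (deriv g ` {a..b})"
    by (intro compact_imp_bounded compact_continuous_image) auto
  then obtain C where C: "\<forall>x\<in>{a..b}. norm (deriv g x) \<le> C" unfolding bounded_iff by auto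
  have "\<bar>g s - g t\<bar> \<le> \<bar>C\<bar> * \<bar>s - t\<bar>" if "s \<in> {a..b}" "t \<in> {a..b}" for s t
    using field_differentiable_bound[of "{a..b}" g "deriv g" "\<bar>C\<bar>" s t] D C that
    by (force simp: has_field_derivative_at_within)
  then show ?thesis by (intro exI[of _ "\<bar>C\<bar>"]) auto
qed

text \<open>Lipschitz bounds on finitely many adjacent closed intervals glue to one on their union;
  the sum of the constants of the pieces serves for all of them.\<close>

lemma piecewise_analytic_lipschitz:
  assumes "piecewise_analytic L f"
  shows "\<exists>C\<ge>0. \<forall>s\<in>{0..L}. \<forall>t\<in>{0..L}. \<bar>f s - f t\<bar> \<le> C * \<bar>s - t\<bar>"
proof -
  obtain m \<tau> where \<tau>: "\<tau> 0 = 0" "\<tau> m = L"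
    and pieces: "\<And>r. r < (m::nat) \<Longrightarrow> \<exists>U g. open U \<and> {\<tau> r..\<tau> (Suc r)} \<subseteq> U \<and> real_analytic_on g U \<and>
                     (\<forall>t\<in>{\<tau> r..\<tau> (Suc r)}. g t = f t)"
    using assms unfolding piecewise_analytic_def by blast
  have "\<exists>C\<ge>0. \<forall>s\<in>{\<tau> r..\<tau> (Suc r)}. \<forall>t\<in>{\<tau> r..\<tau> (Suc r)}. \<bar>f s - f t\<bar> \<le> C * \<bar>s - t\<bar>" if r: "r < m" for r
  proof -
    obtain U g where U: "{\<tau> r..\<tau> (Suc r)} \<subseteq> U" "real_analytic_on g U" "\<forall>t\<in>{\<tau> r..\<tau> (Suc r)}. g t = f t"
      using pieces[OF r] by auto
    then show ?thesis using real_analytic_on_lipschitz[OF U(2,1)] by (metis (no_types, lifting))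
  qed
  then obtain C where C0: "\<And>r. r < m \<Longrightarrow> C r \<ge> 0"
    and C: "\<And>r s t. r < m \<Longrightarrow> s\<in>{\<tau> r..\<tau> (Suc r)} \<Longrightarrow> t\<in>{\<tau> r..\<tau> (Suc r)} \<Longrightarrow> \<bar>f s - f t\<bar> \<le> C r * \<bar>s - t\<bar>"
    by metis
  define D where "D = (\<Sum>r<m. C r)"
  have D0: "D \<ge> 0" unfolding D_def by (intro sum_nonneg) (use C0 in auto)
  have CD: "C r \<le> D" if "r < m" for r
    unfolding D_def using that C0 by (intro member_le_sum) auto
  have cover: "{\<tau> 0..\<tau> k} \<subseteq> (\<Union>r\<in>{..<k}. {\<tau> r..\<tau> (Suc r)}) \<union> {\<tau> 0}" for k
  proof (induction k)
    case (Suc k)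
    show ?case
    proof
      fix x assume "x \<in> {\<tau> 0..\<tau> (Suc k)}"
      then show "x \<in> (\<Union>r\<in>{..<Suc k}. {\<tau> r..\<tau> (Suc r)}) \<union> {\<tau> 0}"
      proof (cases "x \<le> \<tau> k")
        case True
        then have "x \<in> (\<Union>r\<in>{..<k}. {\<tau> r..\<tau> (Suc r)}) \<union> {\<tau> 0}"
          using Suc \<open>x \<in> _\<close> by (meson atLeastAtMost_iff subsetD)
        then show ?thesis by (auto simp: less_Suc_eq)
      next
        case False
        then have "x \<in> {\<tau> k..\<tau> (Suc k)}" using \<open>x \<in> _\<close> by simp
        then show ?thesis by blast
      qed
    qed
  qed auto
  \<comment> \<open>The additional index m carries the one-point piece at \<open>\<tau> 0\<close>,
    so that the covering is also correct for m = 0.\<close>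
  have "D-lipschitz_on {0..L} f"
  proof (rule lipschitz_on_closed_Union[of "insert m {..<m}" D "\<lambda>r. if r < m then {\<tau> r..\<tau> (Suc r)} else {\<tau> 0}"])
    fix i assume "i \<in> insert m {..<m}"
    show "D-lipschitz_on (if i < m then {\<tau> i..\<tau> (Suc i)} else {\<tau> 0}) f"
    proof (rule lipschitz_onI)
      fix x y assume xy: "x \<in> (if i < m then {\<tau> i..\<tau> (Suc i)} else {\<tau> 0})" "y \<in> (if i < m then {\<tau> i..\<tau> (Suc i)} else {\<tau> 0})"
      show "dist (f x) (f y) \<le> D * dist x y"
      proof (cases "i < m")
        case True
        then have "\<bar>f x - f y\<bar> \<le> C i * \<bar>x - y\<bar>" using C xy by simp
        also have "\<dots> \<le> D * \<bar>x - y\<bar>" using CD[OF True] by (intro mult_right_mono) auto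
        finally show ?thesis by (simp add: dist_real_def)
      qed (use xy in simp)
    qed (rule D0)
  next
    show "{0..L} \<subseteq> (\<Union>i\<in>insert m {..<m}. if i < m then {\<tau> i..\<tau> (Suc i)} else {\<tau> 0})"
      using cover[of m] \<tau> by (fastforce split: if_splits)
  qed (use D0 in auto)
  then show ?thesis using D0 by (intro exI[of _ D]) (auto simp: lipschitz_on_def dist_real_def)
qed

text \<open>Splits K near 0 into a smooth part of size t^2, since an even analytic function has
  vanishing derivative at 0, and the singular part \<open>D0\<close> with leading term c t^\<alpha>.
  The added 1 in the bounds for k1 and k2 comes from the analytic summand.\<close>

lemma cond_A_near_zero:
  assumes "cond_A L c \<alpha> K" and "0 < L"
  shows "\<exists>\<delta>>0. \<delta> \<le> 1 \<and> \<delta> \<le> L \<and> (\<exists>C\<ge>0. \<exists>D0 k1 k2.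
    (\<forall>t. 0 < t \<and> t < \<delta> \<longrightarrow> (K has_real_derivative k1 t) (at t) \<and> (k1 has_real_derivative k2 t) (at t)
      \<and> \<bar>k1 t\<bar> \<le> C * (t powr (\<alpha> - 1) + 1) \<and> \<bar>k2 t\<bar> \<le> C * (t powr (\<alpha> - 2) + 1)
      \<and> \<bar>K t - K 0 - D0 t\<bar> \<le> C * t\<^sup>2 \<and> \<bar>D0 t\<bar> \<le> C * t powr \<alpha>)
    \<and> (\<lambda>t. D0 t - c * t powr \<alpha>) \<in> o[at_right 0](\<lambda>t. t powr \<alpha>))"
proof -
  obtain A B D where \<alpha>: "0 < \<alpha>" and h: "\<forall>t\<in>{-L..L}. K t = A t + B t"
    "\<forall>t\<in>{-L..L}. A (- t) = A t" "real_analytic_on A {-L..L}"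
    "continuous_on {-L..L} B"
    "\<forall>t\<in>{0<..L}. D 0 t = B t"
    "\<forall>k. \<forall>t\<in>{0<..L}. (D k has_real_derivative D (Suc k) t) (at t within {0<..L})"
    "\<forall>k. (\<lambda>t. D k t - falling \<alpha> k * c * t powr (\<alpha> - real k)) \<in> o[at_right 0](\<lambda>t. t powr (\<alpha> - real k))"
    using assms(1) unfolding cond_A_def by (elim conjE exE) (rule that; assumption)
  note A_an = h(3) and B_cont = h(4)
  have K: "\<And>t. t \<in> {-L..L} \<Longrightarrow> K t = A t + B t" using h(1) by (rule bspec)
  have A_even: "\<And>t. t \<in> {-L..L} \<Longrightarrow> A (- t) = A t" using h(2) by (rule bspec)
  have D0: "\<And>t. t \<in> {0<..L} \<Longrightarrow> D 0 t = B t" using h(5) by (rule bspec)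
  have D: "(D k has_real_derivative D (Suc k) t) (at t within {0<..L})" if "t \<in> {0<..L}" for k t
    using h(6)[rule_format, OF that] .
  have Do: "(\<lambda>t. D k t - falling \<alpha> k * c * t powr (\<alpha> - real k)) \<in> o[at_right 0](\<lambda>t. t powr (\<alpha> - real k))" for k
    using h(7) by (rule spec)
  obtain r A1 A2 where r: "r > 0"
    and A: "\<And>y. \<bar>y\<bar> < r \<Longrightarrow> (A has_real_derivative A1 y) (at y) \<and> (A1 has_real_derivative A2 y) (at y) \<and> isCont A2 y"
    using real_analytic_on_derivatives[OF A_an, of 0] \<open>0 < L\<close> by auto
  \<comment> \<open>Differentiating A(-t) = A(t) at 0.\<close>
  have "A1 0 = - A1 0"
  proof (rule DERIV_unique[of A])
    show "(A has_real_derivative A1 0) (at 0)" using A[of 0] r by simp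
    have "((\<lambda>t. A (- t)) has_real_derivative - A1 0) (at 0)"
      using DERIV_mirror[of A "A1 0" 0] A[of 0] r by simp
    then show "(A has_real_derivative - A1 0) (at 0)"
      by (rule has_field_derivative_transform_within_open[of _ _ _ "{-L<..<L}"]) (use A_even \<open>0 < L\<close> in auto)
  qed
  then have A10: "A1 0 = 0" by simp
  have "continuous_on {0..r/2} A2" using A r by (intro continuous_at_imp_continuous_on) auto
  then have "bounded (A2 ` {0..r/2})" by (intro compact_imp_bounded compact_continuous_image) auto
  then obtain C2 where "\<forall>t\<in>{0..r/2}. \<bar>A2 t\<bar> \<le> C2" unfolding bounded_iff by auto
  then have C2: "\<And>t. t \<in> {0..r/2} \<Longrightarrow> \<bar>A2 t\<bar> \<le> C2" by blast
  have C20: "C2 \<ge> 0" using C2[of 0] r by auto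
  have A1b: "\<bar>A1 t\<bar> \<le> C2 * t" if t: "0 < t" "t \<le> r / 2" for t
  proof -
    obtain z where "0 < z" "z < t" "A1 t - A1 0 = (t - 0) * A2 z"
      using MVT2[OF t(1), of A1 A2] A t r by auto
    then show ?thesis using C2[of z] t A10 by (simp add: abs_mult mult.commute mult_left_mono)
  qed
  have A0b: "\<bar>A t - A 0\<bar> \<le> C2 * t\<^sup>2" if t: "0 < t" "t \<le> r / 2" for t
  proof -
    obtain z where z: "0 < z" "z < t" "A t - A 0 = (t - 0) * A1 z"
      using MVT2[OF t(1), of A A1] A t r by auto
    have "\<bar>A t - A 0\<bar> = t * \<bar>A1 z\<bar>" using z t by (simp add: abs_mult)
    also have "\<dots> \<le> t * (C2 * t)" using A1b[of z] z t C20
      by (intro mult_left_mono) (auto intro: order.trans[OF _ mult_left_mono])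
    finally show ?thesis by (simp add: power2_eq_square mult_ac)
  qed
  have "\<exists>d>0. \<forall>t. 0 < t \<and> t < d \<longrightarrow> \<bar>D k t\<bar> \<le> (\<bar>falling \<alpha> k * c\<bar> + 1) * t powr (\<alpha> - real k)" for k
  proof -
    have "eventually (\<lambda>t. norm (D k t - falling \<alpha> k * c * t powr (\<alpha> - real k)) \<le> 1 * norm (t powr (\<alpha> - real k))) (at_right 0)"
      by (rule landau_o.smallD[OF Do]) simp
    then obtain d where d: "d > 0" and dd: "\<And>t. 0 < t \<Longrightarrow> t < d \<Longrightarrow>
       \<bar>D k t - falling \<alpha> k * c * t powr (\<alpha> - real k)\<bar> \<le> t powr (\<alpha> - real k)"
      unfolding eventually_at_right_field by auto
    have "\<bar>D k t\<bar> \<le> (\<bar>falling \<alpha> k * c\<bar> + 1) * t powr (\<alpha> - real k)" if "0 < t" "t < d" for t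
    proof -
      have "\<bar>D k t\<bar> \<le> \<bar>falling \<alpha> k * c * t powr (\<alpha> - real k)\<bar> + \<bar>D k t - falling \<alpha> k * c * t powr (\<alpha> - real k)\<bar>" by simp
      also have "\<dots> \<le> \<bar>falling \<alpha> k * c\<bar> * t powr (\<alpha> - real k) + t powr (\<alpha> - real k)"
        using dd[OF that] by (simp add: abs_mult)
      finally show ?thesis by (simp add: distrib_right)
    qed
    with d show ?thesis by blast
  qed
  then obtain d where d0: "\<And>k. d k > 0"
    and dD: "\<And>k t. 0 < t \<Longrightarrow> t < d k \<Longrightarrow> \<bar>D k t\<bar> \<le> (\<bar>falling \<alpha> k * c\<bar> + 1) * t powr (\<alpha> - real k)"
    by metis
  \<comment> \<open>The summand C2 bounds the second derivative of A, C2 * r the first, and the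
    finite sum covers the singular part and its first two derivatives.\<close>
  define C where "C = C2 * (1 + r) + (\<Sum>k\<le>2. \<bar>falling \<alpha> k * c\<bar> + 1)"
  have CC2: "C2 \<le> C" "C2 * r \<le> C"
    unfolding C_def using C20 r by (auto simp: algebra_simps intro!: add_increasing2 sum_nonneg add_nonneg_nonneg mult_nonneg_nonneg)
  have Ck: "\<bar>falling \<alpha> k * c\<bar> + 1 \<le> C" if "k \<le> 2" for k
  proof -
    have "\<bar>falling \<alpha> k * c\<bar> + 1 \<le> (\<Sum>k\<le>2. \<bar>falling \<alpha> k * c\<bar> + 1)"
      using that by (intro member_le_sum) auto
    then show ?thesis using C20 r by (simp add: C_def add_increasing)
  qed
  have C0: "C \<ge> 0" using CC2 C20 by linarith
  define \<delta> where "\<delta> = Min {1, L, r / 2, d 0, d 1, d 2}"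
  have \<delta>: "\<delta> > 0" "\<delta> \<le> 1" "\<delta> \<le> L" "\<delta> \<le> r / 2" "\<delta> \<le> d 0" "\<delta> \<le> d 1" "\<delta> \<le> d 2"
    unfolding \<delta>_def using \<open>0 < L\<close> r d0 by auto
  \<comment> \<open>B is continuous at 0 and of order t^\<alpha> from the right. So K 0 is the value
    of A alone, and K t - K 0 separates into the two parts.\<close>
  have B0: "B 0 = 0"
  proof (rule tendsto_unique[of "at_right 0" B])
    have "(B \<longlongrightarrow> B 0) (at 0 within {-L..L})" using B_cont \<open>0 < L\<close> by (auto simp: continuous_on_def)
    then have "(B \<longlongrightarrow> B 0) (at 0 within {0..L})" by (rule tendsto_within_subset) auto
    then show "(B \<longlongrightarrow> B 0) (at_right 0)"
      using \<open>0 < L\<close> by (simp add: at_within_Icc_at_right)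
    show "(B \<longlongrightarrow> 0) (at_right 0)"
    proof (rule Lim_null_comparison)
      show "eventually (\<lambda>t. norm (B t) \<le> C * t powr \<alpha>) (at_right 0)"
        unfolding eventually_at_right_field
      proof (intro exI[of _ \<delta>] conjI allI impI \<delta>(1))
        fix t assume t: "0 < t" "t < \<delta>"
        have "\<bar>B t\<bar> \<le> (\<bar>falling \<alpha> 0 * c\<bar> + 1) * t powr \<alpha>" using dD[of t 0] t \<delta> D0[of t] by simp
        also have "\<dots> \<le> C * t powr \<alpha>" using Ck[of 0] by (intro mult_right_mono) auto
        finally show "norm (B t) \<le> C * t powr \<alpha>" by simp
      qed
      have "((\<lambda>t. t powr \<alpha>) \<longlongrightarrow> 0) (at_right 0)"
        by (rule tendsto_eq_rhs[OF tendsto_powr'[of "\<lambda>t. t" 0 _ "\<lambda>_. \<alpha>" \<alpha>]])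
           (use \<alpha> in \<open>auto simp: eventually_at_right_less eventually_at_filter\<close>)
      from tendsto_mult_left[OF this, of C] show "((\<lambda>t. C * t powr \<alpha>) \<longlongrightarrow> 0) (at_right 0)" by simp
    qed
  qed simp
  have falling0: "falling \<alpha> 0 = 1"
  proof -
    have "Gamma (\<alpha> + 1) > 0" by (rule Gamma_real_pos) (use \<alpha> in simp)
    then show ?thesis by (simp add: falling_def)
  qed
  have main: "(K has_real_derivative A1 t + D 1 t) (at t) \<and> ((\<lambda>t. A1 t + D 1 t) has_real_derivative A2 t + D 2 t) (at t)
      \<and> \<bar>A1 t + D 1 t\<bar> \<le> C * (t powr (\<alpha> - 1) + 1) \<and> \<bar>A2 t + D 2 t\<bar> \<le> C * (t powr (\<alpha> - 2) + 1)
      \<and> \<bar>K t - K 0 - D 0 t\<bar> \<le> C * t\<^sup>2 \<and> \<bar>D 0 t\<bar> \<le> C * t powr \<alpha>"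
    if t: "0 < t" "t < \<delta>" for t
  proof (intro conjI)
    have Dt: "(D k has_real_derivative D (Suc k) t) (at t)" for k
    proof -
      \<comment> \<open>The one-sided derivative at L is avoided by t < \<delta> \<le> L; on the
        open interval it is an ordinary derivative.\<close>
      have "(D k has_real_derivative D (Suc k) t) (at t within {0<..<L})"
        by (rule has_field_derivative_subset[OF D]) (use t \<delta> in auto)
      then show ?thesis using t \<delta> by (simp add: at_within_open[of t "{0<..<L}"])
    qed
    have "((\<lambda>t. A t + D 0 t) has_real_derivative A1 t + D 1 t) (at t)"
      using A[of t] Dt[of 0] t \<delta> by (intro DERIV_add) auto
    then show "(K has_real_derivative A1 t + D 1 t) (at t)"
      by (rule has_field_derivative_transform_within_open[of _ _ t "{0<..<L}"]) (use t \<delta> K D0 in auto)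
    show "((\<lambda>t. A1 t + D 1 t) has_real_derivative A2 t + D 2 t) (at t)"
      using A[of t] Dt[of 1] t \<delta> by (intro DERIV_add) (auto simp: numeral_2_eq_2)
    have bD: "\<bar>D k t\<bar> \<le> C * t powr (\<alpha> - real k)" if "k \<le> 2" for k
    proof -
      have "k = 0 \<or> k = 1 \<or> k = 2" using that by auto
      then have "\<bar>D k t\<bar> \<le> (\<bar>falling \<alpha> k * c\<bar> + 1) * t powr (\<alpha> - real k)" using dD[of t k] t \<delta> by auto
      also have "\<dots> \<le> C * t powr (\<alpha> - real k)" using Ck[OF that] by (intro mult_right_mono) auto
      finally show ?thesis .
    qed
    have "\<bar>A1 t\<bar> \<le> C2 * t" using A1b t \<delta> by simp
    also have "\<dots> \<le> C2 * r" using t \<delta> C20 r by (intro mult_left_mono) auto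
    finally have "\<bar>A1 t\<bar> \<le> C" using CC2 by simp
    then show "\<bar>A1 t + D 1 t\<bar> \<le> C * (t powr (\<alpha> - 1) + 1)"
      using bD[of 1] by (simp add: distrib_left)
    have "\<bar>A2 t\<bar> \<le> C" using C2[of t] t \<delta> CC2 by simp
    then show "\<bar>A2 t + D 2 t\<bar> \<le> C * (t powr (\<alpha> - 2) + 1)"
      using bD[of 2] by (simp add: distrib_left)
    have "\<bar>K t - K 0 - D 0 t\<bar> = \<bar>A t - A 0\<bar>"
      using K[of t] K[of 0] D0[of t] B0 t \<delta> by simp
    also have "\<dots> \<le> C2 * t\<^sup>2" using A0b t \<delta> by simp
    also have "\<dots> \<le> C * t\<^sup>2" using CC2 by (intro mult_right_mono) auto
    finally show "\<bar>K t - K 0 - D 0 t\<bar> \<le> C * t\<^sup>2" .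
    show "\<bar>D 0 t\<bar> \<le> C * t powr \<alpha>" using bD[of 0] by simp
  qed
  have "(\<lambda>t. D 0 t - c * t powr \<alpha>) \<in> o[at_right 0](\<lambda>t. t powr \<alpha>)"
    using Do[of 0] falling0 by simp
  note last = this
  show ?thesis
    by (rule exI[of _ \<delta>], intro conjI \<delta>(1-3), rule exI[of _ C], rule conjI[OF C0],
        rule exI[of _ "D 0"], rule exI[of _ "\<lambda>t. A1 t + D 1 t"], rule exI[of _ "\<lambda>t. A2 t + D 2 t"],
        rule conjI[OF _ last], intro allI impI, elim conjE, rule main)
qed

text \<open>The kernel \<open>m\<^sup>-\<^sup>1\<^sup>/\<^sup>2 \<kappa>(d m\<^sup>-\<^sup>1\<^sup>/\<^sup>2)\<close> along a path on which \<open>d\<close> and \<open>m\<close> are affine. Replacing the local range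
  by its linear interpolation in each grid cell leaves all increments unchanged, so no smoothness of
  the local range is needed to control mixed differences.\<close>

definition affine_kernel ::
  "(real \<Rightarrow> real) \<Rightarrow> real \<Rightarrow> real \<Rightarrow> real \<Rightarrow> real \<Rightarrow> real \<Rightarrow> real \<Rightarrow> real \<Rightarrow> real" where
  "affine_kernel \<kappa> d e \<mu> p q u v =
    (\<mu> + p * u + q * v) powr (-1/2) * \<kappa> ((d + e * (u - v)) * (\<mu> + p * u + q * v) powr (-1/2))"

text \<open>With r = m^(-1/2) the derivative of r along an affine m is -(slope / 2) r^3. All further
  derivatives of the kernel thus stay polynomial in r and can be bounded term by term.\<close>

lemma DERIV_powr_minus_half:
  fixes \<mu> p q :: real
  assumes "0 < \<mu> + p * u + q * v"
  shows "((\<lambda>u. (\<mu> + p * u + q * v) powr (-1/2)) has_real_derivative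
      - (p / 2) * ((\<mu> + p * u + q * v) powr (-1/2)) ^ 3) (at u)"
    and "((\<lambda>v. (\<mu> + p * u + q * v) powr (-1/2)) has_real_derivative
      - (q / 2) * ((\<mu> + p * u + q * v) powr (-1/2)) ^ 3) (at v)"
proof -
  define m where "m = \<mu> + p * u + q * v"
  have "m > 0" using assms by (simp add: m_def)
  have "(m powr (-1/2)) ^ 3 = m powr ((-1/2) * 3)"
    using \<open>m > 0\<close> powr_powr[of m "-1/2" 3] powr_realpow[of "m powr (-1/2)" 3] by simp
  then have cube: "(m powr (-1/2)) ^ 3 = m powr (-3/2)" by simp
  have D: "((\<lambda>z. z powr (-1/2)) has_real_derivative (-1/2) * m powr (-1/2 - 1)) (at m)"
    by (rule has_real_derivative_powr[OF \<open>m > 0\<close>])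
  have "((\<lambda>u. \<mu> + p * u + q * v) has_real_derivative p) (at u)" "((\<lambda>v. \<mu> + p * u + q * v) has_real_derivative q) (at v)"
    by (auto intro!: derivative_eq_intros)
  from DERIV_chain2[OF D[unfolded m_def] this(1)] DERIV_chain2[OF D[unfolded m_def] this(2)] cube
  show "((\<lambda>u. (\<mu> + p * u + q * v) powr (-1/2)) has_real_derivative
      - (p / 2) * ((\<mu> + p * u + q * v) powr (-1/2)) ^ 3) (at u)"
    and "((\<lambda>v. (\<mu> + p * u + q * v) powr (-1/2)) has_real_derivative
      - (q / 2) * ((\<mu> + p * u + q * v) powr (-1/2)) ^ 3) (at v)"
    by (auto simp: m_def algebra_simps)
qed

text \<open>The product rule for the partial derivative in u of the affine kernel. R, Y, F and G
  stand for scale, argument, \<kappa> and the derivative of \<kappa> along the path in v.\<close>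

lemma DERIV_mixed_kernel:
  fixes R Y F G :: "real \<Rightarrow> real"
  assumes R: "(R has_real_derivative - (q / 2) * R v ^ 3) (at v)" and Y: "(Y has_real_derivative Y') (at v)"
    and F: "(F has_real_derivative F') (at v)" and G: "(G has_real_derivative G') (at v)"
  shows "((\<lambda>v. - (p / 2) * R v ^ 3 * (F v + Y v * G v) + e * R v ^ 2 * G v) has_real_derivative
    - (p / 2) * (3 * R v ^ 2 * (- (q / 2) * R v ^ 3)) * (F v + Y v * G v)
    - (p / 2) * R v ^ 3 * (F' + Y' * G v + Y v * G')
    + e * (2 * R v * (- (q / 2) * R v ^ 3)) * G v + e * R v ^ 2 * G') (at v)"
proof -
  have R3: "((\<lambda>v. R v ^ 3) has_real_derivative 3 * R v ^ 2 * (- (q / 2) * R v ^ 3)) (at v)"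
    by (rule DERIV_cong[OF DERIV_power[OF R]]) simp
  have R2: "((\<lambda>v. R v ^ 2) has_real_derivative 2 * R v * (- (q / 2) * R v ^ 3)) (at v)"
    by (rule DERIV_cong[OF DERIV_power[OF R]]) simp
  have A: "((\<lambda>v. F v + Y v * G v) has_real_derivative F' + (Y' * G v + G' * Y v)) (at v)"
    by (intro DERIV_add DERIV_mult F Y G)
  show ?thesis
    by (rule DERIV_cong[OF DERIV_add[OF DERIV_mult[OF DERIV_cmult[OF R3] A] DERIV_mult[OF DERIV_cmult[OF R2] G]]])
       (simp add: algebra_simps)
qed

text \<open>By the mean value theorem the mixed difference over the unit square is a mixed partial
  derivative at an inner point. Each differentiation produces a factor e, p or q, all of order h.
  The constant depends only on \<open>m0\<close> and \<Lambda>, hence is the same for all grid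
  cells; the cell enters through the set Y of arguments and the bound B valid there.\<close>

lemma affine_kernel_bounds:
  assumes m0: "0 < (m0::real)" and Lam: "0 \<le> \<Lambda>"
  shows "\<exists>C\<ge>0. \<forall>\<kappa> k1 k2 Y B d e h \<mu> p q. 
    (\<forall>y\<in>Y. (\<kappa> has_real_derivative k1 y) (at y) \<and> (k1 has_real_derivative k2 y) (at y)
       \<and> \<bar>y\<bar> \<le> 1 \<and> \<bar>\<kappa> y\<bar> \<le> B \<and> \<bar>k1 y\<bar> \<le> B \<and> \<bar>k2 y\<bar> \<le> B) \<longrightarrow>
    0 \<le> B \<longrightarrow> 0 \<le> h \<longrightarrow> \<bar>e\<bar> \<le> h \<longrightarrow> \<bar>p\<bar> \<le> \<Lambda> * h \<longrightarrow> \<bar>q\<bar> \<le> \<Lambda> * h \<longrightarrow>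
    (\<forall>u\<in>{0..1}. \<forall>v\<in>{0..1}. m0 \<le> \<mu> + p * u + q * v
        \<and> (d + e * (u - v)) * (\<mu> + p * u + q * v) powr (-1/2) \<in> Y) \<longrightarrow>
    (let f = affine_kernel \<kappa> d e \<mu> p q in
      \<bar>f 1 1 - f 1 0 - f 0 1 + f 0 0\<bar> \<le> C * B * h\<^sup>2 \<and> \<bar>f 1 1 - f 0 1\<bar> \<le> C * B * h
      \<and> \<bar>f 1 1 - f 1 0\<bar> \<le> C * B * h \<and> \<bar>f 1 1\<bar> \<le> C * B)"
proof -
  define r0 where "r0 = m0 powr (-1/2)"
  have r0: "r0 > 0" using m0 by (simp add: r0_def)
  \<comment> \<open>Here \<open>r0\<close> bounds r, \<open>c1 * h\<close> bounds the v-derivative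
    of the argument, \<open>Ca * B * h\<close> the first partial derivatives, and
    \<open>Cb * B * h\<^sup>2\<close> the mixed one.\<close>
  define c1 where "c1 = r0 + \<Lambda> / 2 * r0\<^sup>2"
  have c1: "c1 \<ge> 0" unfolding c1_def using r0 Lam by simp
  define Ca where "Ca = \<Lambda> * r0 ^ 3 + r0\<^sup>2"
  define Cb where "Cb = 3/2 * \<Lambda>\<^sup>2 * r0 ^ 5 + 3/2 * \<Lambda> * r0 ^ 3 * c1 + \<Lambda> * r0 ^ 4 + r0\<^sup>2 * c1"
  define C where "C = r0 + Ca + Cb"
  have Ca0: "Ca \<ge> 0" and Cb0: "Cb \<ge> 0" using r0 Lam c1 by (simp_all add: Ca_def Cb_def)
  then have C0: "C \<ge> 0" and CC: "r0 \<le> C" "Ca \<le> C" "Cb \<le> C" using r0 by (simp_all add: C_def)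
  show ?thesis unfolding Let_def
  proof (rule exI[of _ C], intro conjI allI impI C0)
    fix \<kappa> k1 k2 :: "real \<Rightarrow> real" and Y B d e h \<mu> p q
    assume \<kappa>: "\<forall>y\<in>Y. (\<kappa> has_real_derivative k1 y) (at y) \<and> (k1 has_real_derivative k2 y) (at y)
       \<and> \<bar>y\<bar> \<le> 1 \<and> \<bar>\<kappa> y\<bar> \<le> B \<and> \<bar>k1 y\<bar> \<le> B \<and> \<bar>k2 y\<bar> \<le> B"
      and B: "0 \<le> B" and h: "0 \<le> h" and e: "\<bar>e\<bar> \<le> h" and p: "\<bar>p\<bar> \<le> \<Lambda> * h" and q: "\<bar>q\<bar> \<le> \<Lambda> * h"
      and dom: "\<forall>u\<in>{0..1}. \<forall>v\<in>{0..1}. m0 \<le> \<mu> + p * u + q * v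
        \<and> (d + e * (u - v)) * (\<mu> + p * u + q * v) powr (-1/2) \<in> Y"
    define r where "r u v = (\<mu> + p * u + q * v) powr (-1/2)" for u v
    define y where "y u v = (d + e * (u - v)) * r u v" for u v
    define f where "f = affine_kernel \<kappa> d e \<mu> p q"
    have f: "f u v = r u v * \<kappa> (y u v)" for u v
      by (simp add: f_def affine_kernel_def r_def y_def)
    define fu where "fu u v = - (p/2) * r u v ^ 3 * (\<kappa> (y u v) + y u v * k1 (y u v)) + e * r u v ^ 2 * k1 (y u v)" for u v
    define fv where "fv u v = - (q/2) * r u v ^ 3 * (\<kappa> (y u v) + y u v * k1 (y u v)) - e * r u v ^ 2 * k1 (y u v)" for u v
    define yv where "yv u v = - e * r u v - q/2 * r u v ^ 2 * y u v" for u v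
    define fuv where "fuv u v = 3/4 * p * q * r u v ^ 5 * (\<kappa> (y u v) + y u v * k1 (y u v))
        - (p/2) * r u v ^ 3 * (2 * k1 (y u v) + y u v * k2 (y u v)) * yv u v
        - e * q * r u v ^ 4 * k1 (y u v) + e * r u v ^ 2 * k2 (y u v) * yv u v" for u v
    have yY: "y u v \<in> Y" and mpos: "m0 \<le> \<mu> + p * u + q * v" if "u \<in> {0..1}" "v \<in> {0..1}" for u v
      using dom that unfolding y_def r_def by blast+
    have r_le: "r u v \<le> r0" and r_pos: "r u v > 0" if "u \<in> {0..1}" "v \<in> {0..1}" for u v
      using mpos[OF that] m0 unfolding r_def r0_def by (auto intro!: powr_mono2')
    have Dru: "((\<lambda>u. r u v) has_real_derivative - (p / 2) * r u v ^ 3) (at u)"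
      and Drv: "((\<lambda>v. r u v) has_real_derivative - (q / 2) * r u v ^ 3) (at v)"
      if "u \<in> {0..1}" "v \<in> {0..1}" for u v
      using DERIV_powr_minus_half[of \<mu> p u q v] mpos[OF that] m0 unfolding r_def by auto
    have Dyu: "((\<lambda>u. y u v) has_real_derivative e * r u v - p/2 * r u v ^ 2 * y u v) (at u)"
      and Dyv: "((\<lambda>v. y u v) has_real_derivative yv u v) (at v)"
      if "u \<in> {0..1}" "v \<in> {0..1}" for u v
    proof -
      have "((\<lambda>u. d + e * (u - v)) has_real_derivative e) (at u)" "((\<lambda>v. d + e * (u - v)) has_real_derivative - e) (at v)"
        by (auto intro!: derivative_eq_intros)
      note D1 = DERIV_mult[OF this(1) Dru[OF that]] and D2 = DERIV_mult[OF this(2) Drv[OF that]]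
      show "((\<lambda>u. y u v) has_real_derivative e * r u v - p/2 * r u v ^ 2 * y u v) (at u)"
        unfolding y_def by (rule DERIV_cong[OF D1]) (simp add: power2_eq_square power3_eq_cube)
      show "((\<lambda>v. y u v) has_real_derivative yv u v) (at v)"
        unfolding y_def yv_def by (rule DERIV_cong[OF D2]) (simp add: power2_eq_square power3_eq_cube)
    qed
    have D\<kappa>: "(\<kappa> has_real_derivative k1 (y u v)) (at (y u v))" "(k1 has_real_derivative k2 (y u v)) (at (y u v))"
      "\<bar>y u v\<bar> \<le> 1" "\<bar>\<kappa> (y u v)\<bar> \<le> B" "\<bar>k1 (y u v)\<bar> \<le> B" "\<bar>k2 (y u v)\<bar> \<le> B"
      if "u \<in> {0..1}" "v \<in> {0..1}" for u v
      using \<kappa> yY[OF that] by auto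
    have Dfu: "((\<lambda>u. f u v) has_real_derivative fu u v) (at u)" if "u \<in> {0..1}" "v \<in> {0..1}" for u v
      unfolding f fu_def
      by (rule DERIV_cong[OF DERIV_mult[OF Dru[OF that] DERIV_chain2[OF D\<kappa>(1)[OF that] Dyu[OF that]]]])
         (simp add: power2_eq_square power3_eq_cube algebra_simps)
    have Dfv: "((\<lambda>v. f u v) has_real_derivative fv u v) (at v)" if "u \<in> {0..1}" "v \<in> {0..1}" for u v
      unfolding f fv_def
      by (rule DERIV_cong[OF DERIV_mult[OF Drv[OF that] DERIV_chain2[OF D\<kappa>(1)[OF that] Dyv[OF that]]]])
         (simp add: yv_def power2_eq_square power3_eq_cube algebra_simps)
    have Dfuv: "((\<lambda>v. fu u v) has_real_derivative fuv u v) (at v)" if "u \<in> {0..1}" "v \<in> {0..1}" for u v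
    proof -
      note d1 = DERIV_chain2[OF D\<kappa>(1)[OF that] Dyv[OF that]]
      note d2 = DERIV_chain2[OF D\<kappa>(2)[OF that] Dyv[OF that]]
      show ?thesis unfolding fu_def[abs_def] fuv_def
      proof (rule DERIV_cong[OF DERIV_mixed_kernel[OF Drv[OF that] Dyv[OF that] d1 d2]])
        have "r u v ^ 5 = r u v ^ 2 * r u v ^ 3" "r u v ^ 4 = r u v * r u v ^ 3"
          by (simp_all flip: power_add power_Suc)
        then show "- (p / 2) * (3 * r u v ^ 2 * (- (q / 2) * r u v ^ 3)) * (\<kappa> (y u v) + y u v * k1 (y u v))
           - (p / 2) * r u v ^ 3 * (k1 (y u v) * yv u v + yv u v * k1 (y u v) + y u v * (k2 (y u v) * yv u v))
           + e * (2 * r u v * (- (q / 2) * r u v ^ 3)) * k1 (y u v) + e * r u v ^ 2 * (k2 (y u v) * yv u v)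
          = 3 / 4 * p * q * r u v ^ 5 * (\<kappa> (y u v) + y u v * k1 (y u v))
           - p / 2 * r u v ^ 3 * (2 * k1 (y u v) + y u v * k2 (y u v)) * yv u v
           - e * q * r u v ^ 4 * k1 (y u v) + e * r u v ^ 2 * k2 (y u v) * yv u v"
          by (simp only:) (simp add: algebra_simps)
      qed
    qed
    have bk: "\<bar>\<kappa> (y u v) + y u v * k1 (y u v)\<bar> \<le> 2 * B" "\<bar>2 * k1 (y u v) + y u v * k2 (y u v)\<bar> \<le> 3 * B"
      "\<bar>yv u v\<bar> \<le> c1 * h"
      if uv: "u \<in> {0..1}" "v \<in> {0..1}" for u v
    proof -
      have "\<bar>y u v * k1 (y u v)\<bar> \<le> 1 * B" "\<bar>y u v * k2 (y u v)\<bar> \<le> 1 * B"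
        unfolding abs_mult using D\<kappa>[OF uv] by (intro mult_mono; simp)+
      then show "\<bar>\<kappa> (y u v) + y u v * k1 (y u v)\<bar> \<le> 2 * B" "\<bar>2 * k1 (y u v) + y u v * k2 (y u v)\<bar> \<le> 3 * B"
        using D\<kappa>[OF uv] by (auto simp: abs_le_iff)
      have "\<bar>yv u v\<bar> \<le> \<bar>e\<bar> * r u v + \<bar>q\<bar> / 2 * r u v ^ 2 * \<bar>y u v\<bar>"
        unfolding yv_def by (rule order.trans[OF abs_triangle_ineq4]) (simp add: abs_mult r_pos[OF uv] less_imp_le)
      also have "\<dots> \<le> h * r0 + \<Lambda> * h / 2 * r0 ^ 2 * 1"
        using e q r_le[OF uv] r_pos[OF uv] D\<kappa>(3)[OF uv] h Lam r0
        by (intro add_mono mult_mono divide_right_mono power_mono) auto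
      finally show "\<bar>yv u v\<bar> \<le> c1 * h" by (simp add: c1_def algebra_simps)
    qed
    \<comment> \<open>One estimate for both first partials: (a, b) is (p, e) for u and (q, -e) for
      v.\<close>
    have first: "\<bar>- (a/2) * r u v ^ 3 * (\<kappa> (y u v) + y u v * k1 (y u v)) + b * r u v ^ 2 * k1 (y u v)\<bar> \<le> Ca * B * h"
      if uv: "u \<in> {0..1}" "v \<in> {0..1}" and a: "\<bar>a\<bar> \<le> \<Lambda> * h" "\<bar>b\<bar> \<le> h" for u v a b
    proof -
      have "\<bar>- (a/2) * r u v ^ 3 * (\<kappa> (y u v) + y u v * k1 (y u v)) + b * r u v ^ 2 * k1 (y u v)\<bar>
        \<le> \<bar>a\<bar> / 2 * r u v ^ 3 * \<bar>\<kappa> (y u v) + y u v * k1 (y u v)\<bar> + \<bar>b\<bar> * r u v ^ 2 * \<bar>k1 (y u v)\<bar>"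
        by (rule order.trans[OF abs_triangle_ineq]) (simp add: abs_mult r_pos[OF uv] less_imp_le)
      also have "\<dots> \<le> \<Lambda> * h / 2 * r0 ^ 3 * (2 * B) + h * r0 ^ 2 * B"
        using a r_le[OF uv] r_pos[OF uv] bk[OF uv] D\<kappa>(5)[OF uv] h Lam r0 B
        by (intro add_mono mult_mono divide_right_mono power_mono) auto
      also have "\<dots> = Ca * B * h" by (simp add: Ca_def algebra_simps)
      finally show ?thesis .
    qed
    have abs4: "\<bar>a - b - c + d\<bar> \<le> \<bar>a\<bar> + \<bar>b\<bar> + \<bar>c\<bar> + \<bar>d\<bar>" for a b c d :: real by linarith
    have bfuv: "\<bar>fuv u v\<bar> \<le> Cb * B * h\<^sup>2" if uv: "u \<in> {0..1}" "v \<in> {0..1}" for u v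
    proof -
      note r_bd = power_mono[OF r_le[OF uv] less_imp_le[OF r_pos[OF uv]]]
      note nn = zero_le_power[OF less_imp_le[OF r_pos[OF uv]]] zero_le_power[OF less_imp_le[OF r0]]
      have "\<bar>3/4 * p * q * r u v ^ 5 * (\<kappa> (y u v) + y u v * k1 (y u v))\<bar>
          = 3/4 * \<bar>p\<bar> * \<bar>q\<bar> * r u v ^ 5 * \<bar>\<kappa> (y u v) + y u v * k1 (y u v)\<bar>"
        by (simp only: abs_mult abs_of_nonneg[OF nn(1)] abs_divide abs_numeral)
      also have "\<dots> \<le> 3/4 * (\<Lambda> * h) * (\<Lambda> * h) * r0 ^ 5 * (2 * B)"
        by (intro mult_mono p q r_bd bk[OF uv]) (simp_all add: h Lam B c1 r0 less_imp_le[OF r_pos[OF uv]] less_imp_le[OF r0])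
      finally have t1: "\<bar>3/4 * p * q * r u v ^ 5 * (\<kappa> (y u v) + y u v * k1 (y u v))\<bar> \<le> \<dots>" .
      have "\<bar>(p/2) * r u v ^ 3 * (2 * k1 (y u v) + y u v * k2 (y u v)) * yv u v\<bar>
          = (\<bar>p\<bar>/2) * r u v ^ 3 * \<bar>2 * k1 (y u v) + y u v * k2 (y u v)\<bar> * \<bar>yv u v\<bar>"
        by (simp only: abs_mult abs_of_nonneg[OF nn(1)] abs_divide abs_numeral)
      also have "\<dots> \<le> (\<Lambda> * h / 2) * r0 ^ 3 * (3 * B) * (c1 * h)"
        by (intro mult_mono divide_right_mono p q r_bd bk[OF uv]) (simp_all add: h Lam B c1 r0 less_imp_le[OF r_pos[OF uv]] less_imp_le[OF r0])
      finally have t2: "\<bar>(p/2) * r u v ^ 3 * (2 * k1 (y u v) + y u v * k2 (y u v)) * yv u v\<bar> \<le> \<dots>" .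
      have "\<bar>e * q * r u v ^ 4 * k1 (y u v)\<bar> = \<bar>e\<bar> * \<bar>q\<bar> * r u v ^ 4 * \<bar>k1 (y u v)\<bar>"
        by (simp only: abs_mult abs_of_nonneg[OF nn(1)])
      also have "\<dots> \<le> h * (\<Lambda> * h) * r0 ^ 4 * B"
        by (intro mult_mono e q r_bd D\<kappa>[OF uv]) (simp_all add: h Lam B c1 r0 less_imp_le[OF r_pos[OF uv]] less_imp_le[OF r0])
      finally have t3: "\<bar>e * q * r u v ^ 4 * k1 (y u v)\<bar> \<le> \<dots>" .
      have "\<bar>e * r u v ^ 2 * k2 (y u v) * yv u v\<bar> = \<bar>e\<bar> * r u v ^ 2 * \<bar>k2 (y u v)\<bar> * \<bar>yv u v\<bar>"
        by (simp only: abs_mult abs_of_nonneg[OF nn(1)])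
      also have "\<dots> \<le> h * r0 ^ 2 * B * (c1 * h)"
        by (intro mult_mono e r_bd D\<kappa>[OF uv] bk[OF uv]) (simp_all add: h Lam B c1 r0 less_imp_le[OF r_pos[OF uv]] less_imp_le[OF r0])
      finally have t4: "\<bar>e * r u v ^ 2 * k2 (y u v) * yv u v\<bar> \<le> \<dots>" .
      have "\<bar>fuv u v\<bar> \<le> 3/4 * (\<Lambda> * h) * (\<Lambda> * h) * r0 ^ 5 * (2 * B)
        + (\<Lambda> * h / 2) * r0 ^ 3 * (3 * B) * (c1 * h)
        + h * (\<Lambda> * h) * r0 ^ 4 * B + h * r0 ^ 2 * B * (c1 * h)"
        unfolding fuv_def by (rule order.trans[OF abs4]) (intro add_mono t1 t2 t3 t4)
      also have "\<dots> = Cb * B * h\<^sup>2" by (simp add: Cb_def power2_eq_square algebra_simps)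
      finally show ?thesis .
    qed
    obtain z where z: "0 < z" "z < 1" "f 1 1 - f 0 1 = (1 - 0) * fu z 1"
      using MVT2[of 0 1 "\<lambda>u. f u 1" "\<lambda>u. fu u 1"] Dfu by auto
    have "\<bar>f 1 1 - f 0 1\<bar> \<le> Ca * B * h" using z first[of z 1 p e] p e by (simp add: fu_def)
    then show "\<bar>affine_kernel \<kappa> d e \<mu> p q 1 1 - affine_kernel \<kappa> d e \<mu> p q 0 1\<bar> \<le> C * B * h"
      unfolding f_def[symmetric] by (rule order.trans) (intro mult_right_mono CC B h)
    obtain z where z: "0 < z" "z < 1" "f 1 1 - f 1 0 = (1 - 0) * fv 1 z"
      using MVT2[of 0 1 "\<lambda>v. f 1 v" "\<lambda>v. fv 1 v"] Dfv by auto
    have "\<bar>f 1 1 - f 1 0\<bar> \<le> Ca * B * h" using z first[of 1 z q "-e"] q e by (simp add: fv_def)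
    then show "\<bar>affine_kernel \<kappa> d e \<mu> p q 1 1 - affine_kernel \<kappa> d e \<mu> p q 1 0\<bar> \<le> C * B * h"
      unfolding f_def[symmetric] by (rule order.trans) (intro mult_right_mono CC B h)
    have "\<bar>f 1 1\<bar> = r 1 1 * \<bar>\<kappa> (y 1 1)\<bar>" using r_pos[of 1 1] by (simp add: f abs_mult)
    also have "\<dots> \<le> r0 * B" using r_pos[of 1 1] r_le[of 1 1] D\<kappa>(4)[of 1 1] r0 by (intro mult_mono) auto
    also have "\<dots> \<le> C * B" using CC B by (intro mult_right_mono)
    finally show "\<bar>affine_kernel \<kappa> d e \<mu> p q 1 1\<bar> \<le> C * B" unfolding f_def .
    \<comment> \<open>Two mean value theorems: in u for the difference of the edges v = 1 and v = 0,
      then in v for \<open>fu z\<close>.\<close>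
    obtain z where z: "0 < z" "z < 1" "(f 1 1 - f 1 0) - (f 0 1 - f 0 0) = (1 - 0) * (fu z 1 - fu z 0)"
      using MVT2[of 0 1 "\<lambda>u. f u 1 - f u 0" "\<lambda>u. fu u 1 - fu u 0"] DERIV_diff[OF Dfu Dfu] by auto
    obtain w where w: "0 < w" "w < 1" "fu z 1 - fu z 0 = (1 - 0) * fuv z w"
      using MVT2[of 0 1 "\<lambda>v. fu z v" "\<lambda>v. fuv z v"] Dfuv[of z] z by auto
    have "\<bar>f 1 1 - f 1 0 - f 0 1 + f 0 0\<bar> = \<bar>fuv z w\<bar>" using z w by simp
    also have "\<dots> \<le> Cb * B * h\<^sup>2" using z w by (intro bfuv) auto
    also have "\<dots> \<le> C * B * h\<^sup>2" using CC B by (intro mult_right_mono) auto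
    finally show "\<bar>affine_kernel \<kappa> d e \<mu> p q 1 1 - affine_kernel \<kappa> d e \<mu> p q 1 0
      - affine_kernel \<kappa> d e \<mu> p q 0 1 + affine_kernel \<kappa> d e \<mu> p q 0 0\<bar> \<le> C * B * h\<^sup>2" unfolding f_def .
  qed
qed

lemma powr_small:
  fixes \<beta> \<epsilon> C :: real
  assumes "0 < \<beta>" "0 < \<epsilon>" "0 \<le> C"
  shows "\<exists>\<delta>>0. \<forall>t. 0 < t \<and> t < \<delta> \<longrightarrow> C * t powr \<beta> \<le> \<epsilon>"
proof -
  define \<delta> where "\<delta> = (\<epsilon> / (C + 1)) powr (1 / \<beta>)"
  have "\<delta> > 0" using assms by (simp add: \<delta>_def)
  moreover have "C * t powr \<beta> \<le> \<epsilon>" if t: "0 < t" "t < \<delta>" for t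
  proof -
    have "t powr \<beta> \<le> \<delta> powr \<beta>" using t assms by (intro powr_mono2) auto
    also have "\<dots> = \<epsilon> / (C + 1)" using assms by (simp add: \<delta>_def powr_powr)
    finally have "C * t powr \<beta> \<le> C * (\<epsilon> / (C + 1))" using assms by (intro mult_left_mono) auto
    also have "\<dots> \<le> \<epsilon>" using assms by (simp add: field_simps)
    finally show ?thesis .
  qed
  ultimately show ?thesis by blast
qed

text \<open>Near 0 the smooth error C t^2 is at most a small multiple of t^q because q < 2, and the
  little-o error because t^\<alpha> \<le> t^q for t \<le> 1. Taking q below \<alpha> serves the
  comparison of a cross-covariance with the scale of X.\<close>

lemma cond_A_expansion:
  assumes A: "cond_A L c \<alpha> K" "0 < L" and q: "q \<le> \<alpha>" "q < 2" and \<epsilon>: "0 < \<epsilon>"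
  shows "\<exists>\<delta>>0. \<forall>t. 0 < t \<and> t < \<delta> \<longrightarrow> \<bar>K t - K 0 - c * t powr \<alpha>\<bar> \<le> \<epsilon> * t powr q"
proof -
  obtain \<delta> C D0 where \<delta>: "\<delta> > 0" "\<delta> \<le> 1" and C: "C \<ge> 0"
    and K: "\<And>t. 0 < t \<Longrightarrow> t < \<delta> \<Longrightarrow> \<bar>K t - K 0 - D0 t\<bar> \<le> C * t\<^sup>2"
    and D0: "(\<lambda>t. D0 t - c * t powr \<alpha>) \<in> o[at_right 0](\<lambda>t. t powr \<alpha>)"
    using cond_A_near_zero[OF A] by blast
  have "\<forall>\<^sub>F t in at_right 0. norm (D0 t - c * t powr \<alpha>) \<le> \<epsilon> / 2 * norm (t powr \<alpha>)"
    by (rule landau_o.smallD[OF D0]) (use \<epsilon> in simp)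
  then obtain d where d: "d > 0" and D: "\<And>t. 0 < t \<Longrightarrow> t < d \<Longrightarrow> \<bar>D0 t - c * t powr \<alpha>\<bar> \<le> \<epsilon> / 2 * t powr \<alpha>"
    unfolding eventually_at_right_field by auto
  obtain e where e: "e > 0" and E: "\<And>t. 0 < t \<Longrightarrow> t < e \<Longrightarrow> C * t powr (2 - q) \<le> \<epsilon> / 2"
    using powr_small[of "2 - q" "\<epsilon> / 2" C] q \<epsilon> C by auto
  have "\<bar>K t - K 0 - c * t powr \<alpha>\<bar> \<le> \<epsilon> * t powr q" if t: "0 < t" "t < Min {\<delta>, d, e}" for t
  proof -
    have "\<bar>K t - K 0 - D0 t\<bar> \<le> C * t powr (2 - q) * t powr q"
      using K[of t] t by (simp add: mult.assoc powr_add[symmetric] powr_realpow)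
    also have "\<dots> \<le> \<epsilon> / 2 * t powr q" using E t by (intro mult_right_mono) auto
    finally have 1: "\<bar>K t - K 0 - D0 t\<bar> \<le> \<epsilon> / 2 * t powr q" .
    have "\<bar>D0 t - c * t powr \<alpha>\<bar> \<le> \<epsilon> / 2 * t powr \<alpha>" using D t by simp
    also have "\<dots> \<le> \<epsilon> / 2 * t powr q" using t q \<delta> \<epsilon> by (intro mult_left_mono powr_mono') auto
    finally show ?thesis using 1 by linarith
  qed
  then show ?thesis using \<delta> d e by (intro exI[of _ "Min {\<delta>, d, e}"]) auto
qed

text \<open>For t < 1, lowering the exponent to p < min 1 \<alpha> lets t^(p-1) and t^(p-2) dominate
  singular and smooth part at once, so one power law replaces the case distinction on
  \<alpha>.\<close>

lemma cond_A_bounds: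
  assumes A: "cond_A L c \<alpha> K" "0 < L" and p: "0 < p" "p < 1" "p < \<alpha>"
  shows "\<exists>\<delta>>0. \<delta> \<le> 1 \<and> (\<exists>C\<ge>0. \<exists>k1 k2. \<forall>t. 0 < t \<and> t < \<delta> \<longrightarrow>
    (K has_real_derivative k1 t) (at t) \<and> (k1 has_real_derivative k2 t) (at t)
    \<and> \<bar>K t\<bar> \<le> C \<and> \<bar>k1 t\<bar> \<le> C * t powr (p - 1) \<and> \<bar>k2 t\<bar> \<le> C * t powr (p - 2) \<and> \<bar>K t - K 0\<bar> \<le> C * t powr p)"
proof -
  obtain \<delta> C D0 k1 k2 where \<delta>: "\<delta> > 0" "\<delta> \<le> 1" and C: "C \<ge> 0"
    and *: "\<And>t. 0 < t \<and> t < \<delta> \<Longrightarrow> (K has_real_derivative k1 t) (at t) \<and> (k1 has_real_derivative k2 t) (at t)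
      \<and> \<bar>k1 t\<bar> \<le> C * (t powr (\<alpha> - 1) + 1) \<and> \<bar>k2 t\<bar> \<le> C * (t powr (\<alpha> - 2) + 1)
      \<and> \<bar>K t - K 0 - D0 t\<bar> \<le> C * t\<^sup>2 \<and> \<bar>D0 t\<bar> \<le> C * t powr \<alpha>"
    using cond_A_near_zero[OF A] by blast
  have "(K has_real_derivative k1 t) (at t) \<and> (k1 has_real_derivative k2 t) (at t)
    \<and> \<bar>K t\<bar> \<le> \<bar>K 0\<bar> + 2 * C \<and> \<bar>k1 t\<bar> \<le> (\<bar>K 0\<bar> + 2 * C) * t powr (p - 1)
    \<and> \<bar>k2 t\<bar> \<le> (\<bar>K 0\<bar> + 2 * C) * t powr (p - 2) \<and> \<bar>K t - K 0\<bar> \<le> (\<bar>K 0\<bar> + 2 * C) * t powr p"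
    if t: "0 < t" "t < \<delta>" for t
  proof -
    have mono: "t powr a \<le> t powr b" if "b \<le> a" for a b using t \<delta> that by (intro powr_mono') auto
    have le: "C * (x + y) \<le> (\<bar>K 0\<bar> + 2 * C) * z" if "x \<le> z" "y \<le> z" "0 \<le> z" for x y z
    proof -
      have "C * (x + y) \<le> C * (z + z)" using that C by (intro mult_left_mono) auto
      also have "\<dots> \<le> (\<bar>K 0\<bar> + 2 * C) * z" using that by (simp add: algebra_simps)
      finally show ?thesis .
    qed
    have one: "t powr a \<ge> 1" if "a \<le> 0" for a using mono[of a 0] that t by simp
    note h = *[of t] t
    have "\<bar>k1 t\<bar> \<le> (\<bar>K 0\<bar> + 2 * C) * t powr (p - 1)"
      using h p by (intro order.trans[OF _ le[of "t powr (\<alpha> - 1)" _ 1]] mono one) auto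
    moreover have "\<bar>k2 t\<bar> \<le> (\<bar>K 0\<bar> + 2 * C) * t powr (p - 2)"
      using h p by (intro order.trans[OF _ le[of "t powr (\<alpha> - 2)" _ 1]] mono one) auto
    moreover have "\<bar>K t - K 0\<bar> \<le> C * (t powr 2 + t powr \<alpha>)"
      using h by (simp add: distrib_left powr_realpow abs_le_iff)
    moreover have "C * (t powr 2 + t powr \<alpha>) \<le> (\<bar>K 0\<bar> + 2 * C) * t powr p"
      using p by (intro le mono) auto
    moreover have "C * (t powr 2 + t powr \<alpha>) \<le> 2 * C"
      using mono[of 0 2] mono[of 0 \<alpha>] p t C mult_left_mono[of "t powr 2 + t powr \<alpha>" 2 C] by simp
    ultimately show ?thesis using h by simp
  qed
  note main = this
  have C': "0 \<le> \<bar>K 0\<bar> + 2 * C" using C by simp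
  show ?thesis
    by (rule exI[of _ \<delta>], intro conjI \<delta>, rule exI[of _ "\<bar>K 0\<bar> + 2 * C"], rule conjI[OF C'],
        rule exI[of _ k1], rule exI[of _ k2], intro allI impI, elim conjE, rule main)
qed

section \<open>Lipschitz calculus for amplitudes and local ranges\<close>

text \<open>One constant bounds both size and slope, so that amplitudes and ranges can share a
  single A.\<close>

definition lipschitz_bounded :: "real \<Rightarrow> real \<Rightarrow> (real \<Rightarrow> real) \<Rightarrow> bool" where
  "lipschitz_bounded L A f \<longleftrightarrow> (\<forall>s\<in>{0..L}. \<bar>f s\<bar> \<le> A) \<and> (\<forall>s\<in>{0..L}. \<forall>t\<in>{0..L}. \<bar>f s - f t\<bar> \<le> A * \<bar>s - t\<bar>)"

lemma lipschitz_boundedD: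
  assumes "lipschitz_bounded L A f" "s \<in> {0..L}"
  shows "\<bar>f s\<bar> \<le> A" "f s \<le> A" "t \<in> {0..L} \<Longrightarrow> \<bar>f s - f t\<bar> \<le> A * \<bar>s - t\<bar>"
    "0 < h \<Longrightarrow> s + h \<in> {0..L} \<Longrightarrow> \<bar>f (s + h) - f s\<bar> \<le> A * h"
proof -
  show 1: "\<bar>f s\<bar> \<le> A" and 2: "t \<in> {0..L} \<Longrightarrow> \<bar>f s - f t\<bar> \<le> A * \<bar>s - t\<bar>" for t
    using assms unfolding lipschitz_bounded_def by blast+
  show "f s \<le> A" using 1 by simp
  show "\<bar>f (s + h) - f s\<bar> \<le> A * h" if "0 < h" "s + h \<in> {0..L}"
    using 2[of "s + h"] that by (simp add: abs_minus_commute)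
qed

lemma lipschitz_bounded_mono: "lipschitz_bounded L A f \<Longrightarrow> A \<le> B \<Longrightarrow> lipschitz_bounded L B f"
  unfolding lipschitz_bounded_def by (meson abs_ge_zero mult_right_mono order.trans)

text \<open>The summand 2AB is the slope from the product rule, AB the bound on the size.\<close>

lemma lipschitz_bounded_mult:
  assumes f: "lipschitz_bounded L A f" and g: "lipschitz_bounded L B g" and L: "0 \<le> L"
  shows "lipschitz_bounded L (2 * A * B + A * B) (\<lambda>s. f s * g s)"
proof -
  have "\<bar>f 0\<bar> \<le> A" "\<bar>g 0\<bar> \<le> B" using f g L by (auto simp: lipschitz_bounded_def)
  then have A: "0 \<le> A" and B: "0 \<le> B" by linarith+
  show ?thesis unfolding lipschitz_bounded_def
  proof (intro conjI ballI)
    fix s assume s: "s \<in> {0..L}"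
    have "\<bar>f s * g s\<bar> \<le> A * B" unfolding abs_mult using f g s A by (intro mult_mono) (auto simp: lipschitz_bounded_def)
    then show "\<bar>f s * g s\<bar> \<le> 2 * A * B + A * B" using A B by simp
    fix t assume t: "t \<in> {0..L}"
    have "\<bar>f s * g s - f t * g t\<bar> = \<bar>(f s - f t) * g s + f t * (g s - g t)\<bar>" by (simp add: algebra_simps)
    also have "\<dots> \<le> \<bar>f s - f t\<bar> * \<bar>g s\<bar> + \<bar>f t\<bar> * \<bar>g s - g t\<bar>"
      by (rule order.trans[OF abs_triangle_ineq]) (simp add: abs_mult)
    also have "\<dots> \<le> (A * \<bar>s - t\<bar>) * B + A * (B * \<bar>s - t\<bar>)"
      using f g s t A by (intro add_mono mult_mono) (auto simp: lipschitz_bounded_def)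
    also have "\<dots> \<le> (2 * A * B + A * B) * \<bar>s - t\<bar>" using A B by (simp add: algebra_simps)
    finally show "\<bar>f s * g s - f t * g t\<bar> \<le> (2 * A * B + A * B) * \<bar>s - t\<bar>" .
  qed
qed

text \<open>For r \<le> 1 the derivative r x^(r-1) decreases, so on values above \<open>m0\<close>
  its largest value is the one at \<open>m0\<close>. The case of interest is the fourth root of the
  local range.\<close>

lemma lipschitz_bounded_powr:
  assumes f: "lipschitz_bounded L A f" and L: "0 \<le> L" and m0: "0 < m0" and f_ge: "\<And>s. s \<in> {0..L} \<Longrightarrow> m0 \<le> f s"
    and r: "0 \<le> r" "r \<le> 1"
  shows "\<exists>B. lipschitz_bounded L B (\<lambda>s. f s powr r)"
proof -
  have fA: "f s \<le> A" if "s \<in> {0..L}" for s using f that by (rule lipschitz_boundedD(2))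
  have "0 \<in> {0..L}" using L by simp
  from fA[OF this] f_ge[OF this] have A: "A \<ge> m0" by linarith
  define B where "B = A powr r + r * m0 powr (r - 1) * A"
  have "\<bar>f s powr r - f t powr r\<bar> \<le> r * m0 powr (r - 1) * \<bar>f s - f t\<bar>" if st: "s \<in> {0..L}" "t \<in> {0..L}" for s t
  proof -
    have "norm (f s powr r - f t powr r) \<le> (r * m0 powr (r - 1)) * norm (f s - f t)"
    proof (rule field_differentiable_bound[of "{m0..}" "\<lambda>x. x powr r" "\<lambda>x. r * x powr (r - 1)"])
      fix z assume z: "z \<in> {m0..}"
      then show "((\<lambda>x. x powr r) has_real_derivative r * z powr (r - 1)) (at z within {m0..})"
        using m0 by (auto intro: has_field_derivative_at_within[OF has_real_derivative_powr])
      have "z powr (r - 1) \<le> m0 powr (r - 1)" using z m0 r by (intro powr_mono2') auto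
      then show "norm (r * z powr (r - 1)) \<le> r * m0 powr (r - 1)" using r by (simp add: abs_mult mult_left_mono)
    qed (use f_ge st in auto)
    then show ?thesis by simp
  qed
  note step = this
  have "lipschitz_bounded L B (\<lambda>s. f s powr r)"
    unfolding lipschitz_bounded_def
  proof (intro conjI ballI)
    fix s assume s: "s \<in> {0..L}"
    have "f s powr r \<le> A powr r" using s fA f_ge[OF s] m0 r by (intro powr_mono2) auto
    moreover have "0 \<le> r * m0 powr (r - 1) * A" using A m0 r by simp
    ultimately show "\<bar>f s powr r\<bar> \<le> B" by (simp add: B_def)
    fix t assume t: "t \<in> {0..L}"
    have "r * m0 powr (r - 1) * \<bar>f s - f t\<bar> \<le> r * m0 powr (r - 1) * (A * \<bar>s - t\<bar>)"
      using lipschitz_boundedD(3)[OF f s t] r by (intro mult_left_mono) auto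
    also have "\<dots> \<le> B * \<bar>s - t\<bar>" unfolding B_def distrib_right by simp
    finally show "\<bar>f s powr r - f t powr r\<bar> \<le> B * \<bar>s - t\<bar>" using step[OF s t] by simp
  qed
  then show ?thesis by (rule exI[of _ B])
qed

section \<open>Mixed differences of the nonstationary kernel\<close>

definition inv_scale :: "(real \<Rightarrow> real) \<Rightarrow> (real \<Rightarrow> real) \<Rightarrow> real \<Rightarrow> real \<Rightarrow> real" where
  "inv_scale \<Phi> \<Psi> s t = ((\<Phi> s + \<Psi> t) / 2) powr (-1/2)"

text \<open>The amplitudes a and b absorb the standard deviations and the fourth roots of the
  ranges. The averaged range then enters only through \<open>inv_scale\<close>, once as a prefactor
  and once as the scale of the distance.\<close>

definition ns_kernel ::
  "(real \<Rightarrow> real) \<Rightarrow> (real \<Rightarrow> real) \<Rightarrow> (real \<Rightarrow> real) \<Rightarrow> (real \<Rightarrow> real) \<Rightarrow> (real \<Rightarrow> real) \<Rightarrow> real \<Rightarrow> real \<Rightarrow> real" where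
  "ns_kernel a b \<Phi> \<Psi> \<kappa> s t = a s * b t * (inv_scale \<Phi> \<Psi> s t * \<kappa> (\<bar>s - t\<bar> * inv_scale \<Phi> \<Psi> s t))"

text \<open>For a covariance C this is the covariance of the increments over [s, s+h] and
  [t, t+h].\<close>

definition mixed_diff :: "(real \<Rightarrow> real \<Rightarrow> real) \<Rightarrow> real \<Rightarrow> real \<Rightarrow> real \<Rightarrow> real" where
  "mixed_diff C s t h = C (s + h) (t + h) - C (s + h) t - C s (t + h) + C s t"

lemma K_NS_eq_ns_kernel:
  assumes "\<And>s. 0 < \<Phi> k l s" "\<And>s. 0 < \<Phi> l k s"
  shows "K_NS \<sigma> \<Phi> K k l = ns_kernel (\<lambda>s. \<sigma> k s * \<Phi> k l s powr (1/4)) (\<lambda>s. \<sigma> l s * \<Phi> l k s powr (1/4)) (\<Phi> k l) (\<Phi> l k) (K k l)"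
proof (intro ext)
  fix s t
  define m where "m = (\<Phi> k l s + \<Phi> l k t) / 2"
  have m: "m > 0" using assms[of s] assms[of t] by (simp add: m_def add_pos_pos)
  have r: "m powr (-1/2) = inverse (sqrt m)" using m by (simp add: powr_minus powr_half_sqrt)
  have Q: "sqrt (Q_NS \<Phi> k l s t) = \<bar>s - t\<bar> * m powr (-1/2)"
    unfolding Q_NS_def r m_def[symmetric] by (simp only: real_sqrt_mult real_sqrt_inverse real_sqrt_abs)
  have P: "(\<bar>\<Phi> k l s\<bar> * \<bar>\<Phi> l k t\<bar>) powr (1/4) = \<Phi> k l s powr (1/4) * \<Phi> l k t powr (1/4)"
    using assms[of s] assms[of t] by (simp add: powr_mult less_imp_le)
  have S: "1 / \<bar>m\<bar> powr (1/2) = m powr (-1/2)" unfolding r using m by (simp add: powr_half_sqrt inverse_eq_divide)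
  have "K_NS \<sigma> \<Phi> K k l s t = \<sigma> k s * \<sigma> l t * (\<Phi> k l s powr (1/4) * \<Phi> l k t powr (1/4)) * (1 / \<bar>m\<bar> powr (1/2))
      * K k l (\<bar>s - t\<bar> * m powr (-1/2))"
    unfolding K_NS_def m_def[symmetric] Q P by (simp only: times_divide_eq_right mult_1_right)
  then show "K_NS \<sigma> \<Phi> K k l s t = ns_kernel (\<lambda>s. \<sigma> k s * \<Phi> k l s powr (1/4)) (\<lambda>s. \<sigma> l s * \<Phi> l k s powr (1/4)) (\<Phi> k l) (\<Phi> l k) (K k l) s t"
    unfolding ns_kernel_def inv_scale_def m_def[symmetric] S by (simp only: mult_ac)
qed

lemma inv_scale_bounds:
  assumes "0 < m0" "m0 \<le> \<Phi> s" "m0 \<le> \<Psi> t" "\<Phi> s \<le> A" "\<Psi> t \<le> A"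
  shows "A powr (-1/2) \<le> inv_scale \<Phi> \<Psi> s t" "inv_scale \<Phi> \<Psi> s t \<le> m0 powr (-1/2)" "0 < inv_scale \<Phi> \<Psi> s t"
  unfolding inv_scale_def using assms by (auto intro!: powr_mono2')

text \<open>Discrete Leibniz rule: in each of the four terms the differences together supply a
  factor h^2, whether they fall on a, b or M.\<close>

lemma product_mixed_difference:
  fixes a0 :: real
  assumes "\<bar>a0\<bar> \<le> A" "\<bar>b0\<bar> \<le> A" "\<bar>a1 - a0\<bar> \<le> A * h" "\<bar>b1 - b0\<bar> \<le> A * h" "0 \<le> A" "0 \<le> h" "0 \<le> E"
    and M: "\<bar>M11 - M10 - M01 + M00\<bar> \<le> E * h\<^sup>2" "\<bar>M11 - M01\<bar> \<le> E * h" "\<bar>M11 - M10\<bar> \<le> E * h" "\<bar>M11\<bar> \<le> E"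
  shows "\<bar>a1 * b1 * M11 - a1 * b0 * M10 - a0 * b1 * M01 + a0 * b0 * M00\<bar> \<le> 4 * A\<^sup>2 * E * h\<^sup>2"
proof -
  have "a1 * b1 * M11 - a1 * b0 * M10 - a0 * b1 * M01 + a0 * b0 * M00
    = a0 * b0 * (M11 - M10 - M01 + M00) + (a1 - a0) * b0 * (M11 - M10) + a0 * (b1 - b0) * (M11 - M01)
      + (a1 - a0) * (b1 - b0) * M11" by (simp add: algebra_simps)
  also have "\<bar>\<dots>\<bar> \<le> \<bar>a0 * b0 * (M11 - M10 - M01 + M00)\<bar> + \<bar>(a1 - a0) * b0 * (M11 - M10)\<bar>
      + \<bar>a0 * (b1 - b0) * (M11 - M01)\<bar> + \<bar>(a1 - a0) * (b1 - b0) * M11\<bar>"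
    by linarith
  also have "\<dots> \<le> A * A * (E * h\<^sup>2) + (A * h) * A * (E * h) + A * (A * h) * (E * h) + (A * h) * (A * h) * E"
    unfolding abs_mult by (intro add_mono mult_mono assms) (simp_all add: assms)
  also have "\<dots> = 4 * A\<^sup>2 * E * h\<^sup>2" by (simp add: power2_eq_square algebra_simps)
  finally show ?thesis .
qed

text \<open>If the two cells are at least one cell apart, all distances between them are at least s
  - t - h > 0, where \<kappa> is smooth; the second derivative of size y^(p-2) sets the decay. The
  condition with \<eta> keeps all arguments below \<delta>. Only the four corners matter, so the
  ranges may be replaced by affine functions between them.\<close>

lemma mixed_diff_off_diagonal:
  assumes \<delta>: "0 < \<delta>" "\<delta> \<le> 1" and C0: "0 \<le> C0" and p: "0 < p" "p < 1"
    and \<kappa>: "\<And>t. 0 < t \<Longrightarrow> t < \<delta> \<Longrightarrow> (\<kappa> has_real_derivative k1 t) (at t) \<and> (k1 has_real_derivative k2 t) (at t)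
       \<and> \<bar>\<kappa> t\<bar> \<le> C0 \<and> \<bar>k1 t\<bar> \<le> C0 * t powr (p - 1) \<and> \<bar>k2 t\<bar> \<le> C0 * t powr (p - 2)"
    and lip: "lipschitz_bounded L A a" "lipschitz_bounded L A b" "lipschitz_bounded L A \<Phi>" "lipschitz_bounded L A \<Psi>"
    and m0: "0 < m0" "\<And>s. s \<in> {0..L} \<Longrightarrow> m0 \<le> \<Phi> s" "\<And>s. s \<in> {0..L} \<Longrightarrow> m0 \<le> \<Psi> s" and L: "0 < L"
  shows "\<exists>D\<ge>0. \<exists>\<eta>>0. \<forall>s t h. 0 < h \<and> 0 \<le> t \<and> t + 2 * h \<le> s \<and> s + h \<le> L \<and> s + h - t < \<eta> \<longrightarrow>
     \<bar>mixed_diff (ns_kernel a b \<Phi> \<Psi> \<kappa>) s t h\<bar> \<le> D * h\<^sup>2 * (s - t - h) powr (p - 2)"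
proof -
  have A: "A > 0" using m0(1) m0(2)[of 0] lipschitz_boundedD(2)[OF lip(3), of 0] L by simp
  obtain C where C: "C \<ge> 0" and main: "\<And>\<kappa> k1 k2 Y B d e h \<mu> p q. 
    (\<forall>y\<in>Y. (\<kappa> has_real_derivative k1 y) (at y) \<and> (k1 has_real_derivative k2 y) (at y)
       \<and> \<bar>y\<bar> \<le> 1 \<and> \<bar>\<kappa> y\<bar> \<le> B \<and> \<bar>k1 y\<bar> \<le> B \<and> \<bar>k2 y\<bar> \<le> B) \<Longrightarrow>
    0 \<le> B \<Longrightarrow> 0 \<le> h \<Longrightarrow> \<bar>e\<bar> \<le> h \<Longrightarrow> \<bar>p\<bar> \<le> A * h \<Longrightarrow> \<bar>q\<bar> \<le> A * h \<Longrightarrow>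
    (\<forall>u\<in>{0..1}. \<forall>v\<in>{0..1}. m0 \<le> \<mu> + p * u + q * v
        \<and> (d + e * (u - v)) * (\<mu> + p * u + q * v) powr (-1/2) \<in> Y) \<Longrightarrow>
    (let f = affine_kernel \<kappa> d e \<mu> p q in
      \<bar>f 1 1 - f 1 0 - f 0 1 + f 0 0\<bar> \<le> C * B * h\<^sup>2 \<and> \<bar>f 1 1 - f 0 1\<bar> \<le> C * B * h
      \<and> \<bar>f 1 1 - f 1 0\<bar> \<le> C * B * h \<and> \<bar>f 1 1\<bar> \<le> C * B)"
    using affine_kernel_bounds[OF m0(1) less_imp_le[OF A]] by blast
  \<comment> \<open>The scale factor is at most m0^(-1/2), so distances below \<eta> give arguments
    below \<delta>. In D the factor 4 A^2 is from the Leibniz rule and the power of A from the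
    smallest scale factor A^(-1/2) raised to p - 2.\<close>
  define \<eta> where "\<eta> = \<delta> * sqrt m0"
  define D where "D = 4 * A\<^sup>2 * (C * (C0 * A powr ((2 - p) / 2)))"
  have "\<bar>mixed_diff (ns_kernel a b \<Phi> \<Psi> \<kappa>) s t h\<bar> \<le> D * h\<^sup>2 * (s - t - h) powr (p - 2)"
    if H: "0 < h" "0 \<le> t" "t + 2 * h \<le> s" "s + h \<le> L" "s + h - t < \<eta>" for s t h
  proof -
    have in0L: "s \<in> {0..L}" "s + h \<in> {0..L}" "t \<in> {0..L}" "t + h \<in> {0..L}" using H by auto
    define \<mu> where "\<mu> = (\<Phi> s + \<Psi> t) / 2"
    define P where "P = (\<Phi> (s + h) - \<Phi> s) / 2"
    define Q where "Q = (\<Psi> (t + h) - \<Psi> t) / 2"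
    \<comment> \<open>Shortest distance times smallest scale: a lower bound for all arguments. B is
      the value at \<open>ylo\<close> of the steepest of the three bounds.\<close>
    define ylo where "ylo = (s - t - h) * A powr (-1/2)"
    define Y where "Y = {y. ylo \<le> y \<and> y < \<delta>}"
    define B where "B = C0 * ylo powr (p - 2)"
    define f where "f = affine_kernel \<kappa> (s - t) h \<mu> P Q"
    have ylo: "ylo > 0" using H A by (simp add: ylo_def)
    \<comment> \<open>The interpolated range is the average of two convex combinations of endpoint
      values, so it inherits their bounds.\<close>
    have range: "m0 \<le> \<mu> + P * u + Q * v" "\<mu> + P * u + Q * v \<le> A" if "u \<in> {0..1}" "v \<in> {0..1}" for u v
    proof -
      have eq: "\<mu> + P * u + Q * v = ((1 - u) * \<Phi> s + u * \<Phi> (s + h) + ((1 - v) * \<Psi> t + v * \<Psi> (t + h))) / 2"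
        by (simp add: \<mu>_def P_def Q_def field_simps)
      have ge: "m0 \<le> (1 - u) * x + u * y" if "m0 \<le> x" "m0 \<le> y" "u \<in> {0..1}" for u x y
        using that convex_bound_le[of "-x" "-m0" "-y" "1 - u" u] by auto
      have le: "(1 - u) * x + u * y \<le> A" if "x \<le> A" "y \<le> A" "u \<in> {0..1}" for u x y
        using that convex_bound_le[of x A y "1 - u" u] by auto
      note lipschitz_boundedD(2)[OF lip(3)] lipschitz_boundedD(2)[OF lip(4)]
      then show "m0 \<le> \<mu> + P * u + Q * v" "\<mu> + P * u + Q * v \<le> A" unfolding eq
        using ge[of "\<Phi> s" "\<Phi> (s + h)" u] ge[of "\<Psi> t" "\<Psi> (t + h)" v] le[of "\<Phi> s" "\<Phi> (s + h)" u] le[of "\<Psi> t" "\<Psi> (t + h)" v]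
          m0 in0L that by auto
    qed
    have bnd: "(let f = affine_kernel \<kappa> (s - t) h \<mu> P Q in
      \<bar>f 1 1 - f 1 0 - f 0 1 + f 0 0\<bar> \<le> C * B * h\<^sup>2 \<and> \<bar>f 1 1 - f 0 1\<bar> \<le> C * B * h
      \<and> \<bar>f 1 1 - f 1 0\<bar> \<le> C * B * h \<and> \<bar>f 1 1\<bar> \<le> C * B)"
    proof (rule main[of Y \<kappa> k1 k2])
      show "\<forall>y\<in>Y. (\<kappa> has_real_derivative k1 y) (at y) \<and> (k1 has_real_derivative k2 y) (at y)
       \<and> \<bar>y\<bar> \<le> 1 \<and> \<bar>\<kappa> y\<bar> \<le> B \<and> \<bar>k1 y\<bar> \<le> B \<and> \<bar>k2 y\<bar> \<le> B"
      proof
        fix y assume "y \<in> Y"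
        then have y: "ylo \<le> y" "0 < y" "y < \<delta>" "y \<le> 1" using ylo \<delta> by (auto simp: Y_def)
        \<comment> \<open>Arguments lie between \<open>ylo\<close> and 1, where y^(p-2) dominates;
          the exponents 0, p - 1 and p - 2 are treated together.\<close>
        have c: "C0 * y powr e \<le> B" if "p - 2 \<le> e" for e
        proof -
          have "y powr e \<le> y powr (p - 2)" using y that by (intro powr_mono') auto
          also have "\<dots> \<le> ylo powr (p - 2)" using y ylo p by (intro powr_mono2') auto
          finally show ?thesis unfolding B_def using C0 by (rule mult_left_mono)
        qed
        show "(\<kappa> has_real_derivative k1 y) (at y) \<and> (k1 has_real_derivative k2 y) (at y)
       \<and> \<bar>y\<bar> \<le> 1 \<and> \<bar>\<kappa> y\<bar> \<le> B \<and> \<bar>k1 y\<bar> \<le> B \<and> \<bar>k2 y\<bar> \<le> B"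
          using \<kappa>[OF y(2,3)] y c[of 0] c[of "p - 1"] c[of "p - 2"] p by auto
      qed
      show "0 \<le> B" using C0 by (simp add: B_def)
      show "\<bar>P\<bar> \<le> A * h" "\<bar>Q\<bar> \<le> A * h"
        using lipschitz_boundedD(4)[OF lip(3) in0L(1) H(1) in0L(2)] lipschitz_boundedD(4)[OF lip(4) in0L(3) H(1) in0L(4)]
          mult_pos_pos[OF A H(1)] by (simp_all add: P_def Q_def)
      show "\<forall>u\<in>{0..1}. \<forall>v\<in>{0..1}. m0 \<le> \<mu> + P * u + Q * v
        \<and> (s - t + h * (u - v)) * (\<mu> + P * u + Q * v) powr (-1/2) \<in> Y"
      proof (intro ballI conjI)
        fix u v :: real assume uv: "u \<in> {0..1}" "v \<in> {0..1}"
        show "m0 \<le> \<mu> + P * u + Q * v" by (rule range[OF uv])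
        have "h * (-1) \<le> h * (u - v)" "h * (u - v) \<le> h * 1"
          by (rule mult_left_mono; use uv H in simp)+
        then have d: "s - t - h \<le> s - t + h * (u - v)" "s - t + h * (u - v) \<le> s - t + h" by auto
        have r: "A powr (-1/2) \<le> (\<mu> + P * u + Q * v) powr (-1/2)" "(\<mu> + P * u + Q * v) powr (-1/2) \<le> m0 powr (-1/2)"
          using range[OF uv] m0(1) by (auto intro!: powr_mono2')
        have "ylo \<le> (s - t + h * (u - v)) * (\<mu> + P * u + Q * v) powr (-1/2)"
          unfolding ylo_def using d r H by (intro mult_mono) auto
        moreover have "(s - t + h * (u - v)) * (\<mu> + P * u + Q * v) powr (-1/2) \<le> (s - t + h) * m0 powr (-1/2)"
          using d r H by (intro mult_mono) auto
        moreover have "(s - t + h) * m0 powr (-1/2) < \<delta>"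
          using H(5) m0(1) by (simp add: \<eta>_def powr_minus powr_half_sqrt field_simps)
        ultimately show "(s - t + h * (u - v)) * (\<mu> + P * u + Q * v) powr (-1/2) \<in> Y" by (simp add: Y_def)
      qed
    qed (use H in auto)
    have arg: "\<mu> + P * 1 + Q * 1 = (\<Phi> (s + h) + \<Psi> (t + h)) / 2" "\<mu> + P * 1 + Q * 0 = (\<Phi> (s + h) + \<Psi> t) / 2"
      "\<mu> + P * 0 + Q * 1 = (\<Phi> s + \<Psi> (t + h)) / 2" "\<mu> + P * 0 + Q * 0 = (\<Phi> s + \<Psi> t) / 2"
      by (simp_all add: \<mu>_def P_def Q_def field_simps)
    have M: "inv_scale \<Phi> \<Psi> (s + h) (t + h) * \<kappa> (\<bar>s + h - (t + h)\<bar> * inv_scale \<Phi> \<Psi> (s + h) (t + h)) = f 1 1"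
      "inv_scale \<Phi> \<Psi> (s + h) t * \<kappa> (\<bar>s + h - t\<bar> * inv_scale \<Phi> \<Psi> (s + h) t) = f 1 0"
      "inv_scale \<Phi> \<Psi> s (t + h) * \<kappa> (\<bar>s - (t + h)\<bar> * inv_scale \<Phi> \<Psi> s (t + h)) = f 0 1"
      "inv_scale \<Phi> \<Psi> s t * \<kappa> (\<bar>s - t\<bar> * inv_scale \<Phi> \<Psi> s t) = f 0 0"
      unfolding f_def affine_kernel_def inv_scale_def arg using H by (simp_all add: algebra_simps)
    have lips: "\<bar>a s\<bar> \<le> A" "\<bar>b t\<bar> \<le> A" "\<bar>a (s + h) - a s\<bar> \<le> A * h" "\<bar>b (t + h) - b t\<bar> \<le> A * h"
      using lipschitz_boundedD(1,4)[OF lip(1) in0L(1)] lipschitz_boundedD(1,4)[OF lip(2) in0L(3)] in0L H by auto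
    have "\<bar>mixed_diff (ns_kernel a b \<Phi> \<Psi> \<kappa>) s t h\<bar> \<le> 4 * A\<^sup>2 * (C * B) * h\<^sup>2"
      unfolding mixed_diff_def ns_kernel_def M
      using bnd A H C C0 by (intro product_mixed_difference lips) (auto simp: Let_def f_def B_def)
    also have "B = C0 * (A powr ((2 - p) / 2) * (s - t - h) powr (p - 2))"
    proof -
      have "(A powr (-1/2)) powr (p - 2) = A powr ((2 - p) / 2)"
        unfolding powr_powr by (rule arg_cong[of _ _ "(powr) A"]) (simp add: field_simps)
      then show ?thesis unfolding B_def ylo_def using A H by (simp add: powr_mult)
    qed
    finally show ?thesis by (simp add: D_def mult_ac)
  qed
  moreover have "D \<ge> 0" using C C0 by (simp add: D_def)
  moreover have "\<eta> > 0" using \<delta> m0 by (simp add: \<eta>_def)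
  ultimately show ?thesis by blast
qed

lemma mixed_diff_diagonal:
  assumes lip: "lipschitz_bounded L A a" "lipschitz_bounded L A b" "lipschitz_bounded L A \<Phi>" "lipschitz_bounded L A \<Psi>"
    and m0: "0 < m0" "\<And>s. s \<in> {0..L} \<Longrightarrow> m0 \<le> \<Phi> s" "\<And>s. s \<in> {0..L} \<Longrightarrow> m0 \<le> \<Psi> s" and L: "0 < L"
  shows "\<exists>D\<ge>0. \<forall>s h. 0 < h \<and> 0 \<le> s \<and> s + h \<le> L \<longrightarrow>
     \<bar>mixed_diff (ns_kernel a b \<Phi> \<Psi> \<kappa>) s s h
       + a (s + h) * b s * inv_scale \<Phi> \<Psi> (s + h) s * (\<kappa> (h * inv_scale \<Phi> \<Psi> (s + h) s) - \<kappa> 0)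
       + a s * b (s + h) * inv_scale \<Phi> \<Psi> s (s + h) * (\<kappa> (h * inv_scale \<Phi> \<Psi> s (s + h)) - \<kappa> 0)\<bar> \<le> D * h\<^sup>2"
proof -
  have A: "A > 0" using m0(1) m0(2)[of 0] lipschitz_boundedD(2)[OF lip(3), of 0] L by simp
  obtain C where C: "C \<ge> 0" and main: "\<And>\<kappa> k1 k2 Y B d e h \<mu> p q. 
    (\<forall>y\<in>Y. (\<kappa> has_real_derivative k1 y) (at y) \<and> (k1 has_real_derivative k2 y) (at y)
       \<and> \<bar>y\<bar> \<le> 1 \<and> \<bar>\<kappa> y\<bar> \<le> B \<and> \<bar>k1 y\<bar> \<le> B \<and> \<bar>k2 y\<bar> \<le> B) \<Longrightarrow>
    0 \<le> B \<Longrightarrow> 0 \<le> h \<Longrightarrow> \<bar>e\<bar> \<le> h \<Longrightarrow> \<bar>p\<bar> \<le> A * h \<Longrightarrow> \<bar>q\<bar> \<le> A * h \<Longrightarrow>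
    (\<forall>u\<in>{0..1}. \<forall>v\<in>{0..1}. m0 \<le> \<mu> + p * u + q * v
        \<and> (d + e * (u - v)) * (\<mu> + p * u + q * v) powr (-1/2) \<in> Y) \<Longrightarrow>
    (let f = affine_kernel \<kappa> d e \<mu> p q in
      \<bar>f 1 1 - f 1 0 - f 0 1 + f 0 0\<bar> \<le> C * B * h\<^sup>2 \<and> \<bar>f 1 1 - f 0 1\<bar> \<le> C * B * h
      \<and> \<bar>f 1 1 - f 1 0\<bar> \<le> C * B * h \<and> \<bar>f 1 1\<bar> \<le> C * B)"
    using affine_kernel_bounds[OF m0(1) less_imp_le[OF A]] by blast
  have "\<bar>mixed_diff (ns_kernel a b \<Phi> \<Psi> \<kappa>) s s h
       + a (s + h) * b s * inv_scale \<Phi> \<Psi> (s + h) s * (\<kappa> (h * inv_scale \<Phi> \<Psi> (s + h) s) - \<kappa> 0)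
       + a s * b (s + h) * inv_scale \<Phi> \<Psi> s (s + h) * (\<kappa> (h * inv_scale \<Phi> \<Psi> s (s + h)) - \<kappa> 0)\<bar> \<le> \<bar>\<kappa> 0\<bar> * (4 * A\<^sup>2 * C) * h\<^sup>2"
    if H: "0 < h" "0 \<le> s" "s + h \<le> L" for s h
  proof -
    have in0L: "s \<in> {0..L}" "s + h \<in> {0..L}" using H by auto
    define \<mu> where "\<mu> = (\<Phi> s + \<Psi> s) / 2"
    define P where "P = (\<Phi> (s + h) - \<Phi> s) / 2"
    define Q where "Q = (\<Psi> (s + h) - \<Psi> s) / 2"
    define f where "f = affine_kernel (\<lambda>_. 1) 0 0 \<mu> P Q"
    have range: "m0 \<le> \<mu> + P * u + Q * v" if "u \<in> {0..1}" "v \<in> {0..1}" for u v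
    proof -
      have eq: "\<mu> + P * u + Q * v = ((1 - u) * \<Phi> s + u * \<Phi> (s + h) + ((1 - v) * \<Psi> s + v * \<Psi> (s + h))) / 2"
        by (simp add: \<mu>_def P_def Q_def field_simps)
      have ge: "m0 \<le> (1 - u) * x + u * y" if "m0 \<le> x" "m0 \<le> y" "u \<in> {0..1}" for u x y
        using that convex_bound_le[of "-x" "-m0" "-y" "1 - u" u] by auto
      show ?thesis unfolding eq
        using ge[of "\<Phi> s" "\<Phi> (s + h)" u] ge[of "\<Psi> s" "\<Psi> (s + h)" v] m0 in0L that by auto
    qed
    have bnd: "(let f = affine_kernel (\<lambda>_. 1) 0 0 \<mu> P Q in
      \<bar>f 1 1 - f 1 0 - f 0 1 + f 0 0\<bar> \<le> C * 1 * h\<^sup>2 \<and> \<bar>f 1 1 - f 0 1\<bar> \<le> C * 1 * h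
      \<and> \<bar>f 1 1 - f 1 0\<bar> \<le> C * 1 * h \<and> \<bar>f 1 1\<bar> \<le> C * 1)"
    \<comment> \<open>The prefactor alone is the affine kernel of the constant function 1; with d =
      e = 0 the only argument is 0.\<close>
    proof (rule main[of "{0}" "\<lambda>_. 1" "\<lambda>_. 0" "\<lambda>_. 0"])
      show "\<bar>P\<bar> \<le> A * h" "\<bar>Q\<bar> \<le> A * h"
        using lipschitz_boundedD(4)[OF lip(3) in0L(1) H(1) in0L(2)] lipschitz_boundedD(4)[OF lip(4) in0L(1) H(1) in0L(2)]
          mult_pos_pos[OF A H(1)] by (simp_all add: P_def Q_def)
    qed (use H range in auto)
    have arg: "\<mu> + P * 1 + Q * 1 = (\<Phi> (s + h) + \<Psi> (s + h)) / 2" "\<mu> + P * 1 + Q * 0 = (\<Phi> (s + h) + \<Psi> s) / 2"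
      "\<mu> + P * 0 + Q * 1 = (\<Phi> s + \<Psi> (s + h)) / 2" "\<mu> + P * 0 + Q * 0 = (\<Phi> s + \<Psi> s) / 2"
      by (simp_all add: \<mu>_def P_def Q_def field_simps)
    have M: "inv_scale \<Phi> \<Psi> (s + h) (s + h) = f 1 1" "inv_scale \<Phi> \<Psi> (s + h) s = f 1 0"
      "inv_scale \<Phi> \<Psi> s (s + h) = f 0 1" "inv_scale \<Phi> \<Psi> s s = f 0 0"
      unfolding f_def affine_kernel_def inv_scale_def arg by simp_all
    have lips: "\<bar>a s\<bar> \<le> A" "\<bar>b s\<bar> \<le> A" "\<bar>a (s + h) - a s\<bar> \<le> A * h" "\<bar>b (s + h) - b s\<bar> \<le> A * h"
      using lipschitz_boundedD(1,4)[OF lip(1) in0L(1)] lipschitz_boundedD(1,4)[OF lip(2) in0L(1)] in0L H by auto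
    define X where "X = a (s + h) * b (s + h) * f 1 1 - a (s + h) * b s * f 1 0 - a s * b (s + h) * f 0 1 + a s * b s * f 0 0"
    have sm: "\<bar>X\<bar> \<le> 4 * A\<^sup>2 * C * h\<^sup>2"
      unfolding X_def using bnd A H C by (intro product_mixed_difference lips) (auto simp: Let_def f_def)
    have eq: "mixed_diff (ns_kernel a b \<Phi> \<Psi> \<kappa>) s s h
       + a (s + h) * b s * inv_scale \<Phi> \<Psi> (s + h) s * (\<kappa> (h * inv_scale \<Phi> \<Psi> (s + h) s) - \<kappa> 0)
       + a s * b (s + h) * inv_scale \<Phi> \<Psi> s (s + h) * (\<kappa> (h * inv_scale \<Phi> \<Psi> s (s + h)) - \<kappa> 0)
      = \<kappa> 0 * X"
      unfolding mixed_diff_def ns_kernel_def M X_def using H(1) by (simp add: algebra_simps)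
    have "\<bar>\<kappa> 0\<bar> * \<bar>X\<bar> \<le> \<bar>\<kappa> 0\<bar> * (4 * A\<^sup>2 * C * h\<^sup>2)" by (rule mult_left_mono[OF sm]) simp
    then show ?thesis unfolding eq abs_mult by (simp only: mult.assoc)
  qed
  moreover have "0 \<le> \<bar>\<kappa> 0\<bar> * (4 * A\<^sup>2 * C)" using C by simp
  ultimately show ?thesis by blast
qed

definition ns_regular ::
  "real \<Rightarrow> real \<Rightarrow> real \<Rightarrow> (real \<Rightarrow> real) \<Rightarrow> (real \<Rightarrow> real) \<Rightarrow> (real \<Rightarrow> real) \<Rightarrow> (real \<Rightarrow> real) \<Rightarrow> bool" where
  "ns_regular L A m0 a b \<Phi> \<Psi> \<longleftrightarrow> 0 < L \<and> 0 < m0 \<and> lipschitz_bounded L A a \<and> lipschitz_bounded L A b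
     \<and> lipschitz_bounded L A \<Phi> \<and> lipschitz_bounded L A \<Psi> \<and> (\<forall>s\<in>{0..L}. m0 \<le> \<Phi> s \<and> m0 \<le> \<Psi> s)"

text \<open>Inserts an expansion of \<kappa> into the two mixed corner terms. D, W and T are fixed
  before c, \<epsilon> and \<delta>, so the precision may still be chosen afterwards: c = 0 gives
  upper bounds, the true coefficient the lower bound.\<close>

lemma mixed_diff_diagonal_expansion:
  assumes R: "ns_regular L A m0 a b \<Phi> \<Psi>" and q: "0 < q"
  shows "\<exists>D\<ge>0. \<exists>W\<ge>0. \<exists>T>0. \<forall>c \<epsilon> \<delta>. 0 \<le> \<epsilon> \<and> 0 < \<delta> \<and>
      (\<forall>t. 0 < t \<and> t < \<delta> \<longrightarrow> \<bar>\<kappa> t - \<kappa> 0 - c * t powr q'\<bar> \<le> \<epsilon> * t powr q) \<longrightarrow>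
    (\<forall>s h. 0 < h \<and> h < \<delta> * T \<and> 0 \<le> s \<and> s + h \<le> L \<longrightarrow>
     \<bar>mixed_diff (ns_kernel a b \<Phi> \<Psi> \<kappa>) s s h + c * h powr q' *
       (a (s + h) * b s * inv_scale \<Phi> \<Psi> (s + h) s powr (1 + q') + a s * b (s + h) * inv_scale \<Phi> \<Psi> s (s + h) powr (1 + q'))\<bar>
       \<le> D * h\<^sup>2 + W * \<epsilon> * h powr q)"
proof -
  have lip: "lipschitz_bounded L A a" "lipschitz_bounded L A b" "lipschitz_bounded L A \<Phi>" "lipschitz_bounded L A \<Psi>"
    and m0: "0 < m0" "\<And>s. s \<in> {0..L} \<Longrightarrow> m0 \<le> \<Phi> s" "\<And>s. s \<in> {0..L} \<Longrightarrow> m0 \<le> \<Psi> s" and L: "0 < L"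
    using R unfolding ns_regular_def by blast+
  obtain D where D: "D \<ge> 0" and dd: "\<And>s h. 0 < h \<and> 0 \<le> s \<and> s + h \<le> L \<Longrightarrow>
     \<bar>mixed_diff (ns_kernel a b \<Phi> \<Psi> \<kappa>) s s h
       + a (s + h) * b s * inv_scale \<Phi> \<Psi> (s + h) s * (\<kappa> (h * inv_scale \<Phi> \<Psi> (s + h) s) - \<kappa> 0)
       + a s * b (s + h) * inv_scale \<Phi> \<Psi> s (s + h) * (\<kappa> (h * inv_scale \<Phi> \<Psi> s (s + h)) - \<kappa> 0)\<bar> \<le> D * h\<^sup>2"
    using mixed_diff_diagonal[OF lip m0 L] by meson
  define rhi where "rhi = m0 powr (-1/2)"
  have rhi: "rhi > 0" using m0 by (simp add: rhi_def)
  \<comment> \<open>Two corners, each with amplitudes at most A and scale at most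
    \<open>rhi\<close>, both outside \<kappa> and inside the power q.\<close>
  define W where "W = 2 * (A * A * rhi * rhi powr q)"
  have W: "W \<ge> 0" using rhi by (simp add: W_def)
  have main: "\<bar>mixed_diff (ns_kernel a b \<Phi> \<Psi> \<kappa>) s s h + c * h powr q' *
       (a (s + h) * b s * inv_scale \<Phi> \<Psi> (s + h) s powr (1 + q') + a s * b (s + h) * inv_scale \<Phi> \<Psi> s (s + h) powr (1 + q'))\<bar>
       \<le> D * h\<^sup>2 + W * \<epsilon> * h powr q"
    if \<epsilon>: "0 \<le> \<epsilon>" and \<delta>: "0 < \<delta>" and g: "\<And>t. 0 < t \<and> t < \<delta> \<Longrightarrow> \<bar>\<kappa> t - \<kappa> 0 - c * t powr q'\<bar> \<le> \<epsilon> * t powr q"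
      and h: "0 < h" "h < \<delta> * (1 / rhi)" "0 \<le> s" "s + h \<le> L" for c \<epsilon> \<delta> s h
  proof -
    have in0L: "s \<in> {0..L}" "s + h \<in> {0..L}" using h by auto
    have term_: "\<bar>w * v * r * (\<kappa> (h * r) - \<kappa> 0) - c * h powr q' * (w * v * r powr (1 + q'))\<bar> \<le> W / 2 * \<epsilon> * h powr q"
      if w: "\<bar>w\<bar> \<le> A" "\<bar>v\<bar> \<le> A" and r: "0 < r" "r \<le> rhi" for w v r
    proof -
      have A0: "0 \<le> A" using w by linarith
      have hr: "0 < h * r" "h * r < \<delta>"
      proof -
        have "h * r \<le> h * rhi" using h r by simp
        also have "\<dots> < \<delta>" using h rhi by (simp add: field_simps)
        finally show "h * r < \<delta>" .
      qed (use h r in simp)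
      have "w * v * r * (\<kappa> (h * r) - \<kappa> 0) - c * h powr q' * (w * v * r powr (1 + q'))
        = w * v * r * (\<kappa> (h * r) - \<kappa> 0 - c * (h * r) powr q')"
        using h r by (simp add: powr_mult powr_add algebra_simps)
      also have "\<bar>\<dots>\<bar> \<le> A * A * rhi * (\<epsilon> * (h * rhi) powr q)"
      proof -
        have "(h * r) powr q \<le> (h * rhi) powr q" using h r q by (intro powr_mono2) auto
        then have "\<bar>\<kappa> (h * r) - \<kappa> 0 - c * (h * r) powr q'\<bar> \<le> \<epsilon> * (h * rhi) powr q"
          using g[of "h * r"] hr \<epsilon> by (meson mult_left_mono order.trans)
        moreover have "\<bar>r\<bar> \<le> rhi" using r by simp
        ultimately show ?thesis unfolding abs_mult using w A0 rhi by (intro mult_mono) auto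
      qed
      also have "\<dots> = W / 2 * \<epsilon> * h powr q" using h rhi by (simp add: W_def powr_mult)
      finally show ?thesis .
    qed
    note i1 = inv_scale_bounds(2,3)[where \<Phi> = \<Phi> and \<Psi> = \<Psi> and s = "s + h" and t = s, OF m0(1) m0(2)[OF in0L(2)] m0(3)[OF in0L(1)] lipschitz_boundedD(2)[OF lip(3) in0L(2)]
        lipschitz_boundedD(2)[OF lip(4) in0L(1)]]
    note i2 = inv_scale_bounds(2,3)[where \<Phi> = \<Phi> and \<Psi> = \<Psi> and s = s and t = "s + h", OF m0(1) m0(2)[OF in0L(1)] m0(3)[OF in0L(2)] lipschitz_boundedD(2)[OF lip(3) in0L(1)]
        lipschitz_boundedD(2)[OF lip(4) in0L(2)]]
    have t1: "\<bar>a (s + h) * b s * inv_scale \<Phi> \<Psi> (s + h) s * (\<kappa> (h * inv_scale \<Phi> \<Psi> (s + h) s) - \<kappa> 0)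
        - c * h powr q' * (a (s + h) * b s * inv_scale \<Phi> \<Psi> (s + h) s powr (1 + q'))\<bar> \<le> W / 2 * \<epsilon> * h powr q"
      using i1 by (intro term_ lipschitz_boundedD(1)[OF lip(1)] lipschitz_boundedD(1)[OF lip(2)] in0L) (auto simp: rhi_def)
    have t2: "\<bar>a s * b (s + h) * inv_scale \<Phi> \<Psi> s (s + h) * (\<kappa> (h * inv_scale \<Phi> \<Psi> s (s + h)) - \<kappa> 0)
        - c * h powr q' * (a s * b (s + h) * inv_scale \<Phi> \<Psi> s (s + h) powr (1 + q'))\<bar> \<le> W / 2 * \<epsilon> * h powr q"
      using i2 by (intro term_ lipschitz_boundedD(1)[OF lip(1)] lipschitz_boundedD(1)[OF lip(2)] in0L) (auto simp: rhi_def)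
    show ?thesis using t1 t2 dd[of h s] h unfolding distrib_left by linarith
  qed
  show ?thesis
    by (rule exI[of _ D], rule conjI[OF D], rule exI[of _ W], rule conjI[OF W], rule exI[of _ "1 / rhi"], rule conjI)
       (use rhi main in auto)
qed

text \<open>Meant for the cross-covariance: the expansion with c = 0 and a precision reduced by W
  leaves \<epsilon>/2, and q < 2 makes the h^2 error at most the other \<epsilon>/2.\<close>

lemma mixed_diff_diagonal_small:
  assumes R: "ns_regular L A m0 a b \<Phi> \<Psi>" and q: "0 < q" "q < 2"
    and \<kappa>: "\<And>\<epsilon>. \<epsilon> > 0 \<Longrightarrow> \<exists>\<delta>>0. \<forall>t. 0 < t \<and> t < \<delta> \<longrightarrow> \<bar>\<kappa> t - \<kappa> 0\<bar> \<le> \<epsilon> * t powr q"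
    and \<epsilon>: "0 < \<epsilon>"
  shows "\<exists>\<eta>>0. \<forall>s h. 0 < h \<and> h < \<eta> \<and> 0 \<le> s \<and> s + h \<le> L \<longrightarrow>
     \<bar>mixed_diff (ns_kernel a b \<Phi> \<Psi> \<kappa>) s s h\<bar> \<le> \<epsilon> * h powr q"
proof -
  obtain D W T where D: "D \<ge> 0" and W: "W \<ge> 0" and T: "T > 0" and main: "\<And>c \<epsilon> \<delta>. 0 \<le> \<epsilon> \<and> 0 < \<delta> \<and>
      (\<forall>t. 0 < t \<and> t < \<delta> \<longrightarrow> \<bar>\<kappa> t - \<kappa> 0 - c * t powr q\<bar> \<le> \<epsilon> * t powr q) \<longrightarrow>
    (\<forall>s h. 0 < h \<and> h < \<delta> * T \<and> 0 \<le> s \<and> s + h \<le> L \<longrightarrow>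
     \<bar>mixed_diff (ns_kernel a b \<Phi> \<Psi> \<kappa>) s s h + c * h powr q *
       (a (s + h) * b s * inv_scale \<Phi> \<Psi> (s + h) s powr (1 + q) + a s * b (s + h) * inv_scale \<Phi> \<Psi> s (s + h) powr (1 + q))\<bar>
       \<le> D * h\<^sup>2 + W * \<epsilon> * h powr q)"
    using mixed_diff_diagonal_expansion[OF R q(1), of \<kappa> q] by blast
  define \<epsilon>' where "\<epsilon>' = \<epsilon> / (2 * (W + 1))"
  have \<epsilon>': "\<epsilon>' > 0" "W * \<epsilon>' \<le> \<epsilon> / 2" using \<epsilon> W by (simp_all add: \<epsilon>'_def field_simps)
  obtain \<delta> where \<delta>: "\<delta> > 0" "\<forall>t. 0 < t \<and> t < \<delta> \<longrightarrow> \<bar>\<kappa> t - \<kappa> 0\<bar> \<le> \<epsilon>' * t powr q"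
    using \<kappa>[OF \<epsilon>'(1)] by blast
  obtain \<eta> where \<eta>: "\<eta> > 0" "\<And>h. 0 < h \<and> h < \<eta> \<Longrightarrow> D * h powr (2 - q) \<le> \<epsilon> / 2"
    using powr_small[of "2 - q" "\<epsilon> / 2" D] q \<epsilon> D by auto
  have "\<bar>mixed_diff (ns_kernel a b \<Phi> \<Psi> \<kappa>) s s h\<bar> \<le> \<epsilon> * h powr q"
    if h: "0 < h" "h < min \<eta> (\<delta> * T)" "0 \<le> s" "s + h \<le> L" for s h
  proof -
    have "\<bar>mixed_diff (ns_kernel a b \<Phi> \<Psi> \<kappa>) s s h\<bar> \<le> D * h\<^sup>2 + W * \<epsilon>' * h powr q"
      using main[of \<epsilon>' \<delta> 0] \<epsilon>' \<delta> h by simp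
    also have "D * h\<^sup>2 = D * h powr (2 - q) * h powr q"
      using h by (simp add: mult.assoc powr_add[symmetric] powr_realpow)
    also have "\<dots> + W * \<epsilon>' * h powr q \<le> \<epsilon> / 2 * h powr q + \<epsilon> / 2 * h powr q"
      using \<eta> \<epsilon>' h by (intro add_mono mult_right_mono) auto
    finally show ?thesis by simp
  qed
  moreover have "min \<eta> (\<delta> * T) > 0" using \<eta> \<delta> T by simp
  ultimately show ?thesis by blast
qed

text \<open>The expansion with c = 0; for h < 1 and q \<le> 2 the h^2 error is dominated by
  h^q.\<close>

lemma mixed_diff_diagonal_bound:
  assumes R: "ns_regular L A m0 a b \<Phi> \<Psi>" and q: "0 < q" "q \<le> 2" and C: "0 \<le> C" and \<delta>: "0 < \<delta>"
    and \<kappa>: "\<And>t. 0 < t \<Longrightarrow> t < \<delta> \<Longrightarrow> \<bar>\<kappa> t - \<kappa> 0\<bar> \<le> C * t powr q"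
  shows "\<exists>D\<ge>0. \<exists>\<eta>>0. \<forall>s h. 0 < h \<and> h < \<eta> \<and> 0 \<le> s \<and> s + h \<le> L \<longrightarrow>
     \<bar>mixed_diff (ns_kernel a b \<Phi> \<Psi> \<kappa>) s s h\<bar> \<le> D * h powr q"
proof -
  obtain D W T where D: "D \<ge> 0" and W: "W \<ge> 0" and T: "T > 0" and main: "\<And>c \<epsilon> \<delta>. 0 \<le> \<epsilon> \<and> 0 < \<delta> \<and>
      (\<forall>t. 0 < t \<and> t < \<delta> \<longrightarrow> \<bar>\<kappa> t - \<kappa> 0 - c * t powr q\<bar> \<le> \<epsilon> * t powr q) \<longrightarrow>
    (\<forall>s h. 0 < h \<and> h < \<delta> * T \<and> 0 \<le> s \<and> s + h \<le> L \<longrightarrow>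
     \<bar>mixed_diff (ns_kernel a b \<Phi> \<Psi> \<kappa>) s s h + c * h powr q *
       (a (s + h) * b s * inv_scale \<Phi> \<Psi> (s + h) s powr (1 + q) + a s * b (s + h) * inv_scale \<Phi> \<Psi> s (s + h) powr (1 + q))\<bar>
       \<le> D * h\<^sup>2 + W * \<epsilon> * h powr q)"
    using mixed_diff_diagonal_expansion[OF R q(1), of \<kappa> q] by blast
  have "\<bar>mixed_diff (ns_kernel a b \<Phi> \<Psi> \<kappa>) s s h\<bar> \<le> (D + W * C) * h powr q"
    if h: "0 < h" "h < min 1 (\<delta> * T)" "0 \<le> s" "s + h \<le> L" for s h
  proof -
    have "\<bar>mixed_diff (ns_kernel a b \<Phi> \<Psi> \<kappa>) s s h\<bar> \<le> D * h\<^sup>2 + W * C * h powr q"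
      using main[of C \<delta> 0] C \<delta> \<kappa> h by simp
    also have "h\<^sup>2 = h powr 2" using h by (simp add: powr_realpow)
    also have "D * h powr 2 + W * C * h powr q \<le> D * h powr q + W * C * h powr q"
      using h q D by (intro add_right_mono mult_left_mono powr_mono') auto
    finally show ?thesis by (simp add: distrib_right)
  qed
  moreover have "min 1 (\<delta> * T) > 0" "0 \<le> D + W * C" using \<delta> T D W C by simp_all
  ultimately show ?thesis by blast
qed

text \<open>Both corner terms have the same sign because the amplitudes are bounded below by
  \<open>a0\<close>, so they cannot cancel. As \<alpha> < 2, the h^2 error is of smaller
  order.\<close>

lemma mixed_diff_diagonal_lower:
  assumes R: "ns_regular L A m0 a b \<Phi> \<Psi>" and \<alpha>: "0 < \<alpha>" "\<alpha> < 2" and c: "c \<noteq> 0" and a0: "0 < a0"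
    and pos: "\<And>s. s \<in> {0..L} \<Longrightarrow> a0 \<le> a s \<and> a0 \<le> b s"
    and \<kappa>: "\<And>\<epsilon>. \<epsilon> > 0 \<Longrightarrow> \<exists>\<delta>>0. \<forall>t. 0 < t \<and> t < \<delta> \<longrightarrow> \<bar>\<kappa> t - \<kappa> 0 - c * t powr \<alpha>\<bar> \<le> \<epsilon> * t powr \<alpha>"
  shows "\<exists>c0>0. \<exists>\<eta>>0. \<forall>s h. 0 < h \<and> h < \<eta> \<and> 0 \<le> s \<and> s + h \<le> L \<longrightarrow>
     c0 * h powr \<alpha> \<le> \<bar>mixed_diff (ns_kernel a b \<Phi> \<Psi> \<kappa>) s s h\<bar>"
proof -
  have lip: "lipschitz_bounded L A \<Phi>" "lipschitz_bounded L A \<Psi>"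
    and m0: "0 < m0" "\<And>s. s \<in> {0..L} \<Longrightarrow> m0 \<le> \<Phi> s" "\<And>s. s \<in> {0..L} \<Longrightarrow> m0 \<le> \<Psi> s" and L: "0 < L"
    using R unfolding ns_regular_def by blast+
  obtain D W T where D: "D \<ge> 0" and W: "W \<ge> 0" and T: "T > 0" and main: "\<And>c \<epsilon> \<delta>. 0 \<le> \<epsilon> \<and> 0 < \<delta> \<and>
      (\<forall>t. 0 < t \<and> t < \<delta> \<longrightarrow> \<bar>\<kappa> t - \<kappa> 0 - c * t powr \<alpha>\<bar> \<le> \<epsilon> * t powr \<alpha>) \<longrightarrow>
    (\<forall>s h. 0 < h \<and> h < \<delta> * T \<and> 0 \<le> s \<and> s + h \<le> L \<longrightarrow>
     \<bar>mixed_diff (ns_kernel a b \<Phi> \<Psi> \<kappa>) s s h + c * h powr \<alpha> *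
       (a (s + h) * b s * inv_scale \<Phi> \<Psi> (s + h) s powr (1 + \<alpha>) + a s * b (s + h) * inv_scale \<Phi> \<Psi> s (s + h) powr (1 + \<alpha>))\<bar>
       \<le> D * h\<^sup>2 + W * \<epsilon> * h powr \<alpha>)"
    using mixed_diff_diagonal_expansion[OF R \<alpha>(1), of \<kappa> \<alpha>] by blast
  define r0 where "r0 = (A powr (-1/2)) powr (1 + \<alpha>)"
  have "0 \<in> {0..L}" using L by simp
  from m0(2)[OF this] lipschitz_boundedD(2)[OF lip(1) this] m0(1) have A: "A > 0" by linarith
  then have r0: "r0 > 0" by (simp add: r0_def)
  define c0 where "c0 = \<bar>c\<bar> * (a0 * a0 * r0)"
  have c0: "c0 > 0" using c a0 r0 by (simp add: c0_def)
  \<comment> \<open>The two corners contribute at least 2 c0 h^\<alpha>. Both errors are kept below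
    half of c0 h^\<alpha>, which leaves c0 h^\<alpha>.\<close>
  define \<epsilon>' where "\<epsilon>' = c0 / (2 * (W + 1))"
  have \<epsilon>': "\<epsilon>' > 0" "W * \<epsilon>' \<le> c0 / 2" using c0 W by (simp_all add: \<epsilon>'_def field_simps)
  obtain \<delta> where \<delta>: "\<delta> > 0" "\<forall>t. 0 < t \<and> t < \<delta> \<longrightarrow> \<bar>\<kappa> t - \<kappa> 0 - c * t powr \<alpha>\<bar> \<le> \<epsilon>' * t powr \<alpha>"
    using \<kappa>[OF \<epsilon>'(1)] by blast
  obtain \<eta> where \<eta>: "\<eta> > 0" "\<And>h. 0 < h \<and> h < \<eta> \<Longrightarrow> D * h powr (2 - \<alpha>) \<le> c0 / 2"
    using powr_small[of "2 - \<alpha>" "c0 / 2" D] \<alpha> c0 D by auto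
  have "c0 * h powr \<alpha> \<le> \<bar>mixed_diff (ns_kernel a b \<Phi> \<Psi> \<kappa>) s s h\<bar>"
    if h: "0 < h" "h < min \<eta> (\<delta> * T)" "0 \<le> s" "s + h \<le> L" for s h
  proof -
    have in0L: "s \<in> {0..L}" "s + h \<in> {0..L}" using h by auto
    define S where "S = a (s + h) * b s * inv_scale \<Phi> \<Psi> (s + h) s powr (1 + \<alpha>) + a s * b (s + h) * inv_scale \<Phi> \<Psi> s (s + h) powr (1 + \<alpha>)"
    have low: "a0 * a0 * r0 \<le> x * y * r powr (1 + \<alpha>)" if "a0 \<le> x" "a0 \<le> y" "A powr (-1/2) \<le> r" for x y r
      unfolding r0_def using that a0 \<alpha> by (intro mult_mono powr_mono2) auto
    have i1: "A powr (-1/2) \<le> inv_scale \<Phi> \<Psi> (s + h) s" and i2: "A powr (-1/2) \<le> inv_scale \<Phi> \<Psi> s (s + h)"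
      by (rule inv_scale_bounds[OF m0(1)]; intro m0 lipschitz_boundedD(2)[OF lip(1)] lipschitz_boundedD(2)[OF lip(2)] in0L)+
    have S: "2 * (a0 * a0 * r0) \<le> S"
      unfolding S_def using low[OF _ _ i1, of "a (s + h)" "b s"] low[OF _ _ i2, of "a s" "b (s + h)"] pos in0L by simp
    have "\<bar>mixed_diff (ns_kernel a b \<Phi> \<Psi> \<kappa>) s s h + c * h powr \<alpha> * S\<bar> \<le> D * h\<^sup>2 + W * \<epsilon>' * h powr \<alpha>"
      unfolding S_def using main[of \<epsilon>' \<delta> c] \<epsilon>' \<delta> h by simp
    also have "D * h\<^sup>2 = D * h powr (2 - \<alpha>) * h powr \<alpha>"
      using h by (simp add: mult.assoc powr_add[symmetric] powr_realpow)
    also have "\<dots> + W * \<epsilon>' * h powr \<alpha> \<le> c0 / 2 * h powr \<alpha> + c0 / 2 * h powr \<alpha>"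
      using \<eta> \<epsilon>' h by (intro add_mono mult_right_mono) auto
    finally have 1: "\<bar>mixed_diff (ns_kernel a b \<Phi> \<Psi> \<kappa>) s s h + c * h powr \<alpha> * S\<bar> \<le> c0 * h powr \<alpha>" by simp
    have S0: "S \<ge> 0" using S a0 r0 by (meson mult_nonneg_nonneg less_imp_le order.trans zero_le_numeral)
    have "2 * c0 * h powr \<alpha> = \<bar>c\<bar> * h powr \<alpha> * (2 * (a0 * a0 * r0))" by (simp add: c0_def)
    also have "\<dots> \<le> \<bar>c\<bar> * h powr \<alpha> * S" by (intro mult_left_mono S) auto
    also have "\<dots> = \<bar>c * h powr \<alpha> * S\<bar>" using S0 by (simp add: abs_mult)
    finally show ?thesis using 1 by linarith
  qed
  moreover have "min \<eta> (\<delta> * T) > 0" using \<eta> \<delta> T by simp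
  ultimately show ?thesis using c0 by blast
qed

subsection \<open>Operator norm of the Gram matrix of the increments\<close>

definition inc :: "(real \<Rightarrow> 'a \<Rightarrow> real) \<Rightarrow> real \<Rightarrow> nat \<Rightarrow> 'a \<Rightarrow> real" where
  "inc V h j x = V (real j * h) x - V ((real j - 1) * h) x"

lemma gaussian_space_diff:
  assumes "gaussian_space M H" "U \<in> H" "V \<in> H" shows "(\<lambda>x. U x - V x) \<in> H"
  using gaussian_spaceD(3)[OF assms(1,2) gaussian_spaceD(4)[OF assms(1,3), of "-1"]] by simp

lemma expectation_inc:
  assumes H: "gaussian_space M H" and UV: "\<And>s. U s \<in> H" "\<And>s. V s \<in> H"
    and C: "\<And>s t. (LINT x|M. U s x * V t x) = C s t"
  shows "(LINT x|M. inc U h i x * inc V h j x) = mixed_diff C ((real i - 1) * h) ((real j - 1) * h) h"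
proof -
  have st: "(real i - 1) * h + h = real i * h" "(real j - 1) * h + h = real j * h" by (simp_all add: algebra_simps)
  have "(LINT x|M. inc U h i x * inc V h j x)
    = (LINT x|M. U (real i * h) x * V (real j * h) x - U (real i * h) x * V ((real j - 1) * h) x
       - U ((real i - 1) * h) x * V (real j * h) x + U ((real i - 1) * h) x * V ((real j - 1) * h) x)"
    by (rule Bochner_Integration.integral_cong) (auto simp: inc_def algebra_simps)
  then show ?thesis by (simp add: mixed_diff_def st gaussian_space_integrable_mult[OF H UV(1) UV(2)] C)
qed

text \<open>The Schur test: 2 |v_i v_j| \<le> v_i^2 + v_j^2, and by symmetry both halves are the
  same row sum.\<close>

lemma quadratic_form_row_sums:
  fixes G :: "'i \<Rightarrow> 'i \<Rightarrow> real"
  assumes sym: "\<And>i j. i \<in> B \<Longrightarrow> j \<in> B \<Longrightarrow> G i j = G j i" and row: "\<And>i. i \<in> B \<Longrightarrow> (\<Sum>j\<in>B. \<bar>G i j\<bar>) \<le> \<rho>"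
  shows "(\<Sum>i\<in>B. \<Sum>j\<in>B. v i * v j * G i j) \<le> \<rho> * (\<Sum>i\<in>B. (v i)\<^sup>2)"
proof -
  have "(\<Sum>i\<in>B. \<Sum>j\<in>B. v i * v j * G i j) \<le> (\<Sum>i\<in>B. \<Sum>j\<in>B. ((v i)\<^sup>2 * \<bar>G i j\<bar> + (v j)\<^sup>2 * \<bar>G i j\<bar>) / 2)"
  proof (intro sum_mono)
    fix i j
    have "v i * v j * G i j \<le> \<bar>v i * v j\<bar> * \<bar>G i j\<bar>" by (metis abs_ge_self abs_mult)
    also have "\<dots> \<le> (((v i)\<^sup>2 + (v j)\<^sup>2) / 2) * \<bar>G i j\<bar>"
      using sum_squares_bound[of "\<bar>v i\<bar>" "\<bar>v j\<bar>"] by (intro mult_right_mono) (auto simp: abs_mult)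
    finally show "v i * v j * G i j \<le> ((v i)\<^sup>2 * \<bar>G i j\<bar> + (v j)\<^sup>2 * \<bar>G i j\<bar>) / 2" by (simp add: distrib_right)
  qed
  also have "\<dots> = ((\<Sum>i\<in>B. \<Sum>j\<in>B. (v i)\<^sup>2 * \<bar>G i j\<bar>) + (\<Sum>i\<in>B. \<Sum>j\<in>B. (v j)\<^sup>2 * \<bar>G i j\<bar>)) / 2"
    by (simp add: sum.distrib sum_divide_distrib[symmetric])
  also have "(\<Sum>i\<in>B. \<Sum>j\<in>B. (v j)\<^sup>2 * \<bar>G i j\<bar>) = (\<Sum>i\<in>B. \<Sum>j\<in>B. (v i)\<^sup>2 * \<bar>G i j\<bar>)"
    by (subst sum.swap) (auto intro!: sum.cong simp: sym)
  also have "((\<Sum>i\<in>B. \<Sum>j\<in>B. (v i)\<^sup>2 * \<bar>G i j\<bar>) + (\<Sum>i\<in>B. \<Sum>j\<in>B. (v i)\<^sup>2 * \<bar>G i j\<bar>)) / 2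
      = (\<Sum>i\<in>B. \<Sum>j\<in>B. (v i)\<^sup>2 * \<bar>G i j\<bar>)" by simp
  also have "\<dots> = (\<Sum>i\<in>B. (v i)\<^sup>2 * (\<Sum>j\<in>B. \<bar>G i j\<bar>))" by (simp only: sum_distrib_left)
  also have "\<dots> \<le> (\<Sum>i\<in>B. (v i)\<^sup>2 * \<rho>)" by (intro sum_mono mult_left_mono row) auto
  also have "\<dots> = \<rho> * (\<Sum>i\<in>B. (v i)\<^sup>2)" by (simp add: sum_distrib_left mult.commute)
  finally show ?thesis .
qed

text \<open>On either side of i the numbers |i - j| - 1 are distinct positive integers, so each half
  is part of the convergent series of n^(p-2); hence the factor 2. The same bound for all i is what
  the row sums need.\<close>

lemma sum_distance_powr:
  assumes p: "p < (1::real)"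
  shows "\<exists>Z\<ge>0. \<forall>(i::nat) B. finite B \<longrightarrow> (\<forall>j\<in>B. i + 2 \<le> j \<or> j + 2 \<le> i) \<longrightarrow>
    (\<Sum>j\<in>B. (\<bar>real i - real j\<bar> - 1) powr (p - 2)) \<le> Z"
proof -
  \<comment> \<open>The term n = 0 is harmless because \<open>0 powr (p - 2)\<close> is 0.\<close>
  define Z where "Z = (\<Sum>n. real n powr (p - 2))"
  have sm: "summable (\<lambda>n. real n powr (p - 2))" using summable_real_powr_iff[of "p - 2"] p by simp
  have half: "(\<Sum>j\<in>B. (\<bar>real i - real j\<bar> - 1) powr (p - 2)) \<le> Z"
    if fin: "finite B" and f: "inj_on f B" "\<And>j. j \<in> B \<Longrightarrow> real (f j) = \<bar>real i - real j\<bar> - 1" for B i and f :: "nat \<Rightarrow> nat"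
  proof -
    have "(\<Sum>j\<in>B. (\<bar>real i - real j\<bar> - 1) powr (p - 2)) = (\<Sum>j\<in>B. real (f j) powr (p - 2))"
      using f(2) by (intro sum.cong) auto
    also have "\<dots> = (\<Sum>n\<in>f ` B. real n powr (p - 2))" using f(1) by (simp add: sum.reindex)
    also have "\<dots> \<le> Z" unfolding Z_def using fin by (intro sum_le_suminf sm) auto
    finally show ?thesis .
  qed
  have "(\<Sum>j\<in>B. (\<bar>real i - real j\<bar> - 1) powr (p - 2)) \<le> 2 * Z"
    if fin: "finite B" and B: "\<forall>j\<in>B. i + 2 \<le> j \<or> j + 2 \<le> i" for i B
  proof -
    have "(\<Sum>j\<in>B. (\<bar>real i - real j\<bar> - 1) powr (p - 2))
      = (\<Sum>j\<in>B \<inter> {j. i + 2 \<le> j}. (\<bar>real i - real j\<bar> - 1) powr (p - 2)) + (\<Sum>j\<in>B - {j. i + 2 \<le> j}. (\<bar>real i - real j\<bar> - 1) powr (p - 2))"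
      using fin by (rule sum.Int_Diff)
    also have "(\<Sum>j\<in>B \<inter> {j. i + 2 \<le> j}. (\<bar>real i - real j\<bar> - 1) powr (p - 2)) \<le> Z"
      using fin by (intro half[where f = "\<lambda>j. j - i - 1"]) (auto simp: inj_on_def of_nat_diff)
    also have "(\<Sum>j\<in>B - {j. i + 2 \<le> j}. (\<bar>real i - real j\<bar> - 1) powr (p - 2)) \<le> Z"
    proof (rule half[where f = "\<lambda>j. i - j - 1"])
      have *: "j + 2 \<le> i" if "j \<in> B - {j. i + 2 \<le> j}" for j using that B by auto
      show "inj_on (\<lambda>j. i - j - 1) (B - {j. i + 2 \<le> j})" using * by (force simp: inj_on_def)
      show "real (i - j - 1) = \<bar>real i - real j\<bar> - 1" if "j \<in> B - {j. i + 2 \<le> j}" for j using *[OF that] by simp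
    qed (use fin in simp)
    finally show ?thesis by simp
  qed
  moreover have "Z \<ge> 0" unfolding Z_def by (intro suminf_nonneg sm) auto
  ultimately show ?thesis by (intro exI[of _ "2 * Z"]) auto
qed

text \<open>The off-diagonal estimate holds only for nearby cells. The grid is therefore cut into m
  blocks of length \<eta>, with m independent of n. The Schur test is applied in each block, and the
  blocks are recombined by Cauchy-Schwarz at the price of a factor m, so no estimate between distant
  cells is required.\<close>

lemma increments_operator_bound:
  assumes R: "ns_regular L A m0 a b \<Phi> \<Psi>" and p: "0 < p" "p < 1"
    and \<delta>: "0 < \<delta>" "\<delta> \<le> 1" and C0: "0 \<le> C0"
    and \<kappa>: "\<And>t. 0 < t \<Longrightarrow> t < \<delta> \<Longrightarrow> (\<kappa> has_real_derivative k1 t) (at t) \<and> (k1 has_real_derivative k2 t) (at t)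
       \<and> \<bar>\<kappa> t\<bar> \<le> C0 \<and> \<bar>k1 t\<bar> \<le> C0 * t powr (p - 1) \<and> \<bar>k2 t\<bar> \<le> C0 * t powr (p - 2) \<and> \<bar>\<kappa> t - \<kappa> 0\<bar> \<le> C0 * t powr p"
    and H: "gaussian_space M H" and VH: "\<And>s. V s \<in> H"
    and C: "\<And>s t. (LINT x|M. V s x * V t x) = ns_kernel a b \<Phi> \<Psi> \<kappa> s t"
  shows "\<exists>D\<ge>0. \<exists>N>0. \<forall>n\<ge>N. \<forall>v. (LINT x|M. (\<Sum>j=1..n. v j * inc V (L / real n) j x)\<^sup>2)
    \<le> D * (L / real n) powr p * (\<Sum>j=1..n. (v j)\<^sup>2)"
proof -
  have lip: "lipschitz_bounded L A a" "lipschitz_bounded L A b" "lipschitz_bounded L A \<Phi>" "lipschitz_bounded L A \<Psi>"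
    and m0: "0 < m0" "\<And>s. s \<in> {0..L} \<Longrightarrow> m0 \<le> \<Phi> s" "\<And>s. s \<in> {0..L} \<Longrightarrow> m0 \<le> \<Psi> s" and L: "0 < L"
    using R unfolding ns_regular_def by blast+
  have p2: "p \<le> 2" using p by simp
  have k3: "\<bar>\<kappa> t - \<kappa> 0\<bar> \<le> C0 * t powr p" if "0 < t" "t < \<delta>" for t using \<kappa>[OF that] by blast
  have k4: "(\<kappa> has_real_derivative k1 t) (at t) \<and> (k1 has_real_derivative k2 t) (at t)
       \<and> \<bar>\<kappa> t\<bar> \<le> C0 \<and> \<bar>k1 t\<bar> \<le> C0 * t powr (p - 1) \<and> \<bar>k2 t\<bar> \<le> C0 * t powr (p - 2)"
    if "0 < t" "t < \<delta>" for t using \<kappa>[OF that] by blast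
  obtain D1 \<eta>1 where D1: "D1 \<ge> 0" "\<eta>1 > 0"
    and diag: "\<And>s h. 0 < h \<and> h < \<eta>1 \<and> 0 \<le> s \<and> s + h \<le> L \<Longrightarrow> \<bar>mixed_diff (ns_kernel a b \<Phi> \<Psi> \<kappa>) s s h\<bar> \<le> D1 * h powr p"
    using mixed_diff_diagonal_bound[OF R p(1) p2 C0 \<delta>(1) k3] by blast
  obtain D2 \<eta>2 where D2: "D2 \<ge> 0" "\<eta>2 > 0"
    and off: "\<And>s t h. 0 < h \<and> 0 \<le> t \<and> t + 2 * h \<le> s \<and> s + h \<le> L \<and> s + h - t < \<eta>2 \<Longrightarrow>
       \<bar>mixed_diff (ns_kernel a b \<Phi> \<Psi> \<kappa>) s t h\<bar> \<le> D2 * h\<^sup>2 * (s - t - h) powr (p - 2)"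
    using mixed_diff_off_diagonal[OF \<delta> C0 p k4 lip m0 L] by blast
  obtain Z where Z: "Z \<ge> 0" and Zb: "\<And>(i::nat) B. finite B \<Longrightarrow> (\<forall>j\<in>B. i + 2 \<le> j \<or> j + 2 \<le> i) \<Longrightarrow>
      (\<Sum>j\<in>B. (\<bar>real i - real j\<bar> - 1) powr (p - 2)) \<le> Z"
    using sum_distance_powr[OF p(2)] by blast
  \<comment> \<open>Half of \<eta>2: left endpoints in one block differ by less than \<eta>, and the
    cell length h < \<eta> uses the other half.\<close>
  define \<eta> where "\<eta> = \<eta>2 / 2"
  have \<eta>: "\<eta> > 0" using D2 by (simp add: \<eta>_def)
  define m where "m = nat \<lfloor>L / \<eta>\<rfloor> + 1"
  define D where "D = real m * (3 * D1 + D2 * Z)"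
  have D: "D \<ge> 0" using D1 D2 Z by (simp add: D_def)
  define N where "N = nat \<lfloor>L / min \<eta>1 \<eta>\<rfloor> + 1"
  have main: "(LINT x|M. (\<Sum>j=1..n. v j * inc V (L / real n) j x)\<^sup>2) \<le> D * (L / real n) powr p * (\<Sum>j=1..n. (v j)\<^sup>2)"
    if n: "N \<le> n" for n v
  proof -
    define h where "h = L / real n"
    have n0: "n > 0" using n by (simp add: N_def)
    have h: "0 < h" using L n0 by (simp add: h_def)
    have nh: "real n * h = L" using n0 by (simp add: h_def)
    have mn: "min \<eta>1 \<eta> > 0" using D1 \<eta> by simp
    have "L / min \<eta>1 \<eta> < real N"
      using L mn unfolding N_def by (simp add: floor_less_iff[symmetric] less_le) linarith
    also have "\<dots> \<le> real n" using n by simp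
    finally have "L < real n * min \<eta>1 \<eta>" using mn by (simp only: pos_divide_less_eq)
    moreover have "0 < real n" using n0 by simp
    ultimately have hs: "h < min \<eta>1 \<eta>" unfolding h_def by (simp only: pos_divide_less_eq mult.commute)
    define G where "G i j = (LINT x|M. inc V h i x * inc V h j x)" for i j
    have incH: "inc V h j \<in> H" for j
      unfolding inc_def[abs_def] by (intro gaussian_space_diff[OF H] VH)
    have Gm: "G i j = mixed_diff (ns_kernel a b \<Phi> \<Psi> \<kappa>) ((real i - 1) * h) ((real j - 1) * h) h" for i j
      unfolding G_def by (rule expectation_inc[OF H VH VH C])
    have Gsym: "G i j = G j i" for i j unfolding G_def by (simp add: mult.commute)
    have end_: "(real j - 1) * h + h \<le> L" "0 \<le> (real j - 1) * h" if "j \<in> {1..n}" for j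
    proof -
      have "(real j - 1) * h + h = real j * h" by (simp add: algebra_simps)
      also have "\<dots> \<le> real n * h" using that h by (intro mult_right_mono) auto
      finally show "(real j - 1) * h + h \<le> L" using nh by simp
      show "0 \<le> (real j - 1) * h" using that h by simp
    qed
    have Gd: "\<bar>G i i\<bar> \<le> D1 * h powr p" if "i \<in> {1..n}" for i
      unfolding Gm using that end_ h hs by (intro diag) auto
    \<comment> \<open>Neighbouring cells are too close for the smooth estimate; 2|xy| \<le> x^2 +
      y^2 reduces them to the diagonal.\<close>
    have Gnear: "\<bar>G i j\<bar> \<le> D1 * h powr p" if "i \<in> {1..n}" "j \<in> {1..n}" for i j
    proof -
      have "\<bar>G i j\<bar> \<le> (LINT x|M. \<bar>inc V h i x * inc V h j x\<bar>)" unfolding G_def by (rule integral_abs_bound)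
      also have "\<dots> \<le> (LINT x|M. (inc V h i x * inc V h i x + inc V h j x * inc V h j x) / 2)"
      proof (intro integral_mono integrable_abs integrable_divide Bochner_Integration.integrable_add gaussian_space_integrable_mult[OF H] incH)
        fix x
        show "\<bar>inc V h i x * inc V h j x\<bar> \<le> (inc V h i x * inc V h i x + inc V h j x * inc V h j x) / 2"
          using sum_squares_bound[of "\<bar>inc V h i x\<bar>" "\<bar>inc V h j x\<bar>"] by (simp add: abs_mult power2_eq_square)
      qed
      also have "\<dots> = (G i i + G j j) / 2"
        by (simp add: G_def gaussian_space_integrable_mult[OF H incH incH])
      finally show ?thesis using abs_le_D1[OF Gd[OF that(1)]] abs_le_D1[OF Gd[OF that(2)]] by simp
    qed
    define bl where "bl j = nat \<lfloor>(real j - 1) * h / \<eta>\<rfloor>" for j :: nat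
    have bl_m: "bl j < m" if "j \<in> {1..n}" for j
    proof -
      have "(real j - 1) * h / \<eta> \<le> L / \<eta>" using end_[OF that] h \<eta> by (intro divide_right_mono) auto
      then have "nat \<lfloor>(real j - 1) * h / \<eta>\<rfloor> \<le> nat \<lfloor>L / \<eta>\<rfloor>" by (intro nat_mono floor_mono)
      then show ?thesis unfolding bl_def m_def by simp
    qed
    have close: "\<bar>(real i - 1) * h - (real j - 1) * h\<bar> < \<eta>" if "i \<in> {1..n}" "j \<in> {1..n}" "bl i = bl j" for i j
    proof -
      have "0 \<le> (real i - 1) * h / \<eta>" "0 \<le> (real j - 1) * h / \<eta>" using end_[OF that(1)] end_[OF that(2)] \<eta> by auto
      then have "\<lfloor>(real i - 1) * h / \<eta>\<rfloor> = \<lfloor>(real j - 1) * h / \<eta>\<rfloor>" using that(3) unfolding bl_def by (simp add: eq_nat_nat_iff)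
      then have "\<bar>(real i - 1) * h / \<eta> - (real j - 1) * h / \<eta>\<bar> < 1" by linarith
      then show ?thesis using \<eta> by (simp add: diff_divide_distrib[symmetric] pos_divide_less_eq)
    qed
    have Gfar1: "\<bar>G i j\<bar> \<le> D2 * h powr p * (\<bar>real i - real j\<bar> - 1) powr (p - 2)"
      if ij: "i \<in> {1..n}" "j \<in> {1..n}" "bl i = bl j" "j + 2 \<le> i" for i j
    proof -
      have "(real j + 2) * h \<le> real i * h" using ij(4) h by (intro mult_right_mono) auto
      then have "\<bar>G i j\<bar> \<le> D2 * h\<^sup>2 * ((real i - 1) * h - (real j - 1) * h - h) powr (p - 2)"
        unfolding Gm
      proof (intro off conjI)
        show "(real j - 1) * h + 2 * h \<le> (real i - 1) * h"
          using \<open>(real j + 2) * h \<le> real i * h\<close> by (simp add: algebra_simps)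
        have "\<eta>2 = \<eta> + \<eta>" by (simp add: \<eta>_def)
        moreover have "(real i - 1) * h - (real j - 1) * h < \<eta>" using close[OF ij(1-3)] by (rule abs_less_iff[THEN iffD1, THEN conjunct1])
        ultimately show "(real i - 1) * h + h - (real j - 1) * h < \<eta>2" using hs by simp
      qed (use end_[OF ij(1)] end_[OF ij(2)] h in auto)
      also have "(real i - 1) * h - (real j - 1) * h - h = h * (\<bar>real i - real j\<bar> - 1)"
        using ij(4) by (simp add: algebra_simps)
      also have "(h * (\<bar>real i - real j\<bar> - 1)) powr (p - 2) = h powr (p - 2) * (\<bar>real i - real j\<bar> - 1) powr (p - 2)"
        using h ij(4) by (simp add: powr_mult)
      \<comment> \<open>In units of h the decay is that of |i - j| - 1, and h^2 h^(p-2) = h^p is the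
        same power as on the diagonal.\<close>
      also have "D2 * h\<^sup>2 * (h powr (p - 2) * (\<bar>real i - real j\<bar> - 1) powr (p - 2))
        = D2 * (h powr 2 * h powr (p - 2)) * (\<bar>real i - real j\<bar> - 1) powr (p - 2)" using h by (simp add: powr_realpow)
      also have "h powr 2 * h powr (p - 2) = h powr p" by (simp flip: powr_add)
      finally show ?thesis .
    qed
    have Gfar: "\<bar>G i j\<bar> \<le> D2 * h powr p * (\<bar>real i - real j\<bar> - 1) powr (p - 2)"
      if "i \<in> {1..n}" "j \<in> {1..n}" "bl i = bl j" "j + 2 \<le> i \<or> i + 2 \<le> j" for i j
      using that Gfar1[of i j] Gfar1[of j i] Gsym[of i j] by (auto simp: abs_minus_commute)
    \<comment> \<open>At most three indices are within distance 1 of i; all others are covered by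
      the series bound Z.\<close>
    define \<rho> where "\<rho> = (3 * D1 + D2 * Z) * h powr p"
    define B where "B k = {j \<in> {1..n}. bl j = k}" for k
    have row: "(\<Sum>j\<in>B k. \<bar>G i j\<bar>) \<le> \<rho>" if i: "i \<in> B k" for i k
    proof -
      define F where "F = {j. j + 2 \<le> i \<or> i + 2 \<le> j}"
      have fin: "finite (B k)" by (simp add: B_def)
      have "(\<Sum>j\<in>B k. \<bar>G i j\<bar>) = (\<Sum>j\<in>B k \<inter> F. \<bar>G i j\<bar>) + (\<Sum>j\<in>B k - F. \<bar>G i j\<bar>)"
        using fin by (rule sum.Int_Diff)
      also have "(\<Sum>j\<in>B k \<inter> F. \<bar>G i j\<bar>) \<le> (\<Sum>j\<in>B k \<inter> F. D2 * h powr p * (\<bar>real i - real j\<bar> - 1) powr (p - 2))"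
        using i by (intro sum_mono Gfar) (auto simp: B_def F_def)
      also have "\<dots> = D2 * h powr p * (\<Sum>j\<in>B k \<inter> F. (\<bar>real i - real j\<bar> - 1) powr (p - 2))" by (simp add: sum_distrib_left)
      also have "\<dots> \<le> D2 * h powr p * Z" using fin D2 by (intro mult_left_mono Zb) (auto simp: F_def)
      also have "(\<Sum>j\<in>B k - F. \<bar>G i j\<bar>) \<le> real (card (B k - F)) * (D1 * h powr p)"
        using i by (intro sum_bounded_above Gnear) (auto simp: B_def)
      also have "\<dots> \<le> 3 * (D1 * h powr p)"
      proof -
        have "B k - F \<subseteq> {i - 1..i + 1}" by (auto simp: F_def)
        then have "card (B k - F) \<le> card {i - 1..i + 1}" by (intro card_mono) auto
        also have "\<dots> \<le> 3" by simp
        finally show ?thesis using D1 by (intro mult_right_mono) auto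
      qed
      finally show ?thesis by (simp add: \<rho>_def algebra_simps)
    qed
    have block: "(LINT x|M. (\<Sum>j\<in>B k. v j * inc V h j x)\<^sup>2) \<le> \<rho> * (\<Sum>j\<in>B k. (v j)\<^sup>2)" for k
    proof -
      have "(LINT x|M. (\<Sum>j\<in>B k. v j * inc V h j x)\<^sup>2) = (\<Sum>i\<in>B k. \<Sum>j\<in>B k. v i * v j * G i j)"
        unfolding G_def by (rule gaussian_space_quadratic_form[OF H]) (rule incH)
      also have "\<dots> \<le> \<rho> * (\<Sum>j\<in>B k. (v j)\<^sup>2)" by (rule quadratic_form_row_sums[OF Gsym row])
      finally show ?thesis .
    qed
    have grp: "(\<Sum>j=1..n. f j) = (\<Sum>k<m. \<Sum>j\<in>B k. f j)" for f :: "nat \<Rightarrow> real"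
      unfolding B_def using bl_m by (intro sum.group[symmetric]) auto
    have Bint: "integrable M (\<lambda>x. (\<Sum>j\<in>B k. v j * inc V h j x)\<^sup>2)" for k
      by (intro gaussian_spaceD(5)[OF H] gaussian_space_sum[OF H] incH)
    \<comment> \<open>The square of a sum of m block sums is at most m times the sum of their
      squares.\<close>
    have "(LINT x|M. (\<Sum>j=1..n. v j * inc V h j x)\<^sup>2) \<le> (LINT x|M. (\<Sum>k<m. (\<Sum>j\<in>B k. v j * inc V h j x)\<^sup>2) * real (card {..<m}))"
    proof (rule integral_mono)
      show "integrable M (\<lambda>x. (\<Sum>j=1..n. v j * inc V h j x)\<^sup>2)"
        by (intro gaussian_spaceD(5)[OF H] gaussian_space_sum[OF H] incH)
      show "integrable M (\<lambda>x. (\<Sum>k<m. (\<Sum>j\<in>B k. v j * inc V h j x)\<^sup>2) * real (card {..<m}))"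
        by (intro integrable_mult_left Bochner_Integration.integrable_sum Bint)
      show "(\<Sum>j=1..n. v j * inc V h j x)\<^sup>2 \<le> (\<Sum>k<m. (\<Sum>j\<in>B k. v j * inc V h j x)\<^sup>2) * real (card {..<m})" for x
        unfolding grp by (rule sum_squared_le_sum_of_squares)
    qed
    also have "\<dots> = (\<Sum>k<m. (LINT x|M. (\<Sum>j\<in>B k. v j * inc V h j x)\<^sup>2)) * real m"
      by (simp add: Bint Bochner_Integration.integral_sum)
    also have "\<dots> \<le> (\<Sum>k<m. \<rho> * (\<Sum>j\<in>B k. (v j)\<^sup>2)) * real m" by (intro mult_right_mono sum_mono block) auto
    also have "\<dots> = D * h powr p * (\<Sum>j=1..n. (v j)\<^sup>2)"
      unfolding grp D_def \<rho>_def by (simp add: sum_distrib_left[symmetric] mult_ac)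
    finally show ?thesis by (simp add: h_def)
  qed
  have "N > 0" by (simp add: N_def)
  with D main show ?thesis by blast
qed

section \<open>Tail bound for the least squares ratio, and consistency\<close>

text \<open>Chebyshev for denominator P and numerator Q separately, both with variance at most 2
  \<rho> S. The deviations S/2 and \<epsilon> S/4 yield 8 \<rho> / S and 32 \<rho> / (\<epsilon>^2
  S).\<close>

lemma sum_products_ratio_tail:
  fixes U V :: "nat \<Rightarrow> 'a \<Rightarrow> real"
  assumes H: "gaussian_space M H" and UV: "\<And>j. U j \<in> H" "\<And>j. V j \<in> H" and I: "finite I"
    and opU: "\<And>v. (LINT x|M. (\<Sum>j\<in>I. v j * U j x)\<^sup>2) \<le> \<rho> * (\<Sum>j\<in>I. (v j)\<^sup>2)"
    and opV: "\<And>v. (LINT x|M. (\<Sum>j\<in>I. v j * V j x)\<^sup>2) \<le> \<rho> * (\<Sum>j\<in>I. (v j)\<^sup>2)"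
    and S: "(\<Sum>j\<in>I. LINT x|M. U j x * U j x) = S" "0 < S"
    and T: "\<bar>\<Sum>j\<in>I. LINT x|M. U j x * V j x\<bar> \<le> \<epsilon> * S / 4" and \<epsilon>: "0 < \<epsilon>"
  shows "measure M {x \<in> space M. \<epsilon> < \<bar>(\<Sum>j\<in>I. U j x * (U j x * \<beta> + V j x)) / (\<Sum>j\<in>I. (U j x)\<^sup>2) - \<beta>\<bar>}
    \<le> (8 + 32 / \<epsilon>\<^sup>2) * (\<rho> / S)"
proof -
  interpret prob_space M using H by (rule gaussian_spaceD)
  define T where "T = (\<Sum>j\<in>I. LINT x|M. U j x * V j x)"
  define P where "P x = (\<Sum>j\<in>I. U j x * U j x)" for x
  define Q where "Q x = (\<Sum>j\<in>I. U j x * V j x)" for x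
  have [measurable]: "U j \<in> borel_measurable M" "V j \<in> borel_measurable M" for j
    using gaussian_spaceD(2)[OF H] UV by auto
  note vP = gaussian_product_sum_variance[where U = U and V = U, OF H I UV(1) UV(1) opU, unfolded S(1)]
  note vQ = gaussian_product_sum_variance[where U = U and V = V, OF H I UV(1) UV(2) opV]
  have S': "(\<Sum>i\<in>I. LINT x|M. (U i x)\<^sup>2) = S" using S(1) by (simp add: power2_eq_square)
  define E1 where "E1 = {x \<in> space M. S\<^sup>2 / 4 \<le> (P x - S)\<^sup>2}"
  define E2 where "E2 = {x \<in> space M. (\<epsilon> * S / 4)\<^sup>2 \<le> (Q x - T)\<^sup>2}"
  have [measurable]: "P \<in> borel_measurable M" "Q \<in> borel_measurable M" unfolding P_def[abs_def] Q_def[abs_def] by measurable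
  have "measure M E1 \<le> (LINT x|M. (P x - S)\<^sup>2) / (S\<^sup>2 / 4)"
    unfolding E1_def using vP(1) S(2) by (intro integral_Markov_inequality_measure[where A = "{}"]) (auto simp: P_def)
  also have "\<dots> \<le> (2 * \<rho> * S) / (S\<^sup>2 / 4)"
    using vP(2) S(2) unfolding S' P_def by (intro divide_right_mono) auto
  also have "\<dots> = 8 * (\<rho> / S)" using S(2) by (simp add: power2_eq_square field_simps)
  finally have m1: "measure M E1 \<le> 8 * (\<rho> / S)" .
  have "measure M E2 \<le> (LINT x|M. (Q x - T)\<^sup>2) / ((\<epsilon> * S / 4)\<^sup>2)"
    unfolding E2_def using vQ(1) S(2) \<epsilon> by (intro integral_Markov_inequality_measure[where A = "{}"]) (auto simp: Q_def T_def)
  also have "\<dots> \<le> (2 * \<rho> * S) / ((\<epsilon> * S / 4)\<^sup>2)"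
    using vQ(2) S(2) unfolding S' Q_def T_def by (intro divide_right_mono) auto
  also have "\<dots> = 32 / \<epsilon>\<^sup>2 * (\<rho> / S)" using S(2) \<epsilon> by (simp add: power2_eq_square field_simps)
  finally have m2: "measure M E2 \<le> 32 / \<epsilon>\<^sup>2 * (\<rho> / S)" .
  \<comment> \<open>Outside both events P > S/2 and |Q| < \<epsilon> S/4 + \<epsilon> S/4, so |Q /
    P| < \<epsilon>. A vanishing denominator belongs to the first event.\<close>
  have sub: "{x \<in> space M. \<epsilon> < \<bar>(\<Sum>j\<in>I. U j x * (U j x * \<beta> + V j x)) / (\<Sum>j\<in>I. (U j x)\<^sup>2) - \<beta>\<bar>} \<subseteq> E1 \<union> E2"
  proof
    fix x assume x: "x \<in> {x \<in> space M. \<epsilon> < \<bar>(\<Sum>j\<in>I. U j x * (U j x * \<beta> + V j x)) / (\<Sum>j\<in>I. (U j x)\<^sup>2) - \<beta>\<bar>}"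
    show "x \<in> E1 \<union> E2"
    proof (rule ccontr)
      assume "x \<notin> E1 \<union> E2"
      then have "(P x - S)\<^sup>2 < (S / 2)\<^sup>2" "(Q x - T)\<^sup>2 < (\<epsilon> * S / 4)\<^sup>2" using x by (auto simp: E1_def E2_def power_divide)
      then have b: "\<bar>P x - S\<bar> < S / 2" "\<bar>Q x - T\<bar> < \<epsilon> * S / 4"
        using S(2) \<epsilon> by (auto dest!: power2_less_imp_less[of "\<bar>_\<bar>", simplified] simp: abs_le_square_iff[symmetric] not_le[symmetric])
      have Px: "P x > S / 2" using b by linarith
      then have P0: "P x > 0" using S(2) by linarith
      have "\<bar>Q x\<bar> < \<epsilon> * S / 2" using b T unfolding T_def[symmetric] by linarith
      also have "\<dots> \<le> \<epsilon> * P x" using Px \<epsilon> by simp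
      finally have Qx: "\<bar>Q x\<bar> < \<epsilon> * P x" .
      have "(\<Sum>j\<in>I. U j x * (U j x * \<beta> + V j x)) = \<beta> * P x + Q x"
        by (simp add: P_def Q_def sum_distrib_left sum.distrib[symmetric] algebra_simps)
      moreover have "(\<Sum>j\<in>I. (U j x)\<^sup>2) = P x" by (simp add: P_def power2_eq_square)
      ultimately have "(\<Sum>j\<in>I. U j x * (U j x * \<beta> + V j x)) / (\<Sum>j\<in>I. (U j x)\<^sup>2) - \<beta> = Q x / P x"
        using P0 by (simp add: field_simps)
      moreover have "\<bar>Q x / P x\<bar> < \<epsilon>" using Qx P0 by (simp add: abs_divide pos_divide_less_eq)
      ultimately show False using x by simp
    qed
  qed
  have "E1 \<in> sets M" "E2 \<in> sets M" unfolding E1_def E2_def by measurable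
  then have "measure M {x \<in> space M. \<epsilon> < \<bar>(\<Sum>j\<in>I. U j x * (U j x * \<beta> + V j x)) / (\<Sum>j\<in>I. (U j x)\<^sup>2) - \<beta>\<bar>} \<le> measure M (E1 \<union> E2)"
    using sub by (intro finite_measure_mono) auto
  also have "\<dots> \<le> measure M E1 + measure M E2" using \<open>E1 \<in> sets M\<close> \<open>E2 \<in> sets M\<close> by (rule measure_Un_le)
  finally show ?thesis using m1 m2 unfolding distrib_right by linarith
qed

lemma positive_piecewise_analytic_bounds:
  assumes "0 < L" "continuous_on {0..L} f" "piecewise_analytic L f" "\<And>s. 0 < f s"
  shows "\<exists>A m0. 0 < m0 \<and> lipschitz_bounded L A f \<and> (\<forall>s\<in>{0..L}. m0 \<le> f s)"
proof -
  obtain C where C: "\<forall>s\<in>{0..L}. \<forall>t\<in>{0..L}. \<bar>f s - f t\<bar> \<le> C * \<bar>s - t\<bar>"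
    using piecewise_analytic_lipschitz[OF assms(3)] by blast
  obtain x where x: "x \<in> {0..L}" "\<forall>s\<in>{0..L}. f x \<le> f s"
    using continuous_attains_inf[of "{0..L}" f] assms by auto
  obtain y where y: "y \<in> {0..L}" "\<forall>s\<in>{0..L}. f s \<le> f y"
    using continuous_attains_sup[of "{0..L}" f] assms by auto
  have "lipschitz_bounded L (max C (f y)) f" unfolding lipschitz_bounded_def
  proof (intro conjI ballI)
    fix s assume s: "s \<in> {0..L}"
    have "f s \<le> f y" using y s by blast
    then show "\<bar>f s\<bar> \<le> max C (f y)" using assms(4)[of s] by simp
    fix t assume t: "t \<in> {0..L}"
    have "\<bar>f s - f t\<bar> \<le> C * \<bar>s - t\<bar>" using C s t by blast
    also have "\<dots> \<le> max C (f y) * \<bar>s - t\<bar>" by (intro mult_right_mono) auto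
    finally show "\<bar>f s - f t\<bar> \<le> max C (f y) * \<bar>s - t\<bar>" .
  qed
  then show ?thesis using x assms(4)[of x] by blast
qed

text \<open>Continuity on a compact interval turns positivity into uniform positivity; maxima and
  minima of the separate constants then give common ones.\<close>

lemma ns_regular_exists:
  assumes L: "0 < L"
    and f: "\<And>f. f \<in> {\<sigma>, \<sigma>', \<Phi>, \<Psi>} \<Longrightarrow> continuous_on {0..L} f \<and> piecewise_analytic L f \<and> (\<forall>s. 0 < f s)"
  shows "\<exists>A m0 a0. ns_regular L A m0 (\<lambda>s. \<sigma> s * \<Phi> s powr (1/4)) (\<lambda>s. \<sigma>' s * \<Psi> s powr (1/4)) \<Phi> \<Psi> \<and> 0 < a0
    \<and> (\<forall>s\<in>{0..L}. a0 \<le> \<sigma> s * \<Phi> s powr (1/4) \<and> a0 \<le> \<sigma>' s * \<Psi> s powr (1/4))"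
proof -
  obtain A1 m1 where 1: "0 < m1" "lipschitz_bounded L A1 \<sigma>" "\<forall>s\<in>{0..L}. m1 \<le> \<sigma> s"
    using positive_piecewise_analytic_bounds[OF L, of \<sigma>] f by blast
  obtain A2 m2 where 2: "0 < m2" "lipschitz_bounded L A2 \<sigma>'" "\<forall>s\<in>{0..L}. m2 \<le> \<sigma>' s"
    using positive_piecewise_analytic_bounds[OF L, of \<sigma>'] f by blast
  obtain A3 m3 where 3: "0 < m3" "lipschitz_bounded L A3 \<Phi>" "\<forall>s\<in>{0..L}. m3 \<le> \<Phi> s"
    using positive_piecewise_analytic_bounds[OF L, of \<Phi>] f by blast
  obtain A4 m4 where 4: "0 < m4" "lipschitz_bounded L A4 \<Psi>" "\<forall>s\<in>{0..L}. m4 \<le> \<Psi> s"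
    using positive_piecewise_analytic_bounds[OF L, of \<Psi>] f by blast
  obtain B3 where B3: "lipschitz_bounded L B3 (\<lambda>s. \<Phi> s powr (1/4))"
    using lipschitz_bounded_powr[OF 3(2) _ 3(1), of "1/4"] 3(3) L by auto
  obtain B4 where B4: "lipschitz_bounded L B4 (\<lambda>s. \<Psi> s powr (1/4))"
    using lipschitz_bounded_powr[OF 4(2) _ 4(1), of "1/4"] 4(3) L by auto
  obtain E1 where E1: "lipschitz_bounded L E1 (\<lambda>s. \<sigma> s * \<Phi> s powr (1/4))"
    using lipschitz_bounded_mult[OF 1(2) B3] L by auto
  obtain E2 where E2: "lipschitz_bounded L E2 (\<lambda>s. \<sigma>' s * \<Psi> s powr (1/4))"
    using lipschitz_bounded_mult[OF 2(2) B4] L by auto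
  have "ns_regular L (Max {E1, E2, A3, A4}) (min m3 m4) (\<lambda>s. \<sigma> s * \<Phi> s powr (1/4)) (\<lambda>s. \<sigma>' s * \<Psi> s powr (1/4)) \<Phi> \<Psi>"
    unfolding ns_regular_def using L 3(1,3) 4(1,3)
    by (intro conjI lipschitz_bounded_mono[OF E1] lipschitz_bounded_mono[OF E2] lipschitz_bounded_mono[OF 3(2)] lipschitz_bounded_mono[OF 4(2)])
       (auto simp: min_le_iff_disj)
  moreover have "min (m1 * m3 powr (1/4)) (m2 * m4 powr (1/4)) > 0" using 1 2 3 4 by simp
  moreover have "\<forall>s\<in>{0..L}. min (m1 * m3 powr (1/4)) (m2 * m4 powr (1/4)) \<le> \<sigma> s * \<Phi> s powr (1/4)
      \<and> min (m1 * m3 powr (1/4)) (m2 * m4 powr (1/4)) \<le> \<sigma>' s * \<Psi> s powr (1/4)"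
  proof
    fix s assume s: "s \<in> {0..L}"
    have ge: "m1 \<le> \<sigma> s" "m2 \<le> \<sigma>' s" "m3 \<le> \<Phi> s" "m4 \<le> \<Psi> s" using s 1(3) 2(3) 3(3) 4(3) by blast+
    have "m1 * m3 powr (1/4) \<le> \<sigma> s * \<Phi> s powr (1/4)" "m2 * m4 powr (1/4) \<le> \<sigma>' s * \<Psi> s powr (1/4)"
      by (rule mult_mono; use ge 1(1) 2(1) 3(1) 4(1) in \<open>simp add: powr_mono2\<close>)+
    then show "min (m1 * m3 powr (1/4)) (m2 * m4 powr (1/4)) \<le> \<sigma> s * \<Phi> s powr (1/4)
      \<and> min (m1 * m3 powr (1/4)) (m2 * m4 powr (1/4)) \<le> \<sigma>' s * \<Psi> s powr (1/4)" by linarith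
  qed
  ultimately show ?thesis by blast
qed

lemma eventually_mesh_small:
  assumes "0 < (\<eta>::real)" shows "\<forall>\<^sub>F n in sequentially. L / real n < \<eta>"
proof -
  have "(\<lambda>n. L / real n) \<longlonglongrightarrow> 0" by (rule tendsto_divide_0[OF tendsto_const]) (simp add: filterlim_real_sequentially filterlim_at_top_imp_at_infinity)
  then show ?thesis using assms by (rule order_tendstoD)
qed

lemma mesh_powr_tendsto_zero:
  assumes "0 < (\<beta>::real)" "0 < L" shows "(\<lambda>n. (L / real n) powr \<beta>) \<longlonglongrightarrow> 0"
proof -
  have "(\<lambda>n. L / real n) \<longlonglongrightarrow> 0" by (rule tendsto_divide_0[OF tendsto_const]) (simp add: filterlim_real_sequentially filterlim_at_top_imp_at_infinity)
  then have "(\<lambda>n. (L / real n) powr \<beta>) \<longlonglongrightarrow> 0 powr \<beta>"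
    by (rule tendsto_powr') (use assms in auto)
  then show ?thesis by simp
qed

text \<open>The tail bound is applied with \<rho> of order h^p from the operator bounds and with S
  n, the summed lower bounds of the variances of the X-increments. The mean of the numerator is o(S
  n) by the faster decay of the cross-covariance.\<close>

theorem ols_diff_consistent:
  assumes L: "0 < L"
    and A: "\<And>k l. k \<in> {1,2} \<Longrightarrow> l \<in> {1,2} \<Longrightarrow> cond_A L (c k l) (\<alpha> k l) (K k l)"
    and c: "c 1 1 \<noteq> 0"
    and \<sigma>: "\<And>k s. k \<in> {1,2} \<Longrightarrow> 0 < \<sigma> k s" and \<Phi>: "\<And>k l s. k \<in> {1,2} \<Longrightarrow> l \<in> {1,2} \<Longrightarrow> 0 < \<Phi> k l s"
    and field: "bivariate_gaussian_field M Z (K_NS \<sigma> \<Phi> K)"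
    and \<alpha>: "\<alpha> 1 1 < \<alpha> 1 2" "\<alpha> 1 1 < \<alpha> 2 2 + 1" "\<alpha> 1 1 < 2"
    and \<sigma>_reg: "\<And>k. k \<in> {1,2} \<Longrightarrow> continuous_on {0..L} (\<sigma> k) \<and> piecewise_analytic L (\<sigma> k)"
    and \<Phi>_reg: "\<And>k l. k \<in> {1,2} \<Longrightarrow> l \<in> {1,2} \<Longrightarrow> continuous_on {0..L} (\<Phi> k l) \<and> piecewise_analytic L (\<Phi> k l)"
  shows "converges_in_probability M (ols_diff L (Z 1) (response \<beta> Z)) \<beta>"
proof -
  interpret prob_space M using field by (simp add: bivariate_gaussian_field_def)
  have \<alpha>0: "0 < \<alpha> 1 1" "0 < \<alpha> 2 2" using A[of 1 1] A[of 2 2] by (auto simp: cond_A_def)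
  \<comment> \<open>The interval for p is nonempty by the assumptions that \<alpha> 1 1 is below 2
    and below \<alpha> 2 2 + 1. Its lower end makes the final exponent p + 1 - \<alpha> 1 1
    positive.\<close>
  obtain p where p: "max 0 (\<alpha> 1 1 - 1) < p" "p < Min {1, \<alpha> 1 1, \<alpha> 2 2}"
    using dense[of "max 0 (\<alpha> 1 1 - 1)" "Min {1, \<alpha> 1 1, \<alpha> 2 2}"] \<alpha> \<alpha>0 by auto
  then have p: "0 < p" "\<alpha> 1 1 - 1 < p" "p < 1" "p < \<alpha> 1 1" "p < \<alpha> 2 2" by auto
  define H where "H = {\<lambda>x. \<Sum>k\<in>{1,2::nat}. \<Sum>s\<in>S. a k s * Z k s x | S a. finite S}"
  have H: "gaussian_space M H" unfolding H_def by (rule bivariate_gaussian_field_space[OF field])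
  have ZH: "Z k s \<in> H" if "k \<in> {1,2}" for k s
    unfolding H_def by (rule CollectI, intro exI[of _ "{s}"] exI[of _ "\<lambda>k' _. if k' = k then 1 else 0"]) (use that in auto)
  have cov: "(LINT x|M. Z k s x * Z l t x) = K_NS \<sigma> \<Phi> K k l s t" if "k \<in> {1,2}" "l \<in> {1,2}" for k l s t
    using field that unfolding bivariate_gaussian_field_def by blast
  define a where "a k l = (\<lambda>s. \<sigma> k s * \<Phi> k l s powr (1/4))" for k l
  have covns: "(LINT x|M. Z k s x * Z l t x) = ns_kernel (a k l) (a l k) (\<Phi> k l) (\<Phi> l k) (K k l) s t"
    if "k \<in> {1,2}" "l \<in> {1,2}" for k l s t
    unfolding cov[OF that] a_def by (subst K_NS_eq_ns_kernel[where k = k and l = l, OF \<Phi>[OF that] \<Phi>[OF that(2,1)]]) (rule refl)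
  have reg: "\<exists>A m0 a0. ns_regular L A m0 (a k l) (a l k) (\<Phi> k l) (\<Phi> l k) \<and> 0 < a0 \<and> (\<forall>s\<in>{0..L}. a0 \<le> a k l s \<and> a0 \<le> a l k s)"
    if "k \<in> {1,2}" "l \<in> {1,2}" for k l
    unfolding a_def
  proof (rule ns_regular_exists[where \<sigma> = "\<sigma> k" and \<sigma>' = "\<sigma> l" and \<Phi> = "\<Phi> k l" and \<Psi> = "\<Phi> l k", OF L])
    have "continuous_on {0..L} (\<sigma> k) \<and> piecewise_analytic L (\<sigma> k) \<and> (\<forall>s. 0 < \<sigma> k s)"
      "continuous_on {0..L} (\<sigma> l) \<and> piecewise_analytic L (\<sigma> l) \<and> (\<forall>s. 0 < \<sigma> l s)"
      "continuous_on {0..L} (\<Phi> k l) \<and> piecewise_analytic L (\<Phi> k l) \<and> (\<forall>s. 0 < \<Phi> k l s)"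
      "continuous_on {0..L} (\<Phi> l k) \<and> piecewise_analytic L (\<Phi> l k) \<and> (\<forall>s. 0 < \<Phi> l k s)"
      using \<sigma>_reg[OF that(1)] \<sigma>_reg[OF that(2)] \<Phi>_reg[OF that] \<Phi>_reg[OF that(2,1)]
        \<sigma>[OF that(1)] \<sigma>[OF that(2)] \<Phi>[OF that] \<Phi>[OF that(2,1)] by blast+
    then show "continuous_on {0..L} f \<and> piecewise_analytic L f \<and> (\<forall>s. 0 < f s)" if "f \<in> {\<sigma> k, \<sigma> l, \<Phi> k l, \<Phi> l k}" for f
      using that by (elim insertE emptyE) simp_all
  qed
  have op: "\<exists>D\<ge>0. \<exists>N>0. \<forall>n\<ge>N. \<forall>v. (LINT x|M. (\<Sum>j=1..n. v j * inc (Z k) (L / real n) j x)\<^sup>2)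
    \<le> D * (L / real n) powr p * (\<Sum>j=1..n. (v j)\<^sup>2)" if k: "k \<in> {1,2}" "p < \<alpha> k k" for k
  proof -
    obtain B m0 where R: "ns_regular L B m0 (a k k) (a k k) (\<Phi> k k) (\<Phi> k k)" using reg[OF k(1) k(1)] by blast
    obtain \<delta> C k1 k2 where \<delta>: "\<delta> > 0" "\<delta> \<le> 1" "C \<ge> 0" and b: "\<forall>t. 0 < t \<and> t < \<delta> \<longrightarrow>
      (K k k has_real_derivative k1 t) (at t) \<and> (k1 has_real_derivative k2 t) (at t)
      \<and> \<bar>K k k t\<bar> \<le> C \<and> \<bar>k1 t\<bar> \<le> C * t powr (p - 1) \<and> \<bar>k2 t\<bar> \<le> C * t powr (p - 2) \<and> \<bar>K k k t - K k k 0\<bar> \<le> C * t powr p"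
      using cond_A_bounds[OF A[OF k(1) k(1)] L p(1,3) k(2)] by blast
    show ?thesis
      by (rule increments_operator_bound[OF R p(1,3) \<delta> b[rule_format, OF conjI] H ZH[OF k(1)] covns[OF k(1) k(1)]])
  qed
  obtain D1 N1 where D1: "D1 \<ge> 0" and op1: "\<And>n v. n \<ge> N1 \<Longrightarrow> (LINT x|M. (\<Sum>j=1..n. v j * inc (Z 1) (L / real n) j x)\<^sup>2)
    \<le> D1 * (L / real n) powr p * (\<Sum>j=1..n. (v j)\<^sup>2)" using op[of 1] p by auto
  obtain D2 N2 where D2: "D2 \<ge> 0" and op2: "\<And>n v. n \<ge> N2 \<Longrightarrow> (LINT x|M. (\<Sum>j=1..n. v j * inc (Z 2) (L / real n) j x)\<^sup>2)
    \<le> D2 * (L / real n) powr p * (\<Sum>j=1..n. (v j)\<^sup>2)" using op[of 2] p by auto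
  define D where "D = max D1 D2"
  obtain B m0 a0 where R11: "ns_regular L B m0 (a 1 1) (a 1 1) (\<Phi> 1 1) (\<Phi> 1 1)"
    and a0: "0 < a0" "\<And>s. s \<in> {0..L} \<Longrightarrow> a0 \<le> a 1 1 s \<and> a0 \<le> a 1 1 s" using reg[of 1 1] by auto
  obtain c0 \<eta>0 where c0: "c0 > 0" "\<eta>0 > 0" and low: "\<And>s h. 0 < h \<and> h < \<eta>0 \<and> 0 \<le> s \<and> s + h \<le> L \<Longrightarrow>
     c0 * h powr \<alpha> 1 1 \<le> \<bar>mixed_diff (ns_kernel (a 1 1) (a 1 1) (\<Phi> 1 1) (\<Phi> 1 1) (K 1 1)) s s h\<bar>"
    using mixed_diff_diagonal_lower[OF R11 \<alpha>0(1) \<alpha>(3) c a0(1) a0(2) cond_A_expansion[OF A[of 1 1] L order_refl \<alpha>(3)]] by auto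
  obtain B' m0' where R12: "ns_regular L B' m0' (a 1 2) (a 2 1) (\<Phi> 1 2) (\<Phi> 2 1)" using reg[of 1 2] by auto
  \<comment> \<open>Since \<alpha> 1 2 > \<alpha> 1 1, the leading term of K 1 2 is itself o(t powr
    \<alpha> 1 1), whatever the value of c 1 2.\<close>
  have cross: "\<exists>\<delta>>0. \<forall>t. 0 < t \<and> t < \<delta> \<longrightarrow> \<bar>K 1 2 t - K 1 2 0\<bar> \<le> \<epsilon> * t powr \<alpha> 1 1" if \<epsilon>: "\<epsilon> > 0" for \<epsilon>
  proof -
    obtain \<delta> where \<delta>: "\<delta> > 0" "\<And>t. 0 < t \<and> t < \<delta> \<Longrightarrow> \<bar>K 1 2 t - K 1 2 0 - c 1 2 * t powr \<alpha> 1 2\<bar> \<le> \<epsilon> / 2 * t powr \<alpha> 1 1"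
      using cond_A_expansion[OF A[of 1 2] L less_imp_le[OF \<alpha>(1)] \<alpha>(3), of "\<epsilon> / 2"] \<epsilon> by auto
    obtain \<delta>' where \<delta>': "\<delta>' > 0" "\<And>t. 0 < t \<and> t < \<delta>' \<Longrightarrow> \<bar>c 1 2\<bar> * t powr (\<alpha> 1 2 - \<alpha> 1 1) \<le> \<epsilon> / 2"
      using powr_small[of "\<alpha> 1 2 - \<alpha> 1 1" "\<epsilon> / 2" "\<bar>c 1 2\<bar>"] \<alpha> \<epsilon> by auto
    have "\<bar>K 1 2 t - K 1 2 0\<bar> \<le> \<epsilon> * t powr \<alpha> 1 1" if t: "0 < t" "t < min \<delta> \<delta>'" for t
    proof -
      have "\<bar>c 1 2 * t powr \<alpha> 1 2\<bar> = \<bar>c 1 2\<bar> * t powr (\<alpha> 1 2 - \<alpha> 1 1) * t powr \<alpha> 1 1"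
        by (simp add: abs_mult mult.assoc flip: powr_add)
      also have "\<dots> \<le> \<epsilon> / 2 * t powr \<alpha> 1 1" using \<delta>' t by (intro mult_right_mono) auto
      finally show ?thesis using \<delta>(2)[of t] t by linarith
    qed
    then show ?thesis using \<delta>(1) \<delta>'(1) by (intro exI[of _ "min \<delta> \<delta>'"]) auto
  qed
  define S where "S n = (\<Sum>j=1..n. LINT x|M. inc (Z 1) (L / real n) j x * inc (Z 1) (L / real n) j x)" for n
  define T where "T n = (\<Sum>j=1..n. LINT x|M. inc (Z 1) (L / real n) j x * inc (Z 2) (L / real n) j x)" for n
  have incH: "inc (Z k) h j \<in> H" if "k \<in> {1,2}" for k h j
    unfolding inc_def[abs_def] by (intro gaussian_space_diff[OF H] ZH that)
  have grid: "0 \<le> (real j - 1) * (L / real n)" "(real j - 1) * (L / real n) + L / real n \<le> L" if "j \<in> {1..n}" for j n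
  proof -
    have "(real j - 1) * (L / real n) + L / real n = real j / real n * L" by (simp add: algebra_simps diff_divide_distrib)
    also have "\<dots> \<le> 1 * L" using that L by (intro mult_right_mono) auto
    finally show "(real j - 1) * (L / real n) + L / real n \<le> L" by simp
    show "0 \<le> (real j - 1) * (L / real n)" using that L by simp
  qed
  \<comment> \<open>There are n cells and n h = L, so n h^\<alpha> = L h^(\<alpha> - 1).\<close>
  have S_low: "c0 * L * (L / real n) powr (\<alpha> 1 1 - 1) \<le> S n" if n: "n > 0" "L / real n < \<eta>0" for n
  proof -
    define h where "h = L / real n"
    have h: "h > 0" using n L by (simp add: h_def)
    have "c0 * h powr \<alpha> 1 1 \<le> (LINT x|M. inc (Z 1) h j x * inc (Z 1) h j x)" if "j \<in> {1..n}" for j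
    proof -
      have "0 \<le> (LINT x|M. inc (Z 1) h j x * inc (Z 1) h j x)" by (intro Bochner_Integration.integral_nonneg) simp
      moreover have "(LINT x|M. inc (Z 1) h j x * inc (Z 1) h j x)
        = mixed_diff (ns_kernel (a 1 1) (a 1 1) (\<Phi> 1 1) (\<Phi> 1 1) (K 1 1)) ((real j - 1) * h) ((real j - 1) * h) h"
        by (rule expectation_inc[OF H ZH ZH covns]) auto
      moreover have "c0 * h powr \<alpha> 1 1 \<le> \<bar>mixed_diff (ns_kernel (a 1 1) (a 1 1) (\<Phi> 1 1) (\<Phi> 1 1) (K 1 1)) ((real j - 1) * h) ((real j - 1) * h) h\<bar>"
        by (intro low conjI h n(2)[folded h_def] grid[OF that, folded h_def])
      ultimately show ?thesis by (simp only: abs_of_nonneg)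
    qed
    then have "(\<Sum>j=1..n. c0 * h powr \<alpha> 1 1) \<le> S n" unfolding S_def h_def[symmetric] by (intro sum_mono) auto
    moreover have "(\<Sum>j=1..n. c0 * h powr \<alpha> 1 1) = c0 * L * h powr (\<alpha> 1 1 - 1)"
    proof -
      have "real n * h = L" using n by (simp add: h_def)
      then have "(\<Sum>j=1..n. c0 * h powr \<alpha> 1 1) = c0 * L * (h powr \<alpha> 1 1 / h)" using h by (auto simp: field_simps)
      then show ?thesis using h by (simp add: powr_diff)
    qed
    ultimately show ?thesis unfolding h_def by (simp only:)
  qed
  have T_up: "\<forall>\<^sub>F n in sequentially. \<bar>T n\<bar> \<le> \<epsilon> * S n / 4" if \<epsilon>: "\<epsilon> > 0" for \<epsilon>
  proof -
    \<comment> \<open>Chosen so that the n cell bounds add up to \<epsilon>/4 times the lower bound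
      of S n.\<close>
    define \<epsilon>' where "\<epsilon>' = \<epsilon> * c0 / 4"
    have \<epsilon>': "\<epsilon>' > 0" using \<epsilon> c0 by (simp add: \<epsilon>'_def)
    obtain \<eta> where \<eta>: "\<eta> > 0" and up: "\<And>s h. 0 < h \<and> h < \<eta> \<and> 0 \<le> s \<and> s + h \<le> L \<Longrightarrow>
      \<bar>mixed_diff (ns_kernel (a 1 2) (a 2 1) (\<Phi> 1 2) (\<Phi> 2 1) (K 1 2)) s s h\<bar> \<le> \<epsilon>' * h powr \<alpha> 1 1"
      using mixed_diff_diagonal_small[OF R12 \<alpha>0(1) \<alpha>(3) cross \<epsilon>'] by auto
    have "\<forall>\<^sub>F n in sequentially. L / real n < \<eta> \<and> L / real n < \<eta>0 \<and> n > 0"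
      by (intro eventually_conj eventually_mesh_small \<eta> c0 eventually_gt_at_top)
    then show ?thesis
    proof eventually_elim
      case (elim n)
      define h where "h = L / real n"
      have h: "h > 0" using elim L by (simp add: h_def)
      have "\<bar>LINT x|M. inc (Z 1) h j x * inc (Z 2) h j x\<bar> \<le> \<epsilon>' * h powr \<alpha> 1 1" if "j \<in> {1..n}" for j
      proof -
        have "(LINT x|M. inc (Z 1) h j x * inc (Z 2) h j x)
          = mixed_diff (ns_kernel (a 1 2) (a 2 1) (\<Phi> 1 2) (\<Phi> 2 1) (K 1 2)) ((real j - 1) * h) ((real j - 1) * h) h"
          by (rule expectation_inc[OF H ZH ZH covns]) auto
        moreover have "\<bar>mixed_diff (ns_kernel (a 1 2) (a 2 1) (\<Phi> 1 2) (\<Phi> 2 1) (K 1 2)) ((real j - 1) * h) ((real j - 1) * h) h\<bar> \<le> \<epsilon>' * h powr \<alpha> 1 1"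
          using elim by (intro up conjI h grid[OF that, folded h_def]) (simp add: h_def)
        ultimately show ?thesis by (simp only:)
      qed
      then have "(\<Sum>j=1..n. \<bar>LINT x|M. inc (Z 1) h j x * inc (Z 2) h j x\<bar>) \<le> (\<Sum>j=1..n. \<epsilon>' * h powr \<alpha> 1 1)"
        by (intro sum_mono) auto
      then have "\<bar>T n\<bar> \<le> (\<Sum>j=1..n. \<epsilon>' * h powr \<alpha> 1 1)"
        unfolding T_def h_def[symmetric] by (rule order.trans[OF sum_abs])
      also have "\<dots> = \<epsilon> / 4 * (c0 * L * h powr (\<alpha> 1 1 - 1))"
      proof -
        have "real n * h = L" using elim by (simp add: h_def)
        then have "(\<Sum>j=1..n. \<epsilon>' * h powr \<alpha> 1 1) = \<epsilon>' * L * (h powr \<alpha> 1 1 / h)" using h by (auto simp: field_simps)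
        then show ?thesis using h by (simp add: powr_diff \<epsilon>'_def)
      qed
      also have "\<dots> \<le> \<epsilon> / 4 * S n" using S_low[of n] elim \<epsilon> by (intro mult_left_mono) (auto simp: h_def)
      finally show ?case by simp
    qed
  qed
  have ols: "ols_diff L (Z 1) (response \<beta> Z) n x
    = (\<Sum>j=1..n. inc (Z 1) (L / real n) j x * (inc (Z 1) (L / real n) j x * \<beta> + inc (Z 2) (L / real n) j x))
      / (\<Sum>j=1..n. (inc (Z 1) (L / real n) j x)\<^sup>2)" for n x
    unfolding ols_diff_def Let_def inc_def response_def
    by (intro arg_cong2[where f = "(/)"] sum.cong refl) (simp add: algebra_simps)
  show ?thesis unfolding converges_in_probability_def
  proof (intro allI impI)
    fix \<epsilon> :: real assume \<epsilon>: "0 < \<epsilon>"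
    define E where "E = (8 + 32 / \<epsilon>\<^sup>2) * (D / (c0 * L))"
    have ev: "\<forall>\<^sub>F n in sequentially. measure M {x \<in> space M. \<epsilon> < \<bar>ols_diff L (Z 1) (response \<beta> Z) n x - \<beta>\<bar>}
        \<le> E * (L / real n) powr (p + 1 - \<alpha> 1 1)"
      using T_up[OF \<epsilon>] eventually_mesh_small[OF c0(2), of L] eventually_ge_at_top[of N1] eventually_ge_at_top[of N2] eventually_gt_at_top[of 0]
    proof eventually_elim
      case (elim n)
      define h where "h = L / real n"
      have h: "h > 0" using elim L by (simp add: h_def)
      define \<rho> where "\<rho> = D * h powr p"
      have "\<rho> \<ge> 0" using D1 by (simp add: \<rho>_def D_def)
      have le: "D1 * h powr p \<le> \<rho>" "D2 * h powr p \<le> \<rho>" unfolding \<rho>_def D_def by (intro mult_right_mono; simp)+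
      have o1: "(LINT x|M. (\<Sum>j=1..n. v j * inc (Z 1) h j x)\<^sup>2) \<le> \<rho> * (\<Sum>j=1..n. (v j)\<^sup>2)"
        and o2: "(LINT x|M. (\<Sum>j=1..n. v j * inc (Z 2) h j x)\<^sup>2) \<le> \<rho> * (\<Sum>j=1..n. (v j)\<^sup>2)" for v
      proof -
        have nn: "0 \<le> (\<Sum>j=1..n. (v j)\<^sup>2)" by (intro sum_nonneg) simp
        show "(LINT x|M. (\<Sum>j=1..n. v j * inc (Z 1) h j x)\<^sup>2) \<le> \<rho> * (\<Sum>j=1..n. (v j)\<^sup>2)"
          by (rule order.trans[OF op1[OF elim(3), folded h_def] mult_right_mono[OF le(1) nn]])
        show "(LINT x|M. (\<Sum>j=1..n. v j * inc (Z 2) h j x)\<^sup>2) \<le> \<rho> * (\<Sum>j=1..n. (v j)\<^sup>2)"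
          by (rule order.trans[OF op2[OF elim(4), folded h_def] mult_right_mono[OF le(2) nn]])
      qed
      have Sl: "c0 * L * h powr (\<alpha> 1 1 - 1) \<le> S n" using S_low[of n] elim by (simp add: h_def)
      have lpos: "0 < c0 * L * h powr (\<alpha> 1 1 - 1)" using c0 L h by simp
      then have Spos: "0 < S n" using Sl by linarith
      have "measure M {x \<in> space M. \<epsilon> < \<bar>ols_diff L (Z 1) (response \<beta> Z) n x - \<beta>\<bar>} \<le> (8 + 32 / \<epsilon>\<^sup>2) * (\<rho> / S n)"
        unfolding ols h_def[symmetric]
        using elim(1) Spos \<epsilon>
        by (intro sum_products_ratio_tail[OF H incH incH _ o1 o2]) (auto simp: S_def T_def h_def)
      also have "\<dots> \<le> (8 + 32 / \<epsilon>\<^sup>2) * (\<rho> / (c0 * L * h powr (\<alpha> 1 1 - 1)))"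
        using Sl lpos \<open>\<rho> \<ge> 0\<close> by (intro mult_left_mono divide_left_mono) auto
      also have "\<rho> / (c0 * L * h powr (\<alpha> 1 1 - 1)) = D / (c0 * L) * (h powr p / h powr (\<alpha> 1 1 - 1))"
        by (simp add: \<rho>_def)
      also have "h powr p / h powr (\<alpha> 1 1 - 1) = h powr (p + 1 - \<alpha> 1 1)"
        by (simp flip: powr_diff add: algebra_simps)
      finally show ?case by (simp add: E_def h_def mult.assoc)
    qed
    have "(\<lambda>n. E * (L / real n) powr (p + 1 - \<alpha> 1 1)) \<longlonglongrightarrow> E * 0"
      by (intro tendsto_mult tendsto_const mesh_powr_tendsto_zero) (use p L in auto)
    then have lim: "(\<lambda>n. E * (L / real n) powr (p + 1 - \<alpha> 1 1)) \<longlonglongrightarrow> 0" by simp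
    show "(\<lambda>n. measure M {x \<in> space M. \<epsilon> < \<bar>ols_diff L (Z 1) (response \<beta> Z) n x - \<beta>\<bar>}) \<longlonglongrightarrow> 0"
      by (rule tendsto_sandwich[OF _ ev tendsto_const lim]) simp
  qed
qed

section \<open>Exponentials in the reproducing kernel Hilbert space of a spectral density\<close>

text \<open>An antiderivative settles the positive half line, reflection the negative one; counting
  the origin twice only costs an inequality.\<close>

lemma integrable_one_plus_abs_powr:
  assumes r: "1 < (r::real)"
  shows "integrable lborel (\<lambda>v. (1 + \<bar>v\<bar>) powr (- r))"
proof -
  define f where "f x = (1 + \<bar>x\<bar>) powr (- r)" for x :: real
  define F where "F x = - ((1 + x) powr (1 - r)) / (r - 1)" for x :: real
  have [measurable]: "f \<in> borel_measurable borel" unfolding f_def[abs_def] by measurable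
  have half: "(\<integral>\<^sup>+x. ennreal (f x) * indicator {0..} x \<partial>lborel) = ennreal (0 - F 0)"
  proof (rule nn_integral_FTC_atLeast)
    fix x :: real assume x: "0 \<le> x"
    have "((\<lambda>z. z powr (1 - r)) has_real_derivative (1 - r) * (1 + x) powr (1 - r - 1)) (at (1 + x))"
      using x by (intro has_real_derivative_powr) auto
    moreover have "((\<lambda>x. 1 + x) has_real_derivative 1) (at x)" by (auto intro!: derivative_eq_intros)
    ultimately have "((\<lambda>x. (1 + x) powr (1 - r)) has_real_derivative (1 - r) * (1 + x) powr (1 - r - 1) * 1) (at x)"
      by (rule DERIV_chain2)
    then have "((\<lambda>x. (- 1 / (r - 1)) * (1 + x) powr (1 - r)) has_real_derivative (- 1 / (r - 1)) * ((1 - r) * (1 + x) powr (1 - r - 1) * 1)) (at x)"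
      by (rule DERIV_cmult)
    moreover have "(- 1 / (r - 1)) * ((1 - r) * (1 + x) powr (1 - r - 1) * 1) = f x"
      using r x by (simp add: f_def field_simps)
    moreover have "F = (\<lambda>x. (- 1 / (r - 1)) * (1 + x) powr (1 - r))" by (simp add: F_def fun_eq_iff)
    ultimately show "(F has_real_derivative f x) (at x)" by simp
  next
    have "((\<lambda>x. (1 + x) powr (1 - r)) \<longlongrightarrow> 0) at_top"
      by (rule tendsto_neg_powr) (use r in \<open>auto intro: filterlim_tendsto_add_at_top[OF tendsto_const] filterlim_ident\<close>)
    then have "((\<lambda>x. - ((1 + x) powr (1 - r)) / (r - 1)) \<longlongrightarrow> - 0 / (r - 1)) at_top"
      by (intro tendsto_divide tendsto_minus tendsto_const) (use r in auto)
    then show "(F \<longlongrightarrow> 0) at_top" unfolding F_def[abs_def] by simp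
  qed (auto simp: f_def)
  have refl: "(\<integral>\<^sup>+x. ennreal (f x) * indicator {..0} x \<partial>lborel) = (\<integral>\<^sup>+x. ennreal (f x) * indicator {0..} x \<partial>lborel)"
    by (subst nn_integral_real_affine[where c = "-1" and t = 0]) (auto simp: f_def indicator_def intro!: nn_integral_cong)
  have "(\<integral>\<^sup>+x. ennreal (norm (f x)) \<partial>lborel) \<le> (\<integral>\<^sup>+x. ennreal (f x) * indicator {0..} x + ennreal (f x) * indicator {..0} x \<partial>lborel)"
    by (intro nn_integral_mono) (auto simp: f_def indicator_def)
  also have "\<dots> = ennreal (0 - F 0) + ennreal (0 - F 0)"
    by (subst nn_integral_add) (auto simp: refl half)
  also have "\<dots> < \<infinity>" by (simp add: ennreal_add_eq_top less_top)
  finally have "integrable lborel f" by (intro integrableI_bounded) auto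
  then show ?thesis by (simp add: f_def[abs_def])
qed

subsection \<open>A function with rapidly decaying Fourier transform that is one on an interval\<close>

definition uniform_real :: "real measure" where
  "uniform_real = density lborel (\<lambda>x. ennreal (indicator {-1..1} x / 2))"

lemma uniform_real_distribution: "real_distribution uniform_real"
proof -
  have half: "ennreal (indicator {-1..1} x / 2) = ennreal (1 / 2) * indicator {-1..1} x" for x :: real
    by (cases "x \<in> {-1..1}") simp_all
  have "emeasure uniform_real (space uniform_real) = (\<integral>\<^sup>+x. ennreal (1 / 2) * indicator {-1..1::real} x \<partial>lborel)"
    unfolding uniform_real_def by (subst emeasure_density) (simp_all only: half, simp_all)
  also have "\<dots> = ennreal (1 / 2) * emeasure lborel {-1..1::real}" by (rule nn_integral_cmult_indicator) simp
  also have "\<dots> = ennreal (1 / 2) * ennreal 2" by (subst emeasure_lborel_Icc) auto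
  also have "\<dots> = ennreal (1 / 2 * 2)" by (rule ennreal_mult[symmetric]) simp_all
  also have "\<dots> = 1" by simp
  finally have "prob_space uniform_real" by (rule prob_spaceI)
  then interpret prob_space uniform_real .
  show ?thesis by unfold_locales (simp add: uniform_real_def)
qed

lemma AE_uniform_real: "AE x in uniform_real. \<bar>x\<bar> \<le> 1"
  unfolding uniform_real_def by (subst AE_density) (auto simp: indicator_def split: if_splits)

text \<open>The transform is sin t / t; the boundary terms of the antiderivative have modulus 1 / (2
  |t|) each.\<close>

lemma char_uniform_real_le: "norm (char uniform_real t) \<le> 1 / \<bar>t\<bar>" if t: "t \<noteq> 0"
proof -
  have "char uniform_real t = (CLINT x|lborel. indicator {-1..1} x *\<^sub>R (iexp (t * x) / 2))"
    unfolding char_def uniform_real_def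
    by (subst integral_density) (auto intro!: Bochner_Integration.integral_cong simp: indicator_def scaleR_conv_of_real)
  also have "\<dots> = iexp (t * 1) / (2 * \<i> * t) - iexp (t * (-1)) / (2 * \<i> * t)"
  proof (rule integral_FTC_atLeastAtMost)
    fix x :: real
    have 1: "((\<lambda>x. t * x) has_vector_derivative t) (at x within {-1..1})"
      unfolding has_real_derivative_iff_has_vector_derivative[symmetric] by (auto intro!: derivative_eq_intros)
    have 2: "(iexp has_vector_derivative (\<i> * iexp (t * x))) (at (t * x) within (\<lambda>x. t * x) ` {-1..1})"
      by (rule has_vector_derivative_iexp)
    have "((\<lambda>x. iexp (t * x)) has_vector_derivative (t *\<^sub>R (\<i> * iexp (t * x)))) (at x within {-1..1})"
      using vector_diff_chain_within[OF 1 2] by (simp only: o_def)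
    then have "((\<lambda>x. iexp (t * x) / (2 * \<i> * t)) has_vector_derivative (t *\<^sub>R (\<i> * iexp (t * x))) / (2 * \<i> * t)) (at x within {-1..1})"
      by (rule has_vector_derivative_divide)
    then show "((\<lambda>x. iexp (t * x) / (2 * \<i> * t)) has_vector_derivative iexp (t * x) / 2) (at x within {-1..1})"
      using t by (simp add: scaleR_conv_of_real)
  next
    show "continuous_on {-1..1} (\<lambda>x. iexp (t * x) / 2)" by (intro continuous_intros) auto
  qed simp
  finally have "norm (char uniform_real t) \<le> norm (iexp (t * 1) / (2 * \<i> * t)) + norm (iexp (t * (-1)) / (2 * \<i> * t))"
    by (simp only:) (rule norm_triangle_ineq4)
  also have "\<dots> = 1 / \<bar>t\<bar>" by (simp add: norm_divide norm_mult)
  finally show ?thesis .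
qed

text \<open>Fubini factorises the exponential. With general f and g it covers both convolutions and
  sums of two independent Gaussian series.\<close>

lemma char_pair_sum:
  assumes "prob_space M" "prob_space N" and [measurable]: "f \<in> borel_measurable M" "g \<in> borel_measurable N"
  shows "char (distr (M \<Otimes>\<^sub>M N) borel (\<lambda>(x, y). f x + g y)) t = char (distr M borel f) t * char (distr N borel g) t"
proof -
  interpret M: prob_space M by fact
  interpret N: prob_space N by fact
  interpret pair_prob_space M N ..
  interpret P: prob_space "M \<Otimes>\<^sub>M N" by (rule P.prob_space_axioms)
  have "char (distr (M \<Otimes>\<^sub>M N) borel (\<lambda>(x, y). f x + g y)) t = (CLINT z|M \<Otimes>\<^sub>M N. iexp (t * (f (fst z) + g (snd z))))"
    unfolding char_def by (subst integral_distr) (auto simp: case_prod_beta)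
  also have "\<dots> = (CLINT z|M \<Otimes>\<^sub>M N. (\<lambda>(x, y). iexp (t * (f x + g y))) z)" by (simp add: case_prod_beta)
  also have "\<dots> = (CLINT x|M. CLINT y|N. (\<lambda>(x, y). iexp (t * (f x + g y))) (x, y))"
    by (rule integral_fst'[symmetric]) (intro P.integrable_const_bound[where B = 1], auto simp: case_prod_beta)
  also have "\<dots> = (CLINT x|M. CLINT y|N. iexp (t * f x) * iexp (t * g y))"
    by (simp add: distrib_left exp_add[symmetric])
  also have "\<dots> = char (distr M borel f) t * char (distr N borel g) t" by (simp add: char_def integral_distr)
  finally show ?thesis .
qed

lemma convolution_real_distribution:
  assumes "real_distribution M" "real_distribution N"
  shows "real_distribution (distr (M \<Otimes>\<^sub>M N) borel (\<lambda>(x, y). x + y))"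
    and "char (distr (M \<Otimes>\<^sub>M N) borel (\<lambda>(x, y). x + y)) t = char M t * char N t"
    and "(AE x in M. \<bar>x\<bar> \<le> a) \<Longrightarrow> (AE x in N. \<bar>x\<bar> \<le> b) \<Longrightarrow> AE x in distr (M \<Otimes>\<^sub>M N) borel (\<lambda>(x, y). x + y). \<bar>x\<bar> \<le> a + b"
proof -
  interpret M: real_distribution M by fact
  interpret N: real_distribution N by fact
  interpret pair_prob_space M N ..
  interpret P: prob_space "M \<Otimes>\<^sub>M N" by (rule P.prob_space_axioms)
  have [measurable]: "(\<lambda>(x, y). x + y) \<in> borel_measurable (M \<Otimes>\<^sub>M N)" by measurable
  interpret D: prob_space "distr (M \<Otimes>\<^sub>M N) borel (\<lambda>(x, y). x + y)" by (rule P.prob_space_distr) measurable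
  show "real_distribution (distr (M \<Otimes>\<^sub>M N) borel (\<lambda>(x, y). x + y))" by unfold_locales simp
  show "char (distr (M \<Otimes>\<^sub>M N) borel (\<lambda>(x, y). x + y)) t = char M t * char N t"
  proof -
    have "distr M borel (\<lambda>x. x) = M" "distr N borel (\<lambda>x. x) = N" by (rule distr_id2; simp)+
    moreover have "char (distr (M \<Otimes>\<^sub>M N) borel (\<lambda>(x, y). x + y)) t = char (distr M borel (\<lambda>x. x)) t * char (distr N borel (\<lambda>x. x)) t"
      by (rule char_pair_sum[OF M.prob_space_axioms N.prob_space_axioms]) simp_all
    ultimately show ?thesis by (simp only:)
  qed
  assume a: "AE x in M. \<bar>x\<bar> \<le> a" and b: "AE x in N. \<bar>x\<bar> \<le> b"
  have "AE z in M \<Otimes>\<^sub>M N. \<bar>fst z + snd z\<bar> \<le> a + b"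
  proof (rule AE_pair_measure)
    show "{z \<in> space (M \<Otimes>\<^sub>M N). \<bar>fst z + snd z\<bar> \<le> a + b} \<in> sets (M \<Otimes>\<^sub>M N)" by measurable
    show "AE x in M. AE y in N. \<bar>fst (x, y) + snd (x, y)\<bar> \<le> a + b"
      using a
    proof eventually_elim
      case (elim x)
      show ?case using b by eventually_elim (use elim in auto)
    qed
  qed
  then show "AE x in distr (M \<Otimes>\<^sub>M N) borel (\<lambda>(x, y). x + y). \<bar>x\<bar> \<le> a + b"
    by (subst AE_distr_iff) (auto simp: case_prod_beta)
qed

text \<open>The law of a sum of n independent uniform variables on [-1, 1], a B-spline; for n = 0 a
  point mass at 0. Each convolution enlarges the support by 1 and adds one power of decay to the
  transform.\<close>

lemma compactly_supported_distribution:
  "\<exists>M. real_distribution M \<and> (AE x in M. \<bar>x\<bar> \<le> real n) \<and> (\<forall>t. t \<noteq> 0 \<longrightarrow> norm (char M t) \<le> (1 / \<bar>t\<bar>) ^ n)"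
proof (induction n)
  case 0
  interpret prob_space "return borel (0::real)" by (rule prob_space_return) simp
  have "real_distribution (return borel (0::real))" by unfold_locales simp
  then show ?case using real_distribution.cmod_char_le_1[of "return borel 0"]
    by (intro exI[of _ "return borel 0"]) (auto simp: AE_return)
next
  case (Suc n)
  then obtain M where M: "real_distribution M" "AE x in M. \<bar>x\<bar> \<le> real n"
    "\<forall>t. t \<noteq> 0 \<longrightarrow> norm (char M t) \<le> (1 / \<bar>t\<bar>) ^ n" by blast
  note conv = convolution_real_distribution[OF M(1) uniform_real_distribution]
  have "norm (char M t * char uniform_real t) \<le> (1 / \<bar>t\<bar>) ^ Suc n" if "t \<noteq> 0" for t
    unfolding norm_mult power_Suc2 using M(3) char_uniform_real_le[OF that] that by (intro mult_mono) auto
  moreover have "AE x in distr (M \<Otimes>\<^sub>M uniform_real) borel (\<lambda>(x, y). x + y). \<bar>x\<bar> \<le> real (Suc n)"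
    using conv(3)[OF M(2) AE_uniform_real] by (simp add: add.commute)
  ultimately show ?case using conv(1,2)
    by (intro exI[of _ "distr (M \<Otimes>\<^sub>M uniform_real) borel (\<lambda>(x, y). x + y)"] conjI) auto
qed

lemma iexp_diff_le: "norm (iexp x - iexp y) \<le> \<bar>x - y\<bar>"
proof -
  have "iexp x - iexp y = iexp y * (iexp (x - y) - 1)" by (simp add: algebra_simps flip: exp_add)
  then have "norm (iexp x - iexp y) = norm (iexp (x - y) - 1)" by (simp only: norm_mult norm_exp_i_times mult_1)
  also have "\<dots> \<le> \<bar>x - y\<bar>" using iexp_approx1[of "x - y" 0] by simp
  finally show ?thesis .
qed

text \<open>Smoothing the indicator of an interval that exceeds [0, L] by more than the support
  radius of M leaves the value 1 on [0, L]. On the Fourier side the transform of the indicator is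
  multiplied by \<open>char M\<close>, which decays fast. Levy's inversion formula identifies the
  integral with the M-mass of an interval containing the whole support.\<close>

lemma plateau_function:
  assumes L: "0 < L" and n: "2 \<le> n"
  shows "\<exists>(\<psi>::real \<Rightarrow> complex) C. \<psi> \<in> borel_measurable borel \<and> 0 \<le> C \<and> (\<forall>t. norm (\<psi> t) \<le> C * (1 + \<bar>t\<bar>) powr (- real n))
    \<and> (\<forall>s\<in>{0..L}. (CLINT t|lborel. iexp (- (t * s)) * \<psi> t) = 1)"
proof -
  define N where "N = n + 2"
  obtain M where M: "real_distribution M" and supp: "AE x in M. \<bar>x\<bar> \<le> real N"
    and decay: "\<And>t. t \<noteq> 0 \<Longrightarrow> norm (char M t) \<le> (1 / \<bar>t\<bar>) ^ N"
    using compactly_supported_distribution[of N] by blast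
  interpret real_distribution M by fact
  \<comment> \<open>With the margin 1 the endpoints s - w and s + u stay strictly outside [-N, N]
    for all s in [0, L]; so they carry no mass, as the inversion formula requires.\<close>
  define u where "u = real N + 1"
  define w where "w = L + real N + 1"
  have uw: "0 < u" "0 < w" using L by (simp_all add: u_def w_def)
  define \<psi> where "\<psi> t = 1 / (2 * pi) * ((iexp (t * w) - iexp (- (t * u))) / (\<i> * t) * char M t)" for t :: real
  have [measurable]: "\<psi> \<in> borel_measurable borel" unfolding \<psi>_def[abs_def] by measurable
  define C where "C = (u + w + 1) * 2 ^ n"
  have C: "C \<ge> 0" using uw by (simp add: C_def)
  have bound: "norm (\<psi> t) \<le> C * (1 + \<bar>t\<bar>) powr (- real n)" for t
  proof -
    have pi: "1 / (2 * pi) \<le> 1 / 2" using pi_ge_two by (simp add: field_simps)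
    have eq: "norm (\<psi> t) = 1 / (2 * pi) * (norm (iexp (t * w) - iexp (- (t * u))) / \<bar>t\<bar> * norm (char M t))"
      by (simp add: \<psi>_def norm_mult norm_divide)
    have P: "(1 + \<bar>t\<bar>) powr (- real n) = 1 / (1 + \<bar>t\<bar>) ^ n" by (simp add: powr_minus powr_realpow inverse_eq_divide)
    \<comment> \<open>Near 0 the quotient is bounded by the length u + w of the interval, at t = 0
      because division by 0 gives 0; away from 0 the decay of \<open>char M\<close> is used.\<close>
    show ?thesis
    proof (cases "\<bar>t\<bar> \<le> 1")
      case True
      have "norm (iexp (t * w) - iexp (- (t * u))) / \<bar>t\<bar> \<le> u + w"
      proof (cases "t = 0")
        case False
        have "norm (iexp (t * w) - iexp (- (t * u))) \<le> \<bar>t * w - - (t * u)\<bar>" by (rule iexp_diff_le)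
        also have "\<dots> = \<bar>t\<bar> * (u + w)" using uw by (simp add: abs_mult distrib_left[symmetric] add.commute)
        finally show ?thesis using False by (simp add: pos_divide_le_eq mult.commute)
      qed (use uw in simp)
      then have "norm (\<psi> t) \<le> 1 * ((u + w) * 1)"
        unfolding eq using pi uw cmod_char_le_1 by (intro mult_mono) auto
      also have "\<dots> * 1 \<le> C * (1 / (1 + \<bar>t\<bar>) ^ n)"
      proof -
        have "(1 + \<bar>t\<bar>) ^ n \<le> 2 ^ n" using True by (intro power_mono) auto
        then have "1 \<le> 2 ^ n * (1 / (1 + \<bar>t\<bar>) ^ n)" by (simp add: field_simps add_pos_nonneg)
        then have "(u + w) * 1 \<le> (u + w + 1) * (2 ^ n * (1 / (1 + \<bar>t\<bar>) ^ n))" using uw by (intro mult_mono) auto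
        then show ?thesis by (simp add: C_def)
      qed
      finally show ?thesis by (simp add: P)
    next
      case False
      then have t: "1 \<le> \<bar>t\<bar>" "t \<noteq> 0" by auto
      have "norm (iexp (t * w) - iexp (- (t * u))) \<le> 2"
        by (rule order.trans[OF norm_triangle_ineq4]) simp
      then have "norm (iexp (t * w) - iexp (- (t * u))) / \<bar>t\<bar> \<le> 2 / 1" using t by (intro frac_le) auto
      then have "norm (\<psi> t) \<le> 1 / 2 * (2 / 1 * (1 / \<bar>t\<bar>) ^ N)"
        unfolding eq using pi decay[OF t(2)] by (intro mult_mono) auto
      also have "\<dots> = (1 / \<bar>t\<bar>) ^ N" by simp
      also have "\<dots> \<le> (1 / \<bar>t\<bar>) ^ n" unfolding N_def using t by (intro power_decreasing) auto
      also have "\<dots> \<le> (2 / (1 + \<bar>t\<bar>)) ^ n" using t by (intro power_mono) (auto simp: field_simps)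
      also have "\<dots> = 1 * (2 ^ n * (1 / (1 + \<bar>t\<bar>) ^ n))" by (simp add: power_divide)
      also have "\<dots> \<le> (u + w + 1) * (2 ^ n * (1 / (1 + \<bar>t\<bar>) ^ n))" using uw by (intro mult_right_mono) auto
      finally show ?thesis by (simp add: P C_def)
    qed
  qed
  have int: "integrable lborel \<psi>"
    by (rule Bochner_Integration.integrable_bound[OF integrable_mult_right[OF integrable_one_plus_abs_powr[of "real n"], of C]])
       (use bound C n in \<open>auto simp: abs_mult\<close>)
  have "(CLINT t|lborel. iexp (- (t * s)) * \<psi> t) = 1" if s: "s \<in> {0..L}" for s
  proof -
    define a b where "a = s - w" "b = s + u"
    have ab: "a \<le> b" using uw by (simp add: a_b_def)
    have out: "a < - real N" "real N < b" using s by (auto simp: a_b_def u_def w_def)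
    have null: "measure M {x} = 0" if "\<bar>x\<bar> > real N" for x
    proof -
      have "AE y in M. y \<notin> {x}" using supp by eventually_elim (use that in auto)
      then show ?thesis by (subst (asm) AE_iff_measurable[OF _ refl]) (auto simp: measure_def)
    qed
    have "measure M {a<..b} = 1"
    proof -
      have "AE y in M. y \<in> {a<..b}" using supp by eventually_elim (use out in auto)
      then show ?thesis by (subst prob_eq_1) auto
    qed
    with Levy_Inversion[OF ab null null] out
    have lim: "(\<lambda>T::nat. 1 / (2 * pi) * (CLBINT t=-T..T. (iexp (-(t * a)) - iexp (-(t * b))) / (\<i> * t) * char M t)) \<longlonglongrightarrow> 1"
      by auto
    have eq: "1 / (2 * pi) * (CLBINT t=-T..T. (iexp (-(t * a)) - iexp (-(t * b))) / (\<i> * t) * char M t)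
      = (CLINT t|lborel. indicator {- real T<..<real T} t *\<^sub>R (iexp (- (t * s)) * \<psi> t))" for T :: nat
    proof -
      have "iexp (- (t * s)) * \<psi> t = 1 / (2 * pi) * ((iexp (-(t * a)) - iexp (-(t * b))) / (\<i> * t) * char M t)" for t
      proof -
        have "iexp (-(t * a)) = iexp (- (t * s)) * iexp (t * w)" "iexp (-(t * b)) = iexp (- (t * s)) * iexp (- (t * u))"
          by (simp_all add: a_b_def algebra_simps flip: exp_add)
        then show ?thesis by (simp add: \<psi>_def algebra_simps diff_divide_distrib)
      qed
      then show ?thesis
        by (simp add: interval_lebesgue_integral_def set_lebesgue_integral_def flip: integral_mult_right_zero)
    qed
    \<comment> \<open>Inversion only gives a limit of truncated integrals; integrability of \<psi>
      turns it into the full integral.\<close>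
    have "(\<lambda>T::nat. CLINT t|lborel. indicator {- real T<..<real T} t *\<^sub>R (iexp (- (t * s)) * \<psi> t)) \<longlonglongrightarrow> (CLINT t|lborel. iexp (- (t * s)) * \<psi> t)"
    proof (rule integral_dominated_convergence[where w = "\<lambda>t. norm (\<psi> t)"])
      show "AE t in lborel. (\<lambda>T::nat. indicator {- real T<..<real T} t *\<^sub>R (iexp (- (t * s)) * \<psi> t)) \<longlonglongrightarrow> iexp (- (t * s)) * \<psi> t"
      proof (rule AE_I2)
        fix t :: real
        have "\<forall>\<^sub>F T::nat in sequentially. indicator {- real T<..<real T} t *\<^sub>R (iexp (- (t * s)) * \<psi> t) = iexp (- (t * s)) * \<psi> t"
          using eventually_gt_at_top[of "nat \<lceil>\<bar>t\<bar>\<rceil>"]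
          by eventually_elim (auto simp: indicator_def, linarith+)
        then show "(\<lambda>T::nat. indicator {- real T<..<real T} t *\<^sub>R (iexp (- (t * s)) * \<psi> t)) \<longlonglongrightarrow> iexp (- (t * s)) * \<psi> t"
          by (rule tendsto_eventually)
      qed
    qed (use int in \<open>auto simp: norm_mult indicator_def\<close>)
    with lim[unfolded eq] show ?thesis by (rule LIMSEQ_unique[symmetric])
  qed
  then show ?thesis using C bound \<open>\<psi> \<in> _\<close> by blast
qed

section \<open>Quadratic forms in the spectral domain\<close>

lemma spectral_density_cos:
  assumes "spectral_density f K"
  shows "integrable lborel (\<lambda>u. f u * cos (u * t))" "K t = (LINT u|lborel. f u * cos (u * t))"
proof -
  have f: "integrable lborel f" and K: "complex_of_real (K t) = (LINT \<omega>|lborel. iexp (\<omega> * t) * complex_of_real (f \<omega>))"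
    using assms unfolding spectral_density_def by auto
  have [measurable]: "f \<in> borel_measurable borel" using f by simp
  show "integrable lborel (\<lambda>u. f u * cos (u * t))"
    by (rule Bochner_Integration.integrable_bound[OF f]) (auto simp: abs_mult mult_left_le)
  have i: "integrable lborel (\<lambda>\<omega>. iexp (\<omega> * t) * complex_of_real (f \<omega>))"
    by (rule Bochner_Integration.integrable_bound[OF f]) (auto simp: norm_mult)
  have "K t = Re (LINT \<omega>|lborel. iexp (\<omega> * t) * complex_of_real (f \<omega>))" using arg_cong[OF K, of Re] by (simp only: Re_complex_of_real)
  also have "\<dots> = (LINT \<omega>|lborel. Re (iexp (\<omega> * t) * complex_of_real (f \<omega>)))" using i by (rule integral_Re[symmetric])
  also have "\<dots> = (LINT u|lborel. f u * cos (u * t))"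
    by (rule Bochner_Integration.integral_cong) (auto simp: Re_exp)
  finally show "K t = (LINT u|lborel. f u * cos (u * t))" .
qed

text \<open>Spectral isometry: the variance of a combination of field values is the integral of f
  times the squared modulus of the trigonometric sum, written with real and imaginary part. It
  follows from cos (x - y) = cos x cos y + sin x sin y.\<close>

lemma spectral_quadratic_form:
  assumes f: "spectral_density f K"
  shows "integrable lborel (\<lambda>u. f u * ((\<Sum>s\<in>S. a s * cos (u * x s))\<^sup>2 + (\<Sum>s\<in>S. a s * sin (u * x s))\<^sup>2))"
    and "(\<Sum>s\<in>S. \<Sum>s'\<in>S. a s * a s' * K (x s - x s'))
      = (LINT u|lborel. f u * ((\<Sum>s\<in>S. a s * cos (u * x s))\<^sup>2 + (\<Sum>s\<in>S. a s * sin (u * x s))\<^sup>2))"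
proof -
  have eq: "f u * ((\<Sum>s\<in>S. a s * cos (u * x s))\<^sup>2 + (\<Sum>s\<in>S. a s * sin (u * x s))\<^sup>2)
      = (\<Sum>s\<in>S. \<Sum>s'\<in>S. a s * a s' * (f u * cos (u * (x s - x s'))))" for u
    by (simp add: power2_eq_square sum_product sum.distrib[symmetric] sum_distrib_left right_diff_distrib cos_diff algebra_simps)
  note i = spectral_density_cos(1)[OF f]
  show "integrable lborel (\<lambda>u. f u * ((\<Sum>s\<in>S. a s * cos (u * x s))\<^sup>2 + (\<Sum>s\<in>S. a s * sin (u * x s))\<^sup>2))"
    unfolding eq by (intro Bochner_Integration.integrable_sum integrable_mult_right i)
  have "(LINT u|lborel. f u * ((\<Sum>s\<in>S. a s * cos (u * x s))\<^sup>2 + (\<Sum>s\<in>S. a s * sin (u * x s))\<^sup>2))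
     = (\<Sum>s\<in>S. LINT u|lborel. (\<Sum>s'\<in>S. a s * a s' * (f u * cos (u * (x s - x s')))))"
    unfolding eq by (intro Bochner_Integration.integral_sum Bochner_Integration.integrable_sum integrable_mult_right i)
  also have "\<dots> = (\<Sum>s\<in>S. \<Sum>s'\<in>S. LINT u|lborel. a s * a s' * (f u * cos (u * (x s - x s'))))"
    by (intro sum.cong refl Bochner_Integration.integral_sum integrable_mult_right i)
  also have "\<dots> = (\<Sum>s\<in>S. \<Sum>s'\<in>S. a s * a s' * K (x s - x s'))"
    by (simp add: spectral_density_cos(2)[OF f])
  finally show "(\<Sum>s\<in>S. \<Sum>s'\<in>S. a s * a s' * K (x s - x s'))
      = (LINT u|lborel. f u * ((\<Sum>s\<in>S. a s * cos (u * x s))\<^sup>2 + (\<Sum>s\<in>S. a s * sin (u * x s))\<^sup>2))" ..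
qed

text \<open>On \<open>[0, L]\<close> the exponential of frequency \<open>\<omega>\<close> agrees with the modulated plateau function, whose
  Fourier transform is concentrated near \<open>\<omega>\<close>.\<close>

lemma exponential_in_rkhs:
  assumes f: "spectral_density f K" and c: "0 < c" and p: "0 \<le> p" and L: "0 < L"
    and low: "\<And>u. c * (1 + \<bar>u\<bar>) powr (- p) \<le> f u"
  shows "\<exists>C\<ge>0. \<forall>\<omega> (S :: nat set) x a. finite S \<longrightarrow> x ` S \<subseteq> {0..L} \<longrightarrow>
    (\<Sum>s\<in>S. a s * cos (\<omega> * x s))\<^sup>2 + (\<Sum>s\<in>S. a s * sin (\<omega> * x s))\<^sup>2
      \<le> C * (1 + \<bar>\<omega>\<bar>) powr p * (\<Sum>s\<in>S. \<Sum>s'\<in>S. a s * a s' * K (x s - x s'))"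
proof -
  \<comment> \<open>Makes p - 2n \<le> -2, so that |\<psi>|^2 remains integrable against the growth
    (1 + |t|)^p of 1 / f.\<close>
  define n where "n = nat \<lceil>p\<rceil> + 2"
  have n: "2 \<le> n" "p - 2 * real n \<le> - 2" using p by (auto simp: n_def) linarith+
  obtain \<psi> Cp where [measurable]: "\<psi> \<in> borel_measurable borel" and Cp: "0 \<le> Cp"
    and \<psi>: "\<And>t. norm (\<psi> t) \<le> Cp * (1 + \<bar>t\<bar>) powr (- real n)"
    and \<psi>1: "\<And>s. s \<in> {0..L} \<Longrightarrow> (CLINT t|lborel. iexp (- (t * s)) * \<psi> t) = 1"
    using plateau_function[OF L n(1)] by blast
  have fm[measurable]: "f \<in> borel_measurable borel" using f by (auto simp: spectral_density_def)
  have fpos: "0 < f u" for u using low[of u] c by (smt (verit) mult_pos_pos powr_gt_zero abs_ge_zero)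
  have \<psi>i: "integrable lborel \<psi>"
    by (rule Bochner_Integration.integrable_bound[OF integrable_mult_right[OF integrable_one_plus_abs_powr[of "real n"], of Cp]])
       (use \<psi> Cp n in \<open>auto simp: abs_mult\<close>)
  define J where "J = (LINT t|lborel. (1 + \<bar>t::real\<bar>) powr (- 2))"
  have J: "J \<ge> 0" unfolding J_def by (intro Bochner_Integration.integral_nonneg) auto
  define C where "C = Cp\<^sup>2 / c * J"
  have C: "C \<ge> 0" using c J by (simp add: C_def)
  have main: "(\<Sum>s\<in>S. a s * cos (\<omega> * x s))\<^sup>2 + (\<Sum>s\<in>S. a s * sin (\<omega> * x s))\<^sup>2
      \<le> C * (1 + \<bar>\<omega>\<bar>) powr p * (\<Sum>s\<in>S. \<Sum>s'\<in>S. a s * a s' * K (x s - x s'))"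
    if fin: "finite S" and S: "x ` S \<subseteq> {0..L}" for \<omega> a and S :: "nat set" and x :: "nat \<Rightarrow> real"
  proof -
    define P where "P u = (\<Sum>s\<in>S. of_real (a s) * iexp (- (u * x s)))" for u :: real
    have [measurable]: "P \<in> borel_measurable borel" unfolding P_def[abs_def] by measurable
    have normP: "(norm (P u))\<^sup>2 = (\<Sum>s\<in>S. a s * cos (u * x s))\<^sup>2 + (\<Sum>s\<in>S. a s * sin (u * x s))\<^sup>2" for u
      unfolding cmod_power2 P_def by (simp add: Re_exp Im_exp sum_negf)
    have Pb: "norm (P u) \<le> (\<Sum>s\<in>S. \<bar>a s\<bar>)" for u
      unfolding P_def by (rule order.trans[OF norm_sum]) (simp add: norm_mult)
    \<comment> \<open>Each exponential is multiplied by the plateau integral, which is 1 at the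
      points x s. So P \<omega> becomes an average of P around \<omega> with weight \<psi>.\<close>
    have "P \<omega> = (\<Sum>s\<in>S. of_real (a s) * iexp (- (\<omega> * x s)) * (CLINT t|lborel. iexp (- (t * x s)) * \<psi> t))"
      unfolding P_def using \<psi>1 S by (intro sum.cong refl) (auto simp: image_subset_iff)
    also have "\<dots> = (\<Sum>s\<in>S. CLINT t|lborel. of_real (a s) * iexp (- (\<omega> * x s)) * (iexp (- (t * x s)) * \<psi> t))"
      by simp
    also have "\<dots> = (CLINT t|lborel. (\<Sum>s\<in>S. of_real (a s) * iexp (- (\<omega> * x s)) * (iexp (- (t * x s)) * \<psi> t)))"
      by (intro Bochner_Integration.integral_sum[symmetric] integrable_mult_right Bochner_Integration.integrable_bound[OF \<psi>i])
         (auto simp: norm_mult)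
    also have "\<dots> = (CLINT t|lborel. P (\<omega> + 1 * t) * \<psi> t)"
      by (intro Bochner_Integration.integral_cong refl)
         (simp add: P_def sum_distrib_right sum_distrib_left distrib_right algebra_simps flip: exp_add)
    finally have "norm (P \<omega>) \<le> (LINT t|lborel. norm (P (\<omega> + 1 * t) * \<psi> t))" by (simp only: integral_norm_bound)
    \<comment> \<open>Splitting off the square root of f prepares Cauchy-Schwarz: the first factor
      has the quadratic form of K as squared norm, the second depends on \<omega> only.\<close>
    also have "\<dots> = (LINT t|lborel. (norm (P (\<omega> + 1 * t)) * sqrt (f (\<omega> + 1 * t))) * (norm (\<psi> t) / sqrt (f (\<omega> + 1 * t))))"
      using fpos by (intro Bochner_Integration.integral_cong refl) (simp add: norm_mult less_imp_neq[symmetric])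
    finally have 1: "norm (P \<omega>) \<le> \<dots>" .
    have UV: "integrable lborel (\<lambda>t. (norm (P (\<omega> + 1 * t)) * sqrt (f (\<omega> + 1 * t))) * (norm (\<psi> t) / sqrt (f (\<omega> + 1 * t))))"
    proof (rule Bochner_Integration.integrable_bound[OF integrable_mult_right[OF integrable_norm[OF \<psi>i], of "\<Sum>s\<in>S. \<bar>a s\<bar>"]])
      show "AE t in lborel. norm ((norm (P (\<omega> + 1 * t)) * sqrt (f (\<omega> + 1 * t))) * (norm (\<psi> t) / sqrt (f (\<omega> + 1 * t)))) \<le> norm ((\<Sum>s\<in>S. \<bar>a s\<bar>) * norm (\<psi> t))"
        using fpos Pb by (intro AE_I2) (simp add: abs_mult less_imp_neq[symmetric] sum_nonneg mult_right_mono less_imp_le)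
    qed measurable
    define g where "g u = f u * (norm (P u))\<^sup>2" for u
    have g: "integrable lborel g" "(\<Sum>s\<in>S. \<Sum>s'\<in>S. a s * a s' * K (x s - x s')) = (LINT u|lborel. g u)"
      unfolding g_def normP using spectral_quadratic_form[OF f] by auto
    have U2eq: "(norm (P (\<omega> + 1 * t)) * sqrt (f (\<omega> + 1 * t)))\<^sup>2 = g (\<omega> + 1 * t)" for t
      using fpos[of "\<omega> + 1 * t"] by (simp add: g_def power_mult_distrib)
    have U2: "integrable lborel (\<lambda>t. (norm (P (\<omega> + 1 * t)) * sqrt (f (\<omega> + 1 * t)))\<^sup>2)"
      unfolding U2eq using g(1) by (subst lborel_integrable_real_affine_iff) auto
    have U2i: "(LINT t|lborel. (norm (P (\<omega> + 1 * t)) * sqrt (f (\<omega> + 1 * t)))\<^sup>2) = (LINT u|lborel. g u)"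
      unfolding U2eq by (subst (2) lborel_integral_real_affine[where c = 1 and t = \<omega>]) auto
    \<comment> \<open>From 1 + |\<omega> + t| \<le> (1 + |\<omega>|) (1 + |t|): the growth in
      \<omega> factors out and is the weight of the statement.\<close>
    have V2b: "(norm (\<psi> t) / sqrt (f (\<omega> + 1 * t)))\<^sup>2 \<le> Cp\<^sup>2 / c * (1 + \<bar>\<omega>\<bar>) powr p * (1 + \<bar>t\<bar>) powr (- 2)" for t
    proof -
      have "(norm (\<psi> t) / sqrt (f (\<omega> + 1 * t)))\<^sup>2 = (norm (\<psi> t))\<^sup>2 * (1 / f (\<omega> + t))"
        using fpos[of "\<omega> + t"] by (simp add: power_divide)
      also have "\<dots> \<le> (Cp * (1 + \<bar>t\<bar>) powr (- real n))\<^sup>2 * ((1 + \<bar>\<omega>\<bar>) powr p * (1 + \<bar>t\<bar>) powr p / c)"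
      proof (intro mult_mono power_mono \<psi>)
        have "1 / f (\<omega> + t) \<le> 1 / (c * (1 + \<bar>\<omega> + t\<bar>) powr (- p))"
          using c low[of "\<omega> + t"] by (intro divide_left_mono mult_pos_pos fpos) auto
        also have "\<dots> = (1 + \<bar>\<omega> + t\<bar>) powr p / c" using c by (simp add: powr_minus field_simps)
        also have "(1 + \<bar>\<omega> + t\<bar>) powr p \<le> ((1 + \<bar>\<omega>\<bar>) * (1 + \<bar>t\<bar>)) powr p"
        proof (intro powr_mono2 p)
          have "0 \<le> \<bar>\<omega>\<bar> * \<bar>t\<bar>" by simp
          then show "1 + \<bar>\<omega> + t\<bar> \<le> (1 + \<bar>\<omega>\<bar>) * (1 + \<bar>t\<bar>)" unfolding ring_distribs by linarith
        qed simp
        also have "\<dots> = (1 + \<bar>\<omega>\<bar>) powr p * (1 + \<bar>t\<bar>) powr p" by (simp add: powr_mult)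
        finally show "1 / f (\<omega> + t) \<le> (1 + \<bar>\<omega>\<bar>) powr p * (1 + \<bar>t\<bar>) powr p / c" using c by (simp add: divide_right_mono)
      qed (use fpos c Cp in \<open>auto intro: less_imp_le\<close>)
      also have "(Cp * (1 + \<bar>t\<bar>) powr (- real n))\<^sup>2 = Cp\<^sup>2 * (1 + \<bar>t\<bar>) powr (- 2 * real n)"
        by (simp add: power_mult_distrib powr_powr mult.commute flip: powr_realpow)
      also have "Cp\<^sup>2 * (1 + \<bar>t\<bar>) powr (- 2 * real n) * ((1 + \<bar>\<omega>\<bar>) powr p * (1 + \<bar>t\<bar>) powr p / c)
         = Cp\<^sup>2 / c * (1 + \<bar>\<omega>\<bar>) powr p * ((1 + \<bar>t\<bar>) powr (p - 2 * real n))" by (simp add: powr_add[symmetric] algebra_simps)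
      also have "\<dots> \<le> Cp\<^sup>2 / c * (1 + \<bar>\<omega>\<bar>) powr p * (1 + \<bar>t\<bar>) powr (- 2)"
        using n c by (intro mult_left_mono powr_mono) auto
      finally show ?thesis .
    qed
    have B: "integrable lborel (\<lambda>t. Cp\<^sup>2 / c * (1 + \<bar>\<omega>\<bar>) powr p * (1 + \<bar>t\<bar>) powr (- 2))"
      by (intro integrable_mult_right integrable_one_plus_abs_powr) simp
    have V2: "integrable lborel (\<lambda>t. (norm (\<psi> t) / sqrt (f (\<omega> + 1 * t)))\<^sup>2)"
      by (rule Bochner_Integration.integrable_bound[OF B]) (use V2b c in \<open>auto simp: abs_mult\<close>)
    have "(norm (P \<omega>))\<^sup>2 \<le> (LINT t|lborel. (norm (P (\<omega> + 1 * t)) * sqrt (f (\<omega> + 1 * t))) * (norm (\<psi> t) / sqrt (f (\<omega> + 1 * t))))\<^sup>2"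
      by (intro power_mono 1) simp
    also have "\<dots> \<le> (LINT u|lborel. g u) * (LINT t|lborel. (norm (\<psi> t) / sqrt (f (\<omega> + 1 * t)))\<^sup>2)"
      using Cauchy_Schwarz_integral[OF UV U2 V2] unfolding U2i .
    also have "\<dots> \<le> (LINT u|lborel. g u) * (LINT t|lborel. Cp\<^sup>2 / c * (1 + \<bar>\<omega>\<bar>) powr p * (1 + \<bar>t\<bar>) powr (- 2))"
    proof (intro mult_left_mono integral_mono V2 B V2b)
      show "0 \<le> (LINT u|lborel. g u)" using fpos by (intro Bochner_Integration.integral_nonneg) (auto simp: g_def less_imp_le)
    qed
    also have "\<dots> = C * (1 + \<bar>\<omega>\<bar>) powr p * (LINT u|lborel. g u)" by (simp add: C_def J_def)
    finally show ?thesis unfolding g(2) normP .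
  qed
  show ?thesis using C main by blast
qed

section \<open>Global bounds from the decay of the densities\<close>

text \<open>The decay condition controls large frequencies; on the remaining compact ball a
  continuous positive function has a positive minimum.\<close>

lemma density_lower_bound:
  assumes cont: "continuous_on UNIV f" and pos: "\<And>\<omega>. 0 < f \<omega>" and q: "0 \<le> q"
    and \<Theta>: "f \<in> \<Theta>[at_infinity](\<lambda>\<omega>. \<bar>\<omega>\<bar> powr (- q))"
  shows "\<exists>c>0. \<forall>\<omega>::real. c * (1 + \<bar>\<omega>\<bar>) powr (- q) \<le> f \<omega>"
proof -
  have "f \<in> \<Omega>[at_infinity](\<lambda>\<omega>. \<bar>\<omega>\<bar> powr (- q))" using \<Theta> by (rule bigthetaD2)
  then obtain c where c: "c > 0" "\<forall>\<^sub>F \<omega> in at_infinity. c * norm (\<bar>\<omega>\<bar> powr (- q)) \<le> norm (f \<omega>)"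
    by (rule landau_omega.bigE) 
  then obtain b where b: "\<And>\<omega>. b \<le> norm \<omega> \<Longrightarrow> c * \<bar>\<omega>\<bar> powr (- q) \<le> f \<omega>"
    using pos unfolding eventually_at_infinity by (auto simp: less_imp_le)
  define B where "B = max b 1"
  have "\<exists>x\<in>cball 0 B. \<forall>y\<in>cball 0 B. f x \<le> f y"
    by (rule continuous_attains_inf) (auto simp: B_def intro: continuous_on_subset[OF cont])
  then obtain x where x: "\<And>y. y \<in> cball 0 B \<Longrightarrow> f x \<le> f y" by blast
  have "min c (f x) * (1 + \<bar>\<omega>\<bar>) powr (- q) \<le> f \<omega>" for \<omega>
  proof (cases "norm \<omega> \<le> B")
    case True
    have "1 + \<bar>\<omega>\<bar> \<noteq> 0" by linarith
    moreover have "(1 + \<bar>\<omega>\<bar>) powr (- q) \<le> (1 + \<bar>\<omega>\<bar>) powr 0" using q by (intro powr_mono) auto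
    ultimately have "(1 + \<bar>\<omega>\<bar>) powr (- q) \<le> 1" by simp
    then have "min c (f x) * (1 + \<bar>\<omega>\<bar>) powr (- q) \<le> f x * 1" using pos[of x] c by (intro mult_mono) auto
    also have "\<dots> \<le> f \<omega>" using x True by simp
    finally show ?thesis .
  next
    case False
    then have w: "1 < \<bar>\<omega>\<bar>" "b \<le> norm \<omega>" by (auto simp: B_def)
    have "(1 + \<bar>\<omega>\<bar>) powr (- q) \<le> \<bar>\<omega>\<bar> powr (- q)" using q w by (intro powr_mono2') auto
    then have "min c (f x) * (1 + \<bar>\<omega>\<bar>) powr (- q) \<le> c * \<bar>\<omega>\<bar> powr (- q)" using c by (intro mult_mono) auto
    also have "\<dots> \<le> f \<omega>" using b w by blast
    finally show ?thesis .
  qed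
  moreover have "min c (f x) > 0" using c pos by simp
  ultimately show ?thesis by blast
qed

text \<open>Far out the product is of order |\<omega>|^(p-q) with q - p > 1; on a bounded set the
  weight is bounded and f integrable. The sum of both majorants avoids splitting the
  integral.\<close>

lemma density_weighted_integrable:
  assumes f: "integrable lborel f" and pos: "\<And>\<omega>. 0 < f \<omega>" and p: "0 \<le> p" "p + 1 < q"
    and \<Theta>: "f \<in> \<Theta>[at_infinity](\<lambda>\<omega>. \<bar>\<omega>\<bar> powr (- q))"
  shows "integrable lborel (\<lambda>\<omega>::real. f \<omega> * (1 + \<bar>\<omega>\<bar>) powr p)"
proof -
  have [measurable]: "f \<in> borel_measurable borel" using f by auto
  have "f \<in> O[at_infinity](\<lambda>\<omega>. \<bar>\<omega>\<bar> powr (- q))" using \<Theta> by (rule bigthetaD1)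
  then obtain c where c: "c > 0" "\<forall>\<^sub>F \<omega> in at_infinity. norm (f \<omega>) \<le> c * norm (\<bar>\<omega>\<bar> powr (- q))"
    by (rule landau_o.bigE)
  then obtain b where b: "\<And>\<omega>. b \<le> norm \<omega> \<Longrightarrow> f \<omega> \<le> c * \<bar>\<omega>\<bar> powr (- q)"
    using pos unfolding eventually_at_infinity by (auto simp: less_imp_le)
  define B where "B = max b 1"
  have le: "f \<omega> * (1 + \<bar>\<omega>\<bar>) powr p \<le> (1 + B) powr p * f \<omega> + c * 2 powr q * (1 + \<bar>\<omega>\<bar>) powr (- (q - p))" for \<omega>
  proof (cases "norm \<omega> \<le> B")
    case True
    then have "f \<omega> * (1 + \<bar>\<omega>\<bar>) powr p \<le> f \<omega> * (1 + B) powr p" using pos[of \<omega>] p by (intro mult_left_mono powr_mono2) auto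
    moreover have "0 \<le> c * 2 powr q * (1 + \<bar>\<omega>\<bar>) powr (- (q - p))" using c by simp
    ultimately show ?thesis by (simp add: mult.commute)
  next
    case False
    then have w: "1 < \<bar>\<omega>\<bar>" "b \<le> norm \<omega>" by (auto simp: B_def)
    \<comment> \<open>For |\<omega>| > 1 one has |\<omega>| \<ge> (1 + |\<omega>|) / 2, whence the
      factor 2^q.\<close>
    have "\<bar>\<omega>\<bar> powr (- q) \<le> ((1 + \<bar>\<omega>\<bar>) / 2) powr (- q)" using w p by (intro powr_mono2') auto
    also have "\<dots> = 2 powr q * (1 + \<bar>\<omega>\<bar>) powr (- q)" by (simp add: powr_divide powr_minus field_simps)
    finally have "f \<omega> \<le> c * (2 powr q * (1 + \<bar>\<omega>\<bar>) powr (- q))" using b[OF w(2)] c by (meson mult_left_mono order.trans less_imp_le)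
    then have "f \<omega> * (1 + \<bar>\<omega>\<bar>) powr p \<le> c * (2 powr q * (1 + \<bar>\<omega>\<bar>) powr (- q)) * (1 + \<bar>\<omega>\<bar>) powr p" by (rule mult_right_mono) simp
    also have "\<dots> = c * 2 powr q * (1 + \<bar>\<omega>\<bar>) powr (- (q - p))" by (simp add: powr_add[symmetric])
    finally show ?thesis using pos[of \<omega>] by (simp add: add_increasing less_imp_le)
  qed
  show ?thesis
  proof (rule Bochner_Integration.integrable_bound)
    show "integrable lborel (\<lambda>\<omega>. (1 + B) powr p * f \<omega> + c * 2 powr q * (1 + \<bar>\<omega>\<bar>) powr (- (q - p)))"
      using p by (intro Bochner_Integration.integrable_add integrable_mult_right f integrable_one_plus_abs_powr) auto
    show "AE \<omega> in lborel. norm (f \<omega> * (1 + \<bar>\<omega>\<bar>) powr p)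
        \<le> norm ((1 + B) powr p * f \<omega> + c * 2 powr q * (1 + \<bar>\<omega>\<bar>) powr (- (q - p)))"
    proof (rule AE_I2)
      fix \<omega> :: real
      have "0 \<le> f \<omega> * (1 + \<bar>\<omega>\<bar>) powr p" using pos[of \<omega>] by simp
      with le[of \<omega>] show "norm (f \<omega> * (1 + \<bar>\<omega>\<bar>) powr p)
        \<le> norm ((1 + B) powr p * f \<omega> + c * 2 powr q * (1 + \<bar>\<omega>\<bar>) powr (- (q - p)))" by (simp only: real_norm_def)
    qed
  qed measurable
qed

section \<open>Series expansions of positive semidefinite kernels\<close>

definition psd_kernel :: "('i \<Rightarrow> 'i \<Rightarrow> real) \<Rightarrow> bool" where
  "psd_kernel K \<longleftrightarrow> (\<forall>x y. K x y = K y x) \<and>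
     (\<forall>S a. finite S \<longrightarrow> 0 \<le> (\<Sum>x\<in>S. \<Sum>y\<in>S. a x * a y * K x y))"

lemma psd_kernel_sym: "psd_kernel K \<Longrightarrow> K x y = K y x"
  and psd_kernel_nonneg: "psd_kernel K \<Longrightarrow> finite S \<Longrightarrow> 0 \<le> (\<Sum>x\<in>S. \<Sum>y\<in>S. a x * a y * K x y)"
  unfolding psd_kernel_def by blast+

lemma psd_kernel_diag: "psd_kernel K \<Longrightarrow> 0 \<le> K x x"
  using psd_kernel_nonneg[of K "{x}" "\<lambda>_. 1"] by simp

text \<open>The map need not be injective: coefficients of points with the same image are added
  up.\<close>

lemma psd_kernel_pullback:
  fixes f :: "'b \<Rightarrow> 'a"
  assumes "psd_kernel K" shows "psd_kernel (\<lambda>p q. K (f p) (f q))"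
  unfolding psd_kernel_def
proof (intro conjI allI impI)
  fix S :: "'b set" and a :: "'b \<Rightarrow> real" assume fin: "finite S"
  define A where "A x = (\<Sum>p\<in>{p \<in> S. f p = x}. a p)" for x
  have grp: "(\<Sum>p\<in>S. a p * g (f p)) = (\<Sum>x\<in>f ` S. A x * g x)" for g
  proof -
    have "(\<Sum>p\<in>S. a p * g (f p)) = (\<Sum>x\<in>f ` S. \<Sum>p\<in>{p \<in> S. f p = x}. a p * g (f p))"
      using fin by (rule sum.image_gen)
    also have "\<dots> = (\<Sum>x\<in>f ` S. A x * g x)" by (intro sum.cong refl) (simp add: A_def sum_distrib_right)
    finally show ?thesis .
  qed
  have "(\<Sum>p\<in>S. \<Sum>q\<in>S. a p * a q * K (f p) (f q)) = (\<Sum>p\<in>S. a p * (\<Sum>q\<in>S. a q * K (f p) (f q)))"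
    by (simp add: sum_distrib_left mult.assoc)
  also have "\<dots> = (\<Sum>p\<in>S. a p * (\<Sum>y\<in>f ` S. A y * K (f p) y))" by (simp only: grp)
  also have "\<dots> = (\<Sum>x\<in>f ` S. A x * (\<Sum>y\<in>f ` S. A y * K x y))" by (rule grp[where g = "\<lambda>x. \<Sum>y\<in>f ` S. A y * K x y"])
  also have "\<dots> = (\<Sum>x\<in>f ` S. \<Sum>y\<in>f ` S. A x * A y * K x y)" by (simp add: sum_distrib_left mult.assoc)
  also have "0 \<le> \<dots>" using assms fin by (intro psd_kernel_nonneg) auto
  finally show "0 \<le> (\<Sum>p\<in>S. \<Sum>q\<in>S. a p * a q * K (f p) (f q))" .
qed (use assms psd_kernel_sym in metis)

lemma psd_kernel_scale:
  fixes K :: "'a \<Rightarrow> 'a \<Rightarrow> real"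
  assumes "psd_kernel K" shows "psd_kernel (\<lambda>x y. c x * c y * K x y)"
  unfolding psd_kernel_def
proof (intro conjI allI impI)
  show "c x * c y * K x y = c y * c x * K y x" for x y using psd_kernel_sym[OF assms, of x y] by simp
  fix S :: "'a set" and a :: "'a \<Rightarrow> real" assume "finite S"
  from psd_kernel_nonneg[OF assms this, of "\<lambda>x. a x * c x"]
  show "0 \<le> (\<Sum>x\<in>S. \<Sum>y\<in>S. a x * a y * (c x * c y * K x y))" by (simp add: mult_ac)
qed

lemma psd_kernel_add: "psd_kernel K \<Longrightarrow> psd_kernel L \<Longrightarrow> psd_kernel (\<lambda>x y. K x y + L x y)"
  unfolding psd_kernel_def by (simp add: distrib_left sum.distrib)

text \<open>The form at the coefficients a plus l times the unit vector at z. As z may already lie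
  in S, its two coefficients are added.\<close>

lemma psd_kernel_insert:
  assumes K: "psd_kernel K" and fin: "finite S"
  shows "0 \<le> (\<Sum>x\<in>S. \<Sum>y\<in>S. a x * a y * K x y) + 2 * l * (\<Sum>x\<in>S. a x * K x z) + l\<^sup>2 * K z z"
proof -
  define a' where "a' x = (if x \<in> S then a x else 0) + (if x = z then l else 0)" for x
  have lin: "(\<Sum>x\<in>insert z S. a' x * g x) = (\<Sum>x\<in>S. a x * g x) + l * g z" for g
  proof -
    have "(\<Sum>x\<in>insert z S. a' x * g x)
      = (\<Sum>x\<in>insert z S. (if x \<in> S then a x else 0) * g x) + (\<Sum>x\<in>insert z S. (if x = z then l else 0) * g x)"
      by (simp add: a'_def distrib_right sum.distrib del: sum.insert)
    also have "(\<Sum>x\<in>insert z S. (if x \<in> S then a x else 0) * g x) = (\<Sum>x\<in>S. a x * g x)"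
      using fin by (intro sum.mono_neutral_cong_right) auto
    also have "(\<Sum>x\<in>insert z S. (if x = z then l else 0) * g x) = (\<Sum>x\<in>{z}. l * g x)"
      using fin by (intro sum.mono_neutral_cong_right) auto
    finally show ?thesis by simp
  qed
  have "0 \<le> (\<Sum>x\<in>insert z S. \<Sum>y\<in>insert z S. a' x * a' y * K x y)"
    using K fin by (intro psd_kernel_nonneg) auto
  also have "\<dots> = (\<Sum>x\<in>insert z S. a' x * (\<Sum>y\<in>insert z S. a' y * K x y))"
    by (simp only: sum_distrib_left mult.assoc)
  also have "\<dots> = (\<Sum>x\<in>S. a x * ((\<Sum>y\<in>S. a y * K x y) + l * K x z)) + l * ((\<Sum>y\<in>S. a y * K z y) + l * K z z)"
    by (simp only: lin)
  also have "(\<Sum>y\<in>S. a y * K z y) = (\<Sum>x\<in>S. a x * K x z)" using psd_kernel_sym[OF K] by (intro sum.cong) auto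
  also have "(\<Sum>x\<in>S. a x * ((\<Sum>y\<in>S. a y * K x y) + l * K x z)) + l * ((\<Sum>x\<in>S. a x * K x z) + l * K z z)
    = (\<Sum>x\<in>S. \<Sum>y\<in>S. a x * a y * K x y) + 2 * l * (\<Sum>x\<in>S. a x * K x z) + l\<^sup>2 * K z z"
    by (simp add: distrib_left sum.distrib sum_distrib_left power2_eq_square algebra_simps)
  finally show ?thesis .
qed

lemma quadratic_nonneg_discriminant:
  fixes Q B D :: real
  assumes "\<And>l. 0 \<le> Q + 2 * l * B + l\<^sup>2 * D" and D: "0 \<le> D"
  shows "B\<^sup>2 \<le> Q * D"
proof (cases "D = 0")
  case True
  have "B = 0"
  proof (rule ccontr)
    assume "B \<noteq> 0"
    \<comment> \<open>With D = 0 the expression is affine in l, and this l gives it the value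
      -1.\<close>
    then show False using assms(1)[of "- (Q + 1) / (2 * B)"] True by (simp add: field_simps)
  qed
  then show ?thesis using True by simp
next
  case False
  then have "D > 0" using D by simp
  have "0 \<le> Q + 2 * (- B / D) * B + (- B / D)\<^sup>2 * D" by (rule assms(1))
  also have "\<dots> = Q - B\<^sup>2 / D" using \<open>D > 0\<close> by (simp add: power2_eq_square field_simps)
  finally show ?thesis using \<open>D > 0\<close> by (simp add: field_simps)
qed

lemma psd_kernel_Cauchy_Schwarz:
  assumes K: "psd_kernel K" and fin: "finite S"
  shows "(\<Sum>x\<in>S. a x * K x z)\<^sup>2 \<le> (\<Sum>x\<in>S. \<Sum>y\<in>S. a x * a y * K x y) * K z z"
  by (intro quadratic_nonneg_discriminant psd_kernel_insert psd_kernel_diag K fin)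

lemma psd_kernel_Cauchy_Schwarz': "psd_kernel K \<Longrightarrow> (K x z)\<^sup>2 \<le> K x x * K z z"
  using psd_kernel_Cauchy_Schwarz[of K "{x}" "\<lambda>_. 1" z] by simp

text \<open>Iterated Schur complements: the covariance left after projecting out the values at t 0,
  ..., t (n-1). A zero pivot leaves the kernel unchanged because division by 0 gives 0.\<close>

primrec schur :: "(nat \<Rightarrow> 'i) \<Rightarrow> ('i \<Rightarrow> 'i \<Rightarrow> real) \<Rightarrow> nat \<Rightarrow> 'i \<Rightarrow> 'i \<Rightarrow> real" where
  "schur t K 0 = K"
| "schur t K (Suc n) = (\<lambda>x y. schur t K n x y - schur t K n x (t n) * schur t K n y (t n) / schur t K n (t n) (t n))"

text \<open>Nonnegativity of the complement is the Cauchy-Schwarz inequality against the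
  pivot.\<close>

lemma psd_schur: fixes K :: "'a \<Rightarrow> 'a \<Rightarrow> real" assumes "psd_kernel K" shows "psd_kernel (schur t K n)"
proof (induction n)
  case (Suc n)
  define R where "R = schur t K n"
  define z where "z = t n"
  have R: "psd_kernel R" using Suc by (simp add: R_def)
  have "psd_kernel (\<lambda>x y. R x y - R x z * R y z / R z z)"
    unfolding psd_kernel_def
  proof (intro conjI allI impI)
    show "R x y - R x z * R y z / R z z = R y x - R y z * R x z / R z z" for x y
      using psd_kernel_sym[OF R, of x y] by simp
    fix S :: "'a set" and a :: "'a \<Rightarrow> real" assume fin: "finite S"
    have "(\<Sum>x\<in>S. \<Sum>y\<in>S. a x * a y * (R x y - R x z * R y z / R z z))
       = (\<Sum>x\<in>S. \<Sum>y\<in>S. a x * a y * R x y) - (\<Sum>x\<in>S. \<Sum>y\<in>S. (a x * R x z) * (a y * R y z)) / R z z"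
      by (simp add: right_diff_distrib sum_subtractf sum_divide_distrib mult_ac)
    also have "(\<Sum>x\<in>S. \<Sum>y\<in>S. (a x * R x z) * (a y * R y z)) = (\<Sum>x\<in>S. a x * R x z)\<^sup>2"
      by (simp add: power2_eq_square sum_product)
    also have "0 \<le> (\<Sum>x\<in>S. \<Sum>y\<in>S. a x * a y * R x y) - (\<Sum>x\<in>S. a x * R x z)\<^sup>2 / R z z"
    proof (cases "R z z = 0")
      case True
      then show ?thesis using psd_kernel_nonneg[OF R fin, of a] by simp
    next
      case False
      then have "R z z > 0" using psd_kernel_diag[OF R, of z] by simp
      then show ?thesis using psd_kernel_Cauchy_Schwarz[OF R fin, of a z] by (simp add: pos_divide_le_eq)
    qed
    finally show "0 \<le> (\<Sum>x\<in>S. \<Sum>y\<in>S. a x * a y * (R x y - R x z * R y z / R z z))" .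
  qed
  then show ?case by (simp add: R_def z_def)
qed (use assms in simp)

text \<open>A nonzero pivot is eliminated by construction, and later steps preserve the zero row. If
  the pivot is 0, Cauchy-Schwarz shows that its row vanished before.\<close>

lemma schur_pivot:
  assumes K: "psd_kernel K" and "i < n"
  shows "schur t K n x (t i) = 0"
  using assms(2)
proof (induction n arbitrary: x)
  case (Suc n)
  note R = psd_schur[OF K, of t n]
  show ?case
  proof (cases "i = n")
    case True
    show ?thesis
    proof (cases "schur t K n (t n) (t n) = 0")
      case z: True
      then have "(schur t K n x (t n))\<^sup>2 \<le> 0" using psd_kernel_Cauchy_Schwarz'[OF R, of x "t n"] by simp
      then have "schur t K n x (t n) = 0" by simp
      then show ?thesis using True z by simp
    next
      case False
      then show ?thesis using True by simp
    qed
  next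
    case False
    then have "i < n" using Suc.prems by simp
    then have "schur t K n y (t i) = 0" for y by (rule Suc.IH)
    moreover have "schur t K n (t i) (t n) = schur t K n (t n) (t i)" by (rule psd_kernel_sym[OF R])
    ultimately show ?thesis by simp
  qed
qed simp

text \<open>Gram-Schmidt along t, that is an infinite Cholesky factorisation: \<open>b n\<close> is
  the n-th eliminated column divided by the root of its pivot. The matrix b n (t i) is triangular, a
  zero pivot makes \<open>b n\<close> vanish altogether, and R is the covariance of what the points
  t i do not determine.\<close>

lemma psd_kernel_expansion:
  fixes t :: "nat \<Rightarrow> 'i"
  assumes K: "psd_kernel K"
  shows "\<exists>b R. psd_kernel R \<and> (\<forall>x. summable (\<lambda>n. (b n x)\<^sup>2)) \<and> (\<forall>x y. (\<lambda>n. b n x * b n y) sums (K x y - R x y))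
    \<and> (\<forall>i x. R x (t i) = 0) \<and> (\<forall>n i. i < n \<longrightarrow> b n (t i) = 0)
    \<and> (\<forall>n x. b n (t n) = 0 \<longrightarrow> b n x = 0)"
proof -
  define b where "b n x = schur t K n x (t n) / sqrt (schur t K n (t n) (t n))" for n x
  have step: "schur t K (Suc n) x y = schur t K n x y - b n x * b n y" for n x y
    using psd_kernel_diag[OF psd_schur[OF K], of t n "t n"] by (simp add: b_def)
  have part: "(\<Sum>n<N. b n x * b n y) = K x y - schur t K N x y" for N x y
    by (induction N) (simp_all add: step del: schur.simps(2))
  have sq: "summable (\<lambda>n. (b n x)\<^sup>2)" for x
  proof (rule bounded_imp_summable)
    show "(\<Sum>n\<le>N. (b n x)\<^sup>2) \<le> K x x" for N
      using part[of x x "Suc N"] psd_kernel_diag[OF psd_schur[OF K], of t "Suc N" x]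
      by (simp add: power2_eq_square lessThan_Suc_atMost del: schur.simps(2))
  qed simp
  have sm: "summable (\<lambda>n. b n x * b n y)" for x y
  proof (rule summable_comparison_test)
    show "\<exists>N. \<forall>n\<ge>N. norm (b n x * b n y) \<le> (b n x)\<^sup>2 + (b n y)\<^sup>2"
    proof (intro exI allI impI)
      fix n
      have "\<bar>b n x\<bar> * \<bar>b n y\<bar> * 2 \<le> (b n x)\<^sup>2 + (b n y)\<^sup>2" using sum_squares_bound[of "\<bar>b n x\<bar>" "\<bar>b n y\<bar>"] by (simp add: mult_ac)
      moreover have "0 \<le> \<bar>b n x\<bar> * \<bar>b n y\<bar>" by simp
      ultimately show "norm (b n x * b n y) \<le> (b n x)\<^sup>2 + (b n y)\<^sup>2" unfolding real_norm_def abs_mult by linarith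
    qed
    show "summable (\<lambda>n. (b n x)\<^sup>2 + (b n y)\<^sup>2)" by (intro summable_add sq)
  qed
  define R where "R x y = K x y - (\<Sum>n. b n x * b n y)" for x y
  have lim: "(\<lambda>N. schur t K N x y) \<longlonglongrightarrow> R x y" for x y
  proof -
    have "(\<lambda>N. K x y - (\<Sum>n<N. b n x * b n y)) \<longlonglongrightarrow> R x y"
      unfolding R_def by (intro tendsto_diff tendsto_const summable_LIMSEQ sm)
    then show ?thesis by (simp add: part)
  qed
  have "psd_kernel R" unfolding psd_kernel_def
  proof (intro conjI allI impI)
    show "R x y = R y x" for x y unfolding R_def using psd_kernel_sym[OF K, of x y] by (simp add: mult.commute)
    fix S :: "'i set" and a :: "'i \<Rightarrow> real" assume fin: "finite S"
    have "(\<lambda>N. \<Sum>x\<in>S. \<Sum>y\<in>S. a x * a y * schur t K N x y) \<longlonglongrightarrow> (\<Sum>x\<in>S. \<Sum>y\<in>S. a x * a y * R x y)"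
      by (intro tendsto_sum tendsto_mult tendsto_const lim)
    then show "0 \<le> (\<Sum>x\<in>S. \<Sum>y\<in>S. a x * a y * R x y)"
      by (rule LIMSEQ_le_const) (use psd_kernel_nonneg[OF psd_schur[OF K] fin] in blast)
  qed
  moreover have "R x (t i) = 0" for x i
  proof (rule LIMSEQ_unique[OF lim])
    have "\<forall>\<^sub>F N in sequentially. schur t K N x (t i) = 0"
      using eventually_gt_at_top[of i] by eventually_elim (rule schur_pivot[OF K])
    then show "(\<lambda>N. schur t K N x (t i)) \<longlonglongrightarrow> 0" by (rule tendsto_eventually)
  qed
  moreover have "b n (t i) = 0" if "i < n" for n i
  proof -
    have "schur t K n (t i) (t n) = 0"
      using schur_pivot[OF K that, of t "t n"] psd_kernel_sym[OF psd_schur[OF K]] by metis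
    then show ?thesis by (simp add: b_def)
  qed
  moreover have "b n x = 0" if "b n (t n) = 0" for n x
    using that by (simp add: b_def)
  moreover have "(\<lambda>n. b n x * b n y) sums (K x y - R x y)" for x y
    using summable_sums[OF sm] by (simp add: R_def)
  ultimately show ?thesis using sq by blast
qed

text \<open>The K-distance of x to t i equals the square sum of differences of expansion
  coefficients plus R x x. Hence R x x is below any such distance, and density of the pivots makes
  it 0.\<close>

lemma residual_zero_of_dense:
  assumes R: "psd_kernel R" and b: "\<And>x y. (\<lambda>n. b n x * b n y :: real) sums (K x y - R x y)"
    and piv: "\<And>i x. R x (t i) = 0"
    and dense: "\<And>\<epsilon>. \<epsilon> > 0 \<Longrightarrow> \<exists>i::nat. K x x - 2 * K x (t i) + K (t i) (t i) < \<epsilon>"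
  shows "R x y = 0"
proof -
  have "R x x \<le> 0 + \<epsilon>" if \<epsilon>: "\<epsilon> > 0" for \<epsilon>
  proof -
    obtain i where i: "K x x - 2 * K x (t i) + K (t i) (t i) < \<epsilon>" using dense[OF \<epsilon>] by blast
    have "(\<lambda>n. (b n x * b n x - 2 * (b n x * b n (t i))) + b n (t i) * b n (t i))
       sums ((K x x - R x x) - 2 * (K x (t i) - R x (t i)) + (K (t i) (t i) - R (t i) (t i)))"
      by (intro sums_add sums_diff sums_mult b)
    moreover have "(b n x * b n x - 2 * (b n x * b n (t i))) + b n (t i) * b n (t i) = (b n x - b n (t i))\<^sup>2" for n
      by (simp add: power2_eq_square algebra_simps)
    ultimately have "(\<lambda>n. (b n x - b n (t i))\<^sup>2) sums (K x x - 2 * K x (t i) + K (t i) (t i) - R x x)" by (simp add: piv algebra_simps)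
    then have "0 \<le> K x x - 2 * K x (t i) + K (t i) (t i) - R x x" by (rule sums_le[OF _ sums_zero, rotated]) auto
    then show ?thesis using i by linarith
  qed
  then have "R x x \<le> 0" by (rule field_le_epsilon)
  then have "R x x = 0" using psd_kernel_diag[OF R, of x] by linarith
  then have "(R x y)\<^sup>2 \<le> 0" using psd_kernel_Cauchy_Schwarz'[OF R, of x y] by simp
  then show ?thesis by simp
qed

section \<open>Gaussian fields from series expansions of their covariance\<close>

text \<open>Levy's uniqueness theorem after normalising to variance 1; variance 0 is separate
  because the limit law is a point mass and has no density.\<close>

lemma centered_normal_from_char:
  assumes M: "prob_space M" and Vm[measurable]: "V \<in> borel_measurable M" and v: "0 \<le> v"
    and char_V: "\<And>t. char (distr M borel V) t = complex_of_real (exp (- (v * t\<^sup>2) / 2))"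
  shows "gaussian_rv M V" "(LINT x|M. V x) = 0" "(LINT x|M. (V x)\<^sup>2) = v"
proof -
  interpret prob_space M by fact
  have rd: "real_distribution (distr M borel W)" if [measurable]: "W \<in> borel_measurable M" for W
  proof -
    interpret D: prob_space "distr M borel W" by (rule prob_space_distr) simp
    show ?thesis by unfold_locales simp
  qed
  have "gaussian_rv M V \<and> (LINT x|M. V x) = 0 \<and> (LINT x|M. (V x)\<^sup>2) = v"
  proof (cases "v = 0")
    case True
    interpret R: prob_space "return borel (0::real)" by (rule prob_space_return) simp
    have "distr M borel V = return borel 0"
    proof (rule Levy_uniqueness[OF rd[OF Vm]])
      show "real_distribution (return borel (0::real))" by unfold_locales simp
      show "char (distr M borel V) = char (return borel 0)"
      proof
        fix t
        have "char (distr M borel V) t = 1" unfolding char_V True by simp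
        moreover have "char (return borel 0) t = 1" by (simp add: char_def integral_return)
        ultimately show "char (distr M borel V) t = char (return borel 0) t" by simp
      qed
    qed
    moreover have "AE x in return borel (0::real). x = 0" by (subst AE_return) auto
    ultimately have "AE x in distr M borel V. x = 0" by (simp only:)
    then have V0: "AE x in M. V x = 0" by (subst (asm) AE_distr_iff) auto
    have "(LINT x|M. V x) = (LINT x|M. 0)" "(LINT x|M. (V x)\<^sup>2) = (LINT x|M. 0)"
      by (rule integral_cong_AE; use V0 in auto)+
    then show ?thesis using V0 True by (auto simp: gaussian_rv_def)
  next
    case False
    define \<sigma> where "\<sigma> = sqrt v"
    have \<sigma>: "0 < \<sigma>" "\<sigma>\<^sup>2 = v" using False v by (simp_all add: \<sigma>_def)
    define W where "W x = V x / \<sigma>" for x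
    have [measurable]: "W \<in> borel_measurable M" unfolding W_def[abs_def] by measurable
    have "distr M borel W = std_normal_distribution"
    proof (rule Levy_uniqueness[OF rd real_dist_normal_dist])
      show "char (distr M borel W) = char std_normal_distribution"
      proof
        fix t
        have "char (distr M borel W) t = char (distr M borel V) (t / \<sigma>)"
          by (simp add: char_def integral_distr W_def)
        also have "\<dots> = complex_of_real (exp (- t\<^sup>2 / 2))"
          unfolding char_V using \<sigma> False by (simp add: power_divide)
        finally show "char (distr M borel W) t = char std_normal_distribution t" by (simp add: char_std_normal_distribution)
      qed
    qed simp
    moreover have "distr M borel W = distr M lborel W" by (rule distr_cong) auto
    ultimately have W: "distributed M lborel W std_normal_density" by (simp add: distributed_def)
    have "distributed M lborel (\<lambda>x. 0 + \<sigma> * W x) (normal_density (0 + \<sigma> * 0) (\<bar>\<sigma>\<bar> * 1))"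
      using \<sigma> by (intro normal_density_affine W) auto
    then have V: "distributed M lborel V (\<lambda>x. ennreal (normal_density 0 \<sigma> x))"
      using \<sigma> by (simp add: W_def)
    have "expectation V = 0" using normal_distributed_expectation[OF \<sigma>(1) V] .
    moreover have "expectation (\<lambda>x. (V x)\<^sup>2) = v"
      using normal_distributed_variance[OF \<sigma>(1) V] \<open>expectation V = 0\<close> \<sigma> by simp
    ultimately show ?thesis using V \<sigma> by (auto simp: gaussian_rv_def)
  qed
  then show "gaussian_rv M V" "(LINT x|M. V x) = 0" "(LINT x|M. (V x)\<^sup>2) = v" by auto
qed

section \<open>Independent normal sequences and series in them\<close>

definition normal_seq :: "(nat \<Rightarrow> real) measure" where
  "normal_seq = PiM UNIV (\<lambda>_. std_normal_distribution)"

lemma sets_normal_seq[measurable_cong]: "sets normal_seq = sets (PiM UNIV (\<lambda>_. borel))"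
  unfolding normal_seq_def by (rule sets_PiM_cong) auto

lemma space_normal_seq[simp]: "space normal_seq = UNIV"
  by (simp add: normal_seq_def space_PiM PiE_def)

lemma prob_space_normal_seq: "prob_space normal_seq"
proof -
  interpret real_distribution std_normal_distribution by (rule real_dist_normal_dist)
  show ?thesis unfolding normal_seq_def by (intro prob_space_PiM) unfold_locales
qed

lemma distr_normal_seq_component: "distr normal_seq borel (\<lambda>\<omega>. \<omega> n) = std_normal_distribution"
proof -
  interpret real_distribution std_normal_distribution by (rule real_dist_normal_dist)
  interpret product_prob_space "\<lambda>_::nat. std_normal_distribution" UNIV by unfold_locales
  have "distr normal_seq borel (\<lambda>\<omega>. \<omega> n) = distr normal_seq std_normal_distribution (\<lambda>\<omega>. \<omega> n)" by (rule distr_cong) auto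
  also have "\<dots> = std_normal_distribution" unfolding normal_seq_def by (rule PiM_component) simp
  finally show ?thesis .
qed

lemma indep_normal_seq: "prob_space.indep_vars normal_seq (\<lambda>_. borel) (\<lambda>n \<omega>. \<omega> n) UNIV"
proof -
  interpret prob_space normal_seq by (rule prob_space_normal_seq)
  have "distr normal_seq (PiM UNIV (\<lambda>_. borel)) (\<lambda>x. \<lambda>i\<in>UNIV. x i) = distr normal_seq normal_seq (\<lambda>x. x)"
    by (rule distr_cong) (auto simp: sets_normal_seq)
  also have "\<dots> = PiM UNIV (\<lambda>i. distr normal_seq borel (\<lambda>\<omega>. \<omega> i))"
    unfolding distr_normal_seq_component by (simp add: distr_id2) (simp add: normal_seq_def)
  finally show ?thesis by (subst indep_vars_iff_distr_eq_PiM') auto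
qed

lemma char_normal_seq_sum:
  assumes "finite A"
  shows "char (distr normal_seq borel (\<lambda>\<omega>. \<Sum>n\<in>A. c n * \<omega> n)) t = complex_of_real (exp (- ((\<Sum>n\<in>A. (c n)\<^sup>2) * t\<^sup>2) / 2))"
proof -
  interpret prob_space normal_seq by (rule prob_space_normal_seq)
  have one: "char (distr normal_seq borel (\<lambda>\<omega>. c n * \<omega> n)) t = complex_of_real (exp (- ((c n)\<^sup>2 * t\<^sup>2) / 2))" for n
  proof -
    have "char (distr normal_seq borel (\<lambda>\<omega>. c n * \<omega> n)) t = char (distr normal_seq borel (\<lambda>\<omega>. \<omega> n)) (t * c n)"
      by (simp add: char_def integral_distr mult.assoc)
    then show ?thesis unfolding distr_normal_seq_component char_std_normal_distribution
      by (simp add: power_mult_distrib mult.commute)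
  qed
  have "indep_vars (\<lambda>_. borel) (\<lambda>n \<omega>. c n * \<omega> n) UNIV"
    by (rule indep_vars_compose2[OF indep_normal_seq, where Y = "\<lambda>n x. c n * x"]) simp
  then have "indep_vars (\<lambda>_. borel) (\<lambda>n \<omega>. c n * \<omega> n) A" by (rule indep_vars_subset) simp
  then have "char (distr normal_seq borel (\<lambda>\<omega>. \<Sum>n\<in>A. c n * \<omega> n)) t = (\<Prod>n\<in>A. complex_of_real (exp (- ((c n)\<^sup>2 * t\<^sup>2) / 2)))"
    by (subst char_distr_sum) (auto simp: one)
  also have "\<dots> = complex_of_real (\<Prod>n\<in>A. exp (- ((c n)\<^sup>2 * t\<^sup>2) / 2))" by simp
  also have "(\<Prod>n\<in>A. exp (- ((c n)\<^sup>2 * t\<^sup>2) / 2)) = exp (\<Sum>n\<in>A. - ((c n)\<^sup>2 * t\<^sup>2) / 2)" using assms by (simp add: exp_sum)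
  also have "(\<Sum>n\<in>A. - ((c n)\<^sup>2 * t\<^sup>2) / 2) = - ((\<Sum>n\<in>A. (c n)\<^sup>2) * t\<^sup>2) / 2"
    by (simp add: sum_negf sum_divide_distrib[symmetric] sum_distrib_right)
  finally show ?thesis .
qed

text \<open>Cauchy-Schwarz against the constant 1 passes from variance to first absolute moment; so
  square summability makes the partial sums Cauchy in L1.\<close>

lemma normal_seq_sum_L1:
  assumes "finite A"
  shows "integrable normal_seq (\<lambda>\<omega>. \<Sum>n\<in>A. c n * \<omega> n)"
    and "(LINT \<omega>|normal_seq. \<bar>\<Sum>n\<in>A. c n * \<omega> n\<bar>) \<le> sqrt (\<Sum>n\<in>A. (c n)\<^sup>2)"
proof -
  interpret prob_space normal_seq by (rule prob_space_normal_seq)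
  define V where "V \<omega> = (\<Sum>n\<in>A. c n * \<omega> n)" for \<omega> :: "nat \<Rightarrow> real"
  have [measurable]: "V \<in> borel_measurable normal_seq" unfolding V_def[abs_def] by measurable
  have v0: "0 \<le> (\<Sum>n\<in>A. (c n)\<^sup>2)" by (intro sum_nonneg) simp
  note V = centered_normal_from_char[OF prob_space_axioms _ v0 char_normal_seq_sum[OF assms, of c, folded V_def], folded V_def, simplified]
  note mom = centered_gaussian_moments(1)[OF prob_space_axioms V(1,2)]
  have int: "integrable normal_seq V" using mom[of 1] by simp
  then show "integrable normal_seq (\<lambda>\<omega>. \<Sum>n\<in>A. c n * \<omega> n)" by (simp add: V_def[abs_def])
  have "(LINT \<omega>|normal_seq. \<bar>V \<omega>\<bar> * 1)\<^sup>2 \<le> (LINT \<omega>|normal_seq. \<bar>V \<omega>\<bar> ^ 2) * (LINT \<omega>|normal_seq. 1 ^ 2)"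
    using int mom[of 2] by (intro Cauchy_Schwarz_integral) auto
  then have "(LINT \<omega>|normal_seq. \<bar>V \<omega>\<bar>)\<^sup>2 \<le> (\<Sum>n\<in>A. (c n)\<^sup>2)" using V(3) prob_space by simp
  then show "(LINT \<omega>|normal_seq. \<bar>\<Sum>n\<in>A. c n * \<omega> n\<bar>) \<le> sqrt (\<Sum>n\<in>A. (c n)\<^sup>2)"
    unfolding V_def by (rule real_le_rsqrt)
qed

text \<open>Completeness of L1 by hand: a subsequence with increments of L1 size at most 2^(-k)
  converges absolutely almost everywhere, and the tail bound r N carries the limit over to the full
  sequence.\<close>

lemma gaussian_series_exists:
  assumes c: "summable (\<lambda>n. (c n :: real)\<^sup>2)"
  shows "\<exists>G. integrable normal_seq G \<and> (\<lambda>N. LINT \<omega>|normal_seq. \<bar>G \<omega> - (\<Sum>n<N. c n * \<omega> n)\<bar>) \<longlonglongrightarrow> 0"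
proof -
  interpret prob_space normal_seq by (rule prob_space_normal_seq)
  define S where "S N \<omega> = (\<Sum>n<N. c n * \<omega> n)" for N and \<omega> :: "nat \<Rightarrow> real"
  define r where "r N = sqrt (\<Sum>n. (c (n + N))\<^sup>2)" for N
  have Si: "integrable normal_seq (S N)" for N unfolding S_def[abs_def] by (rule normal_seq_sum_L1) simp
  have [measurable]: "S N \<in> borel_measurable normal_seq" for N using Si by auto
  have dist: "(LINT \<omega>|normal_seq. \<bar>S N' \<omega> - S N \<omega>\<bar>) \<le> r N" if "N \<le> N'" for N N'
  proof -
    have "S N' \<omega> - S N \<omega> = (\<Sum>n\<in>{N..<N'}. c n * \<omega> n)" for \<omega>
      unfolding S_def using that by (simp add: sum_diff_nat_ivl atLeast0LessThan[symmetric])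
    then have "(LINT \<omega>|normal_seq. \<bar>S N' \<omega> - S N \<omega>\<bar>) \<le> sqrt (\<Sum>n\<in>{N..<N'}. (c n)\<^sup>2)"
      using normal_seq_sum_L1(2)[of "{N..<N'}" c] by simp
    also have "(\<Sum>n\<in>{N..<N'}. (c n)\<^sup>2) = (\<Sum>n<N' - N. (c (n + N))\<^sup>2)"
      using that sum.shift_bounds_nat_ivl[of "\<lambda>n. (c n)\<^sup>2" 0 N "N' - N"] by (simp add: atLeast0LessThan)
    also have "\<dots> \<le> (\<Sum>n. (c (n + N))\<^sup>2)"
      using summable_ignore_initial_segment[OF c, of N] by (intro sum_le_suminf) auto
    finally show ?thesis by (simp add: r_def)
  qed
  have r0: "r \<longlonglongrightarrow> 0"
  proof -
    have "(\<lambda>N. (\<Sum>n. (c n)\<^sup>2) - (\<Sum>n<N. (c n)\<^sup>2)) \<longlonglongrightarrow> (\<Sum>n. (c n)\<^sup>2) - (\<Sum>n. (c n)\<^sup>2)"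
      by (intro tendsto_diff tendsto_const summable_LIMSEQ c)
    then have "(\<lambda>N. sqrt (\<Sum>n. (c (n + N))\<^sup>2)) \<longlonglongrightarrow> sqrt 0"
      by (intro tendsto_real_sqrt) (simp add: suminf_minus_initial_segment[OF c])
    then show ?thesis by (simp add: r_def[abs_def])
  qed
  have "\<exists>N. \<forall>n\<ge>N. r n \<le> (1/2) ^ k" for k
  proof -
    have "\<forall>\<^sub>F n in sequentially. r n < (1/2) ^ k" using r0 by (rule order_tendstoD) simp
    then show ?thesis by (auto simp: eventually_sequentially intro: less_imp_le)
  qed
  then obtain N where N: "\<And>k n. N k \<le> n \<Longrightarrow> r n \<le> (1/2) ^ k" by metis
  \<comment> \<open>The sum makes m monotone and at least N k; the summand k ensures m k \<ge> k,
    which is needed to compare S N with S (m N).\<close>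
  define m where "m k = k + (\<Sum>j\<le>k. N j)" for k
  have mN: "N k \<le> m k" for k unfolding m_def by (rule order.trans[OF member_le_sum[of k "{..k}" N]]) auto
  have m_mono: "m k \<le> m (Suc k)" for k by (simp add: m_def)
  have m_ge: "k \<le> m k" for k by (simp add: m_def)
  define D where "D k \<omega> = S (m (Suc k)) \<omega> - S (m k) \<omega>" for k \<omega>
  have Di: "integrable normal_seq (D k)" for k unfolding D_def[abs_def] by (intro Bochner_Integration.integrable_diff Si)
  have [measurable]: "D k \<in> borel_measurable normal_seq" for k using Di by auto
  have Db: "(LINT \<omega>|normal_seq. \<bar>D k \<omega>\<bar>) \<le> (1/2) ^ k" for k
    unfolding D_def by (rule order.trans[OF dist[OF m_mono] N[OF mN]])
  have sD: "summable (\<lambda>k. LINT \<omega>|normal_seq. \<bar>D (k + K) \<omega>\<bar>)" for K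
  proof (rule summable_comparison_test)
    show "\<exists>N. \<forall>n\<ge>N. norm (LINT \<omega>|normal_seq. \<bar>D (n + K) \<omega>\<bar>) \<le> (1/2) ^ n * (1/2) ^ K"
      using Db by (intro exI[of _ 0]) (auto simp: power_add[symmetric])
    show "summable (\<lambda>n. (1/2) ^ n * (1/2::real) ^ K)" by (intro summable_mult2 summable_geometric) simp
  qed
  have AE_sum: "AE \<omega> in normal_seq. summable (\<lambda>k. \<bar>D k \<omega>\<bar>)"
  proof -
    have "(\<integral>\<^sup>+\<omega>. (\<Sum>k. ennreal \<bar>D k \<omega>\<bar>) \<partial>normal_seq) = (\<Sum>k. \<integral>\<^sup>+\<omega>. ennreal \<bar>D k \<omega>\<bar> \<partial>normal_seq)"
      by (rule nn_integral_suminf) measurable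
    also have "\<dots> = (\<Sum>k. ennreal (LINT \<omega>|normal_seq. \<bar>D k \<omega>\<bar>))"
      by (intro suminf_cong nn_integral_eq_integral) (use Di in auto)
    also have "\<dots> = ennreal (\<Sum>k. LINT \<omega>|normal_seq. \<bar>D k \<omega>\<bar>)"
      using sD[of 0] by (intro suminf_ennreal2) auto
    finally have "(\<integral>\<^sup>+\<omega>. (\<Sum>k. ennreal \<bar>D k \<omega>\<bar>) \<partial>normal_seq) \<noteq> \<infinity>" by simp
    then have "AE \<omega> in normal_seq. (\<Sum>k. ennreal \<bar>D k \<omega>\<bar>) \<noteq> \<infinity>"
      by (intro nn_integral_PInf_AE) auto
    then show ?thesis
    proof eventually_elim
      case (elim \<omega>)
      show ?case by (rule summable_suminf_not_top) (use elim in auto)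
    qed
  qed
  define G where "G \<omega> = S (m 0) \<omega> + (\<Sum>k. D k \<omega>)" for \<omega>
  have tailAE: "AE \<omega> in normal_seq. G \<omega> - S (m K) \<omega> = (\<Sum>k. D (k + K) \<omega>)" for K
    using AE_sum
  proof eventually_elim
    case (elim \<omega>)
    then have "summable (\<lambda>k. D k \<omega>)" by (rule summable_rabs_cancel)
    then have "(\<Sum>k. D k \<omega>) = (\<Sum>k. D (k + K) \<omega>) + (\<Sum>k<K. D k \<omega>)" by (rule suminf_split_initial_segment)
    moreover have "(\<Sum>k<K. D k \<omega>) = S (m K) \<omega> - S (m 0) \<omega>" unfolding D_def by (rule sum_lessThan_telescope)
    ultimately show ?case by (simp add: G_def)
  qed
  have AEK: "AE \<omega> in normal_seq. summable (\<lambda>k. norm (D (k + K) \<omega>))" for K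
    using AE_sum
  proof eventually_elim
    case (elim \<omega>)
    from summable_ignore_initial_segment[OF this, of K] show ?case by simp
  qed
  have Ii: "integrable normal_seq (\<lambda>\<omega>. \<Sum>k. D (k + K) \<omega>)" for K
    using Di AEK sD by (intro integrable_suminf) auto
  have Gi: "integrable normal_seq G"
    using Ii[of 0] unfolding G_def[abs_def] by (intro Bochner_Integration.integrable_add Si) simp
  have tail: "(LINT \<omega>|normal_seq. \<bar>G \<omega> - S (m K) \<omega>\<bar>) \<le> 2 * (1/2) ^ K" for K
  proof -
    have "(LINT \<omega>|normal_seq. \<bar>G \<omega> - S (m K) \<omega>\<bar>) = (LINT \<omega>|normal_seq. \<bar>\<Sum>k. D (k + K) \<omega>\<bar>)"
      using Gi by (intro integral_cong_AE) (use tailAE[of K] in auto)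
    also have "\<dots> \<le> (LINT \<omega>|normal_seq. (\<Sum>k. \<bar>D (k + K) \<omega>\<bar>))"
    proof (rule integral_mono_AE)
      show "integrable normal_seq (\<lambda>\<omega>. \<bar>\<Sum>k. D (k + K) \<omega>\<bar>)" by (intro integrable_abs Ii)
      show "integrable normal_seq (\<lambda>\<omega>. \<Sum>k. \<bar>D (k + K) \<omega>\<bar>)"
        using Di AEK sD by (intro integrable_suminf) auto
      show "AE \<omega> in normal_seq. \<bar>\<Sum>k. D (k + K) \<omega>\<bar> \<le> (\<Sum>k. \<bar>D (k + K) \<omega>\<bar>)"
        using AEK[of K] by eventually_elim (use summable_rabs in auto)
    qed
    also have "\<dots> = (\<Sum>k. LINT \<omega>|normal_seq. \<bar>D (k + K) \<omega>\<bar>)"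
      using Di AEK sD by (intro integral_suminf) auto
    also have "\<dots> \<le> (\<Sum>k. (1/2) ^ k * (1/2) ^ K)"
    proof (rule suminf_le[OF _ sD])
      show "(LINT \<omega>|normal_seq. \<bar>D (k + K) \<omega>\<bar>) \<le> (1/2) ^ k * (1/2) ^ K" for k
        using Db[of "k + K"] by (simp add: power_add)
      show "summable (\<lambda>n. (1/2) ^ n * (1/2::real) ^ K)" by (intro summable_mult2 summable_geometric) simp
    qed
    also have "\<dots> = 2 * (1/2) ^ K"
      using sums_mult2[OF geometric_sums[of "1/2::real"], of "(1/2) ^ K"] by (simp add: sums_iff)
    finally show ?thesis .
  qed
  have "(\<lambda>N. LINT \<omega>|normal_seq. \<bar>G \<omega> - S N \<omega>\<bar>) \<longlonglongrightarrow> 0"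
  proof (rule tendsto_sandwich[OF _ _ tendsto_const])
    have "(LINT \<omega>|normal_seq. \<bar>G \<omega> - S N \<omega>\<bar>) \<le> 2 * (1/2) ^ N + r N" for N
    proof -
      have "(LINT \<omega>|normal_seq. \<bar>G \<omega> - S N \<omega>\<bar>) \<le> (LINT \<omega>|normal_seq. \<bar>G \<omega> - S (m N) \<omega>\<bar> + \<bar>S (m N) \<omega> - S N \<omega>\<bar>)"
        by (intro integral_mono Bochner_Integration.integrable_add integrable_abs Bochner_Integration.integrable_diff Gi Si) auto
      also have "\<dots> = (LINT \<omega>|normal_seq. \<bar>G \<omega> - S (m N) \<omega>\<bar>) + (LINT \<omega>|normal_seq. \<bar>S (m N) \<omega> - S N \<omega>\<bar>)"
        by (intro Bochner_Integration.integral_add integrable_abs Bochner_Integration.integrable_diff Gi Si)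
      also have "\<dots> \<le> 2 * (1/2) ^ N + r N" by (intro add_mono tail dist m_ge)
      finally show ?thesis .
    qed
    then show "\<forall>\<^sub>F N in sequentially. (LINT \<omega>|normal_seq. \<bar>G \<omega> - S N \<omega>\<bar>) \<le> 2 * (1/2) ^ N + r N" by simp
    have "(\<lambda>N. 2 * (1/2) ^ N + r N) \<longlonglongrightarrow> 2 * 0 + 0"
      by (intro tendsto_add tendsto_mult tendsto_const LIMSEQ_power_zero r0) simp
    then show "(\<lambda>N. 2 * (1/2) ^ N + r N) \<longlonglongrightarrow> 0" by simp
  qed simp
  with Gi show ?thesis by (auto simp: S_def)
qed

text \<open>The Wiener integral of c, the random variable \<Sum> c n \<omega> n. Choosing one L1
  limit fixes it only up to null sets, so identities between such variables hold almost
  everywhere.\<close>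

definition wiener :: "(nat \<Rightarrow> real) \<Rightarrow> (nat \<Rightarrow> real) \<Rightarrow> real" where
  "wiener c = (SOME G. integrable normal_seq G
     \<and> (\<lambda>N. LINT \<omega>|normal_seq. \<bar>G \<omega> - (\<Sum>n<N. c n * \<omega> n)\<bar>) \<longlonglongrightarrow> 0)"

lemma wiener:
  assumes "summable (\<lambda>n. (c n)\<^sup>2)"
  shows "integrable normal_seq (wiener c)" "wiener c \<in> borel_measurable normal_seq"
    "(\<lambda>N. LINT \<omega>|normal_seq. \<bar>wiener c \<omega> - (\<Sum>n<N. c n * \<omega> n)\<bar>) \<longlonglongrightarrow> 0"
proof -
  have *: "integrable normal_seq (wiener c)
     \<and> (\<lambda>N. LINT \<omega>|normal_seq. \<bar>wiener c \<omega> - (\<Sum>n<N. c n * \<omega> n)\<bar>) \<longlonglongrightarrow> 0"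
    unfolding wiener_def by (rule someI_ex[OF gaussian_series_exists[OF assms]])
  then show "integrable normal_seq (wiener c)" "(\<lambda>N. LINT \<omega>|normal_seq. \<bar>wiener c \<omega> - (\<Sum>n<N. c n * \<omega> n)\<bar>) \<longlonglongrightarrow> 0"
    by auto
  from * show "wiener c \<in> borel_measurable normal_seq" by auto
qed

lemma wiener_finite:
  assumes fin: "\<And>n. N \<le> n \<Longrightarrow> c n = 0"
  shows "AE \<omega> in normal_seq. wiener c \<omega> = (\<Sum>n<N. c n * \<omega> n)"
proof -
  have "summable (\<lambda>n. (c n)\<^sup>2)" by (rule summable_finite[of "{..<N}"]) (use fin in auto)
  note w = wiener[OF this]
  have Si: "integrable normal_seq (\<lambda>\<omega>. \<Sum>n<N. c n * \<omega> n)" by (rule normal_seq_sum_L1) simp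
  have tail0: "(\<Sum>n<M. c n * \<omega> n) = (\<Sum>n<N. c n * \<omega> n)" if "N \<le> M" for M and \<omega> :: "nat \<Rightarrow> real"
  proof (rule sum.mono_neutral_right)
    show "\<forall>i\<in>{..<M} - {..<N}. c i * \<omega> i = 0" by (auto simp: fin)
  qed (use that in auto)
  have "\<forall>\<^sub>F M in sequentially. (LINT \<omega>|normal_seq. \<bar>wiener c \<omega> - (\<Sum>n<M. c n * \<omega> n)\<bar>)
     = (LINT \<omega>|normal_seq. \<bar>wiener c \<omega> - (\<Sum>n<N. c n * \<omega> n)\<bar>)"
  proof (rule eventually_sequentiallyI)
    fix M assume "N \<le> M"
    show "(LINT \<omega>|normal_seq. \<bar>wiener c \<omega> - (\<Sum>n<M. c n * \<omega> n)\<bar>) = (LINT \<omega>|normal_seq. \<bar>wiener c \<omega> - (\<Sum>n<N. c n * \<omega> n)\<bar>)"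
      unfolding tail0[OF \<open>N \<le> M\<close>] by (rule refl)
  qed
  then have "(\<lambda>M. LINT \<omega>|normal_seq. \<bar>wiener c \<omega> - (\<Sum>n<M. c n * \<omega> n)\<bar>)
     \<longlonglongrightarrow> (LINT \<omega>|normal_seq. \<bar>wiener c \<omega> - (\<Sum>n<N. c n * \<omega> n)\<bar>)" by (rule tendsto_eventually)
  then have "(LINT \<omega>|normal_seq. \<bar>wiener c \<omega> - (\<Sum>n<N. c n * \<omega> n)\<bar>) = 0" using w(3) by (rule LIMSEQ_unique)
  then have "AE \<omega> in normal_seq. \<bar>wiener c \<omega> - (\<Sum>n<N. c n * \<omega> n)\<bar> = 0"
    using w(1) Si by (subst (asm) integral_nonneg_eq_0_iff_AE) auto
  then show ?thesis by eventually_elim simp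
qed

text \<open>Since |e^(ix) - e^(iy)| \<le> |x - y|, L1 convergence forces convergence of
  characteristic functions, and the Gaussian form passes to the limit.\<close>

lemma char_L1_limit:
  assumes V: "integrable normal_seq V" and c: "(\<lambda>n. (c n)\<^sup>2) sums v"
    and lim: "(\<lambda>N. LINT \<omega>|normal_seq. \<bar>V \<omega> - (\<Sum>n<N. c n * \<omega> n)\<bar>) \<longlonglongrightarrow> 0"
  shows "char (distr normal_seq borel V) t = complex_of_real (exp (- (v * t\<^sup>2) / 2))"
proof -
  interpret prob_space normal_seq by (rule prob_space_normal_seq)
  have [measurable]: "V \<in> borel_measurable normal_seq" using V by auto
  define S where "S N \<omega> = (\<Sum>n<N. c n * \<omega> n)" for N and \<omega> :: "nat \<Rightarrow> real"
  have Si: "integrable normal_seq (S N)" for N unfolding S_def[abs_def] by (rule normal_seq_sum_L1) simp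
  have [measurable]: "S N \<in> borel_measurable normal_seq" for N using Si by auto
  have ii: "integrable normal_seq (\<lambda>\<omega>. iexp (t * W \<omega>))" if "W \<in> borel_measurable normal_seq" for W
    using that by (intro integrable_const_bound[where B = 1]) auto
  have "(\<lambda>N. char (distr normal_seq borel (S N)) t) \<longlonglongrightarrow> char (distr normal_seq borel V) t"
  proof (rule LIM_zero_cancel, rule tendsto_norm_zero_cancel, rule tendsto_sandwich[OF _ _ tendsto_const])
    have "norm (char (distr normal_seq borel (S N)) t - char (distr normal_seq borel V) t) \<le> \<bar>t\<bar> * (LINT \<omega>|normal_seq. \<bar>V \<omega> - S N \<omega>\<bar>)" for N
    proof -
      have "char (distr normal_seq borel (S N)) t - char (distr normal_seq borel V) t
        = (CLINT \<omega>|normal_seq. iexp (t * S N \<omega>) - iexp (t * V \<omega>))"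
        unfolding char_def by (simp add: integral_distr ii del: of_real_mult)
      also have "norm \<dots> \<le> (LINT \<omega>|normal_seq. norm (iexp (t * S N \<omega>) - iexp (t * V \<omega>)))" by (rule integral_norm_bound)
      also have "\<dots> \<le> (LINT \<omega>|normal_seq. \<bar>t\<bar> * \<bar>V \<omega> - S N \<omega>\<bar>)"
      proof (rule integral_mono)
        show "integrable normal_seq (\<lambda>\<omega>. norm (iexp (t * S N \<omega>) - iexp (t * V \<omega>)))"
          by (intro integrable_norm Bochner_Integration.integrable_diff ii) auto
        show "integrable normal_seq (\<lambda>\<omega>. \<bar>t\<bar> * \<bar>V \<omega> - S N \<omega>\<bar>)"
          by (intro integrable_mult_right integrable_abs Bochner_Integration.integrable_diff V Si)
        fix \<omega>
        have "norm (iexp (t * S N \<omega>) - iexp (t * V \<omega>)) \<le> \<bar>t * S N \<omega> - t * V \<omega>\<bar>" by (rule iexp_diff_le)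
        also have "\<dots> = \<bar>t\<bar> * \<bar>V \<omega> - S N \<omega>\<bar>" by (simp add: right_diff_distrib[symmetric] abs_mult abs_minus_commute)
        finally show "norm (iexp (t * S N \<omega>) - iexp (t * V \<omega>)) \<le> \<bar>t\<bar> * \<bar>V \<omega> - S N \<omega>\<bar>" .
      qed
      finally show ?thesis by simp
    qed
    then show "\<forall>\<^sub>F N in sequentially. norm (char (distr normal_seq borel (S N)) t - char (distr normal_seq borel V) t) \<le> \<bar>t\<bar> * (LINT \<omega>|normal_seq. \<bar>V \<omega> - S N \<omega>\<bar>)"
      by simp
    show "(\<lambda>N. \<bar>t\<bar> * (LINT \<omega>|normal_seq. \<bar>V \<omega> - S N \<omega>\<bar>)) \<longlonglongrightarrow> 0"
      using tendsto_mult_left[OF lim, of "\<bar>t\<bar>"] by (simp add: S_def)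
  qed simp
  moreover have "(\<lambda>N. char (distr normal_seq borel (S N)) t) \<longlonglongrightarrow> complex_of_real (exp (- (v * t\<^sup>2) / 2))"
  proof -
    have "(\<lambda>N. complex_of_real (exp (- ((\<Sum>n<N. (c n)\<^sup>2) * t\<^sup>2) / 2))) \<longlonglongrightarrow> complex_of_real (exp (- (v * t\<^sup>2) / 2))"
      using c unfolding sums_def by (intro tendsto_intros) auto
    then show ?thesis unfolding S_def by (simp only: char_normal_seq_sum[OF finite_lessThan])
  qed
  ultimately show ?thesis by (rule LIMSEQ_unique)
qed

text \<open>The combination is treated directly as the L1 limit of the partial sums with combined
  coefficients c n; their square sum is the quadratic form of CA.\<close>

lemma char_wiener_sum:
  assumes A: "\<And>x y. (\<lambda>n. A x n * A y n) sums CA x y" and fin: "finite T"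
  shows "(\<lambda>\<omega>. \<Sum>x\<in>T. a x * wiener (A x) \<omega>) \<in> borel_measurable normal_seq"
    and "char (distr normal_seq borel (\<lambda>\<omega>. \<Sum>x\<in>T. a x * wiener (A x) \<omega>)) t
      = complex_of_real (exp (- ((\<Sum>x\<in>T. \<Sum>y\<in>T. a x * a y * CA x y) * t\<^sup>2) / 2))"
    and "0 \<le> (\<Sum>x\<in>T. \<Sum>y\<in>T. a x * a y * CA x y)"
proof -
  interpret prob_space normal_seq by (rule prob_space_normal_seq)
  have sq: "summable (\<lambda>n. (A x n)\<^sup>2)" for x using A[of x x] by (auto simp: power2_eq_square sums_iff)
  note w = wiener[OF sq]
  show "(\<lambda>\<omega>. \<Sum>x\<in>T. a x * wiener (A x) \<omega>) \<in> borel_measurable normal_seq"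
    using w(2) by (intro borel_measurable_sum borel_measurable_times) auto
  define c where "c n = (\<Sum>x\<in>T. a x * A x n)" for n
  have c2: "(c n)\<^sup>2 = (\<Sum>x\<in>T. \<Sum>y\<in>T. a x * a y * (A x n * A y n))" for n
    by (simp add: c_def power2_eq_square sum_product mult_ac)
  have csum: "(\<lambda>n. (c n)\<^sup>2) sums (\<Sum>x\<in>T. \<Sum>y\<in>T. a x * a y * CA x y)"
    unfolding c2 by (intro sums_sum sums_mult A)
  show "0 \<le> (\<Sum>x\<in>T. \<Sum>y\<in>T. a x * a y * CA x y)" using csum by (rule sums_le[OF _ sums_zero, rotated]) simp
  show "char (distr normal_seq borel (\<lambda>\<omega>. \<Sum>x\<in>T. a x * wiener (A x) \<omega>)) t
      = complex_of_real (exp (- ((\<Sum>x\<in>T. \<Sum>y\<in>T. a x * a y * CA x y) * t\<^sup>2) / 2))"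
  proof (rule char_L1_limit[OF _ csum])
    show "integrable normal_seq (\<lambda>\<omega>. \<Sum>x\<in>T. a x * wiener (A x) \<omega>)"
      by (intro Bochner_Integration.integrable_sum integrable_mult_right w)
    define e where "e N x = (LINT \<omega>|normal_seq. \<bar>wiener (A x) \<omega> - (\<Sum>n<N. A x n * \<omega> n)\<bar>)" for N x
    have Si: "integrable normal_seq (\<lambda>\<omega>. \<Sum>n<N. A x n * \<omega> n)" for N x by (rule normal_seq_sum_L1) simp
    have le: "(LINT \<omega>|normal_seq. \<bar>(\<Sum>x\<in>T. a x * wiener (A x) \<omega>) - (\<Sum>n<N. c n * \<omega> n)\<bar>) \<le> (\<Sum>x\<in>T. \<bar>a x\<bar> * e N x)" for N
    proof -
      have eq: "(\<Sum>x\<in>T. a x * wiener (A x) \<omega>) - (\<Sum>n<N. c n * \<omega> n) = (\<Sum>x\<in>T. a x * (wiener (A x) \<omega> - (\<Sum>n<N. A x n * \<omega> n)))" for \<omega>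
      proof -
        have "(\<Sum>n<N. c n * \<omega> n) = (\<Sum>n<N. \<Sum>x\<in>T. a x * (A x n * \<omega> n))" by (simp add: c_def sum_distrib_right mult.assoc)
        also have "\<dots> = (\<Sum>x\<in>T. a x * (\<Sum>n<N. A x n * \<omega> n))" by (subst sum.swap) (simp add: sum_distrib_left)
        finally show ?thesis by (simp add: right_diff_distrib sum_subtractf)
      qed
      have di: "integrable normal_seq (\<lambda>\<omega>. \<bar>wiener (A x) \<omega> - (\<Sum>n<N. A x n * \<omega> n)\<bar>)" for x
        by (intro integrable_abs Bochner_Integration.integrable_diff w Si)
      have "(LINT \<omega>|normal_seq. \<bar>\<Sum>x\<in>T. a x * (wiener (A x) \<omega> - (\<Sum>n<N. A x n * \<omega> n))\<bar>)
        \<le> (LINT \<omega>|normal_seq. (\<Sum>x\<in>T. \<bar>a x\<bar> * \<bar>wiener (A x) \<omega> - (\<Sum>n<N. A x n * \<omega> n)\<bar>))"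
      proof (rule integral_mono)
        show "integrable normal_seq (\<lambda>\<omega>. \<bar>\<Sum>x\<in>T. a x * (wiener (A x) \<omega> - (\<Sum>n<N. A x n * \<omega> n))\<bar>)"
          by (intro integrable_abs Bochner_Integration.integrable_sum integrable_mult_right Bochner_Integration.integrable_diff w Si)
        show "integrable normal_seq (\<lambda>\<omega>. \<Sum>x\<in>T. \<bar>a x\<bar> * \<bar>wiener (A x) \<omega> - (\<Sum>n<N. A x n * \<omega> n)\<bar>)"
          by (intro Bochner_Integration.integrable_sum integrable_mult_right di)
        show "\<bar>\<Sum>x\<in>T. a x * (wiener (A x) \<omega> - (\<Sum>n<N. A x n * \<omega> n))\<bar> \<le> (\<Sum>x\<in>T. \<bar>a x\<bar> * \<bar>wiener (A x) \<omega> - (\<Sum>n<N. A x n * \<omega> n)\<bar>)" for \<omega>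
          by (rule order.trans[OF sum_abs]) (simp add: abs_mult)
      qed
      also have "\<dots> = (\<Sum>x\<in>T. \<bar>a x\<bar> * e N x)"
        by (subst Bochner_Integration.integral_sum) (auto intro!: integrable_mult_right di simp: e_def)
      finally show ?thesis by (simp only: eq)
    qed
    have "(\<lambda>N. \<Sum>x\<in>T. \<bar>a x\<bar> * e N x) \<longlonglongrightarrow> (\<Sum>x\<in>T. \<bar>a x\<bar> * 0)"
      unfolding e_def by (intro tendsto_sum tendsto_mult tendsto_const w)
    then have lim: "(\<lambda>N. \<Sum>x\<in>T. \<bar>a x\<bar> * e N x) \<longlonglongrightarrow> 0" by simp
    show "(\<lambda>N. LINT \<omega>|normal_seq. \<bar>(\<Sum>x\<in>T. a x * wiener (A x) \<omega>) - (\<Sum>n<N. c n * \<omega> n)\<bar>) \<longlonglongrightarrow> 0"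
    proof (rule tendsto_sandwich[OF _ _ tendsto_const lim])
      show "\<forall>\<^sub>F N in sequentially. (LINT \<omega>|normal_seq. \<bar>(\<Sum>x\<in>T. a x * wiener (A x) \<omega>) - (\<Sum>n<N. c n * \<omega> n)\<bar>) \<le> (\<Sum>x\<in>T. \<bar>a x\<bar> * e N x)"
        by (intro always_eventually allI le)
    qed simp
  qed
qed

section \<open>Gaussian fields driven by two independent sequences\<close>

text \<open>The coordinates are kept apart because u will stay fixed while v is shifted. The part A
  collects what must not move, the part B what the shift acts on.\<close>

definition pair_field :: "('x \<Rightarrow> nat \<Rightarrow> real) \<Rightarrow> ('x \<Rightarrow> nat \<Rightarrow> real) \<Rightarrow> 'x \<Rightarrow> (nat \<Rightarrow> real) \<times> (nat \<Rightarrow> real) \<Rightarrow> real" where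
  "pair_field A B x = (\<lambda>(u, v). wiener (A x) u + wiener (B x) v)"

lemma pair_field_gaussian:
  fixes A :: "'x \<Rightarrow> nat \<Rightarrow> real" and a :: "'x \<Rightarrow> real"
  assumes A: "\<And>x y. (\<lambda>n. A x n * A y n) sums CA x y" and B: "\<And>x y. (\<lambda>n. B x n * B y n) sums CB x y"
    and fin: "finite T"
  defines "V \<equiv> \<lambda>z. \<Sum>x\<in>T. a x * pair_field A B x z"
  shows "gaussian_rv (normal_seq \<Otimes>\<^sub>M normal_seq) V" "(LINT z|(normal_seq \<Otimes>\<^sub>M normal_seq). V z) = 0"
    "(LINT z|(normal_seq \<Otimes>\<^sub>M normal_seq). (V z)\<^sup>2) = (\<Sum>x\<in>T. \<Sum>y\<in>T. a x * a y * (CA x y + CB x y))"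
proof -
  interpret S: prob_space normal_seq by (rule prob_space_normal_seq)
  interpret pair_prob_space normal_seq normal_seq ..
  note a = char_wiener_sum[where A = A and CA = CA, OF A fin, of a] and b = char_wiener_sum[where A = B and CA = CB, OF B fin, of a]
  have V: "V = (\<lambda>(u, v). (\<Sum>x\<in>T. a x * wiener (A x) u) + (\<Sum>x\<in>T. a x * wiener (B x) v))"
    by (auto simp: V_def pair_field_def fun_eq_iff distrib_left sum.distrib)
  note [measurable] = a(1) b(1)
  have Vm: "V \<in> borel_measurable (normal_seq \<Otimes>\<^sub>M normal_seq)" unfolding V by measurable
  have sum: "(\<Sum>x\<in>T. \<Sum>y\<in>T. a x * a y * (CA x y + CB x y))
     = (\<Sum>x\<in>T. \<Sum>y\<in>T. a x * a y * CA x y) + (\<Sum>x\<in>T. \<Sum>y\<in>T. a x * a y * CB x y)"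
    by (simp add: distrib_left sum.distrib)
  have ch: "char (distr (normal_seq \<Otimes>\<^sub>M normal_seq) borel V) t
     = complex_of_real (exp (- ((\<Sum>x\<in>T. \<Sum>y\<in>T. a x * a y * (CA x y + CB x y)) * t\<^sup>2) / 2))" for t
  proof -
    have "char (distr (normal_seq \<Otimes>\<^sub>M normal_seq) borel V) t
      = complex_of_real (exp (- ((\<Sum>x\<in>T. \<Sum>y\<in>T. a x * a y * CA x y) * t\<^sup>2) / 2) * exp (- ((\<Sum>x\<in>T. \<Sum>y\<in>T. a x * a y * CB x y) * t\<^sup>2) / 2))"
      unfolding V by (subst char_pair_sum[OF S.prob_space_axioms S.prob_space_axioms a(1) b(1)]) (simp only: a(2) b(2) of_real_mult)
    then show ?thesis unfolding exp_add[symmetric] sum by (simp only: distrib_right add_divide_distrib minus_add_distrib)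
  qed
  have nn: "0 \<le> (\<Sum>x\<in>T. \<Sum>y\<in>T. a x * a y * (CA x y + CB x y))" unfolding sum using a(3) b(3) by simp
  note N = centered_normal_from_char[OF P.prob_space_axioms Vm nn ch]
  show "gaussian_rv (normal_seq \<Otimes>\<^sub>M normal_seq) V" "(LINT z|(normal_seq \<Otimes>\<^sub>M normal_seq). V z) = 0"
    "(LINT z|(normal_seq \<Otimes>\<^sub>M normal_seq). (V z)\<^sup>2) = (\<Sum>x\<in>T. \<Sum>y\<in>T. a x * a y * (CA x y + CB x y))"
    by (fact N)+
qed

text \<open>Polarization of the variance; x = y is separate because the set {x, y} would count the
  point once.\<close>

lemma pair_field_covariance:
  assumes A: "\<And>x y. (\<lambda>n. A x n * A y n) sums CA x y" and B: "\<And>x y. (\<lambda>n. B x n * B y n) sums CB x y"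
  shows "(LINT z|(normal_seq \<Otimes>\<^sub>M normal_seq). pair_field A B x z * pair_field A B y z) = CA x y + CB x y"
proof -
  interpret S: prob_space normal_seq by (rule prob_space_normal_seq)
  interpret pair_prob_space normal_seq normal_seq ..
  note g = pair_field_gaussian[where A = A and B = B and CA = CA and CB = CB, OF A B]
  have sym: "CA x y = CA y x" "CB x y = CB y x" for x y
    using A[of x y] A[of y x] B[of x y] B[of y x] by (auto simp: mult.commute intro: sums_unique2)
  have sq: "(LINT z|(normal_seq \<Otimes>\<^sub>M normal_seq). (pair_field A B x z)\<^sup>2) = CA x x + CB x x" for x
    using g(3)[of "{x}" "\<lambda>_. 1"] by simp
  have int: "integrable (normal_seq \<Otimes>\<^sub>M normal_seq) (\<lambda>z. (pair_field A B x z)\<^sup>2)" for x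
    using centered_gaussian_moments(1)[OF P.prob_space_axioms g(1)[of "{x}" "\<lambda>_. 1"] g(2)[of "{x}" "\<lambda>_. 1"], of 2] by simp
  show ?thesis
  proof (cases "x = y")
    case True
    then show ?thesis using sq[of x] by (simp add: power2_eq_square)
  next
    case False
    have s2: "(LINT z|(normal_seq \<Otimes>\<^sub>M normal_seq). (pair_field A B x z + pair_field A B y z)\<^sup>2)
      = CA x x + CB x x + 2 * (CA x y + CB x y) + (CA y y + CB y y)"
      using g(3)[of "{x, y}" "\<lambda>_. 1"] False sym[of x y] by simp
    have i2: "integrable (normal_seq \<Otimes>\<^sub>M normal_seq) (\<lambda>z. (pair_field A B x z + pair_field A B y z)\<^sup>2)"
      using centered_gaussian_moments(1)[OF P.prob_space_axioms g(1)[of "{x, y}" "\<lambda>_. 1"] g(2)[of "{x, y}" "\<lambda>_. 1"], of 2] False by simp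
    have "(LINT z|(normal_seq \<Otimes>\<^sub>M normal_seq). pair_field A B x z * pair_field A B y z)
      = (LINT z|(normal_seq \<Otimes>\<^sub>M normal_seq). ((pair_field A B x z + pair_field A B y z)\<^sup>2 - (pair_field A B x z)\<^sup>2 - (pair_field A B y z)\<^sup>2) / 2)"
      by (intro Bochner_Integration.integral_cong) (auto simp: power2_eq_square algebra_simps)
    also have "\<dots> = CA x y + CB x y" using i2 int by (simp add: s2 sq)
    finally show ?thesis .
  qed
qed

lemma pair_field_bivariate:
  assumes A: "\<And>x y. (\<lambda>n. A x n * A y n) sums CA x y" and B: "\<And>x y. (\<lambda>n. B x n * B y n) sums CB x y"
    and C: "\<And>k l s s'. k \<in> {1,2::nat} \<Longrightarrow> l \<in> {1,2} \<Longrightarrow> CA (k, s) (l, s') + CB (k, s) (l, s') = C k l s s'"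
  shows "bivariate_gaussian_field (normal_seq \<Otimes>\<^sub>M normal_seq) (\<lambda>k s. pair_field A B (k, s)) C"
proof -
  interpret S: prob_space normal_seq by (rule prob_space_normal_seq)
  interpret pair_prob_space normal_seq normal_seq ..
  note g = pair_field_gaussian[where A = A and B = B and CA = CA and CB = CB, OF A B]
  show ?thesis unfolding bivariate_gaussian_field_def
  proof (intro conjI ballI allI impI)
    show "pair_field A B (k, s) \<in> borel_measurable (normal_seq \<Otimes>\<^sub>M normal_seq)" for k s
      using g(1)[of "{(k, s)}" "\<lambda>_. 1"] by (simp add: gaussian_rv_def)
    show "(LINT z|(normal_seq \<Otimes>\<^sub>M normal_seq). pair_field A B (k, s) z) = 0" for k s
      using g(2)[of "{(k, s)}" "\<lambda>_. 1"] by simp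
    show "(LINT z|(normal_seq \<Otimes>\<^sub>M normal_seq). pair_field A B (k, s) z * pair_field A B (l, s') z) = C k l s s'"
      if "k \<in> {1,2}" "l \<in> {1,2}" for k l s s'
      using pair_field_covariance[where A = A and B = B and CA = CA and CB = CB, OF A B] C[OF that] by simp
    fix S :: "real set" and a :: "nat \<Rightarrow> real \<Rightarrow> real" assume "finite S"
    then show "gaussian_rv (normal_seq \<Otimes>\<^sub>M normal_seq) (\<lambda>z. \<Sum>k\<in>{1,2}. \<Sum>s\<in>S. a k s * pair_field A B (k, s) z)"
      using g(1)[of "{1,2} \<times> S" "\<lambda>(k, s). a k s"] by (simp only: sum.cartesian_product finite_SigmaI finite.intros) (simp add: case_prod_beta)
  qed (rule P.prob_space_axioms)
qed

text \<open>\<open>estimable\<close> quantifies over measures on one particular type. An embedding e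
  with left inverse d moves a field there without changing its law.\<close>

lemma bivariate_gaussian_field_transport:
  assumes field: "bivariate_gaussian_field M Z C"
    and e[measurable]: "e \<in> measurable M M'" and d[measurable]: "d \<in> measurable M' M"
    and de: "\<And>x. x \<in> space M \<Longrightarrow> d (e x) = x"
  shows "bivariate_gaussian_field (distr M M' e) (\<lambda>k s x. Z k s (d x)) C"
proof -
  interpret prob_space M using field by (simp add: bivariate_gaussian_field_def)
  interpret D: prob_space "distr M M' e" by (rule prob_space_distr) simp
  have f: "\<And>k s. k \<in> {1,2} \<Longrightarrow> Z k s \<in> borel_measurable M"
    "\<And>S a. finite S \<Longrightarrow> gaussian_rv M (\<lambda>x. \<Sum>k\<in>{1,2}. \<Sum>s\<in>S. a k s * Z k s x)"
    "\<And>k s. k \<in> {1,2} \<Longrightarrow> (LINT x|M. Z k s x) = 0"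
    "\<And>k l s s'. k \<in> {1,2} \<Longrightarrow> l \<in> {1,2} \<Longrightarrow> (LINT x|M. Z k s x * Z l s' x) = C k l s s'"
    using field unfolding bivariate_gaussian_field_def by blast+
  have int: "(LINT x|distr M M' e. V (d x)) = (LINT x|M. V x)" if [measurable]: "V \<in> borel_measurable M" for V :: "_ \<Rightarrow> real"
    by (subst integral_distr) (auto simp: de intro!: Bochner_Integration.integral_cong)
  have gauss: "gaussian_rv (distr M M' e) (\<lambda>x. V (d x))" if V: "gaussian_rv M V" for V
  proof -
    have Vm[measurable]: "V \<in> borel_measurable M" using V by (simp add: gaussian_rv_def)
    have "distr (distr M M' e) lborel (\<lambda>x. V (d x)) = distr M lborel V"
      by (subst distr_distr) (auto simp: de o_def intro!: distr_cong)
    moreover have "(AE x in distr M M' e. V (d x) = \<mu>) \<longleftrightarrow> (AE x in M. V x = \<mu>)" for \<mu>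
      by (subst AE_distr_iff) (auto simp: de intro!: AE_cong)
    ultimately show ?thesis using V by (simp add: gaussian_rv_def distributed_def)
  qed
  show ?thesis unfolding bivariate_gaussian_field_def
  proof (intro conjI ballI allI impI)
    show "(\<lambda>x. Z k s (d x)) \<in> borel_measurable (distr M M' e)" if "k \<in> {1,2}" for k s
      using f(1)[OF that] by simp
    show "gaussian_rv (distr M M' e) (\<lambda>x. \<Sum>k\<in>{1,2}. \<Sum>s\<in>S. a k s * Z k s (d x))" if "finite S" for S a
      by (rule gauss[OF f(2)[OF that]])
    show "(LINT x|distr M M' e. Z k s (d x)) = 0" if "k \<in> {1,2}" for k s
      using int[OF f(1)[OF that]] f(3)[OF that] by simp
    show "(LINT x|distr M M' e. Z k s (d x) * Z l s' (d x)) = C k l s s'" if "k \<in> {1,2}" "l \<in> {1,2}" for k l s s'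
      using int[of "\<lambda>x. Z k s x * Z l s' x"] f(1)[OF that(1)] f(1)[OF that(2)] f(4)[OF that] by simp
  qed (rule D.prob_space_axioms)
qed

section \<open>Shifting finitely many coordinates of a Gaussian sequence\<close>

text \<open>Completing the square: the translated density divided by the original one is exp (a x -
  a^2/2).\<close>

lemma nn_integral_std_normal_shift:
  assumes [measurable]: "F \<in> borel_measurable borel"
  shows "(\<integral>\<^sup>+x. F (x + a) \<partial>std_normal_distribution) = (\<integral>\<^sup>+x. F x * ennreal (exp (a * x - a\<^sup>2 / 2)) \<partial>std_normal_distribution)"
proof -
  have "(\<integral>\<^sup>+x. F (x + a) \<partial>std_normal_distribution) = (\<integral>\<^sup>+x. ennreal (std_normal_density x) * F (x + a) \<partial>lborel)"
    by (subst nn_integral_density) auto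
  also have "\<dots> = (\<integral>\<^sup>+x. ennreal (std_normal_density (- a + 1 * x)) * F (- a + 1 * x + a) \<partial>lborel)"
    by (subst nn_integral_real_affine[where c = 1 and t = "- a"]) auto
  also have "\<dots> = (\<integral>\<^sup>+x. ennreal (std_normal_density x) * (F x * ennreal (exp (a * x - a\<^sup>2 / 2))) \<partial>lborel)"
  proof (rule nn_integral_cong)
    fix x
    have "std_normal_density (- a + 1 * x) = std_normal_density x * exp (a * x - a\<^sup>2 / 2)"
      by (simp add: std_normal_density_def power2_eq_square field_simps flip: exp_add)
    then show "ennreal (std_normal_density (- a + 1 * x)) * F (- a + 1 * x + a) = ennreal (std_normal_density x) * (F x * ennreal (exp (a * x - a\<^sup>2 / 2)))"
      by (simp add: ennreal_mult mult_ac)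
  qed
  also have "\<dots> = (\<integral>\<^sup>+x. F x * ennreal (exp (a * x - a\<^sup>2 / 2)) \<partial>std_normal_distribution)"
    by (subst nn_integral_density) auto
  finally show ?thesis .
qed

lemma measurable_case_nat_seq[measurable]:
  "(\<lambda>(x, \<omega>). case_nat x \<omega>) \<in> measurable (std_normal_distribution \<Otimes>\<^sub>M normal_seq) normal_seq"
proof -
  have "(\<lambda>(x, \<omega>). case_nat x \<omega>) \<in> measurable (std_normal_distribution \<Otimes>\<^sub>M normal_seq) (PiM UNIV (\<lambda>_. borel))"
  proof (rule measurable_PiM_single')
    fix i :: nat
    show "(\<lambda>z. (case z of (x, \<omega>) \<Rightarrow> case_nat x \<omega>) i) \<in> borel_measurable (std_normal_distribution \<Otimes>\<^sub>M normal_seq)"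
      by (cases i) (auto simp: case_prod_beta)
  qed auto
  then show ?thesis using measurable_cong_sets[OF refl sets_normal_seq] by blast
qed

lemma nn_integral_normal_seq_iter:
  assumes [measurable]: "f \<in> borel_measurable normal_seq"
  shows "(\<integral>\<^sup>+\<omega>. f \<omega> \<partial>normal_seq) = (\<integral>\<^sup>+x. \<integral>\<^sup>+\<omega>. f (case_nat x \<omega>) \<partial>normal_seq \<partial>std_normal_distribution)"
proof -
  interpret real_distribution std_normal_distribution by (rule real_dist_normal_dist)
  interpret S: sequence_space std_normal_distribution by unfold_locales
  interpret N: prob_space normal_seq by (rule prob_space_normal_seq)
  have "(\<integral>\<^sup>+\<omega>. f \<omega> \<partial>normal_seq) = (\<integral>\<^sup>+\<omega>. f \<omega> \<partial>distr (std_normal_distribution \<Otimes>\<^sub>M normal_seq) normal_seq (\<lambda>(x, \<omega>). case_nat x \<omega>))"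
    using S.PiM_iter by (simp add: normal_seq_def)
  also have "\<dots> = (\<integral>\<^sup>+z. f (case z of (x, \<omega>) \<Rightarrow> case_nat x \<omega>) \<partial>(std_normal_distribution \<Otimes>\<^sub>M normal_seq))"
    by (rule nn_integral_distr) measurable
  also have "\<dots> = (\<integral>\<^sup>+x. \<integral>\<^sup>+\<omega>. f (case (x, \<omega>) of (x, \<omega>) \<Rightarrow> case_nat x \<omega>) \<partial>normal_seq \<partial>std_normal_distribution)"
    by (rule N.nn_integral_fst[symmetric]) measurable
  finally show ?thesis by simp
qed

definition shift_seq :: "nat \<Rightarrow> (nat \<Rightarrow> real) \<Rightarrow> (nat \<Rightarrow> real) \<Rightarrow> nat \<Rightarrow> real" where
  "shift_seq N h \<omega> n = \<omega> n + (if n < N then h n else 0)"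

text \<open>The Cameron-Martin likelihood ratio of the shifted law with respect to the original one,
  a product over the N shifted coordinates.\<close>

definition shift_density :: "nat \<Rightarrow> (nat \<Rightarrow> real) \<Rightarrow> (nat \<Rightarrow> real) \<Rightarrow> real" where
  "shift_density N h \<omega> = exp (\<Sum>n<N. h n * \<omega> n - (h n)\<^sup>2 / 2)"

lemma measurable_into_normal_seq:
  assumes "\<And>i. (\<lambda>x. f x i) \<in> borel_measurable M"
  shows "f \<in> measurable M normal_seq"
proof -
  have "f \<in> measurable M (PiM UNIV (\<lambda>_. borel))" by (rule measurable_PiM_single') (use assms in auto)
  then show ?thesis using measurable_cong_sets[OF refl sets_normal_seq] by blast
qed

text \<open>Induction on the number of shifted coordinates: coordinate 0 is split off by
  \<open>case_nat\<close> and shifted in one dimension, and the hypothesis handles the tail. It must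
  therefore hold for all h and \<phi>.\<close>

lemma nn_integral_shift_seq:
  assumes "\<phi> \<in> borel_measurable normal_seq"
  shows "(\<integral>\<^sup>+\<omega>. \<phi> (shift_seq N h \<omega>) \<partial>normal_seq) = (\<integral>\<^sup>+\<omega>. \<phi> \<omega> * ennreal (shift_density N h \<omega>) \<partial>normal_seq)"
  using assms
proof (induction N arbitrary: h \<phi>)
  case 0
  then show ?case by (simp add: shift_seq_def[abs_def] shift_density_def)
next
  case (Suc N)
  note [measurable] = Suc.prems
  have sm[measurable]: "shift_seq N' h' \<in> measurable normal_seq normal_seq" for N' h'
    by (rule measurable_into_normal_seq) (simp add: shift_seq_def)
  have dm[measurable]: "shift_density N' h' \<in> borel_measurable normal_seq" for N' h'
    unfolding shift_density_def[abs_def] by measurable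
  interpret N: prob_space normal_seq by (rule prob_space_normal_seq)
  define h' where "h' n = h (Suc n)" for n
  have split: "shift_seq (Suc N) h (case_nat x \<omega>) = case_nat (x + h 0) (shift_seq N h' \<omega>)" for x \<omega>
    by (auto simp: shift_seq_def h'_def fun_eq_iff split: nat.split)
  have dsplit: "shift_density (Suc N) h (case_nat x \<omega>) = exp (h 0 * x - (h 0)\<^sup>2 / 2) * shift_density N h' \<omega>" for x \<omega>
    unfolding shift_density_def h'_def by (subst sum.lessThan_Suc_shift) (simp add: exp_add)
  have cm[measurable]: "case_nat y \<in> measurable normal_seq normal_seq" for y :: real
  proof (rule measurable_into_normal_seq)
    show "(\<lambda>\<omega>. case_nat y \<omega> i) \<in> borel_measurable normal_seq" for i by (cases i) auto
  qed
  define F where "F y = (\<integral>\<^sup>+\<omega>. \<phi> (case_nat y \<omega>) * ennreal (shift_density N h' \<omega>) \<partial>normal_seq)" for y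
  have m1: "(\<lambda>z. \<phi> (case_nat (fst z) (snd z))) \<in> borel_measurable (std_normal_distribution \<Otimes>\<^sub>M normal_seq)"
    using measurable_compose[OF measurable_case_nat_seq Suc.prems] by (simp add: case_prod_beta)
  have Fm: "F \<in> borel_measurable std_normal_distribution"
    unfolding F_def[abs_def] using m1
    by (intro N.borel_measurable_nn_integral) (auto simp: case_prod_beta intro!: borel_measurable_times_ennreal measurable_compose[OF measurable_snd])
  then have Fb[measurable]: "F \<in> borel_measurable borel" by simp
  have "(\<integral>\<^sup>+\<omega>. \<phi> (shift_seq (Suc N) h \<omega>) \<partial>normal_seq)
    = (\<integral>\<^sup>+x. \<integral>\<^sup>+\<omega>. \<phi> (case_nat (x + h 0) (shift_seq N h' \<omega>)) \<partial>normal_seq \<partial>std_normal_distribution)"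
    by (subst nn_integral_normal_seq_iter) (simp_all only: split, measurable)
  also have "\<dots> = (\<integral>\<^sup>+x. F (x + h 0) \<partial>std_normal_distribution)"
    unfolding F_def by (intro nn_integral_cong Suc.IH[of "\<lambda>\<omega>. \<phi> (case_nat _ \<omega>)"]) measurable
  also have "\<dots> = (\<integral>\<^sup>+x. F x * ennreal (exp (h 0 * x - (h 0)\<^sup>2 / 2)) \<partial>std_normal_distribution)"
    by (rule nn_integral_std_normal_shift[OF Fb])
  also have "\<dots> = (\<integral>\<^sup>+x. \<integral>\<^sup>+\<omega>. \<phi> (case_nat x \<omega>) * ennreal (shift_density (Suc N) h (case_nat x \<omega>)) \<partial>normal_seq \<partial>std_normal_distribution)"
  proof (rule nn_integral_cong)
    fix x
    have "(\<integral>\<^sup>+\<omega>. \<phi> (case_nat x \<omega>) * ennreal (shift_density (Suc N) h (case_nat x \<omega>)) \<partial>normal_seq)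
      = (\<integral>\<^sup>+\<omega>. (\<phi> (case_nat x \<omega>) * ennreal (shift_density N h' \<omega>)) * ennreal (exp (h 0 * x - (h 0)\<^sup>2 / 2)) \<partial>normal_seq)"
      unfolding dsplit by (intro nn_integral_cong) (simp add: ennreal_mult shift_density_def mult_ac)
    also have "\<dots> = F x * ennreal (exp (h 0 * x - (h 0)\<^sup>2 / 2))"
      unfolding F_def by (rule nn_integral_multc) measurable
    finally show "F x * ennreal (exp (h 0 * x - (h 0)\<^sup>2 / 2)) = (\<integral>\<^sup>+\<omega>. \<phi> (case_nat x \<omega>) * ennreal (shift_density (Suc N) h (case_nat x \<omega>)) \<partial>normal_seq)" ..
  qed
  also have "\<dots> = (\<integral>\<^sup>+\<omega>. \<phi> \<omega> * ennreal (shift_density (Suc N) h \<omega>) \<partial>normal_seq)"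
    by (subst nn_integral_normal_seq_iter[symmetric]) measurable
  finally show ?case .
qed

text \<open>The square of the density of h is exp (\<Sum> h^2) times the density of 2h, and the
  latter has integral 1. So the second moment depends on the square sum alone and not on N.\<close>

lemma nn_integral_shift_density_square:
  "(\<integral>\<^sup>+\<omega>. ennreal ((shift_density N h \<omega>)\<^sup>2) \<partial>normal_seq) = ennreal (exp (\<Sum>n<N. (h n)\<^sup>2))"
proof -
  interpret prob_space normal_seq by (rule prob_space_normal_seq)
  have eq: "(shift_density N h \<omega>)\<^sup>2 = exp (\<Sum>n<N. (h n)\<^sup>2) * shift_density N (\<lambda>n. 2 * h n) \<omega>" for \<omega>
  proof -
    have "(shift_density N h \<omega>)\<^sup>2 = exp (2 * (\<Sum>n<N. h n * \<omega> n - (h n)\<^sup>2 / 2))"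
      by (simp add: shift_density_def exp_double)
    also have "2 * (\<Sum>n<N. h n * \<omega> n - (h n)\<^sup>2 / 2) = (\<Sum>n<N. (h n)\<^sup>2) + (\<Sum>n<N. (2 * h n) * \<omega> n - (2 * h n)\<^sup>2 / 2)"
      unfolding sum_distrib_left sum.distrib[symmetric] by (intro sum.cong) (simp_all add: power2_eq_square algebra_simps)
    finally show ?thesis by (simp add: exp_add shift_density_def)
  qed
  have [measurable]: "shift_density N h' \<in> borel_measurable normal_seq" for h'
    unfolding shift_density_def[abs_def] by measurable
  have "(\<integral>\<^sup>+\<omega>. ennreal ((shift_density N h \<omega>)\<^sup>2) \<partial>normal_seq)
    = (\<integral>\<^sup>+\<omega>. ennreal (exp (\<Sum>n<N. (h n)\<^sup>2)) * (1 * ennreal (shift_density N (\<lambda>n. 2 * h n) \<omega>)) \<partial>normal_seq)"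
    unfolding eq by (intro nn_integral_cong) (simp add: ennreal_mult shift_density_def)
  also have "\<dots> = ennreal (exp (\<Sum>n<N. (h n)\<^sup>2)) * (\<integral>\<^sup>+\<omega>. 1 * ennreal (shift_density N (\<lambda>n. 2 * h n) \<omega>) \<partial>normal_seq)"
    by (rule nn_integral_cmult) measurable
  also have "(\<integral>\<^sup>+\<omega>. 1 * ennreal (shift_density N (\<lambda>n. 2 * h n) \<omega>) \<partial>normal_seq) = 1"
    by (subst nn_integral_shift_seq[symmetric]) (simp_all add: emeasure_space_1[simplified])
  finally show ?thesis by simp
qed

text \<open>The shift depends on u only, so for fixed u it is deterministic with density q.
  Integrating 2q \<le> \<epsilon> q^2 + 1/\<epsilon> over the section of A, the second moment gives
  the first term and the section itself the second. Where the square sum exceeds R the probability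
  is bounded by 1.\<close>

lemma shift_probability_bound:
  fixes h :: "nat \<Rightarrow> (nat \<Rightarrow> real) \<Rightarrow> real"
  assumes hm[measurable]: "\<And>n. h n \<in> borel_measurable normal_seq"
    and A[measurable]: "A \<in> sets (normal_seq \<Otimes>\<^sub>M normal_seq)" and \<epsilon>: "0 < \<epsilon>"
  shows "emeasure (normal_seq \<Otimes>\<^sub>M normal_seq) {(u, v). (u, shift_seq N (\<lambda>n. h n u) v) \<in> A}
    \<le> ennreal (\<epsilon> * exp R / 2) + ennreal (1 / (2 * \<epsilon>)) * emeasure (normal_seq \<Otimes>\<^sub>M normal_seq) A
      + emeasure normal_seq {u. R < (\<Sum>n<N. (h n u)\<^sup>2)}"
proof -
  interpret S: prob_space normal_seq by (rule prob_space_normal_seq)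
  define \<tau> where "\<tau> z = (fst z, shift_seq N (\<lambda>n. h n (fst z)) (snd z))" for z
  have "(\<lambda>z. shift_seq N (\<lambda>n. h n (fst z)) (snd z)) \<in> measurable (normal_seq \<Otimes>\<^sub>M normal_seq) normal_seq"
    by (rule measurable_into_normal_seq) (simp add: shift_seq_def)
  then have \<tau>m[measurable]: "\<tau> \<in> measurable (normal_seq \<Otimes>\<^sub>M normal_seq) (normal_seq \<Otimes>\<^sub>M normal_seq)"
    unfolding \<tau>_def[abs_def] by (intro measurable_Pair) auto
  have shm[measurable]: "shift_seq N h' \<in> measurable normal_seq normal_seq" for h'
    by (rule measurable_into_normal_seq) (simp add: shift_seq_def)
  have dm[measurable]: "shift_density N h' \<in> borel_measurable normal_seq" for h'
    unfolding shift_density_def[abs_def] by measurable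
  have set_eq: "{(u, v). (u, shift_seq N (\<lambda>n. h n u) v) \<in> A} = \<tau> -` A \<inter> space (normal_seq \<Otimes>\<^sub>M normal_seq)"
    by (auto simp: \<tau>_def space_pair_measure)
  define bad where "bad = {u. R < (\<Sum>n<N. (h n u)\<^sup>2)}"
  have bad[measurable]: "bad \<in> sets normal_seq"
  proof -
    have "{u \<in> space normal_seq. R < (\<Sum>n<N. (h n u)\<^sup>2)} \<in> sets normal_seq" by measurable
    then show ?thesis by (simp add: bad_def)
  qed
  have Au[measurable]: "Pair u -` A \<in> sets normal_seq" for u by (rule sets_Pair1[OF A])
  have inner: "(\<integral>\<^sup>+v. indicator A (u, shift_seq N (\<lambda>n. h n u) v) \<partial>normal_seq)
      \<le> ennreal (\<epsilon> * exp R / 2) + ennreal (1 / (2 * \<epsilon>)) * emeasure normal_seq (Pair u -` A) + indicator bad u" for u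
  proof (cases "u \<in> bad")
    case True
    have "(\<integral>\<^sup>+v. indicator A (u, shift_seq N (\<lambda>n. h n u) v) \<partial>normal_seq) \<le> (\<integral>\<^sup>+v. 1 \<partial>normal_seq)"
      by (intro nn_integral_mono) (simp add: indicator_def)
    also have "\<dots> = 1" by (simp add: S.emeasure_space_1[simplified])
    finally show ?thesis using True by (simp add: add_increasing)
  next
    case False
    then have le: "(\<Sum>n<N. (h n u)\<^sup>2) \<le> R" by (simp add: bad_def)
    define q where "q = shift_density N (\<lambda>n. h n u)"
    have q0: "0 \<le> q v" for v by (simp add: q_def shift_density_def)
    have [measurable]: "q \<in> borel_measurable normal_seq" unfolding q_def by measurable
    have "(\<integral>\<^sup>+v. indicator A (u, shift_seq N (\<lambda>n. h n u) v) \<partial>normal_seq)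
       = (\<integral>\<^sup>+v. indicator (Pair u -` A) (shift_seq N (\<lambda>n. h n u) v) \<partial>normal_seq)"
      by (intro nn_integral_cong) (simp add: indicator_def)
    also have "\<dots> = (\<integral>\<^sup>+v. indicator (Pair u -` A) v * ennreal (q v) \<partial>normal_seq)"
      unfolding q_def by (rule nn_integral_shift_seq) measurable
    also have "\<dots> \<le> (\<integral>\<^sup>+v. ennreal (\<epsilon> / 2) * ennreal ((q v)\<^sup>2) + ennreal (1 / (2 * \<epsilon>)) * indicator (Pair u -` A) v \<partial>normal_seq)"
    proof (rule nn_integral_mono)
      fix v
      \<comment> \<open>Expanded square of \<epsilon> q - 1, divided by \<epsilon>.\<close>
      have "2 * q v \<le> \<epsilon> * (q v)\<^sup>2 + 1 / \<epsilon>"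
      proof -
        have "0 \<le> (\<epsilon> * q v - 1)\<^sup>2 / \<epsilon>" using \<epsilon> by simp
        also have "\<dots> = \<epsilon> * (q v)\<^sup>2 + 1 / \<epsilon> - 2 * q v" using \<epsilon> by (simp add: power2_eq_square field_simps)
        finally show ?thesis by simp
      qed
      then have "q v \<le> \<epsilon> / 2 * (q v)\<^sup>2 + 1 / (2 * \<epsilon>)" by simp
      then have "ennreal (q v) \<le> ennreal (\<epsilon> / 2 * (q v)\<^sup>2 + 1 / (2 * \<epsilon>))" by (rule ennreal_leI)
      also have "\<dots> = ennreal (\<epsilon> / 2) * ennreal ((q v)\<^sup>2) + ennreal (1 / (2 * \<epsilon>))"
        using \<epsilon> by (simp add: ennreal_plus[symmetric] ennreal_mult[symmetric] del: ennreal_plus)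
      finally show "indicator (Pair u -` A) v * ennreal (q v) \<le> ennreal (\<epsilon> / 2) * ennreal ((q v)\<^sup>2) + ennreal (1 / (2 * \<epsilon>)) * indicator (Pair u -` A) v"
        by (cases "v \<in> Pair u -` A") auto
    qed
    also have "\<dots> = ennreal (\<epsilon> / 2) * ennreal (exp (\<Sum>n<N. (h n u)\<^sup>2)) + ennreal (1 / (2 * \<epsilon>)) * emeasure normal_seq (Pair u -` A)"
      by (subst nn_integral_add) (auto simp: nn_integral_cmult q_def nn_integral_shift_density_square)
    also have "ennreal (\<epsilon> / 2) * ennreal (exp (\<Sum>n<N. (h n u)\<^sup>2)) \<le> ennreal (\<epsilon> * exp R / 2)"
      using le \<epsilon> by (simp add: ennreal_mult[symmetric] ennreal_leI)
    finally show ?thesis using False by (simp add: add_mono)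
  qed
  have "emeasure (normal_seq \<Otimes>\<^sub>M normal_seq) (\<tau> -` A \<inter> space (normal_seq \<Otimes>\<^sub>M normal_seq))
    = (\<integral>\<^sup>+z. indicator A (\<tau> z) \<partial>(normal_seq \<Otimes>\<^sub>M normal_seq))"
  proof -
    have "(\<integral>\<^sup>+z. indicator A (\<tau> z) \<partial>(normal_seq \<Otimes>\<^sub>M normal_seq))
      = (\<integral>\<^sup>+z. indicator (\<tau> -` A \<inter> space (normal_seq \<Otimes>\<^sub>M normal_seq)) z \<partial>(normal_seq \<Otimes>\<^sub>M normal_seq))"
      by (intro nn_integral_cong) (simp split: split_indicator)
    also have "\<dots> = emeasure (normal_seq \<Otimes>\<^sub>M normal_seq) (\<tau> -` A \<inter> space (normal_seq \<Otimes>\<^sub>M normal_seq))"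
      by (intro nn_integral_indicator measurable_sets[OF _ A]) measurable
    finally show ?thesis ..
  qed
  also have "\<dots> = (\<integral>\<^sup>+u. \<integral>\<^sup>+v. indicator A (\<tau> (u, v)) \<partial>normal_seq \<partial>normal_seq)"
    by (rule S.nn_integral_fst[symmetric]) measurable
  also have "\<dots> \<le> (\<integral>\<^sup>+u. ennreal (\<epsilon> * exp R / 2) + ennreal (1 / (2 * \<epsilon>)) * emeasure normal_seq (Pair u -` A) + indicator bad u \<partial>normal_seq)"
    unfolding \<tau>_def fst_conv snd_conv by (intro nn_integral_mono inner)
  also have "\<dots> = ennreal (\<epsilon> * exp R / 2) + ennreal (1 / (2 * \<epsilon>)) * (\<integral>\<^sup>+u. emeasure normal_seq (Pair u -` A) \<partial>normal_seq) + emeasure normal_seq bad"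
    by (simp add: nn_integral_add nn_integral_cmult S.measurable_emeasure_Pair[OF A] S.emeasure_space_1[simplified])
  also have "(\<integral>\<^sup>+u. emeasure normal_seq (Pair u -` A) \<partial>normal_seq) = emeasure (normal_seq \<Otimes>\<^sub>M normal_seq) A"
    by (rule S.emeasure_pair_measure_alt[OF A, symmetric])
  finally show ?thesis unfolding set_eq bad_def .
qed

section \<open>From cylinder sets to all Borel sets of sequences\<close>

definition depends_below :: "nat \<Rightarrow> (nat \<Rightarrow> 'b) set \<Rightarrow> bool" where
  "depends_below N U \<longleftrightarrow> (\<forall>y y'. (\<forall>i<N. y i = y' i) \<longrightarrow> (y \<in> U \<longleftrightarrow> y' \<in> U))"

lemma depends_below_mono: "depends_below N U \<Longrightarrow> N \<le> N' \<Longrightarrow> depends_below N' U"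
  unfolding depends_below_def by (meson order_less_le_trans)

text \<open>The product topology has a countable basis of cylinders, and finite unions of basic sets
  involve only finitely many coordinates.\<close>

lemma open_sequence_set_exhaustion:
  fixes U :: "(nat \<Rightarrow> 'b::second_countable_topology) set"
  assumes U: "open U"
  shows "\<exists>V. incseq V \<and> (\<Union>m. V m) = U \<and> (\<forall>m. open (V m) \<and> (\<exists>N. depends_below N (V m)))"
proof -
  obtain K :: "(nat \<Rightarrow> 'b) set set" where K: "topological_basis K" "countable K"
    and cyl: "\<forall>k\<in>K. \<exists>X. k = Pi\<^sub>E UNIV X \<and> (\<forall>i. open (X i)) \<and> finite {i. X i \<noteq> UNIV}"
    using product_topology_countable_basis by blast
  obtain B' where B': "B' \<subseteq> K" "\<Union>B' = U" using K(1) U unfolding topological_basis_def by blast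
  show ?thesis
  proof (cases "B' = {}")
    case True
    then show ?thesis using B' by (intro exI[of _ "\<lambda>_. {}"]) (auto simp: depends_below_def incseq_def)
  next
    case False
    have cB: "countable B'" using B'(1) K(2) by (rule countable_subset)
    define k where "k = from_nat_into B'"
    have kB: "range k = B'" unfolding k_def using range_from_nat_into[OF False cB] .
    define V where "V m = (\<Union>j<m. k j)" for m
    have "incseq V" unfolding V_def incseq_def by (auto intro: order_less_le_trans)
    moreover have "(\<Union>m. V m) = U"
    proof -
      have "(\<Union>m. V m) = \<Union>(range k)" unfolding V_def by (auto intro!: exI[of _ "Suc _"])
      then show ?thesis using kB B'(2) by simp
    qed
    moreover have "open (V m) \<and> (\<exists>N. depends_below N (V m))" for m
    proof
      have kK: "k j \<in> K" for j using kB B'(1) by blast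
      show "open (V m)" unfolding V_def using kK K(1) by (auto intro!: open_UN topological_basis_open)
      have "\<exists>N. depends_below N (k j)" for j
      proof -
        obtain X where X: "k j = Pi\<^sub>E UNIV X" "finite {i. X i \<noteq> UNIV}" using cyl kK[of j] by blast
        obtain N where N: "\<And>i. X i \<noteq> UNIV \<Longrightarrow> i < N" using finite_nat_set_iff_bounded[THEN iffD1, OF X(2)] by blast
        have "y \<in> k j \<longleftrightarrow> y' \<in> k j" if "\<forall>i<N. y i = y' i" for y y'
          unfolding X(1) PiE_UNIV_domain Pi_iff using that N by (metis UNIV_I)
        then show ?thesis unfolding depends_below_def by blast
      qed
      then obtain Nf where Nf: "\<And>j. depends_below (Nf j) (k j)" by metis
      have "depends_below (\<Sum>j<m. Nf j) (V m)"
      proof -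
        have "depends_below (\<Sum>j<m. Nf j) (k j)" if "j < m" for j
          by (rule depends_below_mono[OF Nf]) (use that in \<open>auto intro: member_le_sum\<close>)
        then show ?thesis unfolding depends_below_def V_def by blast
      qed
      then show "\<exists>N. depends_below N (V m)" ..
    qed
    ultimately show ?thesis by blast
  qed
qed

text \<open>F c reads the pair of X and cX + W along the points. Because x i = \<Sum> b n i * h n,
  replacing v by v + h turns F 0 into F 1; for a set depending on the first N values only N
  coordinates have to be moved. The resulting bound is free of N and extends to Borel sets by
  regularity.\<close>

lemma shift_testing:
  fixes h x :: "nat \<Rightarrow> (nat \<Rightarrow> real) \<Rightarrow> real" and b :: "nat \<Rightarrow> nat \<Rightarrow> real"
  assumes hm[measurable]: "\<And>n. h n \<in> borel_measurable normal_seq"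
    and xm[measurable]: "\<And>i. x i \<in> borel_measurable normal_seq"
    and hi: "\<And>n. integrable normal_seq (\<lambda>u. (h n u)\<^sup>2)" and hC: "\<And>N. (\<Sum>n<N. LINT u|normal_seq. (h n u)\<^sup>2) \<le> C"
    and xh: "AE u in normal_seq. \<forall>i. x i u = (\<Sum>n\<le>i. b n i * h n u)"
  defines "F \<equiv> \<lambda>c::real. \<lambda>(u, v). \<lambda>i. (x i u, c * x i u + (\<Sum>n\<le>i. b n i * v n))"
  shows "F c \<in> measurable (normal_seq \<Otimes>\<^sub>M normal_seq) borel"
    and "\<exists>D\<ge>0. \<forall>B\<in>sets borel. measure (normal_seq \<Otimes>\<^sub>M normal_seq) {z. F 1 z \<in> B}
      \<le> 1 / 2 + D * measure (normal_seq \<Otimes>\<^sub>M normal_seq) {z. F 0 z \<in> B}"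
proof -
  interpret S: prob_space normal_seq by (rule prob_space_normal_seq)
  interpret pair_prob_space normal_seq normal_seq ..
  let ?\<Omega> = "normal_seq \<Otimes>\<^sub>M normal_seq"
  have sp: "space ?\<Omega> = UNIV" by (simp add: space_pair_measure)
  have Fm[measurable]: "F c \<in> measurable ?\<Omega> borel" for c
  proof -
    have "F c \<in> measurable ?\<Omega> (PiM UNIV (\<lambda>_::nat. borel :: (real \<times> real) measure))"
    proof (rule measurable_PiM_single')
      fix i :: nat
      have "(\<lambda>z. (x i (fst z), c * x i (fst z) + (\<Sum>n\<le>i. b n i * snd z n))) \<in> measurable ?\<Omega> (borel \<Otimes>\<^sub>M borel)" by measurable
      then show "(\<lambda>z. F c z i) \<in> measurable ?\<Omega> borel" by (simp add: F_def case_prod_beta borel_prod)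
    qed auto
    then show ?thesis using measurable_cong_sets[OF refl sets_PiM_equal_borel] by blast
  qed
  then show "F c \<in> measurable ?\<Omega> borel" .
  have C: "0 \<le> C" using hC[of 0] by simp
  \<comment> \<open>By Markov the square sum of h exceeds R with probability at most C / R \<le>
    1/4, for every N.\<close>
  define R where "R = 4 * C + 1"
  have R: "R > 0" using C by (simp add: R_def)
  define D where "D = exp R"
  have Fset[measurable]: "{z. F c z \<in> B} \<in> sets ?\<Omega>" if "B \<in> sets borel" for c B
    using measurable_sets[OF Fm that, of c] by (simp add: sp vimage_def)
  have bad: "emeasure normal_seq {u. R < (\<Sum>n<N. (h n u)\<^sup>2)} \<le> ennreal (1 / 4)" for N
  proof -
    have "measure normal_seq {u \<in> space normal_seq. R \<le> (\<Sum>n<N. (h n u)\<^sup>2)} \<le> (LINT u|normal_seq. (\<Sum>n<N. (h n u)\<^sup>2)) / R"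
      using R hi by (intro integral_Markov_inequality_measure[where A = "{}"] AE_I2 sum_nonneg) auto
    also have "(LINT u|normal_seq. (\<Sum>n<N. (h n u)\<^sup>2)) / R \<le> C / R"
      using hC[of N] R hi by (intro divide_right_mono) (auto simp: Bochner_Integration.integral_sum)
    also have "\<dots> \<le> 1 / 4" using C by (simp add: R_def field_simps)
    finally have "measure normal_seq {u \<in> space normal_seq. R \<le> (\<Sum>n<N. (h n u)\<^sup>2)} \<le> 1 / 4" .
    then have "emeasure normal_seq {u \<in> space normal_seq. R \<le> (\<Sum>n<N. (h n u)\<^sup>2)} \<le> ennreal (1 / 4)"
      by (simp add: S.emeasure_eq_measure ennreal_leI)
    moreover have "emeasure normal_seq {u. R < (\<Sum>n<N. (h n u)\<^sup>2)} \<le> emeasure normal_seq {u \<in> space normal_seq. R \<le> (\<Sum>n<N. (h n u)\<^sup>2)}"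
    proof (rule emeasure_mono)
      show "{u \<in> space normal_seq. R \<le> (\<Sum>n<N. (h n u)\<^sup>2)} \<in> sets normal_seq" by measurable
    qed (auto simp: space_normal_seq)
    ultimately show ?thesis by (rule order.trans[rotated])
  qed
  have AEz: "AE z in ?\<Omega>. \<forall>i. x i (fst z) = (\<Sum>n\<le>i. b n i * h n (fst z))"
  proof (rule AE_pair_measure)
    show "{z \<in> space ?\<Omega>. \<forall>i. x i (fst z) = (\<Sum>n\<le>i. b n i * h n (fst z))} \<in> sets ?\<Omega>" by measurable
    show "AE u in normal_seq. AE v in normal_seq. \<forall>i. x i (fst (u, v)) = (\<Sum>n\<le>i. b n i * h n (fst (u, v)))"
      using xh by eventually_elim simp
  qed
  have cyl: "measure ?\<Omega> {z. F 1 z \<in> U} \<le> 1 / 2 + D * measure ?\<Omega> {z. F 0 z \<in> U}"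
    if U: "U \<in> sets borel" and N: "depends_below N U" for U N
  proof -
    define A where "A = {z. F 0 z \<in> U}"
    have A[measurable]: "A \<in> sets ?\<Omega>" unfolding A_def by (rule Fset[OF U])
    define \<tau> where "\<tau> z = (fst z, shift_seq N (\<lambda>n. h n (fst z)) (snd z))" for z
    have "(\<lambda>z. shift_seq N (\<lambda>n. h n (fst z)) (snd z)) \<in> measurable ?\<Omega> normal_seq"
      by (rule measurable_into_normal_seq) (simp add: shift_seq_def)
    then have [measurable]: "\<tau> \<in> measurable ?\<Omega> ?\<Omega>"
      unfolding \<tau>_def[abs_def] by (intro measurable_Pair) auto
    have \<tau>A: "{(u, v). (u, shift_seq N (\<lambda>n. h n u) v) \<in> A} = \<tau> -` A \<inter> space ?\<Omega>" by (auto simp: \<tau>_def sp)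
    have "AE z in ?\<Omega>. z \<in> {z. F 1 z \<in> U} \<longleftrightarrow> z \<in> \<tau> -` A \<inter> space ?\<Omega>"
      using AEz
    proof eventually_elim
      case (elim z)
      \<comment> \<open>Triangularity: for i < N the sum runs over n \<le> i < N, where the
        truncated shift is the full one.\<close>
      have "F 1 z i = F 0 (\<tau> z) i" if "i < N" for i
      proof -
        have "(\<Sum>n\<le>i. b n i * shift_seq N (\<lambda>n. h n (fst z)) (snd z) n) = (\<Sum>n\<le>i. b n i * h n (fst z) + b n i * snd z n)"
          using that by (intro sum.cong) (auto simp: shift_seq_def distrib_left)
        also have "\<dots> = x i (fst z) + (\<Sum>n\<le>i. b n i * snd z n)" using elim by (simp add: sum.distrib)
        finally show ?thesis by (simp add: F_def \<tau>_def case_prod_beta)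
      qed
      then have "F 1 z \<in> U \<longleftrightarrow> F 0 (\<tau> z) \<in> U" using N unfolding depends_below_def by blast
      then show ?case by (simp add: A_def sp)
    qed
    then have "emeasure ?\<Omega> {z. F 1 z \<in> U} = emeasure ?\<Omega> (\<tau> -` A \<inter> space ?\<Omega>)"
      by (rule emeasure_eq_AE) (use Fset[OF U] in measurable)
    \<comment> \<open>With \<epsilon> = exp (- R) / 2 the first term is 1/4 and the coefficient 1 /
      (2 \<epsilon>) is D = exp R; the exceptional event contributes the other 1/4.\<close>
    also have "\<dots> \<le> ennreal ((exp (- R) / 2) * exp R / 2) + ennreal (1 / (2 * (exp (- R) / 2))) * emeasure ?\<Omega> A
       + emeasure normal_seq {u. R < (\<Sum>n<N. (h n u)\<^sup>2)}"
      unfolding \<tau>A[symmetric] by (rule shift_probability_bound[OF hm A]) simp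
    also have "\<dots> \<le> ennreal ((exp (- R) / 2) * exp R / 2) + ennreal (1 / (2 * (exp (- R) / 2))) * emeasure ?\<Omega> A + ennreal (1 / 4)"
      by (intro add_left_mono bad)
    also have "(exp (- R) / 2) * exp R / 2 = 1 / 4" by (simp add: exp_minus)
    also have "1 / (2 * (exp (- R) / 2)) = D" by (simp add: D_def exp_minus field_simps)
    also have "ennreal (1 / 4) + ennreal D * emeasure ?\<Omega> A + ennreal (1 / 4) = ennreal (1 / 2 + D * measure ?\<Omega> A)"
      unfolding P.emeasure_eq_measure by (simp add: D_def ennreal_mult[symmetric] ennreal_plus[symmetric] del: ennreal_plus)
    finally show ?thesis
      unfolding P.emeasure_eq_measure A_def by (subst (asm) ennreal_le_iff) (auto simp: D_def)
  qed
  have "measure ?\<Omega> {z. F 1 z \<in> B} \<le> 1 / 2 + D * measure ?\<Omega> {z. F 0 z \<in> B}" if B: "B \<in> sets borel" for B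
  proof (rule field_le_epsilon)
    fix e :: real assume e: "0 < e"
    define \<mu> where "\<mu> = distr ?\<Omega> borel (F 0)"
    interpret \<mu>: prob_space \<mu> unfolding \<mu>_def by (rule P.prob_space_distr) simp
    have \<mu>: "emeasure \<mu> W = ennreal (measure ?\<Omega> {z. F 0 z \<in> W})" if "W \<in> sets borel" for W
      unfolding \<mu>_def using that by (subst emeasure_distr) (auto simp: P.emeasure_eq_measure sp vimage_def)
    have D: "D > 0" by (simp add: D_def)
    \<comment> \<open>Outer regularity is needed only for the law of F 0: an open superset enlarges
      the left side anyway, and exceeds B by at most e / D on the right, which costs e after
      multiplication by D.\<close>
    have "(INF U\<in>{U. B \<subseteq> U \<and> open U}. emeasure \<mu> U) = emeasure \<mu> B"
      by (rule outer_regular[symmetric]) (use B \<mu>.emeasure_finite in \<open>auto simp: \<mu>_def\<close>)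
    also have "\<dots> < emeasure \<mu> B + ennreal (e / D)" using e D by (simp add: \<mu>[OF B] ennreal_plus[symmetric] ennreal_less_iff del: ennreal_plus)
    finally obtain U where U: "B \<subseteq> U" "open U" and lt: "emeasure \<mu> U < emeasure \<mu> B + ennreal (e / D)"
      unfolding INF_less_iff by blast
    have Ub: "U \<in> sets borel" using U(2) by simp
    have lt': "measure ?\<Omega> {z. F 0 z \<in> U} \<le> measure ?\<Omega> {z. F 0 z \<in> B} + e / D"
      using lt e D unfolding \<mu>[OF B] \<mu>[OF Ub] by (simp add: ennreal_plus[symmetric] ennreal_less_iff del: ennreal_plus)
    obtain V where V: "incseq V" "(\<Union>m. V m) = U" "\<And>m. open (V m)" "\<And>m. \<exists>N. depends_below N (V m)"
      using open_sequence_set_exhaustion[OF U(2)] by blast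
    have "(\<lambda>m. measure ?\<Omega> {z. F 1 z \<in> V m}) \<longlonglongrightarrow> measure ?\<Omega> (\<Union>m. {z. F 1 z \<in> V m})"
    proof (rule P.finite_Lim_measure_incseq)
      show "range (\<lambda>m. {z. F 1 z \<in> V m}) \<subseteq> sets ?\<Omega>" using V(3) by (auto intro!: Fset)
      show "incseq (\<lambda>m. {z. F 1 z \<in> V m})" using V(1) unfolding incseq_def by blast
    qed
    moreover have "(\<Union>m. {z. F 1 z \<in> V m}) = {z. F 1 z \<in> U}" using V(2) by auto
    moreover have "measure ?\<Omega> {z. F 1 z \<in> V m} \<le> 1 / 2 + D * measure ?\<Omega> {z. F 0 z \<in> U}" for m
    proof -
      obtain N where "depends_below N (V m)" using V(4) by blast
      then have "measure ?\<Omega> {z. F 1 z \<in> V m} \<le> 1 / 2 + D * measure ?\<Omega> {z. F 0 z \<in> V m}"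
        using V(3) by (intro cyl) auto
      also have "measure ?\<Omega> {z. F 0 z \<in> V m} \<le> measure ?\<Omega> {z. F 0 z \<in> U}"
        using V(2) Ub by (intro P.finite_measure_mono Fset) auto
      finally show ?thesis using D by simp
    qed
    ultimately have "measure ?\<Omega> {z. F 1 z \<in> U} \<le> 1 / 2 + D * measure ?\<Omega> {z. F 0 z \<in> U}"
      by (intro LIMSEQ_le_const2[of _ "measure ?\<Omega> {z. F 1 z \<in> U}"]) auto
    moreover have "measure ?\<Omega> {z. F 1 z \<in> B} \<le> measure ?\<Omega> {z. F 1 z \<in> U}"
      using U(1) Ub by (intro P.finite_measure_mono Fset) auto
    moreover have "D * measure ?\<Omega> {z. F 0 z \<in> U} \<le> D * measure ?\<Omega> {z. F 0 z \<in> B} + e"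
      using mult_left_mono[OF lt', of D] D by (simp add: distrib_left)
    ultimately show "measure ?\<Omega> {z. F 1 z \<in> B} \<le> 1 / 2 + D * measure ?\<Omega> {z. F 0 z \<in> B} + e" by linarith
  qed
  then show "\<exists>D\<ge>0. \<forall>B\<in>sets borel. measure ?\<Omega> {z. F 1 z \<in> B} \<le> 1 / 2 + D * measure ?\<Omega> {z. F 0 z \<in> B}"
    by (intro exI[of _ D]) (auto simp: D_def)
qed

section \<open>Coordinates along a pivot sequence\<close>

text \<open>Finite combinations of point evaluations along t. They can be applied alike to a path of
  X, to cosines and sines and to the functions \<open>b m\<close>, so each coordinate is a single
  object in all settings.\<close>

definition evaluation_functional :: "(nat \<Rightarrow> 'i) \<Rightarrow> (('i \<Rightarrow> real) \<Rightarrow> real) \<Rightarrow> bool" where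
  "evaluation_functional t \<phi> \<longleftrightarrow> (\<exists>N r. \<forall>g. \<phi> g = (\<Sum>i<N. r i * g (t i)))"

lemma evaluation_functionalE:
  assumes "evaluation_functional t \<phi>"
  obtains N r where "\<And>g. \<phi> g = (\<Sum>i<N::nat. r i * g (t i))"
  using assms unfolding evaluation_functional_def by blast

lemma evaluation_functional_eval: "evaluation_functional t (\<lambda>g. g (t n))"
  unfolding evaluation_functional_def
  by (intro exI[of _ "Suc n"] exI[of _ "\<lambda>i. if i = n then 1 else 0"]) (simp add: if_distrib[of "\<lambda>y. y * _"] cong: if_cong)

lemma evaluation_functional_zero: "evaluation_functional t (\<lambda>g. 0)"
  unfolding evaluation_functional_def by (intro exI[of _ 0]) simp

lemma evaluation_functional_scale:
  assumes "evaluation_functional t \<phi>" shows "evaluation_functional t (\<lambda>g. c * \<phi> g)"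
proof -
  obtain N r where "\<And>g. \<phi> g = (\<Sum>i<N. r i * g (t i))" using evaluation_functionalE[OF assms] by metis
  then show ?thesis unfolding evaluation_functional_def
    by (intro exI[of _ N] exI[of _ "\<lambda>i. c * r i"]) (simp add: sum_distrib_left mult.assoc)
qed

lemma evaluation_functional_add:
  assumes "evaluation_functional t \<phi>" "evaluation_functional t \<psi>"
  shows "evaluation_functional t (\<lambda>g. \<phi> g + \<psi> g)"
proof -
  obtain N r where r: "\<And>g. \<phi> g = (\<Sum>i<N. r i * g (t i))" using evaluation_functionalE[OF assms(1)] by metis
  obtain N' r' where r': "\<And>g. \<psi> g = (\<Sum>i<N'. r' i * g (t i))" using evaluation_functionalE[OF assms(2)] by metis
  have pad: "(\<Sum>i<n. q i * g (t i)) = (\<Sum>i<m. (if i < n then q i else 0) * g (t i))" if "n \<le> m" for n m :: nat and q :: "nat \<Rightarrow> real" and g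
    using that by (intro sum.mono_neutral_cong_left) (auto simp: not_less)
  show ?thesis unfolding evaluation_functional_def
    by (intro exI[of _ "max N N'"] exI[of _ "\<lambda>i. (if i < N then r i else 0) + (if i < N' then r' i else 0)"])
       (simp add: r r' distrib_right sum.distrib pad[of N "max N N'"] pad[of N' "max N N'"])
qed

lemma evaluation_functional_sum:
  "finite S \<Longrightarrow> (\<And>j. j \<in> S \<Longrightarrow> evaluation_functional t (\<phi> j)) \<Longrightarrow> evaluation_functional t (\<lambda>g. \<Sum>j\<in>S. \<phi> j g)"
  by (induction S rule: finite_induct) (auto intro: evaluation_functional_zero evaluation_functional_add)

text \<open>Forward substitution in the triangular system g (t i) = \<Sum> b n (t i) * h n. At a
  zero pivot the coordinate is 0 by the convention for division.\<close>

fun pivot_coeff :: "(nat \<Rightarrow> 'i \<Rightarrow> real) \<Rightarrow> (nat \<Rightarrow> 'i) \<Rightarrow> ('i \<Rightarrow> real) \<Rightarrow> nat \<Rightarrow> real" where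
  "pivot_coeff b t g n = (g (t n) - (\<Sum>j<n. b j (t n) * pivot_coeff b t g j)) / b n (t n)"

declare pivot_coeff.simps[simp del]

lemma evaluation_functional_residual:
  assumes "\<And>j. j < n \<Longrightarrow> evaluation_functional t (\<phi> j)"
  shows "evaluation_functional t (\<lambda>g. g (t i) - (\<Sum>j<(n::nat). c j * \<phi> j g))"
proof -
  have "evaluation_functional t (\<lambda>g. g (t i) + (- 1) * (\<Sum>j<n. c j * \<phi> j g))"
    using assms by (intro evaluation_functional_add evaluation_functional_eval evaluation_functional_scale evaluation_functional_sum finite_lessThan) auto
  then show ?thesis by simp
qed

lemma evaluation_functional_pivot_coeff: "evaluation_functional t (\<lambda>g. pivot_coeff b t g n)"
proof (induction n rule: less_induct)
  case (less n)
  have "evaluation_functional t (\<lambda>g. 1 / b n (t n) * (g (t n) - (\<Sum>j<n. b j (t n) * pivot_coeff b t g j)))"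
    using less by (intro evaluation_functional_scale evaluation_functional_residual)
  then show ?case by (subst pivot_coeff.simps) simp
qed

text \<open>The coordinates are dual to the functions \<open>b m\<close>: below index m all values b
  m (t n) are 0, at m the pivot is normalised, and above m the substitution subtracts exactly b m (t
  n). A vanishing pivot makes \<open>b m\<close> zero everywhere.\<close>

lemma pivot_coeff_basis:
  assumes piv: "\<And>i n. i < n \<Longrightarrow> b n (t i) = 0" and deg: "\<And>n x. b n (t n) = 0 \<Longrightarrow> b n x = 0"
  shows "pivot_coeff b t (b m) n = (if n = m \<and> b m (t m) \<noteq> 0 then 1 else 0)"
proof (induction n rule: less_induct)
  case (less n)
  have "(\<Sum>j<n. b j (t n) * pivot_coeff b t (b m) j) = (\<Sum>j<n. if j = m then (if b m (t m) \<noteq> 0 then b m (t n) else 0) else 0)"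
    using less by (intro sum.cong) auto
  also have "\<dots> = (if m < n then b m (t n) else 0)" using deg[of m "t n"] by simp
  finally show ?case
    using piv[of n m] by (subst pivot_coeff.simps) (cases n m rule: linorder_cases; simp)
qed

text \<open>Parseval: the values on the \<open>b m\<close> are the coordinates of \<phi>, whose
  squared norm is the quadratic form of K, since R vanishes at the points.\<close>

lemma evaluation_functional_sums_square:
  assumes b: "\<And>x y. (\<lambda>n. b n x * b n y :: real) sums (K x y - R x y)" and R0: "\<And>i x. R x (t i) = 0"
    and \<phi>: "\<And>g. \<phi> g = (\<Sum>i<N::nat. r i * g (t i))"
  shows "(\<lambda>m. (\<phi> (b m))\<^sup>2) sums (\<Sum>i<N. \<Sum>j<N. r i * r j * K (t i) (t j))"
proof -
  have "(\<lambda>m. \<Sum>i<N. \<Sum>j<N. r i * r j * (b m (t i) * b m (t j))) sums (\<Sum>i<N. \<Sum>j<N. r i * r j * K (t i) (t j))"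
    using b[of "t _" "t _"] by (intro sums_sum sums_mult) (simp add: R0)
  moreover have "(\<phi> (b m))\<^sup>2 = (\<Sum>i<N. \<Sum>j<N. r i * r j * (b m (t i) * b m (t j)))" for m
    unfolding \<phi> power2_eq_square sum_product by (intro sum.cong refl) (simp add: mult_ac)
  ultimately show ?thesis by simp
qed

text \<open>Hypothesis C says that evaluation functionals are bounded at g by the norm that K gives
  them: g has squared norm at most C in the reproducing kernel space over the points. The square sum
  is Bessel's inequality; reconstruction is triangular substitution wherever the pivot is
  nonzero.\<close>

lemma
  assumes b: "\<And>x y. (\<lambda>n. b n x * b n y :: real) sums (K x y - R x y)" and R0: "\<And>i x. R x (t i) = 0"
    and piv: "\<And>i n. i < n \<Longrightarrow> b n (t i) = 0" and deg: "\<And>n x. b n (t n) = 0 \<Longrightarrow> b n x = 0"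
    and C: "\<And>N r. (\<Sum>i<N::nat. r i * g (t i))\<^sup>2 \<le> C * (\<Sum>i<N. \<Sum>j<N. r i * r j * K (t i) (t j))"
  shows pivot_coeff_square_sum: "0 \<le> C \<Longrightarrow> (\<Sum>n<M. (pivot_coeff b t g n)\<^sup>2) \<le> C"
    and pivot_coeff_reconstruct: "g (t i) = (\<Sum>n\<le>i. b n (t i) * pivot_coeff b t g n)"
proof -
  have basis: "pivot_coeff b t (b m) n = (if n = m \<and> b m (t m) \<noteq> 0 then 1 else 0)" for m n
    by (rule pivot_coeff_basis) (use piv deg in blast)+
  have bound: "(\<phi> g)\<^sup>2 \<le> C * s" if ev: "evaluation_functional t \<phi>" and s: "(\<lambda>m. (\<phi> (b m))\<^sup>2) sums s" for \<phi> s
  proof -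
    obtain N :: nat and r where r: "\<And>g. \<phi> g = (\<Sum>i<N. r i * g (t i))" using evaluation_functionalE[OF ev] by metis
    have "s = (\<Sum>i<N. \<Sum>j<N. r i * r j * K (t i) (t j))"
      using sums_unique2[OF s evaluation_functional_sums_square[of b K R t \<phi>, OF b R0 r]] .
    then show ?thesis using C[of r N] by (simp add: r)
  qed
  show "(\<Sum>n<M. (pivot_coeff b t g n)\<^sup>2) \<le> C" if C0: "0 \<le> C"
  proof -
    define v where "v n = pivot_coeff b t g n" for n
    \<comment> \<open>Duality: combining the coordinates with the coordinates of g as weights gives
      \<phi> g = S, while \<phi> has squared norm at most S; so S^2 \<le> C S.\<close>
    define \<phi> where "\<phi> f = (\<Sum>n<M. v n * pivot_coeff b t f n)" for f
    define S where "S = (\<Sum>n<M. (v n)\<^sup>2)"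
    have ev: "evaluation_functional t \<phi>" unfolding \<phi>_def[abs_def]
      by (intro evaluation_functional_sum evaluation_functional_scale evaluation_functional_pivot_coeff finite_lessThan)
    have \<phi>b: "\<phi> (b m) = (if m < M \<and> b m (t m) \<noteq> 0 then v m else 0)" for m
    proof -
      have "\<phi> (b m) = (\<Sum>n<M. if n = m then (if b m (t m) \<noteq> 0 then v m else 0) else 0)"
        unfolding \<phi>_def basis by (intro sum.cong) auto
      then show ?thesis by simp
    qed
    have "(\<lambda>m. (\<phi> (b m))\<^sup>2) sums (\<Sum>m<M. (\<phi> (b m))\<^sup>2)" by (rule sums_finite) (auto simp: \<phi>b)
    then have "(\<phi> g)\<^sup>2 \<le> C * (\<Sum>m<M. (\<phi> (b m))\<^sup>2)" by (rule bound[OF ev])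
    also have "\<dots> \<le> C * S" unfolding S_def using C0 by (intro mult_left_mono sum_mono) (auto simp: \<phi>b)
    also have "\<phi> g = S" by (simp add: \<phi>_def S_def v_def power2_eq_square)
    finally have "S * S \<le> C * S" by (simp add: power2_eq_square)
    moreover have "0 \<le> S" unfolding S_def by (intro sum_nonneg) simp
    ultimately have "S \<le> C" using C0 by (cases "S = 0") auto
    then show ?thesis by (simp add: S_def v_def)
  qed
  show "g (t i) = (\<Sum>n\<le>i. b n (t i) * pivot_coeff b t g n)"
  proof (cases "b i (t i) = 0")
    case False
    then show ?thesis by (subst lessThan_Suc_atMost[symmetric]) (simp add: pivot_coeff.simps[of b t g i])
  next
    case True
    \<comment> \<open>At a zero pivot the equation for t i is not solved by substitution. But the
      residual functional vanishes on all \<open>b m\<close>, hence has norm 0 and annihilates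
      g.\<close>
    define \<phi> where "\<phi> f = f (t i) - (\<Sum>j<i. b j (t i) * pivot_coeff b t f j)" for f
    have ev: "evaluation_functional t \<phi>" unfolding \<phi>_def[abs_def]
      by (intro evaluation_functional_residual evaluation_functional_pivot_coeff)
    have "\<phi> (b m) = 0" for m
    proof -
      have "(\<Sum>j<i. b j (t i) * pivot_coeff b t (b m) j) = (\<Sum>j<i. if j = m then (if b m (t m) \<noteq> 0 then b m (t i) else 0) else 0)"
        unfolding basis by (intro sum.cong) auto
      also have "\<dots> = (if m < i then b m (t i) else 0)" using deg[of m "t i"] by simp
      finally show ?thesis unfolding \<phi>_def using True piv[of i m] by (cases m i rule: linorder_cases) auto
    qed
    then have "(\<lambda>m. (\<phi> (b m))\<^sup>2) sums 0" by simp
    from bound[OF ev this] have "\<phi> g = 0" by simp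
    then show ?thesis using True by (subst lessThan_Suc_atMost[symmetric]) (simp add: \<phi>_def)
  qed
qed

lemma spectral_density_isCont_0:
  assumes f: "spectral_density f K"
  shows "isCont K 0"
proof (rule continuous_at_sequentiallyI)
  fix s :: "nat \<Rightarrow> real" assume s: "s \<longlonglongrightarrow> 0"
  have fi: "integrable lborel f" using f by (simp add: spectral_density_def)
  have "(\<lambda>n. LINT u|lborel. f u * cos (u * s n)) \<longlonglongrightarrow> (LINT u|lborel. f u * cos (u * 0))"
  proof (rule integral_dominated_convergence[where w = "\<lambda>u. \<bar>f u\<bar>"])
    show "AE u in lborel. (\<lambda>n. f u * cos (u * s n)) \<longlonglongrightarrow> f u * cos (u * 0)"
      using s by (intro AE_I2 tendsto_intros)
    show "AE u in lborel. norm (f u * cos (u * s n)) \<le> \<bar>f u\<bar>" for n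
      by (intro AE_I2) (simp add: abs_mult mult_left_le)
  qed (use fi in \<open>auto intro!: borel_measurable_times borel_measurable_integrable\<close>)
  then show "(\<lambda>n. K (s n)) \<longlonglongrightarrow> K 0" unfolding spectral_density_cos(2)[OF f] .
qed

section \<open>The process X in pivot coordinates, and the test bound for the responses\<close>

text \<open>The coordinates h n are evaluation functionals of X, so their second moments are
  spectral integrals of the coordinates of cosines and sines. Summed over n, Bessel's inequality
  bounds these by the weight, and f1 integrates the weight.\<close>

lemma pivot_coeff_process:
  fixes X :: "real \<Rightarrow> 'a \<Rightarrow> real" and t :: "nat \<Rightarrow> real"
  assumes Xm: "\<And>N r. (\<lambda>u. \<Sum>i<N::nat. r i * X (t i) u) \<in> borel_measurable M"
    and Xi: "\<And>N r. integrable M (\<lambda>u. (\<Sum>i<N::nat. r i * X (t i) u)\<^sup>2)"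
    and XK: "\<And>N r. (LINT u|M. (\<Sum>i<N::nat. r i * X (t i) u)\<^sup>2) = (\<Sum>i<N. \<Sum>j<N. r i * r j * K1 (t i - t j))"
    and f1: "spectral_density f1 K1" and f1p: "integrable lborel (\<lambda>\<omega>. f1 \<omega> * (1 + \<bar>\<omega>\<bar>) powr p)"
    and C0: "0 \<le> C" and rkhs: "\<And>\<omega> N r. (\<Sum>i<N::nat. r i * cos (\<omega> * t i))\<^sup>2 + (\<Sum>i<N. r i * sin (\<omega> * t i))\<^sup>2
      \<le> C * (1 + \<bar>\<omega>\<bar>) powr p * (\<Sum>i<N. \<Sum>j<N. r i * r j * K2 (t i - t j))"
    and b: "\<And>x y. (\<lambda>n. b n x * b n y :: real) sums (K2 (x - y) - R x y)" and R0: "\<And>i x. R x (t i) = 0"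
    and piv: "\<And>i n. i < n \<Longrightarrow> b n (t i) = 0" and deg: "\<And>n x. b n (t n) = 0 \<Longrightarrow> b n x = 0"
  defines "h \<equiv> \<lambda>n u. pivot_coeff b t (\<lambda>s. X s u) n"
  shows "h n \<in> borel_measurable M" "integrable M (\<lambda>u. (h n u)\<^sup>2)"
    and "\<exists>D. \<forall>N. (\<Sum>n<N. LINT u|M. (h n u)\<^sup>2) \<le> D"
    and "AE u in M. \<forall>i. X (t i) u = (\<Sum>n\<le>i. b n (t i) * h n u)"
proof -
  define E where "E \<phi> \<omega> = f1 \<omega> * ((\<phi> (\<lambda>s. cos (\<omega> * s)))\<^sup>2 + (\<phi> (\<lambda>s. sin (\<omega> * s)))\<^sup>2)" for \<phi> :: "(real \<Rightarrow> real) \<Rightarrow> real" and \<omega>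
  have ev: "(\<lambda>u. \<phi> (\<lambda>s. X s u)) \<in> borel_measurable M" "integrable M (\<lambda>u. (\<phi> (\<lambda>s. X s u))\<^sup>2)"
    "integrable lborel (E \<phi>)" "(LINT u|M. (\<phi> (\<lambda>s. X s u))\<^sup>2) = (LINT \<omega>|lborel. E \<phi> \<omega>)"
    if evf: "evaluation_functional t \<phi>" for \<phi>
  proof -
    obtain N :: nat and r where r: "\<And>g. \<phi> g = (\<Sum>i<N. r i * g (t i))" using evaluation_functionalE[OF evf] by metis
    show "(\<lambda>u. \<phi> (\<lambda>s. X s u)) \<in> borel_measurable M" "integrable M (\<lambda>u. (\<phi> (\<lambda>s. X s u))\<^sup>2)"
      unfolding r by (rule Xm Xi)+
    show "integrable lborel (E \<phi>)" unfolding E_def[abs_def] r by (rule spectral_quadratic_form(1)[OF f1])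
    show "(LINT u|M. (\<phi> (\<lambda>s. X s u))\<^sup>2) = (LINT \<omega>|lborel. E \<phi> \<omega>)"
      unfolding E_def r XK by (rule spectral_quadratic_form(2)[OF f1])
  qed
  have evh: "evaluation_functional t (\<lambda>g. pivot_coeff b t g n)" for n by (rule evaluation_functional_pivot_coeff)
  note hn = ev[OF evh, folded h_def]
  show "h n \<in> borel_measurable M" "integrable M (\<lambda>u. (h n u)\<^sup>2)" using hn(1)[of n] hn(2)[of n] by (simp_all add: h_def)
  have C': "0 \<le> C * (1 + \<bar>\<omega>\<bar>) powr p" for \<omega> using C0 by simp
  have cosb: "(\<Sum>i<N::nat. r i * cos (\<omega> * t i))\<^sup>2 \<le> C * (1 + \<bar>\<omega>\<bar>) powr p * (\<Sum>i<N. \<Sum>j<N. r i * r j * K2 (t i - t j))"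
    and sinb: "(\<Sum>i<N::nat. r i * sin (\<omega> * t i))\<^sup>2 \<le> C * (1 + \<bar>\<omega>\<bar>) powr p * (\<Sum>i<N. \<Sum>j<N. r i * r j * K2 (t i - t j))" for \<omega> r N
    using rkhs[where \<omega> = \<omega> and N = N and r = r] by (smt (verit) zero_le_power2)+
  have pc: "(\<Sum>n<N. (pivot_coeff b t g n)\<^sup>2) \<le> D" if "0 \<le> D"
    "\<And>N r. (\<Sum>i<N::nat. r i * g (t i))\<^sup>2 \<le> D * (\<Sum>i<N. \<Sum>j<N. r i * r j * K2 (t i - t j))" for N g D
    by (rule pivot_coeff_square_sum[where K = "\<lambda>s s'. K2 (s - s')" and R = R])
       (use b R0 piv deg that in blast)+
  have pr: "g (t i) = (\<Sum>n\<le>i. b n (t i) * pivot_coeff b t g n)" if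
    "\<And>N r. (\<Sum>i<N::nat. r i * g (t i))\<^sup>2 \<le> D * (\<Sum>i<N. \<Sum>j<N. r i * r j * K2 (t i - t j))" for i g D
    by (rule pivot_coeff_reconstruct[where K = "\<lambda>s s'. K2 (s - s')" and R = R and C = D])
       (use b R0 piv deg that in blast)+
  have f1nn: "0 \<le> f1 \<omega>" for \<omega> using f1 by (simp add: spectral_density_def)
  show "\<exists>D. \<forall>N. (\<Sum>n<N. LINT u|M. (h n u)\<^sup>2) \<le> D"
  proof (intro exI allI)
    fix N :: nat
    have "(\<Sum>n<N. LINT u|M. (h n u)\<^sup>2) = (\<Sum>n<N. LINT \<omega>|lborel. E (\<lambda>g. pivot_coeff b t g n) \<omega>)"
      using hn(4) by (simp add: h_def)
    also have "\<dots> = (LINT \<omega>|lborel. (\<Sum>n<N. E (\<lambda>g. pivot_coeff b t g n) \<omega>))"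
      by (intro Bochner_Integration.integral_sum[symmetric] ev(3) evh)
    also have "\<dots> \<le> (LINT \<omega>|lborel. 2 * C * (f1 \<omega> * (1 + \<bar>\<omega>\<bar>) powr p))"
    proof (intro integral_mono Bochner_Integration.integrable_sum ev(3) evh integrable_mult_right f1p)
      fix \<omega>
      have "(\<Sum>n<N. E (\<lambda>g. pivot_coeff b t g n) \<omega>)
        = f1 \<omega> * ((\<Sum>n<N. (pivot_coeff b t (\<lambda>s. cos (\<omega> * s)) n)\<^sup>2) + (\<Sum>n<N. (pivot_coeff b t (\<lambda>s. sin (\<omega> * s)) n)\<^sup>2))"
        by (simp add: E_def sum_distrib_left sum.distrib distrib_left)
      \<comment> \<open>Bessel's inequality is used once for the cosine and once for the sine, hence
        2 C.\<close>
      also have "\<dots> \<le> f1 \<omega> * (C * (1 + \<bar>\<omega>\<bar>) powr p + C * (1 + \<bar>\<omega>\<bar>) powr p)"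
        by (intro mult_left_mono add_mono f1nn pc C' cosb sinb)
      finally show "(\<Sum>n<N. E (\<lambda>g. pivot_coeff b t g n) \<omega>) \<le> 2 * C * (f1 \<omega> * (1 + \<bar>\<omega>\<bar>) powr p)"
        by (simp add: algebra_simps)
    qed
    finally show "(\<Sum>n<N. LINT u|M. (h n u)\<^sup>2) \<le> (LINT \<omega>|lborel. 2 * C * (f1 \<omega> * (1 + \<bar>\<omega>\<bar>) powr p))" .
  qed
  have "AE u in M. X (t i) u = (\<Sum>n\<le>i. b n (t i) * h n u)" for i
  proof -
    \<comment> \<open>The reconstruction error vanishes on the cosine and sine of each frequency, so
      its second moment as a functional of X is an integral of 0.\<close>
    define \<phi> where "\<phi> g = g (t i) - (\<Sum>n<Suc i. b n (t i) * pivot_coeff b t g n)" for g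
    have ev\<phi>: "evaluation_functional t \<phi>" unfolding \<phi>_def[abs_def]
      by (intro evaluation_functional_residual evaluation_functional_pivot_coeff)
    have "cos (\<omega> * t i) = (\<Sum>n\<le>i. b n (t i) * pivot_coeff b t (\<lambda>s. cos (\<omega> * s)) n)" for \<omega>
      by (rule pr[of "\<lambda>s. cos (\<omega> * s)", OF cosb])
    moreover have "sin (\<omega> * t i) = (\<Sum>n\<le>i. b n (t i) * pivot_coeff b t (\<lambda>s. sin (\<omega> * s)) n)" for \<omega>
      by (rule pr[of "\<lambda>s. sin (\<omega> * s)", OF sinb])
    ultimately have "\<phi> (\<lambda>s. cos (\<omega> * s)) = 0" "\<phi> (\<lambda>s. sin (\<omega> * s)) = 0" for \<omega>
      unfolding \<phi>_def lessThan_Suc_atMost by simp_all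
    then have "E \<phi> \<omega> = 0" for \<omega> by (simp add: E_def)
    then have "(LINT u|M. (\<phi> (\<lambda>s. X s u))\<^sup>2) = 0" using ev(4)[OF ev\<phi>] by simp
    then have "AE u in M. (\<phi> (\<lambda>s. X s u))\<^sup>2 = 0"
      by (subst (asm) integral_nonneg_eq_0_iff_AE[OF ev(2)[OF ev\<phi>]]) auto
    then show ?thesis by eventually_elim (simp add: \<phi>_def h_def lessThan_Suc_atMost)
  qed
  then show "AE u in M. \<forall>i. X (t i) u = (\<Sum>n\<le>i. b n (t i) * h n u)" by (simp add: AE_all_countable)
qed

lemma psd_kernel_stationary: "stationary_covariance K \<Longrightarrow> psd_kernel (\<lambda>s s'. K (s - s'))"
proof -
  assume K: "stationary_covariance K"
  then have "K (s - s') = K (s' - s)" for s s'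
    using minus_diff_eq[of s s'] unfolding stationary_covariance_def by metis
  with K show ?thesis unfolding psd_kernel_def stationary_covariance_def by blast
qed

text \<open>Expands X and the residual of W together, as the block-diagonal kernel on component and
  position. The pivots are all rational positions; \<open>Rle\<close> makes the residual as
  continuous as K2 although R is not stationary, so nothing remains after expansion.\<close>

lemma psd_kernel_expansion_stationary_pair:
  fixes R :: "real \<Rightarrow> real \<Rightarrow> real"
  assumes K1: "stationary_covariance K1" "isCont K1 0" and R: "psd_kernel R"
    and K2: "isCont K2 0" and Rle: "\<And>s s'. R s s - 2 * R s s' + R s' s' \<le> 2 * (K2 0 - K2 (s - s'))"
  defines "J \<equiv> \<lambda>(p :: nat \<times> real) (q :: nat \<times> real). of_bool (fst p = 1) * of_bool (fst q = 1) * K1 (snd p - snd q)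
      + of_bool (fst p = 2) * of_bool (fst q = 2) * R (snd p) (snd q)"
  shows "\<exists>a. \<forall>p q. (\<lambda>n. a n p * a n q :: real) sums J p q"
proof -
  have J: "psd_kernel J" unfolding J_def
    by (intro psd_kernel_add psd_kernel_scale psd_kernel_pullback[where f = snd] psd_kernel_stationary K1 R
        psd_kernel_pullback[OF psd_kernel_stationary[OF K1(1)], where f = snd])
  \<comment> \<open>All component indices are enumerated: the expansion must be exact also at
    indices other than 1 and 2, where the kernel is 0.\<close>
  define \<tau> where "\<tau> = from_nat_into ((UNIV :: nat set) \<times> (\<rat> :: real set))"
  have \<tau>: "range \<tau> = UNIV \<times> \<rat>" unfolding \<tau>_def
  proof (rule range_from_nat_into)
    show "(UNIV :: nat set) \<times> (\<rat> :: real set) \<noteq> {}" using Rats_0 by blast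
    show "countable ((UNIV :: nat set) \<times> (\<rat> :: real set))" by (intro countable_SIGMA countable_rat) simp
  qed
  obtain a R' where a': "\<forall>p q. (\<lambda>n. a n p * a n q) sums (J p q - R' p q)" and R': "psd_kernel R'"
    and piv': "\<forall>i p. R' p (\<tau> i) = 0"
    using psd_kernel_expansion[OF J, of \<tau>] by (elim exE conjE) (rule that; assumption)
  have a: "(\<lambda>n. a n p * a n q) sums (J p q - R' p q)" and piv: "R' p (\<tau> i) = 0" for p q i
    using a' piv' by blast+
  have "\<exists>i. J p p - 2 * J p (\<tau> i) + J (\<tau> i) (\<tau> i) < \<epsilon>" if \<epsilon>: "\<epsilon> > 0" for p \<epsilon>
  proof -
    obtain d1 where d1: "d1 > 0" "\<And>x. \<bar>x\<bar> < d1 \<Longrightarrow> \<bar>K1 x - K1 0\<bar> < \<epsilon> / 2"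
      using K1(2) \<epsilon> unfolding continuous_at_eps_delta dist_real_def by (metis diff_zero half_gt_zero)
    obtain d2 where d2: "d2 > 0" "\<And>x. \<bar>x\<bar> < d2 \<Longrightarrow> \<bar>K2 x - K2 0\<bar> < \<epsilon> / 2"
      using K2 \<epsilon> unfolding continuous_at_eps_delta dist_real_def by (metis diff_zero half_gt_zero)
    obtain q :: real where q: "q \<in> \<rat>" "snd p - min d1 d2 < q" "q < snd p"
      using Rats_dense_in_real[of "snd p - min d1 d2" "snd p"] d1 d2 by auto
    have "(fst p, q) \<in> range \<tau>" unfolding \<tau> using q by auto
    then obtain i where i: "\<tau> i = (fst p, q)" by auto
    have "\<bar>snd p - q\<bar> < d1" "\<bar>snd p - q\<bar> < d2" using q by auto
    note d' = d1(2)[OF this(1)] d2(2)[OF this(2)]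
    have d: "2 * (K1 0 - K1 (snd p - q)) < \<epsilon>" using d'(1)[unfolded abs_less_iff] by argo
    have d0: "2 * (K2 0 - K2 (snd p - q)) < \<epsilon>" using d'(2)[unfolded abs_less_iff] by argo
    show ?thesis
    proof (intro exI[of _ i])
      have "J p p - 2 * J p (\<tau> i) + J (\<tau> i) (\<tau> i)
        = of_bool (fst p = 1) * (2 * (K1 0 - K1 (snd p - q)))
          + of_bool (fst p = 2) * (R (snd p) (snd p) - 2 * R (snd p) q + R q q)"
        by (simp add: J_def i)
      also have "\<dots> < \<epsilon>"
        using d order.strict_trans1[OF Rle[of "snd p" q] d0] \<epsilon> by (cases "fst p = 1"; cases "fst p = 2") auto
      finally show "J p p - 2 * J p (\<tau> i) + J (\<tau> i) (\<tau> i) < \<epsilon>" .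
    qed
  qed
  then have "R' p q = 0" for p q
    by (intro residual_zero_of_dense[where R = R' and K = J and b = a and t = \<tau>, OF R' a piv])
  then have "\<forall>p q. (\<lambda>n. a n p * a n q) sums J p q" using a by simp
  then show ?thesis by blast
qed

text \<open>W is split along t: its projection onto the values at the points is driven by v, its
  residual together with X by u. At the points the residual vanishes, so there X is a function of u
  and W a finite sum in v, which is the setting of the shift bound. Away from the points both parts
  are needed to give W its full covariance.\<close>

lemma response_testing:
  fixes t :: "nat \<Rightarrow> real"
  assumes K1: "stationary_covariance K1" "spectral_density f1 K1"
    and K2: "stationary_covariance K2" "spectral_density f2 K2"
    and L: "0 < L" and t: "range t \<subseteq> {0..L}" and c: "0 < c" "0 \<le> p" and low: "\<And>u. c * (1 + \<bar>u\<bar>) powr (- p) \<le> f2 u"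
    and f1p: "integrable lborel (\<lambda>\<omega>. f1 \<omega> * (1 + \<bar>\<omega>\<bar>) powr p)"
  shows "\<exists>Z D. bivariate_gaussian_field (normal_seq \<Otimes>\<^sub>M normal_seq) Z
      (\<lambda>k l s s'. if k = l then (if k = 1 then K1 else K2) (s - s') else 0) \<and>
    (\<forall>B\<in>sets (borel :: (nat \<Rightarrow> real \<times> real) measure).
      measure (normal_seq \<Otimes>\<^sub>M normal_seq) {z \<in> space (normal_seq \<Otimes>\<^sub>M normal_seq). (\<lambda>i. (Z 1 (t i) z, response 1 Z (t i) z)) \<in> B}
      \<le> 1 / 2 + D * measure (normal_seq \<Otimes>\<^sub>M normal_seq) {z \<in> space (normal_seq \<Otimes>\<^sub>M normal_seq). (\<lambda>i. (Z 1 (t i) z, response 0 Z (t i) z)) \<in> B})"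
proof -
  interpret S: prob_space normal_seq by (rule prob_space_normal_seq)
  interpret pair_prob_space normal_seq normal_seq ..
  let ?\<Omega> = "normal_seq \<Otimes>\<^sub>M normal_seq"
  have sp: "space ?\<Omega> = UNIV" by (simp add: space_pair_measure)
  obtain b R where R: "psd_kernel R" and b': "\<forall>x y. (\<lambda>n. b n x * b n y) sums (K2 (x - y) - R x y)"
    and R0': "\<forall>i x. R x (t i) = 0" and piv': "\<forall>n i. i < n \<longrightarrow> b n (t i) = 0" and deg': "\<forall>n x. b n (t n) = 0 \<longrightarrow> b n x = 0"
    using psd_kernel_expansion[OF psd_kernel_stationary[OF K2(1)], of t] by (elim exE conjE) (rule that; assumption)
  have b: "(\<lambda>n. b n x * b n y) sums (K2 (x - y) - R x y)" and R0: "R x (t i) = 0" for x y i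
    using b' R0' by blast+
  have piv: "b n (t i) = 0" if "i < n" for i n using piv' that by blast
  have deg: "b n x = 0" if "b n (t n) = 0" for n x using deg' that by blast
  \<comment> \<open>The difference of both sides is the sum of the squares of b n s - b n
    s'.\<close>
  have Rle: "R s s - 2 * R s s' + R s' s' \<le> 2 * (K2 0 - K2 (s - s'))" for s s'
  proof -
    have "(\<lambda>n. b n s * b n s - 2 * (b n s * b n s') + b n s' * b n s')
      sums ((K2 (s - s) - R s s) - 2 * (K2 (s - s') - R s s') + (K2 (s' - s') - R s' s'))"
      by (intro sums_add sums_diff sums_mult b)
    then have "(\<lambda>n. (b n s - b n s')\<^sup>2) sums ((K2 (s - s) - R s s) - 2 * (K2 (s - s') - R s s') + (K2 (s' - s') - R s' s'))"
      by (rule back_subst[of "\<lambda>f. f sums _"]) (simp add: power2_eq_square algebra_simps)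
    from sums_le[OF _ sums_zero this] have "0 \<le> (K2 (s - s) - R s s) - 2 * (K2 (s - s') - R s s') + (K2 (s' - s') - R s' s')"
      by simp
    then show ?thesis by simp
  qed
  define J where "J = (\<lambda>(p :: nat \<times> real) (q :: nat \<times> real). of_bool (fst p = 1) * of_bool (fst q = 1) * K1 (snd p - snd q)
      + of_bool (fst p = 2) * of_bool (fst q = 2) * R (snd p) (snd q))"
  obtain a where a: "\<And>p q. (\<lambda>n. a n p * a n q) sums J p q"
    using psd_kernel_expansion_stationary_pair[OF K1(1) spectral_density_isCont_0[OF K1(2)] R spectral_density_isCont_0[OF K2(2)] Rle]
    unfolding J_def by blast
  define A where "A p n = a n p" for p n
  define B where "B p n = of_bool (fst p = (2::nat)) * b n (snd p)" for p n
  define CB where "CB p q = of_bool (fst p = (2::nat)) * of_bool (fst q = (2::nat)) * (K2 (snd p - snd q) - R (snd p) (snd q))" for p q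
  have A: "(\<lambda>n. A p n * A q n) sums J p q" for p q using a by (simp add: A_def)
  have B: "(\<lambda>n. B p n * B q n) sums CB p q" for p q
    using sums_mult[OF b[of "snd p" "snd q"], of "of_bool (fst p = 2) * of_bool (fst q = 2)"]
    by (simp add: B_def CB_def mult_ac)
  define Z where "Z k s = pair_field A B (k, s)" for k s
  have field: "bivariate_gaussian_field ?\<Omega> Z (\<lambda>k l s s'. if k = l then (if k = 1 then K1 else K2) (s - s') else 0)"
    unfolding Z_def[abs_def] by (rule pair_field_bivariate[OF A B]) (auto simp: J_def CB_def)
  define X where "X s = wiener (A (1, s))" for s
  have summ: "summable (\<lambda>n. (A p n)\<^sup>2)" for p using sums_summable[OF A[of p p]] by (simp add: power2_eq_square)
  have XJ: "(\<lambda>n. A (1, t i) n * A (1, t j) n) sums K1 (t i - t j)" for i j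
    using A[of "(1, t i)" "(1, t j)"] by (simp add: J_def)
  note cw = char_wiener_sum[where A = "\<lambda>i. A (1, t i)" and CA = "\<lambda>i j. K1 (t i - t j)" and T = "{..<N}" for N, OF XJ finite_lessThan, folded X_def]
  note gauss = centered_normal_from_char[OF prob_space_normal_seq cw(1) cw(3) cw(2)]
  have Xi: "integrable normal_seq (\<lambda>u. (\<Sum>i<N. r i * X (t i) u)\<^sup>2)" for N r
    by (rule centered_gaussian_moments(1)[OF prob_space_normal_seq gauss(1,2)])
  obtain C where C: "0 \<le> C" and "\<And>\<omega> (S :: nat set) x a. finite S \<Longrightarrow> x ` S \<subseteq> {0..L} \<Longrightarrow>
    (\<Sum>s\<in>S. a s * cos (\<omega> * x s))\<^sup>2 + (\<Sum>s\<in>S. a s * sin (\<omega> * x s))\<^sup>2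
      \<le> C * (1 + \<bar>\<omega>\<bar>) powr p * (\<Sum>s\<in>S. \<Sum>s'\<in>S. a s * a s' * K2 (x s - x s'))"
    using exponential_in_rkhs[OF K2(2) c L low] by blast
  then have rk: "(\<Sum>i<N. r i * cos (\<omega> * t i))\<^sup>2 + (\<Sum>i<N. r i * sin (\<omega> * t i))\<^sup>2
      \<le> C * (1 + \<bar>\<omega>\<bar>) powr p * (\<Sum>i<N. \<Sum>j<N. r i * r j * K2 (t i - t j))" for N r \<omega>
    using t by blast
  define h where "h n u = pivot_coeff b t (\<lambda>s. X s u) n" for n u
  have hm: "h n \<in> borel_measurable normal_seq" and hi: "integrable normal_seq (\<lambda>u. (h n u)\<^sup>2)" for n
    unfolding h_def[abs_def]
    by (rule pivot_coeff_process[where X = X and M = normal_seq and R = R, OF cw(1) Xi gauss(3) K1(2) f1p C rk b R0];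
        use piv deg in blast)+
  obtain D' where D': "\<And>N. (\<Sum>n<N. LINT u|normal_seq. (h n u)\<^sup>2) \<le> D'"
    using pivot_coeff_process(3)[where X = X and M = normal_seq and R = R, OF cw(1) Xi gauss(3) K1(2) f1p C rk b R0] piv deg
    unfolding h_def[abs_def] by blast
  have xh: "AE u in normal_seq. \<forall>i. X (t i) u = (\<Sum>n\<le>i. b n (t i) * h n u)"
    unfolding h_def
    by (rule pivot_coeff_process(4)[where X = X and M = normal_seq and R = R, OF cw(1) Xi gauss(3) K1(2) f1p C rk b R0];
        use piv deg in blast)
  have Xm: "X (t i) \<in> borel_measurable normal_seq" for i unfolding X_def by (rule wiener[OF summ])
  define F where "F c = (\<lambda>(u, v). \<lambda>i. (X (t i) u, c * X (t i) u + (\<Sum>n\<le>i. b n (t i) * v n)))" for c :: real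
  note test = shift_testing[where h = h and x = "\<lambda>i. X (t i)" and b = "\<lambda>n i. b n (t i)", OF hm Xm hi D' xh]
  have Fm: "F c \<in> measurable ?\<Omega> borel" for c unfolding F_def by (rule test(1))
  obtain D where D: "\<And>U. U \<in> sets borel \<Longrightarrow> measure ?\<Omega> {z. F 1 z \<in> U} \<le> 1 / 2 + D * measure ?\<Omega> {z. F 0 z \<in> U}"
    using test(2) unfolding F_def by blast
  have lift: "AE z in ?\<Omega>. P (fst z)" "AE z in ?\<Omega>. P (snd z)"
    if P: "AE u in normal_seq. P u" and [measurable]: "Measurable.pred normal_seq P" for P
  proof -
    show "AE z in ?\<Omega>. P (fst z)" by (rule AE_pair_measure) (use P in auto)
    show "AE z in ?\<Omega>. P (snd z)" by (rule AE_pair_measure) (use P in auto)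
  qed
  have wm[measurable]: "wiener (A p) \<in> borel_measurable normal_seq" "wiener (B p) \<in> borel_measurable normal_seq" for p
    using wiener(2)[OF summ[of p]] wiener(2)[of "B p"] sums_summable[OF B[of p p]] by (simp_all add: power2_eq_square)
  have Z: "AE z in ?\<Omega>. Z 1 (t i) z = X (t i) (fst z) \<and> Z 2 (t i) z = (\<Sum>n\<le>i. b n (t i) * snd z n)" for i
  proof -
    \<comment> \<open>The coefficients of the residual at t i have square sum R (t i) (t i) =
      0.\<close>
    have "A (2, t i) n = 0" for n
    proof -
      have "(\<lambda>n. A (2, t i) n * A (2, t i) n) sums 0" using A[of "(2, t i)" "(2, t i)"] by (simp add: J_def R0)
      then have "(\<Sum>n. A (2, t i) n * A (2, t i) n) = 0" "summable (\<lambda>n. A (2, t i) n * A (2, t i) n)"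
        by (auto simp: sums_iff)
      then show ?thesis by (subst (asm) suminf_eq_zero_iff) auto
    qed
    then have 1: "AE u in normal_seq. wiener (A (2, t i)) u = 0" using wiener_finite[of 0 "A (2, t i)"] by simp
    have 2: "AE v in normal_seq. wiener (B (1, t i)) v = 0" using wiener_finite[of 0 "B (1, t i)"] by (simp add: B_def)
    have 3: "AE v in normal_seq. wiener (B (2, t i)) v = (\<Sum>n\<le>i. b n (t i) * v n)"
      using wiener_finite[of "Suc i" "B (2, t i)"] piv[of i] by (simp add: B_def lessThan_Suc_atMost Suc_le_eq)
    have "AE z in ?\<Omega>. wiener (A (2, t i)) (fst z) = 0" by (rule lift(1)[OF 1]) measurable
    moreover have "AE z in ?\<Omega>. wiener (B (1, t i)) (snd z) = 0" by (rule lift(2)[OF 2]) measurable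
    moreover have "AE z in ?\<Omega>. wiener (B (2, t i)) (snd z) = (\<Sum>n\<le>i. b n (t i) * snd z n)"
    proof (rule lift(2)[OF 3])
      have "(\<lambda>v. \<Sum>n\<le>i. b n (t i) * v n) \<in> borel_measurable normal_seq"
        by measurable
      then have "{v \<in> space normal_seq. wiener (B (2, t i)) v = (\<Sum>n\<le>i. b n (t i) * v n)} \<in> sets normal_seq"
        by (intro borel_measurable_eq wm(2))
      then show "Measurable.pred normal_seq (\<lambda>v. wiener (B (2, t i)) v = (\<Sum>n\<le>i. b n (t i) * v n))"
        unfolding pred_def .
    qed
    ultimately show ?thesis by eventually_elim (simp add: Z_def pair_field_def X_def case_prod_beta)
  qed
  define G where "G c z = (\<lambda>i. (Z 1 (t i) z, response c Z (t i) z))" for c z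
  have [measurable]: "Z 1 s \<in> borel_measurable ?\<Omega>" "Z 2 s \<in> borel_measurable ?\<Omega>" for s
    using field by (simp_all add: bivariate_gaussian_field_def)
  have Gm: "G c \<in> measurable ?\<Omega> borel" for c
  proof -
    have "G c \<in> measurable ?\<Omega> (PiM UNIV (\<lambda>_::nat. borel :: (real \<times> real) measure))"
    proof (rule measurable_PiM_single')
      show "(\<lambda>z. G c z i) \<in> measurable ?\<Omega> borel" for i unfolding G_def response_def borel_prod[symmetric] by measurable
    qed auto
    then show ?thesis using measurable_cong_sets[OF refl sets_PiM_equal_borel] by blast
  qed
  have eq: "measure ?\<Omega> {z \<in> space ?\<Omega>. G c z \<in> U} = measure ?\<Omega> {z. F c z \<in> U}" if U: "U \<in> sets borel" for U c
  proof (rule P.finite_measure_eq_AE)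
    have "AE z in ?\<Omega>. \<forall>i. Z 1 (t i) z = X (t i) (fst z) \<and> Z 2 (t i) z = (\<Sum>n\<le>i. b n (t i) * snd z n)"
      using Z by (simp add: AE_all_countable)
    then have "AE z in ?\<Omega>. G c z = F c z"
      by eventually_elim (simp add: G_def F_def response_def case_prod_beta fun_eq_iff mult.commute)
    then show "AE z in ?\<Omega>. z \<in> {z \<in> space ?\<Omega>. G c z \<in> U} \<longleftrightarrow> z \<in> {z. F c z \<in> U}"
      by eventually_elim (simp add: sp)
    show "{z \<in> space ?\<Omega>. G c z \<in> U} \<in> sets ?\<Omega>" using measurable_sets[OF Gm U] by (simp add: vimage_def Int_def conj_commute)
    show "{z. F c z \<in> U} \<in> sets ?\<Omega>" using measurable_sets[OF Fm U] by (simp add: vimage_def sp)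
  qed
  show ?thesis
    by (intro exI[of _ Z] exI[of _ D] conjI field ballI) (use D eq in \<open>simp add: G_def\<close>)
qed

section \<open>Non-estimability\<close>

lemma sets_PiM_countable_support:
  assumes "A \<in> sets (PiM I M)"
  shows "\<exists>J. countable J \<and> J \<subseteq> I \<and>
    (\<forall>x\<in>space (PiM I M). \<forall>y\<in>space (PiM I M). (\<forall>i\<in>J. x i = y i) \<longrightarrow> (x \<in> A \<longleftrightarrow> y \<in> A))"
  using assms unfolding sets_PiM_single
proof (induction A rule: sigma_sets.induct)
  case (Basic a)
  then obtain i A where i: "i \<in> I" and a: "a = {f \<in> \<Pi>\<^sub>E i\<in>I. space (M i). f i \<in> A}" by blast
  show ?case
    by (intro exI[of _ "{i}"]) (auto simp: i a space_PiM)
next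
  case Empty
  show ?case by (intro exI[of _ "{}"]) simp
next
  case (Compl a)
  then obtain J where J: "countable J" "J \<subseteq> I"
    "\<forall>x\<in>space (PiM I M). \<forall>y\<in>space (PiM I M). (\<forall>i\<in>J. x i = y i) \<longrightarrow> (x \<in> a \<longleftrightarrow> y \<in> a)" by blast
  show ?case
  proof (intro exI[of _ J] conjI ballI impI J)
    fix x y assume "x \<in> space (PiM I M)" "y \<in> space (PiM I M)" "\<forall>i\<in>J. x i = y i"
    with J(3) show "x \<in> (\<Pi>\<^sub>E i\<in>I. space (M i)) - a \<longleftrightarrow> y \<in> (\<Pi>\<^sub>E i\<in>I. space (M i)) - a"
      unfolding space_PiM by blast
  qed
next
  case (Union a)
  from choice[OF allI[OF Union.IH]] obtain J where J: "\<forall>n. countable (J n) \<and> J n \<subseteq> I \<and>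
    (\<forall>x\<in>space (PiM I M). \<forall>y\<in>space (PiM I M). (\<forall>i\<in>J n. x i = y i) \<longrightarrow> (x \<in> a n \<longleftrightarrow> y \<in> a n))" by (rule exE)
  note Jc = J[THEN spec, THEN conjunct1] and Js = J[THEN spec, THEN conjunct2, THEN conjunct1]
    and Jx = J[THEN spec, THEN conjunct2, THEN conjunct2]
  show ?case
  proof (intro exI[of _ "\<Union>n. J n"] conjI ballI impI)
    show "countable (\<Union>n. J n)" by (intro countable_UN Jc) simp
    show "(\<Union>n. J n) \<subseteq> I" using Js by blast
    fix x y assume xy: "x \<in> space (PiM I M)" "y \<in> space (PiM I M)" "\<forall>i\<in>\<Union>n. J n. x i = y i"
    then have "x \<in> a n \<longleftrightarrow> y \<in> a n" for n
      by (intro Jx[THEN bspec, THEN bspec, rule_format] xy) auto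
    then show "x \<in> \<Union>(range a) \<longleftrightarrow> y \<in> \<Union>(range a)" by blast
  qed
qed

text \<open>The countable supports of all the A n are merged into one sequence. \<open>B n\<close>
  is the preimage of A n under a map that spreads a sequence over the index set; this makes it Borel
  without choosing representatives.\<close>

lemma sets_PiM_sequence:
  fixes A :: "nat \<Rightarrow> ('i \<Rightarrow> 'b :: second_countable_topology) set" and I :: "'i set"
  assumes A: "\<And>n. A n \<in> sets (PiM I (\<lambda>_. borel))" and I: "I \<noteq> {}"
  shows "\<exists>t :: nat \<Rightarrow> 'i. range t \<subseteq> I \<and> (\<exists>B. \<forall>n. B n \<in> sets borel \<and>
    (\<forall>x\<in>space (PiM I (\<lambda>_. borel :: 'b measure)). x \<in> A n \<longleftrightarrow> (\<lambda>i. x (t i)) \<in> B n))"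
proof -
  let ?P = "PiM I (\<lambda>_. borel :: 'b measure)"
  from choice[OF allI[OF sets_PiM_countable_support[OF A]]]
  obtain J where J: "\<forall>n. countable (J n) \<and> J n \<subseteq> I \<and>
    (\<forall>x\<in>space ?P. \<forall>y\<in>space ?P. (\<forall>i\<in>J n. x i = y i) \<longrightarrow> (x \<in> A n \<longleftrightarrow> y \<in> A n))" by (rule exE)
  note Jc = J[THEN spec, THEN conjunct1] and Js = J[THEN spec, THEN conjunct2, THEN conjunct1]
    and Jx = J[THEN spec, THEN conjunct2, THEN conjunct2]
  obtain i0 where i0: "i0 \<in> I" using I by blast
  define J' where "J' = insert i0 (\<Union>n. J n)"
  have J': "countable J'" "J' \<subseteq> I" "J' \<noteq> {}" "\<And>n. J n \<subseteq> J'"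
    unfolding J'_def using Js i0 by (auto intro!: countable_insert countable_UN Jc)
  define t where "t = from_nat_into J'"
  have t: "range t = J'" unfolding t_def using J' by (intro range_from_nat_into)
  define k where "k i = (SOME m. t m = i)" for i
  have k: "t (k i) = i" if "i \<in> J'" for i
    using that unfolding t[symmetric] k_def by (auto intro: someI)
  \<comment> \<open>Outside J' the position k i is arbitrary, which is harmless since membership in
    A n ignores those coordinates.\<close>
  define \<iota> where "\<iota> y = (\<lambda>i\<in>I. y (k i))" for y :: "nat \<Rightarrow> 'b"
  have \<iota>m: "\<iota> \<in> measurable borel ?P"
  proof -
    have "\<iota> \<in> measurable (PiM UNIV (\<lambda>_::nat. borel)) ?P"
      unfolding \<iota>_def[abs_def] by (intro measurable_restrict measurable_component_singleton) simp
    then show ?thesis using measurable_cong_sets[OF sets_PiM_equal_borel refl] by blast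
  qed
  define B where "B n = \<iota> -` A n \<inter> space borel" for n
  have "B n \<in> sets borel" for n unfolding B_def using A by (intro measurable_sets[OF \<iota>m])
  moreover have "x \<in> A n \<longleftrightarrow> (\<lambda>i. x (t i)) \<in> B n" if x: "x \<in> space ?P" for x n
  proof -
    have "\<iota> (\<lambda>i. x (t i)) \<in> space ?P" by (simp add: \<iota>_def space_PiM)
    moreover have "\<forall>i\<in>J n. \<iota> (\<lambda>i. x (t i)) i = x i"
    proof
      fix i assume "i \<in> J n"
      then have "i \<in> J'" "i \<in> I" using J'(2,4) by blast+
      then show "\<iota> (\<lambda>i. x (t i)) i = x i" by (simp add: \<iota>_def k)
    qed
    ultimately have "\<iota> (\<lambda>i. x (t i)) \<in> A n \<longleftrightarrow> x \<in> A n" using Jx[THEN bspec, THEN bspec] x by blast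
    then show ?thesis by (simp add: B_def)
  qed
  ultimately show ?thesis using t J'(2) by (intro exI[of _ t]) blast
qed

section \<open>The independent stationary submodel and the contradiction\<close>

text \<open>Independence must satisfy condition A too. The constant c = 0 is allowed, and 1 is an
  exponent that is no even integer.\<close>

lemma cond_A_zero: "cond_A L 0 1 (\<lambda>_. 0)"
  unfolding cond_A_def
proof (intro conjI)
  show "\<not> (\<exists>m::nat. 1 = 2 * real m)"
  proof
    assume "\<exists>m::nat. 1 = 2 * real m"
    then obtain m :: nat where "real 1 = real (2 * m)" by auto
    then show False unfolding of_nat_eq_iff by presburger
  qed
  have "real_analytic_on (\<lambda>_. 0) {-L..L}"
    unfolding real_analytic_on_def by (intro ballI exI[of _ 1] conjI exI[of _ "\<lambda>_. 0"]) auto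
  then show "\<exists>A B D. (\<forall>t\<in>{-L..L}. 0 = A t + B t) \<and>
        (\<forall>t\<in>{-L..L}. A (- t) = A t) \<and> real_analytic_on A {-L..L} \<and>
        (\<forall>t\<in>{-L..L}. B (- t) = B t) \<and> continuous_on {-L..L} B \<and>
        (\<forall>t\<in>{0<..L}. D 0 t = B t) \<and>
        (\<forall>k. \<forall>t\<in>{0<..L}. (D k has_real_derivative D (Suc k) t) (at t within {0<..L})) \<and>
        (\<forall>k. (\<lambda>t. D k t - falling 1 k * 0 * t powr (1 - real k)) \<in> o[at_right 0](\<lambda>t. t powr (1 - real k)))"
    by (intro exI[of _ "\<lambda>_. 0"] exI[of _ "\<lambda>_ _. 0"]) simp
qed simp

text \<open>With all \<sigma> and \<Phi> equal to 1 the prefactor is 1 and the distance unscaled;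
  evenness removes the absolute value left by the square root.\<close>

lemma in_model_stationary_independent:
  assumes K: "\<forall>k\<in>{1,2}. stationary_covariance (K k k)"
    and cls: "(\<lambda>_. 1) \<in> CS" "(\<lambda>_. 1) \<in> CP" "(\<lambda>_. 0) \<in> CC"
    and field: "bivariate_gaussian_field M Z (\<lambda>k l s s'. if k = l then (if k = 1 then K 1 1 else K 2 2) (s - s') else 0)"
  shows "in_model L K CS CP CC M Z"
proof -
  let ?C = "K_NS (\<lambda>_ _. 1) (\<lambda>_ _ _. 1) (\<lambda>k l. if k = l then K k l else (\<lambda>_. 0))"
  have even: "K k k \<bar>x\<bar> = K k k x" if "k \<in> {1,2}" for k x
    using K that unfolding stationary_covariance_def by (auto simp: abs_if)
  have C: "?C k l s s' = (if k = l then K k k (s - s') else 0)" if "k \<in> {1,2}" for k l s s'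
    using even[OF that, of "s - s'"] by (auto simp: K_NS_def Q_NS_def)
  have evm: "K k k (s - s') = K k k (s' - s)" if "k \<in> {1,2}" for k s s'
    using K that minus_diff_eq[of s s'] unfolding stationary_covariance_def by metis
  have psd: "0 \<le> (\<Sum>s\<in>S. \<Sum>s'\<in>S. a s * a s' * K k k (s - s'))" if "k \<in> {1,2}" "finite S" for k S a
    using K that unfolding stationary_covariance_def by blast
  have valid: "valid_matrix_covariance ?C"
    unfolding valid_matrix_covariance_def
  proof (intro conjI ballI allI impI)
    show "?C k l s s' = ?C l k s' s" if "k \<in> {1,2}" "l \<in> {1,2}" for k l s s'
      unfolding C[OF that(1)] C[OF that(2)] using evm[OF that(1)] by simp
    fix S :: "real set" and a :: "nat \<Rightarrow> real \<Rightarrow> real" assume fin: "finite S"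
    have "(\<Sum>k\<in>{1,2}. \<Sum>l\<in>{1,2}. \<Sum>s\<in>S. \<Sum>s'\<in>S. a k s * a l s' * ?C k l s s')
      = (\<Sum>s\<in>S. \<Sum>s'\<in>S. a 1 s * a 1 s' * K 1 1 (s - s')) + (\<Sum>s\<in>S. \<Sum>s'\<in>S. a 2 s * a 2 s' * K 2 2 (s - s'))"
      by (simp add: C)
    then show "0 \<le> (\<Sum>k\<in>{1,2}. \<Sum>l\<in>{1,2}. \<Sum>s\<in>S. \<Sum>s'\<in>S. a k s * a l s' * ?C k l s s')"
      using psd[OF _ fin, of 1 "a 1"] psd[OF _ fin, of 2 "a 2"] by simp
  qed
  have "bivariate_gaussian_field M Z ?C"
    using field unfolding bivariate_gaussian_field_def by (auto simp: C)
  moreover have "stationary_cross_covariance (\<lambda>_. 0)"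
    unfolding stationary_cross_covariance_def valid_matrix_covariance_def by (intro exI[of _ "\<lambda>_ _ _. 0"]) simp
  ultimately show ?thesis
    unfolding in_model_def
    by (intro exI[of _ "\<lambda>_ _. 1"] exI[of _ "\<lambda>_ _ _. 1"] exI[of _ "\<lambda>_. 0"] conjI ballI allI zero_less_one cls valid
        exI[of "\<lambda>c. \<exists>\<alpha>. cond_A L c \<alpha> _" 0] exI[of _ 1] cond_A_zero)
qed

text \<open>A pair of sequences is stored as a step path: its n-th entries are read off at time n,
  and intermediate times repeat them.\<close>

lemma path_space_embedding:
  defines "M' \<equiv> PiM UNIV (\<lambda>_::real. borel :: (real \<times> real) measure)"
  shows "\<exists>e d. e \<in> measurable (normal_seq \<Otimes>\<^sub>M normal_seq) M' \<and> d \<in> measurable M' (normal_seq \<Otimes>\<^sub>M normal_seq) \<and> (\<forall>z. d (e z) = z)"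
proof -
  define e where "e z = (\<lambda>s::real. (fst z (nat \<lfloor>s\<rfloor>), snd z (nat \<lfloor>s\<rfloor>)))" for z :: "(nat \<Rightarrow> real) \<times> (nat \<Rightarrow> real)"
  define d where "d x = (\<lambda>n::nat. fst (x (real n)), \<lambda>n. snd (x (real n)))" for x :: "real \<Rightarrow> real \<times> real"
  have "e \<in> measurable (normal_seq \<Otimes>\<^sub>M normal_seq) M'"
    unfolding M'_def
  proof (rule measurable_PiM_single')
    show "(\<lambda>z. e z s) \<in> measurable (normal_seq \<Otimes>\<^sub>M normal_seq) borel" for s
      unfolding e_def borel_prod[symmetric] by measurable
  qed auto
  moreover have "d \<in> measurable M' (normal_seq \<Otimes>\<^sub>M normal_seq)"
  proof -
    have c: "(\<lambda>x. x (real n)) \<in> measurable M' (borel \<Otimes>\<^sub>M borel)" for n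
      unfolding M'_def borel_prod by measurable
    show ?thesis unfolding d_def[abs_def]
      by (intro measurable_Pair measurable_into_normal_seq measurable_compose[OF c] measurable_fst measurable_snd)
  qed
  moreover have "d (e z) = z" for z by (simp add: d_def e_def)
  ultimately show ?thesis by blast
qed

text \<open>One field serves for \<beta> = 0 and \<beta> = 1, since the model only concerns (X, W).
  Testing whether the estimator exceeds 1/2 would distinguish the two responses with vanishing
  error, against the one-sided bound.\<close>

theorem not_estimable:
  assumes L: "0 < L" and K: "\<forall>k\<in>{1,2}. stationary_covariance (K k k)"
    and cls: "(\<lambda>_. 1) \<in> CS" "(\<lambda>_. 1) \<in> CP" "(\<lambda>_. 0) \<in> CC"
    and f1: "spectral_density f1 (K 1 1)" and f2: "spectral_density f2 (K 2 2)"
    and c: "0 < c" "0 \<le> p" and low: "\<And>u. c * (1 + \<bar>u\<bar>) powr (- p) \<le> f2 u"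
    and f1p: "integrable lborel (\<lambda>\<omega>. f1 \<omega> * (1 + \<bar>\<omega>\<bar>) powr p)"
  shows "\<not> estimable L K CS CP CC"
proof
  let ?P = "PiM {0..L} (\<lambda>_. borel :: (real \<times> real) measure)"
  let ?\<Omega> = "normal_seq \<Otimes>\<^sub>M normal_seq"
  assume "estimable L K CS CP CC"
  then obtain T :: "nat \<Rightarrow> (real \<Rightarrow> real \<times> real) \<Rightarrow> real" where T[measurable]: "\<And>n. T n \<in> borel_measurable ?P"
    and conv: "\<And>\<beta> (M :: (real \<Rightarrow> real \<times> real) measure) Z. in_model L K CS CP CC M Z \<Longrightarrow>
       converges_in_probability M (\<lambda>n x. T n (\<lambda>s\<in>{0..L}. (Z 1 s x, response \<beta> Z s x))) \<beta>"
    unfolding estimable_def by blast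
  \<comment> \<open>The threshold halfway between the candidates 0 and 1. The sets for all n are
    treated at once, so a single sequence of points serves every n.\<close>
  define A where "A n = {x \<in> space ?P. 1 / 2 < T n x}" for n
  have A: "A n \<in> sets ?P" for n unfolding A_def by measurable
  have "{0..L} \<noteq> {}" using L by simp
  from sets_PiM_sequence[of A "{0..L}", OF A this] obtain t B where t: "range t \<subseteq> {0..L}"
    and B: "\<And>n. B n \<in> sets (borel :: (nat \<Rightarrow> real \<times> real) measure)"
    and AB: "\<And>n x. x \<in> space ?P \<Longrightarrow> x \<in> A n \<longleftrightarrow> (\<lambda>i. x (t i)) \<in> B n" by blast
  have K1: "stationary_covariance (K 1 1)" and K2: "stationary_covariance (K 2 2)" using K by auto
  obtain Z D where field: "bivariate_gaussian_field ?\<Omega> Z (\<lambda>k l s s'. if k = l then (if k = 1 then K 1 1 else K 2 2) (s - s') else 0)"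
    and test: "\<And>B. B \<in> sets borel \<Longrightarrow> measure ?\<Omega> {z \<in> space ?\<Omega>. (\<lambda>i. (Z 1 (t i) z, response 1 Z (t i) z)) \<in> B}
      \<le> 1 / 2 + D * measure ?\<Omega> {z \<in> space ?\<Omega>. (\<lambda>i. (Z 1 (t i) z, response 0 Z (t i) z)) \<in> B}"
    using response_testing[OF K1 f1 K2 f2 L t c low f1p] by blast
  interpret \<Omega>: prob_space ?\<Omega> using field by (simp add: bivariate_gaussian_field_def)
  have [measurable]: "Z 1 s \<in> borel_measurable ?\<Omega>" "Z 2 s \<in> borel_measurable ?\<Omega>" for s
    using field by (simp_all add: bivariate_gaussian_field_def)
  define path where "path \<beta> z = (\<lambda>s\<in>{0..L}. (Z 1 s z, response \<beta> Z s z))" for \<beta> z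
  have path_m[measurable]: "path \<beta> \<in> measurable ?\<Omega> ?P" for \<beta>
    unfolding path_def[abs_def] response_def borel_prod[symmetric] by (intro measurable_restrict) measurable
  have path_in: "path \<beta> z \<in> space ?P" for \<beta> z by (simp add: path_def space_PiM)
  have path_A: "path \<beta> z \<in> A n \<longleftrightarrow> (\<lambda>i. (Z 1 (t i) z, response \<beta> Z (t i) z)) \<in> B n" for \<beta> z n
    using AB[OF path_in, of \<beta> z n] t by (simp add: path_def image_subset_iff)
  obtain e d where e[measurable]: "e \<in> measurable ?\<Omega> (PiM UNIV (\<lambda>_::real. borel :: (real \<times> real) measure))"
    and d[measurable]: "d \<in> measurable (PiM UNIV (\<lambda>_::real. borel :: (real \<times> real) measure)) ?\<Omega>" and de: "\<And>z. d (e z) = z"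
    using path_space_embedding by blast
  define M where "M = distr ?\<Omega> (PiM UNIV (\<lambda>_::real. borel :: (real \<times> real) measure)) e"
  have "in_model L K CS CP CC M (\<lambda>k s x. Z k s (d x))" unfolding M_def
    by (intro in_model_stationary_independent K cls bivariate_gaussian_field_transport field e d de)
  from conv[OF this] have conv': "converges_in_probability M (\<lambda>n x. T n (path \<beta> (d x))) \<beta>" for \<beta>
    by (simp add: path_def[abs_def] response_def)
  \<comment> \<open>Convergence holds on the path type; it is pulled back along e to the product of
    sequence spaces, where the test bound lives.\<close>
  have lim: "(\<lambda>n. measure ?\<Omega> {z \<in> space ?\<Omega>. \<epsilon> < \<bar>T n (path \<beta> z) - \<beta>\<bar>}) \<longlonglongrightarrow> 0" if "0 < \<epsilon>" for \<epsilon> \<beta>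
  proof -
    have eq: "measure M {x \<in> space M. \<epsilon> < \<bar>T n (path \<beta> (d x)) - \<beta>\<bar>} = measure ?\<Omega> {z \<in> space ?\<Omega>. \<epsilon> < \<bar>T n (path \<beta> z) - \<beta>\<bar>}" for n
    proof -
      have "{x \<in> space M. \<epsilon> < \<bar>T n (path \<beta> (d x)) - \<beta>\<bar>} \<in> sets (PiM UNIV (\<lambda>_::real. borel :: (real \<times> real) measure))"
        unfolding M_def space_distr by measurable
      then show ?thesis unfolding M_def
        by (subst measure_distr) (auto simp: de measurable_space[OF e] intro!: arg_cong[where f = "measure ?\<Omega>"])
    qed
    show ?thesis using conv'[of \<beta>, unfolded converges_in_probability_def, rule_format, OF that] unfolding eq .
  qed
  define q where "q n = measure ?\<Omega> {z \<in> space ?\<Omega>. path 0 z \<in> A n}" for n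
  define r where "r n = measure ?\<Omega> {z \<in> space ?\<Omega>. path 1 z \<notin> A n}" for n
  have Aset[measurable]: "{z \<in> space ?\<Omega>. path \<beta> z \<in> A n} \<in> sets ?\<Omega>" for \<beta> n
    using measurable_sets[OF path_m A] by (simp add: vimage_def Int_def conj_commute)
  have q: "q \<longlonglongrightarrow> 0"
  proof (rule tendsto_sandwich[OF _ _ tendsto_const lim[of "1 / 2" 0]])
    show "\<forall>\<^sub>F n in sequentially. q n \<le> measure ?\<Omega> {z \<in> space ?\<Omega>. 1 / 2 < \<bar>T n (path 0 z) - 0\<bar>}"
      unfolding q_def by (intro always_eventually allI \<Omega>.finite_measure_mono) (auto simp: A_def)
  qed (auto simp: q_def)
  have r: "r \<longlonglongrightarrow> 0"
  proof (rule tendsto_sandwich[OF _ _ tendsto_const lim[of "1 / 4" 1]])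
    \<comment> \<open>Outside A n the estimator is at most 1/2, hence more than 1/4 away from
      1.\<close>
    show "\<forall>\<^sub>F n in sequentially. r n \<le> measure ?\<Omega> {z \<in> space ?\<Omega>. 1 / 4 < \<bar>T n (path 1 z) - 1\<bar>}"
      unfolding r_def using path_in by (intro always_eventually allI \<Omega>.finite_measure_mono) (auto simp: A_def)
  qed (auto simp: r_def)
  have "1 - r n \<le> 1 / 2 + D * q n" for n
  proof -
    have "1 - r n = measure ?\<Omega> {z \<in> space ?\<Omega>. path 1 z \<in> A n}"
    proof -
      have "r n = measure ?\<Omega> (space ?\<Omega> - {z \<in> space ?\<Omega>. path 1 z \<in> A n})"
        unfolding r_def by (intro arg_cong[where f = "measure ?\<Omega>"]) auto
      then show ?thesis using \<Omega>.prob_compl[OF Aset[of 1 n]] by simp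
    qed
    also have "\<dots> \<le> 1 / 2 + D * q n" unfolding q_def path_A by (rule test[OF B])
    finally show ?thesis .
  qed
  moreover have "(\<lambda>n. 1 - r n) \<longlonglongrightarrow> 1 - 0" "(\<lambda>n. 1 / 2 + D * q n) \<longlonglongrightarrow> 1 / 2 + D * 0"
    by (intro tendsto_intros q r)+
  ultimately have "1 - 0 \<le> 1 / 2 + D * (0 :: real)" using LIMSEQ_le by blast
  then show False by simp
qed

theorem corollary7:
  fixes L :: real
    and K :: "nat \<Rightarrow> nat \<Rightarrow> real \<Rightarrow> real"
    and c \<alpha> :: "nat \<Rightarrow> nat \<Rightarrow> real"
  assumes "0 < L"
    and "\<forall>k\<in>{1,2}. stationary_covariance (K k k)"
    and "stationary_cross_covariance (K 1 2)" and "stationary_cross_covariance (K 2 1)"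
    and "\<forall>k\<in>{1,2}. \<forall>l\<in>{1,2}. cond_A L (c k l) (\<alpha> k l) (K k l)"
    and "\<forall>k\<in>{1,2}. c k k \<noteq> 0"
  shows
    "(\<forall>(M :: 'a measure) Z \<sigma> \<Phi> \<beta>.
        (\<forall>k\<in>{1,2}. \<forall>s. 0 < \<sigma> k s) \<and>
        (\<forall>k\<in>{1,2}. \<forall>l\<in>{1,2}. \<forall>s. 0 < \<Phi> k l s) \<and>
        valid_matrix_covariance (K_NS \<sigma> \<Phi> K) \<and>
        bivariate_gaussian_field M Z (K_NS \<sigma> \<Phi> K) \<and>
        \<alpha> 1 1 < Min {\<alpha> 1 2, \<alpha> 2 2 + 1, 2} \<and>
        (\<forall>k\<in>{1,2}. continuous_on {0..L} (\<sigma> k) \<and> piecewise_analytic L (\<sigma> k)) \<and>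
        (\<forall>k\<in>{1,2}. \<forall>l\<in>{1,2}. continuous_on {0..L} (\<Phi> k l) \<and> piecewise_analytic L (\<Phi> k l))
        \<longrightarrow> converges_in_probability M (ols_diff L (Z 1) (response \<beta> Z)) \<beta>)
     \<and>
     (\<forall>f1 f2 CS CP CC.
        \<alpha> 1 1 > \<alpha> 2 2 + 1 \<and>
        (\<forall>a>0. (\<lambda>_. a) \<in> CS) \<and> (\<forall>a>0. (\<lambda>_. a) \<in> CP) \<and> (\<lambda>_. 0) \<in> CC \<and>
        spectral_density f1 (K 1 1) \<and> spectral_density f2 (K 2 2) \<and>
        regular_densities L f1 f2 \<and>
        f1 \<in> \<Theta>[at_infinity](\<lambda>\<omega>. \<bar>\<omega>\<bar> powr (- (\<alpha> 1 1 + 1))) \<and>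
        f2 \<in> \<Theta>[at_infinity](\<lambda>\<omega>. \<bar>\<omega>\<bar> powr (- (\<alpha> 2 2 + 1)))
        \<longrightarrow> \<not> estimable L K CS CP CC)"
proof (intro conjI allI impI)
  fix M :: "'a measure" and Z \<sigma> \<Phi> \<beta>
  assume H: "(\<forall>k\<in>{1,2}. \<forall>s. 0 < \<sigma> k s) \<and>
        (\<forall>k\<in>{1,2}. \<forall>l\<in>{1,2}. \<forall>s. 0 < \<Phi> k l s) \<and>
        valid_matrix_covariance (K_NS \<sigma> \<Phi> K) \<and>
        bivariate_gaussian_field M Z (K_NS \<sigma> \<Phi> K) \<and>
        \<alpha> 1 1 < Min {\<alpha> 1 2, \<alpha> 2 2 + 1, 2} \<and>
        (\<forall>k\<in>{1,2}. continuous_on {0..L} (\<sigma> k) \<and> piecewise_analytic L (\<sigma> k)) \<and>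
        (\<forall>k\<in>{1,2}. \<forall>l\<in>{1,2}. continuous_on {0..L} (\<Phi> k l) \<and> piecewise_analytic L (\<Phi> k l))"
  have \<alpha>: "\<alpha> 1 1 < \<alpha> 1 2" "\<alpha> 1 1 < \<alpha> 2 2 + 1" "\<alpha> 1 1 < 2" using H by simp_all
  have field: "bivariate_gaussian_field M Z (K_NS \<sigma> \<Phi> K)" using H by blast
  show "converges_in_probability M (ols_diff L (Z 1) (response \<beta> Z)) \<beta>"
  proof (rule ols_diff_consistent[where c = c, OF \<open>0 < L\<close> _ _ _ _ field \<alpha>])
    show "c 1 1 \<noteq> 0" using assms(6) by simp
    show "cond_A L (c k l) (\<alpha> k l) (K k l)" if "k \<in> {1,2}" "l \<in> {1,2}" for k l
      using assms(5) that by blast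
    show "0 < \<sigma> k s" if "k \<in> {1,2}" for k s using H that by blast
    show "0 < \<Phi> k l s" if "k \<in> {1,2}" "l \<in> {1,2}" for k l s using H that by blast
    show "continuous_on {0..L} (\<sigma> k) \<and> piecewise_analytic L (\<sigma> k)" if "k \<in> {1,2}" for k
      using H that by blast
    show "continuous_on {0..L} (\<Phi> k l) \<and> piecewise_analytic L (\<Phi> k l)" if "k \<in> {1,2}" "l \<in> {1,2}" for k l
      using H that by blast
  qed
next
  fix f1 f2 :: "real \<Rightarrow> real" and CS CP CC :: "(real \<Rightarrow> real) set"
  assume H: "\<alpha> 1 1 > \<alpha> 2 2 + 1 \<and>
        (\<forall>a>0. (\<lambda>_. a) \<in> CS) \<and> (\<forall>a>0. (\<lambda>_. a) \<in> CP) \<and> (\<lambda>_. 0) \<in> CC \<and>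
        spectral_density f1 (K 1 1) \<and> spectral_density f2 (K 2 2) \<and>
        regular_densities L f1 f2 \<and>
        f1 \<in> \<Theta>[at_infinity](\<lambda>\<omega>. \<bar>\<omega>\<bar> powr (- (\<alpha> 1 1 + 1))) \<and>
        f2 \<in> \<Theta>[at_infinity](\<lambda>\<omega>. \<bar>\<omega>\<bar> powr (- (\<alpha> 2 2 + 1)))"
  have pos: "0 < \<alpha> 2 2" using assms(5) by (simp add: cond_A_def)
  have cls: "(\<lambda>_. 1) \<in> CS" "(\<lambda>_. 1) \<in> CP" "(\<lambda>_. 0) \<in> CC" using H by simp_all
  have f1: "spectral_density f1 (K 1 1)" and f2: "spectral_density f2 (K 2 2)" using H by blast+
  have reg: "0 < f1 \<omega>" "0 < f2 \<omega>" "continuous_on UNIV f2" for \<omega>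
    using H by (simp_all add: regular_densities_def)
  have f1i: "integrable lborel f1" using f1 by (simp add: spectral_density_def)
  \<comment> \<open>The weight exponent is p = \<alpha> 2 2 + 1, the decay rate of f2.\<close>
  obtain c where c: "0 < c" and low: "\<And>\<omega>. c * (1 + \<bar>\<omega>\<bar>) powr (- (\<alpha> 2 2 + 1)) \<le> f2 \<omega>"
    using density_lower_bound[OF reg(3,2), of "\<alpha> 2 2 + 1"] H pos by auto
  \<comment> \<open>The condition p + 1 < q reads \<alpha> 2 2 + 2 < \<alpha> 1 1 + 1, which is the
    assumption of (b).\<close>
  have f1p: "integrable lborel (\<lambda>\<omega>. f1 \<omega> * (1 + \<bar>\<omega>\<bar>) powr (\<alpha> 2 2 + 1))"
    by (rule density_weighted_integrable[OF f1i reg(1), where q = "\<alpha> 1 1 + 1"]) (use H pos in auto)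
  have p0: "0 \<le> \<alpha> 2 2 + 1" using pos by simp
  show "\<not> estimable L K CS CP CC"
    by (rule not_estimable[where K = K and p = "\<alpha> 2 2 + 1" and c = c, OF \<open>0 < L\<close> assms(2) cls f1 f2 c p0 low f1p])
qed

end
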